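(* Let $\Omega\subset\mathbb{R}^n$, $n\ge 2$, be a bounded domain, let $T>0$, and let $n<p<\infty$. Put $\Omega_T=\Omega\times(0,T)$ and $P_T=(\Omega\times\{0\})\cup(\partial\Omega\times[0,T))$. Let $h\in C(P_T,\mathbb{R}^+)$ with $\inf_{P_T}h>0$. Then the problem $$\Delta_p u=(p-1)u^{p-2}u_t\ \text{ in }\Omega_T,\qquad u(x,t)=h(x,t)\ \ \forall (x,t)\in P_T,$$ has a unique positive viscosity solution $u$ that is continuous on $\Omega_T\cup P_T$.
   Context: $\mathbb{R}^+=(0,\infty)$. $\Delta_p\psi=\operatorname{div}(|D\psi|^{p-2}D\psi)$ is the $p$-Laplacian in the $x$-variables ($D$ is the gradient in $x$); for a function $\psi$ that is $C^2$ in $x$ it means $|D\psi|^{p-2}\operatorname{tr}(D^2\psi)+(p-2)|D\psi|^{p-4}\sum_{i,j}\psi_{x_i}\psi_{x_j}\psi_{x_ix_j}$ where $D\psi\neq0$, and, where $D\psi=0$, it means $0$ if $p\ne2$ and $\operatorname{tr}(D^2\psi)$ if $p=2$. A test function is a function $\psi$ on $\Omega_T$ that is $C^2$ in $x$ and $C^1$ in $t$. For a function $u>0$ on $\Omega_T$: $u$ is a (viscosity) sub-solution of the equation, i.e. $\Delta_pu-(p-1)u^{p-2}u_t\ge0$ in $\Omega_T$, if $u$ is upper semicontinuous on $\Omega_T$ and for every test function $\psi$ and $(y,s)\in\Omega_T$ such that $u-\psi$ has a local maximum at $(y,s)$, $\Delta_p\psi(y,s)-(p-1)u(y,s)^{p-2}\psi_t(y,s)\ge0$.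 It is a (viscosity) super-solution, i.e. $\Delta_pu-(p-1)u^{p-2}u_t\le0$, if $u$ is lower semicontinuous on $\Omega_T$ and $\Delta_p\psi(y,s)-(p-1)u(y,s)^{p-2}\psi_t(y,s)\le0$ whenever $u-\psi$ has a local minimum at $(y,s)\in\Omega_T$. A positive viscosity solution of the problem is a function $u>0$, continuous on $\Omega_T\cup P_T=\overline\Omega\times[0,T)$, which is both a sub-solution and a super-solution of the equation in $\Omega_T$ and satisfies $u=h$ on $P_T$. *)

theory Defs
  imports "HOL-Analysis.Analysis"
begin

text \<open>Space-time points are pairs \<open>(x, t)\<close> with \<open>x\<close> in \<open>real ^ 'n\<close> and \<open>t\<close> real. Functions of
  \<open>(x, t)\<close> are total; all notions below only depend on their values on the sets in question.\<close>

definition cylinder :: "(real ^ 'n) set \<Rightarrow> real \<Rightarrow> ((real ^ 'n) \<times> real) set" where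
  "cylinder \<Omega> T = \<Omega> \<times> {0<..<T}"

definition parabolic_boundary :: "(real ^ 'n) set \<Rightarrow> real \<Rightarrow> ((real ^ 'n) \<times> real) set" where
  "parabolic_boundary \<Omega> T = \<Omega> \<times> {0} \<union> frontier \<Omega> \<times> {0..<T}"

definition x_gradient :: "((real ^ 'n) \<times> real \<Rightarrow> real) \<Rightarrow> (real ^ 'n) \<times> real \<Rightarrow> real ^ 'n" where
  "x_gradient \<psi> = (\<lambda>(x, t). \<chi> i. frechet_derivative (\<lambda>y. \<psi> (y, t)) (at x) (axis i 1))"

definition x_hessian :: "((real ^ 'n) \<times> real \<Rightarrow> real) \<Rightarrow> (real ^ 'n) \<times> real \<Rightarrow> real ^ 'n ^ 'n" where
  "x_hessian \<psi> = (\<lambda>(x, t). jacobian (\<lambda>y. x_gradient \<psi> (y, t)) (at x))"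

definition t_derivative :: "((real ^ 'n) \<times> real \<Rightarrow> real) \<Rightarrow> (real ^ 'n) \<times> real \<Rightarrow> real" where
  "t_derivative \<psi> = (\<lambda>(x, t). deriv (\<lambda>\<tau>. \<psi> (x, \<tau>)) t)"

text \<open>\<open>C\<^sup>2\<close> in \<open>x\<close> and \<open>C\<^sup>1\<close> in \<open>t\<close>, for open \<open>S\<close>: the derivatives exist and are jointly
  continuous in \<open>(x, t)\<close>; continuity of \<open>\<psi>\<close> itself on \<open>S\<close> follows.\<close>

definition test_function :: "((real ^ 'n) \<times> real) set \<Rightarrow> ((real ^ 'n) \<times> real \<Rightarrow> real) \<Rightarrow> bool" where
  "test_function S \<psi> \<longleftrightarrow>
     (\<forall>(x, t)\<in>S. (\<lambda>y. \<psi> (y, t)) differentiable at x \<and>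
                 (\<lambda>y. x_gradient \<psi> (y, t)) differentiable at x \<and>
                 (\<lambda>\<tau>. \<psi> (x, \<tau>)) differentiable at t) \<and>
     continuous_on S (x_gradient \<psi>) \<and>
     continuous_on S (x_hessian \<psi>) \<and>
     continuous_on S (t_derivative \<psi>)"

definition p_laplacian ::
  "real \<Rightarrow> ((real ^ 'n) \<times> real \<Rightarrow> real) \<Rightarrow> (real ^ 'n) \<times> real \<Rightarrow> real" where
  "p_laplacian p \<psi> z =
     (let D = x_gradient \<psi> z; H = x_hessian \<psi> z in
      if D \<noteq> 0 then
        norm D powr (p - 2) * trace H +
        (p - 2) * norm D powr (p - 4) * (\<Sum>i\<in>UNIV. \<Sum>j\<in>UNIV. D $ i * D $ j * H $ i $ j)
      else if p = 2 then trace H else 0)"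

definition upper_semicontinuous_on :: "'a::topological_space set \<Rightarrow> ('a \<Rightarrow> real) \<Rightarrow> bool" where
  "upper_semicontinuous_on S u \<longleftrightarrow> (\<forall>z\<in>S. \<forall>a. u z < a \<longrightarrow> (\<forall>\<^sub>F w in at z within S. u w < a))"

definition lower_semicontinuous_on :: "'a::topological_space set \<Rightarrow> ('a \<Rightarrow> real) \<Rightarrow> bool" where
  "lower_semicontinuous_on S u \<longleftrightarrow> (\<forall>z\<in>S. \<forall>a. a < u z \<longrightarrow> (\<forall>\<^sub>F w in at z within S. a < u w))"

definition local_max_on :: "'a::topological_space set \<Rightarrow> ('a \<Rightarrow> real) \<Rightarrow> 'a \<Rightarrow> bool" where
  "local_max_on S f z \<longleftrightarrow> z \<in> S \<and> (\<forall>\<^sub>F w in at z within S. f w \<le> f z)"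

definition local_min_on :: "'a::topological_space set \<Rightarrow> ('a \<Rightarrow> real) \<Rightarrow> 'a \<Rightarrow> bool" where
  "local_min_on S f z \<longleftrightarrow> z \<in> S \<and> (\<forall>\<^sub>F w in at z within S. f z \<le> f w)"

definition viscosity_subsolution ::
  "real \<Rightarrow> ((real ^ 'n) \<times> real) set \<Rightarrow> ((real ^ 'n) \<times> real \<Rightarrow> real) \<Rightarrow> bool" where
  "viscosity_subsolution p S u \<longleftrightarrow>
     (\<forall>z\<in>S. 0 < u z) \<and>
     upper_semicontinuous_on S u \<and>
     (\<forall>\<psi> z. test_function S \<psi> \<longrightarrow> local_max_on S (\<lambda>w. u w - \<psi> w) z \<longrightarrow>
        p_laplacian p \<psi> z - (p - 1) * u z powr (p - 2) * t_derivative \<psi> z \<ge> 0)"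

definition viscosity_supersolution ::
  "real \<Rightarrow> ((real ^ 'n) \<times> real) set \<Rightarrow> ((real ^ 'n) \<times> real \<Rightarrow> real) \<Rightarrow> bool" where
  "viscosity_supersolution p S u \<longleftrightarrow>
     (\<forall>z\<in>S. 0 < u z) \<and>
     lower_semicontinuous_on S u \<and>
     (\<forall>\<psi> z. test_function S \<psi> \<longrightarrow> local_min_on S (\<lambda>w. u w - \<psi> w) z \<longrightarrow>
        p_laplacian p \<psi> z - (p - 1) * u z powr (p - 2) * t_derivative \<psi> z \<le> 0)"

definition positive_viscosity_solution ::
  "real \<Rightarrow> (real ^ 'n) set \<Rightarrow> real \<Rightarrow> ((real ^ 'n) \<times> real \<Rightarrow> real) \<Rightarrow> ((real ^ 'n) \<times> real \<Rightarrow> real)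
   \<Rightarrow> bool" where
  "positive_viscosity_solution p \<Omega> T h u \<longleftrightarrow>
     (\<forall>z \<in> cylinder \<Omega> T \<union> parabolic_boundary \<Omega> T. 0 < u z) \<and>
     continuous_on (cylinder \<Omega> T \<union> parabolic_boundary \<Omega> T) u \<and>
     viscosity_subsolution p (cylinder \<Omega> T) u \<and>
     viscosity_supersolution p (cylinder \<Omega> T) u \<and>
     (\<forall>z \<in> parabolic_boundary \<Omega> T. u z = h z)"

end

theory Submission
  imports Defs
begin

text \<open>Substituting \<open>u = exp v\<close> turns the equation into \<open>v\<^sub>t = F(Dv, D\<^sup>2v)\<close> with \<open>F\<close> degenerate elliptic
  and independent of \<open>v\<close>. For comparison, a subsolution and a supersolution are doubled and
  regularized by sup-convolution; the points at which their difference has a touching affine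
  function form a set of positive measure, because the gradient is Lipschitz on it and covers a
  ball. Alexandrov's theorem is avoided: integrals of squared increments, rescaled dyadically,
  increase to a limit that obeys the parallelogram law, so every Lipschitz function is nearly affine
  at some small scale around most points. Applied to the gradients this makes both functions nearly
  quadratic at a common point and scale, which is enough to compare their jets. Existence is
  Perron's method. The barriers are \<open>c \<plusminus> A|x - x\<^sub>0|\<^sup>\<alpha> \<plusminus> B(t - t\<^sub>0)\<^sup>2\<close> with \<open>0 < \<alpha> < (p - n)/(p - 1)\<close> at the
  lateral boundary, which works without regularity of the domain because \<open>n < p\<close>, and
  \<open>c \<plusminus> A|x - x\<^sub>0|\<^sup>2 \<plusminus> Bt\<close> at the initial time.\<close>

section \<open>Lipschitz functions are almost affine at small scales\<close>

text \<open>The operator sees only the two derivatives, so jets at two different points can be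
  compared directly. Hence one fixed c in the sup-convolutions is enough: it only has to keep the
  two points close enough to stay off the boundary, and no limit of large c is taken. What tends to
  zero is a tolerance \<epsilon> in the sum of the gradients and of the Hessians, while the bounds
  on each of them stay fixed; compactness and continuity of the operator then conclude. Continuity
  at vanishing gradient is where p > 2 enters.

  A viscosity inequality only tests touching, so the second-order expansion need not hold in the
  limit of small radii. An error \<eta> r^2 on a single ball of radius r suffices: a paraboloid with
  Hessian larger by 8 \<eta> touches at some interior point, and the gradient there has moved by
  O(r).

  Two features of the data shape the barriers. As h may be unbounded as t approaches T, barriers
  from above exist only up to times T1 < T. The positive lower bound of h allows barriers from below
  to be truncated at a constant, which is itself a solution.\<close>

lemma lborel_integral_translate:
  fixes f :: "'a::euclidean_space \<Rightarrow> real"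
  assumes "f \<in> borel_measurable borel"
  shows "(\<integral>z. f (z + a) \<partial>lborel) = (\<integral>z. f z \<partial>lborel)"
proof -
  have "(\<integral>z. f z \<partial>lborel) = (\<integral>z. f z \<partial>(distr lborel borel ((+) a)))"
    by (simp add: lborel_distr_plus)
  also have "\<dots> = (\<integral>z. f (a + z) \<partial>lborel)"
    using assms by (intro integral_distr) auto
  finally show ?thesis by (simp add: add.commute)
qed

lemma integrable_compact_support:
  fixes f :: "'a::euclidean_space \<Rightarrow> real"
  assumes "continuous_on UNIV f" and "\<And>x. norm x > R \<Longrightarrow> f x = 0"
  shows "integrable lborel f"
proof -
  have "integrable lborel (\<lambda>x. indicator (cball 0 R) x *\<^sub>R f x)"
    using assms(1) by (intro borel_integrable_compact) (auto intro: continuous_on_subset)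
  moreover have "(\<lambda>x. indicator (cball 0 R) x *\<^sub>R f x) = f"
    using assms(2) by (fastforce simp: indicator_def not_le)
  ultimately show ?thesis by simp
qed

section \<open>Energies of increments and of second differences\<close>

definition increment_energy :: "('a::euclidean_space \<Rightarrow> real) \<Rightarrow> 'a \<Rightarrow> real" where
  "increment_energy F e = (\<integral>z. (F (z + e) - F z)\<^sup>2 \<partial>lborel)"

definition second_difference :: "('a::real_vector \<Rightarrow> real) \<Rightarrow> 'a \<Rightarrow> 'a \<Rightarrow> 'a \<Rightarrow> real" where
  "second_difference F e e' z = F (z + e + e') - F (z + e) - F (z + e') + F z"

locale compactly_supported_Lipschitz =
  fixes F :: "'a::euclidean_space \<Rightarrow> real" and L R :: real
  assumes Lipschitz: "\<And>x y. \<bar>F x - F y\<bar> \<le> L * norm (x - y)"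
    and support: "\<And>x. norm x > R \<Longrightarrow> F x = 0"
begin

lemma continuous: "continuous_on A F"
proof -
  have "L-lipschitz_on A F" if "L \<ge> 0"
    using that Lipschitz by (intro lipschitz_onI) (auto simp: dist_norm)
  moreover have "L \<ge> 0"
  proof -
    obtain b :: 'a where b: "b \<in> Basis" using nonempty_Basis by blast
    have "0 \<le> L * norm (b - 0)" using Lipschitz[of b 0] by linarith
    thus ?thesis using b by simp
  qed
  ultimately show ?thesis using lipschitz_on_continuous_on by blast
qed

lemma continuous_shift: "continuous_on UNIV (\<lambda>z. F (z + e))"
  by (intro continuous_on_compose2[OF continuous[of UNIV]] continuous_intros) auto

lemma support_shift: "norm z > R + norm e \<Longrightarrow> F (z + e) = 0"
  using support[of "z + e"] norm_triangle_ineq4[of "z + e" e] by auto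

lemma continuous_difference_sq: "continuous_on UNIV (\<lambda>z. (F (z + e) - F (z + e'))\<^sup>2)"
  by (intro continuous_intros continuous_shift)

lemma integrable_difference_sq: "integrable lborel (\<lambda>z. (F (z + e) - F (z + e'))\<^sup>2)"
  using continuous_difference_sq support_shift
  by (intro integrable_compact_support[of _ "R + norm e + norm e'"])
     (auto, smt (verit) norm_ge_zero)

lemma integral_difference_sq:
  "(\<integral>z. (F (z + e + e') - F (z + e'))\<^sup>2 \<partial>lborel) = increment_energy F e"
proof -
  have "(\<lambda>z. (F (z + e) - F (z + 0))\<^sup>2) \<in> borel_measurable borel"
    using continuous_difference_sq by (rule borel_measurable_continuous_onI)
  hence "(\<lambda>z. (F (z + e) - F z)\<^sup>2) \<in> borel_measurable borel" by simp
  from lborel_integral_translate[OF this, of e'] show ?thesis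
    by (simp add: increment_energy_def ac_simps)
qed

lemma integrable_second_difference: "integrable lborel (\<lambda>z. (second_difference F e e' z)\<^sup>2)"
proof (rule integrable_compact_support[of _ "R + norm e + norm e'"])
  show "continuous_on UNIV (\<lambda>z. (second_difference F e e' z)\<^sup>2)"
    unfolding second_difference_def add.assoc
    by (intro continuous_intros continuous_shift continuous)
next
  fix z :: 'a assume "norm z > R + norm e + norm e'"
  moreover have "norm (e + e') \<le> norm e + norm e'" by (rule norm_triangle_ineq)
  ultimately have "F (z + (e + e')) = 0" "F (z + e) = 0" "F (z + e') = 0" "F (z + 0) = 0"
    by (intro support_shift; smt (verit) norm_ge_zero norm_zero)+
  thus "(second_difference F e e' z)\<^sup>2 = 0" by (simp add: second_difference_def add.assoc)
qed

text \<open>Euler's quadrilateral identity: the squared sides minus the squared diagonals.\<close>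

lemma integral_second_difference:
  "(\<integral>z. (second_difference F e e' z)\<^sup>2 \<partial>lborel) =
     2 * increment_energy F e + 2 * increment_energy F e'
     - increment_energy F (e + e') - increment_energy F (e - e')"
proof -
  have pt: "(second_difference F e e' z)\<^sup>2 =
     (F (z + e) - F (z + 0))\<^sup>2 + (F (z + (e + e')) - F (z + e'))\<^sup>2 + (F (z + e') - F (z + 0))\<^sup>2
     + (F (z + (e + e')) - F (z + e))\<^sup>2 - (F (z + (e + e')) - F (z + 0))\<^sup>2 - (F (z + e) - F (z + e'))\<^sup>2" for z
    unfolding second_difference_def add.assoc by (simp add: power2_eq_square algebra_simps)
  have 1: "(\<integral>z. (F (z + e) - F (z + 0))\<^sup>2 \<partial>lborel) = increment_energy F e" for e
    by (simp add: increment_energy_def)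
  have 2: "(\<integral>z. (F (z + (e + e')) - F (z + e'))\<^sup>2 \<partial>lborel) = increment_energy F e" for e e'
    using integral_difference_sq[of e e'] by (simp add: add.assoc)
  have 3: "(\<integral>z. (F (z + e) - F (z + e'))\<^sup>2 \<partial>lborel) = increment_energy F (e - e')"
    using 2[of "e - e'" e'] by simp
  show ?thesis unfolding pt
    by (simp add: integrable_difference_sq 1 2 3 add.commute[of e e'] del: add_0_right)
       (use 2[of e e'] 2[of e' e] in \<open>simp add: add.commute\<close>)
qed

text \<open>The increment is at most L |e| and vanishes unless z or z + e lies in the ball, whence
  the factor 2. The quadratic order in e keeps the energies bounded after division by the square of
  the scale.\<close>

lemma increment_energy_le:
  "increment_energy F e \<le> 2 * L\<^sup>2 * measure lborel (cball (0::'a) R) * (norm e)\<^sup>2"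
proof -
  let ?B = "cball (0::'a) R"
  have m: "emeasure lborel ?B < \<infinity>" by (intro emeasure_bounded_finite) auto
  have i0: "integrable lborel (indicator ?B :: 'a \<Rightarrow> real)"
    using m by (intro integrable_real_indicator) auto
  have i1: "integrable lborel (\<lambda>z. indicator ?B (z + e) :: real)"
  proof -
    have "emeasure lborel (cball (- e) R) < \<infinity>" by (intro emeasure_bounded_finite) auto
    hence "integrable lborel (indicator (cball (- e) R) :: 'a \<Rightarrow> real)"
      by (intro integrable_real_indicator) auto
    moreover have "(\<lambda>z. indicator ?B (z + e) :: real) = indicator (cball (- e) R)"
      by (auto simp: indicator_def dist_norm fun_eq_iff norm_minus_commute add.commute)
    ultimately show ?thesis by simp
  qed
  have "increment_energy F e \<le> (\<integral>z. L\<^sup>2 * (norm e)\<^sup>2 * (indicator ?B z + indicator ?B (z + e)) \<partial>lborel)"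
    unfolding increment_energy_def
  proof (rule integral_mono)
    show "integrable lborel (\<lambda>z. (F (z + e) - F z)\<^sup>2)"
      using integrable_difference_sq[of e 0] by simp
    show "integrable lborel (\<lambda>z. L\<^sup>2 * (norm e)\<^sup>2 * (indicator ?B z + indicator ?B (z + e)))"
      using i0 i1 by auto
    fix z
    have 1: "(F (z + e) - F z)\<^sup>2 \<le> L\<^sup>2 * (norm e)\<^sup>2"
      using Lipschitz[of "z + e" z] by (metis abs_ge_zero abs_le_square_iff abs_of_nonneg add_diff_cancel_left' order_trans power_mult_distrib)
    show "(F (z + e) - F z)\<^sup>2 \<le> L\<^sup>2 * (norm e)\<^sup>2 * (indicator ?B z + indicator ?B (z + e))"
    proof (cases "z \<in> ?B \<or> z + e \<in> ?B")
      case True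
      hence "1 \<le> (indicator ?B z + indicator ?B (z + e) :: real)" by (auto simp: indicator_def)
      from mult_left_mono[OF this, of "L\<^sup>2 * (norm e)\<^sup>2"] 1 show ?thesis by auto
    next
      case False thus ?thesis using support[of z] support[of "z + e"] by (auto simp: not_le)
    qed
  qed
  also have "\<dots> = 2 * L\<^sup>2 * measure lborel ?B * (norm e)\<^sup>2"
  proof -
    have "(\<integral>z. indicator ?B (z + e) \<partial>lborel) = (\<integral>z. (indicator ?B z :: real) \<partial>lborel)"
      by (intro lborel_integral_translate borel_measurable_indicator) auto
    thus ?thesis using i0 i1 by simp
  qed
  finally show ?thesis .
qed

text \<open>The scaled energies increase to a limit \<open>E\<close> as the dyadic scale decreases. The defect
  \<open>Q(e, e')\<close> of the parallelogram law for \<open>E\<close> is nonnegative, and \<open>E (2e) = 4 E e\<close> gives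
  \<open>Q(e + e', e - e') = - 2 Q(e, e')\<close>; hence \<open>Q = 0\<close>.\<close>

lemma second_difference_dyadic_tendsto_0:
  "(\<lambda>k. 4 ^ k * (\<integral>z. (second_difference F (e /\<^sub>R 2 ^ k) (e' /\<^sub>R 2 ^ k) z)\<^sup>2 \<partial>lborel)) \<longlonglongrightarrow> 0"
proof -
  define D where "D = increment_energy F"
  define I where "I = (\<lambda>e k. 4 ^ k * D (e /\<^sub>R 2 ^ k))"
  have D0: "D 0 = 0" by (simp add: D_def increment_energy_def)
  have nn: "0 \<le> 2 * D e + 2 * D e' - D (e + e') - D (e - e')" for e e'
    unfolding D_def integral_second_difference[symmetric] by simp
  \<comment> \<open>The case e = e' of the defect inequality; it is what makes the rescaled energies
    increase with k.\<close>
  have D2: "D (2 *\<^sub>R e) \<le> 4 * D e" for e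
    using nn[of e e] D0 by (simp add: scaleR_2)
  have inc: "incseq (I e)" for e
  proof (rule incseq_SucI)
    fix k
    have "D (e /\<^sub>R 2 ^ k) \<le> 4 * D (e /\<^sub>R 2 ^ Suc k)"
      using D2[of "e /\<^sub>R 2 ^ Suc k"] by simp
    thus "I e k \<le> I e (Suc k)" by (simp add: I_def)
  qed
  have bd: "I e k \<le> 2 * L\<^sup>2 * measure lborel (cball (0::'a) R) * (norm e)\<^sup>2" for e k
  proof -
    have "I e k \<le> 4 ^ k * (2 * L\<^sup>2 * measure lborel (cball (0::'a) R) * (norm (e /\<^sub>R 2 ^ k))\<^sup>2)"
      unfolding I_def D_def by (intro mult_left_mono increment_energy_le) auto
    also have "(norm (e /\<^sub>R 2 ^ k))\<^sup>2 = (norm e)\<^sup>2 / 4 ^ k"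
    proof -
      have "((2::real) ^ k)\<^sup>2 = 4 ^ k" by (simp add: power2_eq_square flip: power_mult_distrib)
      thus ?thesis by (simp add: power_divide divide_inverse_commute power_mult_distrib power_inverse)
    qed
    finally show ?thesis by simp
  qed
  have "\<forall>e. \<exists>E. I e \<longlonglongrightarrow> E"
    using incseq_convergent[OF inc] bd by metis
  then obtain E where E: "\<And>e. I e \<longlonglongrightarrow> E e" by metis
  have lim: "(\<lambda>k. 4 ^ k * (2 * D (e /\<^sub>R 2 ^ k) + 2 * D (e' /\<^sub>R 2 ^ k) - D (e /\<^sub>R 2 ^ k + e' /\<^sub>R 2 ^ k) - D (e /\<^sub>R 2 ^ k - e' /\<^sub>R 2 ^ k)))
     \<longlonglongrightarrow> 2 * E e + 2 * E e' - E (e + e') - E (e - e')" (is "?f e e' \<longlonglongrightarrow> ?Q e e'") for e e'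
  proof -
    have "(\<lambda>k. 2 * I e k + 2 * I e' k - I (e + e') k - I (e - e') k) \<longlonglongrightarrow> ?Q e e'"
      by (intro tendsto_intros E)
    thus ?thesis by (simp add: I_def algebra_simps)
  qed
  have Q: "0 \<le> ?Q e e'" for e e'
    by (rule LIMSEQ_le_const[OF lim]) (use nn in auto)
  have E2: "E (2 *\<^sub>R e) = 4 * E e" for e
  proof -
    have "(\<lambda>k. I (2 *\<^sub>R e) (Suc k)) \<longlonglongrightarrow> E (2 *\<^sub>R e)" using E LIMSEQ_Suc by blast
    moreover have "I (2 *\<^sub>R e) (Suc k) = 4 * I e k" for k by (simp add: I_def)
    ultimately have "(\<lambda>k. 4 * I e k) \<longlonglongrightarrow> E (2 *\<^sub>R e)" by simp
    moreover have "(\<lambda>k. 4 * I e k) \<longlonglongrightarrow> 4 * E e" by (intro tendsto_intros E)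
    ultimately show ?thesis using LIMSEQ_unique by blast
  qed
  have "?Q (e + e') (e - e') = - 2 * ?Q e e'"
    using E2[of e] E2[of e'] by (simp add: scaleR_2 algebra_simps)
  hence "0 \<le> - 2 * ?Q e e'" using Q[of "e + e'" "e - e'"] by metis
  moreover have "q = 0" if "0 \<le> - 2 * q" "0 \<le> q" for q :: real using that by simp
  ultimately have "?Q e e' = 0" using Q[of e e'] by blast
  thus ?thesis using lim[of e e'] unfolding integral_second_difference D_def by simp
qed

end

section \<open>From small second differences to affine approximation on a ball\<close>

text \<open>Walk from 0 to the lattice point in unit steps, one for each unit of the sum of the |n
  b|; every step costs at most \<epsilon>. Second differences against single basis steps thus
  control additivity on the whole box.\<close>

lemma lattice_almost_additive:
  fixes g :: "'a::euclidean_space \<Rightarrow> real" and m :: nat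
  defines "P \<equiv> (\<lambda>n. \<Sum>b\<in>Basis. (of_int (n b) / of_nat m) *\<^sub>R b)"
  assumes step: "\<And>n b. b \<in> Basis \<Longrightarrow> \<forall>c\<in>Basis. \<bar>n c\<bar> \<le> int m \<Longrightarrow>
      \<bar>g (P n + (1 / of_nat m) *\<^sub>R b) - g (P n) - g ((1 / of_nat m) *\<^sub>R b)\<bar> \<le> \<epsilon>"
    and "g 0 = 0" and "\<forall>c\<in>Basis. \<bar>n c\<bar> \<le> int m"
  shows "\<bar>g (P n) - (\<Sum>b\<in>Basis. of_int (n b) * g ((1 / of_nat m) *\<^sub>R b))\<bar> \<le> \<epsilon> * (\<Sum>b\<in>Basis. \<bar>of_int (n b)\<bar>)"
  using assms(4)
proof (induction "nat (\<Sum>b\<in>Basis. \<bar>n b\<bar>)" arbitrary: n rule: less_induct)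
  case less
  show ?case
  proof (cases "\<forall>b\<in>Basis. n b = 0")
    case True
    thus ?thesis using \<open>g 0 = 0\<close> by (simp add: P_def)
  next
    case False
    then obtain b where b: "b \<in> Basis" "n b \<noteq> 0" by blast
    define s where "s = sgn (n b)"
    \<comment> \<open>One unit towards 0 in a nonzero coordinate: this stays in the box and lowers
      the sum by one.\<close>
    define n' where "n' = n(b := n b - s)"
    have s: "s = 1 \<or> s = -1" "\<bar>n b - s\<bar> = \<bar>n b\<bar> - 1"
      using b(2) unfolding s_def by (auto simp: sgn_if)
    have n'le: "\<forall>c\<in>Basis. \<bar>n' c\<bar> \<le> int m"
      using less(2) s unfolding n'_def by (auto split: if_splits)
    have sum: "(\<Sum>c\<in>Basis. f (n c) c) = (\<Sum>c\<in>Basis. f (n' c) c) - f (n b - s) b + f (n b) b"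
      for f :: "int \<Rightarrow> 'a \<Rightarrow> 'c::ab_group_add"
    proof -
      have "(\<Sum>c\<in>Basis - {b}. f (n c) c) = (\<Sum>c\<in>Basis - {b}. f (n' c) c)"
        by (intro sum.cong) (auto simp: n'_def)
      thus ?thesis using b(1) by (simp add: sum.remove[of Basis b] n'_def)
    qed
    have abs_sum: "(\<Sum>c\<in>Basis. \<bar>n c\<bar>) = (\<Sum>c\<in>Basis. \<bar>n' c\<bar>) + 1"
      using sum[of "\<lambda>k c. \<bar>k\<bar>"] s by simp
    have abs_sum': "(\<Sum>c\<in>Basis. \<bar>real_of_int (n c)\<bar>) = (\<Sum>c\<in>Basis. \<bar>real_of_int (n' c)\<bar>) + 1"
      using abs_sum by (metis (mono_tags, lifting) of_int_1 of_int_abs of_int_add of_int_sum sum.cong)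
    have "0 \<le> (\<Sum>c\<in>Basis. \<bar>n' c\<bar>)" by (intro sum_nonneg) auto
    hence IH: "\<bar>g (P n') - (\<Sum>b\<in>Basis. of_int (n' b) * g ((1 / of_nat m) *\<^sub>R b))\<bar> \<le> \<epsilon> * (\<Sum>b\<in>Basis. \<bar>of_int (n' b)\<bar>)"
      using abs_sum n'le by (intro less(1)) auto
    have Pn: "P n = P n' + (of_int s / of_nat m) *\<^sub>R b"
      unfolding P_def sum[of "\<lambda>k c. (of_int k / of_nat m) *\<^sub>R c"]
      by (simp add: diff_divide_distrib scaleR_diff_left)
    have lin: "(\<Sum>b\<in>Basis. of_int (n b) * g ((1 / of_nat m) *\<^sub>R b)) =
        (\<Sum>b\<in>Basis. of_int (n' b) * g ((1 / of_nat m) *\<^sub>R b)) + of_int s * g ((1 / of_nat m) *\<^sub>R b)"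
      unfolding sum[of "\<lambda>k c. of_int k * g ((1 / of_nat m) *\<^sub>R c)"] by (simp add: algebra_simps)
    have "\<bar>g (P n) - g (P n') - of_int s * g ((1 / of_nat m) *\<^sub>R b)\<bar> \<le> \<epsilon>"
      using s(1)
    proof
      assume "s = 1"
      thus ?thesis using step[OF b(1) n'le] Pn by simp
    next
      \<comment> \<open>In a negative coordinate the step is read backwards: P n' is one positive
        step beyond P n, so the hypothesis is used at n.\<close>
      assume "s = -1"
      thus ?thesis using step[OF b(1) less(2)] Pn by simp
    qed
    thus ?thesis using IH unfolding lin abs_sum' by (simp add: algebra_simps)
  qed
qed

text \<open>Markov's inequality, in the form in which it produces a point.\<close>

lemma exists_point_below_mean:
  fixes G :: "'a::euclidean_space \<Rightarrow> real"
  assumes G: "integrable lborel G" "\<And>z. 0 \<le> G z"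
    and K: "compact K" and lt: "(\<integral>z. G z \<partial>lborel) < \<delta> * measure lborel K"
  shows "\<exists>z\<in>K. G z < \<delta>"
proof (rule ccontr)
  assume "\<not> ?thesis"
  hence ge: "\<And>z. z \<in> K \<Longrightarrow> \<delta> \<le> G z" by (auto simp: not_less)
  have sK: "K \<in> sets lborel" using K by (simp add: borel_compact)
  have fK: "emeasure lborel K < \<infinity>" using emeasure_bounded_finite[OF compact_imp_bounded[OF K]] by simp
  have iK: "integrable lborel (\<lambda>z. \<delta> * indicator K z)"
    using sK fK by (intro integrable_mult_right integrable_real_indicator)
  have "\<delta> * measure lborel K = (\<integral>z. \<delta> * indicator K z \<partial>lborel)" using sK fK by simp
  also have "\<dots> \<le> (\<integral>z. G z \<partial>lborel)"
    using G ge by (intro integral_mono[OF iK]) (auto simp: indicator_def)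
  finally show False using lt by simp
qed

lemma not_negligible_measure_pos:
  fixes K :: "'a::euclidean_space set"
  assumes "compact K" "\<not> negligible K"
  shows "0 < measure lborel K"
proof -
  have "measure lebesgue K \<noteq> 0"
    using assms negligible_iff_measure0 lmeasurable_compact by blast
  moreover have "measure lebesgue K = measure lborel K"
    using assms(1) by (intro measure_completion) (simp add: borel_compact)
  ultimately show ?thesis by (simp add: zero_less_measure_iff)
qed


text \<open>The sum \<open>G k\<close> of the squared second differences over finitely many lattice
  directions has integral o(4^(-k)), so at some point of K all of them are below \<epsilon> h with h
  = 2^(-k). There each \<open>F j\<close> is nearly additive on the lattice of mesh h/m, and the
  Lipschitz bound fills the gaps.\<close>

lemma exists_almost_affine_scale_compact_support:
  fixes F :: "'j \<Rightarrow> 'a::euclidean_space \<Rightarrow> real"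
  assumes J: "finite J" and F: "\<And>j. j \<in> J \<Longrightarrow> compactly_supported_Lipschitz (F j) L R"
    and K: "compact K" "\<not> negligible K" and "\<eta> > 0" "r0 > 0"
  shows "\<exists>z\<in>K. \<exists>r. 0 < r \<and> r < r0 \<and>
    (\<forall>j\<in>J. \<exists>l. linear l \<and> (\<forall>y. norm y \<le> r \<longrightarrow> \<bar>F j (z + y) - F j z - l y\<bar> \<le> \<eta> * r))"
proof -
  define N where "N = real DIM('a)"
  have N: "N \<ge> 1" unfolding N_def by (simp add: Suc_leI)
  have Lip: "\<bar>F j x - F j y\<bar> \<le> L * norm (x - y)" if "j \<in> J" for j x y
    using F[OF that] by (simp add: compactly_supported_Lipschitz.Lipschitz)
  \<comment> \<open>The mesh h/m has to be so fine that the two Lipschitz errors, of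
    \<open>F j\<close> and of the linear map, add up to at most \<eta> h/2.\<close>
  obtain m0 :: nat where m0: "4 * N * \<bar>L\<bar> / \<eta> \<le> real m0" using real_arch_simple by blast
  define m where "m = Suc m0"
  have m: "0 < real m" "4 * N * \<bar>L\<bar> / \<eta> \<le> real m" using m0 unfolding m_def by auto
  \<comment> \<open>A lattice point is reached in at most N m steps of cost \<epsilon> h each, in
    total \<eta> h/2.\<close>
  define \<epsilon> where "\<epsilon> = \<eta> / (2 * N * real m)"
  have \<epsilon>: "\<epsilon> > 0" using \<open>\<eta> > 0\<close> N m unfolding \<epsilon>_def by simp
  define P where "P = (\<lambda>n. \<Sum>b\<in>Basis. (of_int (n b) / of_nat m) *\<^sub>R (b::'a))"
  define \<Lambda> where "\<Lambda> = P ` (PiE Basis (\<lambda>_. {- int m..int m}))"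
  have fin: "finite \<Lambda>" unfolding \<Lambda>_def by (intro finite_imageI finite_PiE) auto
  define G where "G = (\<lambda>k z. \<Sum>j\<in>J. \<Sum>v\<in>\<Lambda>. \<Sum>b\<in>Basis.
     (second_difference (F j) (v /\<^sub>R 2 ^ k) (((1 / real m) *\<^sub>R b) /\<^sub>R 2 ^ k) z)\<^sup>2)"
  have int: "integrable lborel (\<lambda>z. (second_difference (F j) e e' z)\<^sup>2)" if "j \<in> J" for j e e'
    using compactly_supported_Lipschitz.integrable_second_difference[OF F[OF that]] .
  have Gint: "integrable lborel (G k)" for k
    unfolding G_def using int by (intro Bochner_Integration.integrable_sum) auto
  have Gnn: "0 \<le> G k z" for k z unfolding G_def by (intro sum_nonneg) auto
  have "(\<lambda>k. \<Sum>j\<in>J. \<Sum>v\<in>\<Lambda>. \<Sum>b\<in>Basis. 4 ^ k * (\<integral>z.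
     (second_difference (F j) (v /\<^sub>R 2 ^ k) (((1 / real m) *\<^sub>R b) /\<^sub>R 2 ^ k) z)\<^sup>2 \<partial>lborel)) \<longlonglongrightarrow> 0"
    by (intro tendsto_null_sum compactly_supported_Lipschitz.second_difference_dyadic_tendsto_0[OF F])
  moreover have "(\<Sum>j\<in>J. \<Sum>v\<in>\<Lambda>. \<Sum>b\<in>Basis. 4 ^ k * (\<integral>z.
     (second_difference (F j) (v /\<^sub>R 2 ^ k) (((1 / real m) *\<^sub>R b) /\<^sub>R 2 ^ k) z)\<^sup>2 \<partial>lborel)) = 4 ^ k * (\<integral>z. G k z \<partial>lborel)" for k
    unfolding G_def using int
    by (simp add: Bochner_Integration.integral_sum Bochner_Integration.integrable_sum sum_distrib_left)
  ultimately have lim: "(\<lambda>k. 4 ^ k * (\<integral>z. G k z \<partial>lborel)) \<longlonglongrightarrow> 0" by simp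
  \<comment> \<open>Positive measure of K turns the vanishing integrals into a point of K at which
    \<open>G k\<close> is small.\<close>
  have pos: "0 < \<epsilon>\<^sup>2 * measure lborel K" using \<epsilon> not_negligible_measure_pos[OF K] by simp
  have ev1: "\<forall>\<^sub>F k in sequentially. 4 ^ k * (\<integral>z. G k z \<partial>lborel) < \<epsilon>\<^sup>2 * measure lborel K"
    using order_tendstoD(2)[OF lim pos] .
  have "(\<lambda>k. inverse (2::real) ^ k) \<longlonglongrightarrow> 0" by (intro LIMSEQ_realpow_zero) auto
  from order_tendstoD(2)[OF this \<open>r0 > 0\<close>] have ev2: "\<forall>\<^sub>F k in sequentially. inverse (2::real) ^ k < r0" .
  obtain k where k: "4 ^ k * (\<integral>z. G k z \<partial>lborel) < \<epsilon>\<^sup>2 * measure lborel K" "inverse (2::real) ^ k < r0"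
    using eventually_happens'[OF _ eventually_conj[OF ev1 ev2]] by auto
  define h where "h = inverse (2::real) ^ k"
  have h: "0 < h" "h < r0" "h = inverse (2 ^ k)" "h\<^sup>2 * 4 ^ k = 1"
    using k(2) unfolding h_def
    by (auto simp: power_inverse power2_eq_square field_simps simp flip: power_mult_distrib)
  have "h\<^sup>2 * (4 ^ k * (\<integral>z. G k z \<partial>lborel)) < h\<^sup>2 * (\<epsilon>\<^sup>2 * measure lborel K)"
    using k(1) h(1) by (intro mult_strict_left_mono) auto
  moreover have "h\<^sup>2 * (4 ^ k * (\<integral>z. G k z \<partial>lborel)) = (\<integral>z. G k z \<partial>lborel)"
    unfolding mult.assoc[symmetric] h(4) by simp
  ultimately have "(\<integral>z. G k z \<partial>lborel) < (\<epsilon>\<^sup>2 * h\<^sup>2) * measure lborel K"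
    by (simp only: ac_simps)
  from exists_point_below_mean[OF Gint Gnn K(1) this]
  obtain z where z: "z \<in> K" "G k z < \<epsilon>\<^sup>2 * h\<^sup>2" by blast
  have sd: "\<bar>second_difference (F j) (h *\<^sub>R v) (h *\<^sub>R ((1 / real m) *\<^sub>R b)) z\<bar> \<le> \<epsilon> * h"
    if "j \<in> J" "v \<in> \<Lambda>" "b \<in> Basis" for j v b
  proof -
    let ?s = "\<lambda>j v b. (second_difference (F j) (v /\<^sub>R 2 ^ k) (((1 / real m) *\<^sub>R b) /\<^sub>R 2 ^ k) z)\<^sup>2"
    have "?s j v b \<le> (\<Sum>b\<in>Basis. ?s j v b)"
      using that by (intro member_le_sum) auto
    also have "\<dots> \<le> (\<Sum>v\<in>\<Lambda>. \<Sum>b\<in>Basis. ?s j v b)"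
      using that fin by (intro member_le_sum[of v \<Lambda> "\<lambda>v. \<Sum>b\<in>Basis. ?s j v b"]) (auto intro!: sum_nonneg)
    also have "\<dots> \<le> G k z"
      unfolding G_def using that J
      by (intro member_le_sum[of j J "\<lambda>j. \<Sum>v\<in>\<Lambda>. \<Sum>b\<in>Basis. ?s j v b"]) (auto intro!: sum_nonneg)
    also have "\<dots> \<le> (\<epsilon> * h)\<^sup>2" using z(2) by (simp add: power_mult_distrib)
    finally show ?thesis using \<epsilon> h(1)
      by (metis abs_le_square_iff abs_of_pos h(3) mult_pos_pos)
  qed
  show ?thesis
  proof (intro bexI[OF _ z(1)] exI[of _ h] conjI ballI h(1,2))
    fix j assume j: "j \<in> J"
    define g where "g = (\<lambda>v. F j (z + h *\<^sub>R v) - F j z)"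
    \<comment> \<open>The linear map with the same increments as \<open>g\<close> along the basis
      steps of the mesh.\<close>
    define l where "l = (\<lambda>y. \<Sum>b\<in>Basis. (y \<bullet> b) * (real m * g ((1 / real m) *\<^sub>R b) / h))"
    have lin: "linear l" unfolding l_def
      by (intro linearI) (auto simp: inner_add_left sum.distrib distrib_right sum_distrib_left mult.assoc add_divide_distrib)
    have Lnn: "0 \<le> L"
    proof -
      obtain b :: 'a where b: "b \<in> Basis" using nonempty_Basis by blast
      have "0 \<le> L * norm (b - 0)" using Lip[OF j, of b 0] by linarith
      thus ?thesis using b by simp
    qed
    have slope: "\<bar>real m * g ((1 / real m) *\<^sub>R b) / h\<bar> \<le> L" if "b \<in> Basis" for b
    proof -
      have "\<bar>g ((1 / real m) *\<^sub>R b)\<bar> \<le> L * (h / real m)"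
        using Lip[OF j, of "z + h *\<^sub>R ((1 / real m) *\<^sub>R b)" z] that h(1) m(1) unfolding g_def by simp
      thus ?thesis using m(1) h(1) by (simp add: abs_mult field_simps)
    qed
    have lle: "\<bar>l y\<bar> \<le> L * (\<Sum>b\<in>Basis. \<bar>y \<bullet> b\<bar>)" for y
    proof -
      have "\<bar>l y\<bar> \<le> (\<Sum>b\<in>Basis. \<bar>(y \<bullet> b) * (real m * g ((1 / real m) *\<^sub>R b) / h)\<bar>)"
        unfolding l_def by (rule sum_abs)
      also have "\<dots> \<le> (\<Sum>b\<in>Basis. \<bar>y \<bullet> b\<bar> * L)"
        using slope by (intro sum_mono) (simp only: abs_mult, intro mult_left_mono, auto)
      finally show ?thesis by (simp add: sum_distrib_left mult.commute)
    qed
    have "\<bar>F j (z + y) - F j z - l y\<bar> \<le> \<eta> * h" if y: "norm y \<le> h" for y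
    proof -
      define n where "n = (\<lambda>b. if b \<in> Basis then \<lfloor>real m * (y \<bullet> b) / h\<rfloor> else undefined)"
      have nb: "\<forall>b\<in>Basis. \<bar>n b\<bar> \<le> int m"
      proof
        fix b :: 'a assume b: "b \<in> Basis"
        have "\<bar>y \<bullet> b\<bar> \<le> h" using Basis_le_norm[OF b, of y] y by linarith
        hence "\<bar>real m * (y \<bullet> b) / h\<bar> \<le> real m"
          using h(1) m(1) by (simp add: abs_mult field_simps)
        hence "- real_of_int (int m) \<le> real m * (y \<bullet> b) / h" "real m * (y \<bullet> b) / h \<le> real_of_int (int m)"
          by (simp_all only: abs_le_iff of_int_of_nat_eq minus_le_iff)
        hence "- int m \<le> \<lfloor>real m * (y \<bullet> b) / h\<rfloor>" "\<lfloor>real m * (y \<bullet> b) / h\<rfloor> \<le> int m"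
          by (metis le_floor_iff of_int_minus, metis floor_mono floor_of_int)
        thus "\<bar>n b\<bar> \<le> int m" using b unfolding n_def by simp
      qed
      define w where "w = y - h *\<^sub>R P n"
      have Pb: "P n \<bullet> b = of_int (n b) / real m" if "b \<in> Basis" for b
        unfolding P_def using that by (simp add: inner_sum_left inner_Basis if_distrib sum.delta' cong: if_cong)
      have wb: "\<bar>w \<bullet> b\<bar> \<le> h / real m" if b: "b \<in> Basis" for b
      proof -
        have "\<bar>x - of_int \<lfloor>x\<rfloor>\<bar> \<le> 1" for x :: real by linarith
        hence "\<bar>real m * (y \<bullet> b) / h - of_int (n b)\<bar> \<le> 1" using b unfolding n_def by simp
        from mult_left_mono[OF this, of "h / real m"]
        have "h / real m * \<bar>real m * (y \<bullet> b) / h - of_int (n b)\<bar> \<le> h / real m"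
          using h(1) m(1) by simp
        moreover have "w \<bullet> b = h / real m * (real m * (y \<bullet> b) / h - of_int (n b))"
          using b h(1) m(1) unfolding w_def by (simp add: inner_diff_left Pb field_simps)
        ultimately show ?thesis using h(1) m(1) by (simp only: abs_mult abs_divide)
      qed
      have ws: "(\<Sum>b\<in>Basis. \<bar>w \<bullet> b\<bar>) \<le> N * (h / real m)"
        using sum_bounded_above[of Basis "\<lambda>b. \<bar>w \<bullet> b\<bar>" "h / real m"] wb unfolding N_def by simp
      have nw: "norm w \<le> N * (h / real m)" using norm_le_l1[of w] ws by linarith
      have t1: "\<bar>F j (z + y) - F j (z + h *\<^sub>R P n)\<bar> \<le> L * (N * (h / real m))"
        using Lip[OF j, of "z + y" "z + h *\<^sub>R P n"] mult_left_mono[OF nw Lnn] unfolding w_def by simp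
      have t2: "\<bar>l w\<bar> \<le> L * (N * (h / real m))"
        using lle[of w] mult_left_mono[OF ws Lnn] by linarith
      have ly: "l y = l (h *\<^sub>R P n) + l w"
        using linear_add[OF lin, of "h *\<^sub>R P n" w] unfolding w_def by simp
      have lP: "l (h *\<^sub>R P n) = (\<Sum>b\<in>Basis. of_int (n b) * g ((1 / of_nat m) *\<^sub>R b))"
        unfolding l_def using m(1) h(1) by (intro sum.cong) (auto simp: Pb)
      have t3: "\<bar>g (P n) - (\<Sum>b\<in>Basis. of_int (n b) * g ((1 / of_nat m) *\<^sub>R b))\<bar> \<le> (\<epsilon> * h) * (\<Sum>b\<in>(Basis::'a set). \<bar>of_int (n b)\<bar>)"
        unfolding P_def
      proof (rule lattice_almost_additive)
        fix n' :: "'a \<Rightarrow> int" and b assume b: "b \<in> (Basis::'a set)" and n': "\<forall>c\<in>Basis. \<bar>n' c\<bar> \<le> int m"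
        \<comment> \<open>\<open>\<Lambda>\<close> is indexed by extensional functions; restricting
          the coefficients to the basis leaves the lattice point unchanged.\<close>
        have "P (restrict n' Basis) \<in> \<Lambda>"
          unfolding \<Lambda>_def using n' by (intro imageI) (auto simp: abs_le_iff)
        moreover have "P (restrict n' Basis) = P n'" unfolding P_def by (intro sum.cong) auto
        ultimately have PL: "P n' \<in> \<Lambda>" by simp
        have sdg: "second_difference (F j) (h *\<^sub>R v) (h *\<^sub>R u) z = g (v + u) - g v - g u" for v u
          unfolding second_difference_def g_def scaleR_add_right add.assoc by simp
        show "\<bar>g ((\<Sum>b\<in>Basis. (real_of_int (n' b) / real m) *\<^sub>R b) + (1 / real m) *\<^sub>R b)
           - g (\<Sum>b\<in>Basis. (real_of_int (n' b) / real m) *\<^sub>R b) - g ((1 / real m) *\<^sub>R b)\<bar> \<le> \<epsilon> * h"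
          using sd[OF j PL b] by (simp only: sdg P_def)
      qed (use nb in \<open>auto simp: g_def\<close>)
      have "(\<Sum>b\<in>(Basis::'a set). \<bar>real_of_int (n b)\<bar>) \<le> N * real m"
        using sum_bounded_above[of "Basis::'a set" "\<lambda>b. \<bar>real_of_int (n b)\<bar>" "real m"] nb
        unfolding N_def by (metis (mono_tags, lifting) of_int_abs of_int_le_iff of_int_of_nat_eq)
      hence "(\<epsilon> * h) * (\<Sum>b\<in>(Basis::'a set). \<bar>of_int (n b)\<bar>) \<le> (\<epsilon> * h) * (N * real m)"
        using \<epsilon> h(1) by (intro mult_left_mono) auto
      also have "\<dots> = \<eta> / 2 * h" using N m(1) unfolding \<epsilon>_def by (simp add: field_simps)
      finally have t3': "\<bar>g (P n) - l (h *\<^sub>R P n)\<bar> \<le> \<eta> / 2 * h" using t3 lP by simp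
      have "4 * N * L \<le> \<eta> * real m" using m Lnn \<open>\<eta> > 0\<close> by (simp add: field_simps)
      hence "4 * N * L * h \<le> \<eta> * real m * h" using h(1) by (intro mult_right_mono) auto
      hence t4: "2 * (L * (N * (h / real m))) \<le> \<eta> / 2 * h"
        using m(1) by (simp add: field_simps)
      moreover have "F j (z + y) - F j z - l y = (F j (z + y) - F j (z + h *\<^sub>R P n))
          + (g (P n) - l (h *\<^sub>R P n)) - l w"
        unfolding ly g_def by simp
      moreover have "\<bar>a + b - c\<bar> \<le> \<eta> * h"
        if "\<bar>a\<bar> \<le> q" "\<bar>c\<bar> \<le> q" "\<bar>b\<bar> \<le> \<eta> / 2 * h" "2 * q \<le> \<eta> / 2 * h" for a b c q
        using that by (simp add: field_simps)
      ultimately show ?thesis using t1 t2 t3' t4 by metis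
    qed
    thus "\<exists>l. linear l \<and> (\<forall>y. norm y \<le> h \<longrightarrow> \<bar>F j (z + y) - F j z - l y\<bar> \<le> \<eta> * h)"
      using lin by blast
  qed
qed

text \<open>Clamping to the band between -c and c, where c is a tent that vanishes far away, gives
  compact support and preserves a Lipschitz bound, while nothing changes near K.\<close>

theorem exists_almost_affine_scale:
  fixes F :: "'j \<Rightarrow> 'a::euclidean_space \<Rightarrow> real"
  assumes J: "finite J" and F: "\<And>j x y. j \<in> J \<Longrightarrow> \<bar>F j x - F j y\<bar> \<le> L * norm (x - y)"
    and K: "compact K" "\<not> negligible K" and "\<eta> > 0" "r0 > 0"
  shows "\<exists>z\<in>K. \<exists>r. 0 < r \<and> r < r0 \<and>
    (\<forall>j\<in>J. \<exists>l. linear l \<and> (\<forall>y. norm y \<le> r \<longrightarrow> \<bar>F j (z + y) - F j z - l y\<bar> \<le> \<eta> * r))"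
proof -
  obtain R1 where R1: "R1 > 0" "\<And>z. z \<in> K \<Longrightarrow> norm z \<le> R1"
    using compact_imp_bounded[OF K(1)] bounded_pos by blast
  \<comment> \<open>A bound for every |F j| on the ball of radius R1 + 1, so that the clamp is
    inactive there.\<close>
  define M where "M = \<bar>L\<bar> * (R1 + 1) + (\<Sum>j\<in>J. \<bar>F j 0\<bar>)"
  have Mnn: "0 \<le> M" unfolding M_def using R1(1) by (intro add_nonneg_nonneg sum_nonneg) auto
  define c where "c = (\<lambda>z::'a. M * max 0 (R1 + 2 - norm z))"
  have c_Lip: "\<bar>c x - c y\<bar> \<le> M * norm (x - y)" for x y
  proof -
    have "\<bar>max 0 (R1 + 2 - norm x) - max 0 (R1 + 2 - norm y)\<bar> \<le> norm (x - y)"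
      using norm_triangle_ineq3[of x y] by linarith
    thus ?thesis unfolding c_def using Mnn by (simp add: abs_mult mult_left_mono flip: right_diff_distrib)
  qed
  have c_ge: "M \<le> c z" if "norm z \<le> R1 + 1" for z
    unfolding c_def using that Mnn mult_left_mono[of 1 "max 0 (R1 + 2 - norm z)" M] by simp
  have c_nn: "0 \<le> c z" for z unfolding c_def using Mnn by simp
  define F' where "F' = (\<lambda>j z. max (- c z) (min (F j z) (c z)))"
  have eq: "F' j z = F j z" if "j \<in> J" "norm z \<le> R1 + 1" for j z
  proof -
    have "\<bar>F j z\<bar> \<le> \<bar>F j 0\<bar> + L * norm z" using F[OF that(1), of z 0] by simp
    also have "L * norm z \<le> \<bar>L\<bar> * (R1 + 1)" using that(2) by (intro mult_mono) auto
    also have "\<bar>F j 0\<bar> \<le> (\<Sum>j\<in>J. \<bar>F j 0\<bar>)" using J that(1) by (intro member_le_sum) auto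
    finally have "\<bar>F j z\<bar> \<le> M" unfolding M_def by simp
    thus ?thesis unfolding F'_def using c_ge[OF that(2)] by (simp add: max_def min_def abs_le_iff)
  qed
  have cs: "compactly_supported_Lipschitz (F' j) (max L M) (R1 + 2)" if "j \<in> J" for j
  proof
    fix x y :: 'a
    have le: "L * norm (x - y) \<le> max L M * norm (x - y)" "M * norm (x - y) \<le> max L M * norm (x - y)"
      by (intro mult_right_mono; simp)+
    note * = order_trans[OF F[OF that, of x y] le(1)] order_trans[OF c_Lip[of x y] le(2)]
    have min: "\<bar>min a b - min a' b'\<bar> \<le> q" if "\<bar>a - a'\<bar> \<le> q" "\<bar>b - b'\<bar> \<le> q" for a a' b b' q :: real
      using that by (simp add: min_def abs_le_iff)
    have max: "\<bar>max a b - max a' b'\<bar> \<le> q" if "\<bar>a - a'\<bar> \<le> q" "\<bar>b - b'\<bar> \<le> q" for a a' b b' q :: real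
      using that by (simp add: max_def abs_le_iff)
    show "\<bar>F' j x - F' j y\<bar> \<le> max L M * norm (x - y)"
      unfolding F'_def using * by (intro max min) simp_all
  next
    fix x :: 'a assume "norm x > R1 + 2"
    hence "c x = 0" unfolding c_def by simp
    thus "F' j x = 0" unfolding F'_def by simp
  qed
  \<comment> \<open>A radius below 1 keeps z + y in the ball where clamped and original functions
    agree.\<close>
  have "min r0 1 > 0" using \<open>r0 > 0\<close> by simp
  from exists_almost_affine_scale_compact_support[of J F' "max L M" "R1 + 2", OF J cs K \<open>\<eta> > 0\<close> this]
  obtain z r where zr: "z \<in> K" "0 < r" "r < min r0 1"
    "\<forall>j\<in>J. \<exists>l. linear l \<and> (\<forall>y. norm y \<le> r \<longrightarrow> \<bar>F' j (z + y) - F' j z - l y\<bar> \<le> \<eta> * r)" by blast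
  have "F' j (z + y) = F j (z + y)" if "j \<in> J" "norm y \<le> r" for j y
    using that zr R1(2)[OF zr(1)] norm_triangle_ineq[of z y] by (intro eq) auto
  moreover have "F' j z = F j z" if "j \<in> J" for j
    using that R1(2)[OF zr(1)] by (intro eq) auto
  ultimately show ?thesis using zr by (intro bexI[OF _ zr(1)] exI[of _ r]) auto
qed

section \<open>Semicontinuous functions\<close>

lemma lower_semicontinuous_on_uminus:
  "lower_semicontinuous_on S u \<longleftrightarrow> upper_semicontinuous_on S (\<lambda>z. - u z)"
proof
  assume l: "lower_semicontinuous_on S u"
  show "upper_semicontinuous_on S (\<lambda>z. - u z)"
    unfolding upper_semicontinuous_on_def
  proof (intro ballI allI impI)
    fix z a assume "z \<in> S" "- u z < a"
    hence "\<forall>\<^sub>F w in at z within S. - a < u w" using l unfolding lower_semicontinuous_on_def by simp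
    thus "\<forall>\<^sub>F w in at z within S. - u w < a" by eventually_elim simp
  qed
next
  assume l: "upper_semicontinuous_on S (\<lambda>z. - u z)"
  show "lower_semicontinuous_on S u"
    unfolding lower_semicontinuous_on_def
  proof (intro ballI allI impI)
    fix z a assume "z \<in> S" "a < u z"
    hence "\<forall>\<^sub>F w in at z within S. - u w < - a"
      using l[unfolded upper_semicontinuous_on_def, rule_format, of z "- a"] by simp
    thus "\<forall>\<^sub>F w in at z within S. a < u w" by eventually_elim simp
  qed
qed

lemma upper_semicontinuous_on_subset:
  "upper_semicontinuous_on S u \<Longrightarrow> R \<subseteq> S \<Longrightarrow> upper_semicontinuous_on R u"
  unfolding upper_semicontinuous_on_def by (blast intro: filter_leD[OF at_le])

lemma continuous_on_imp_upper_semicontinuous_on: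
  "continuous_on S u \<Longrightarrow> upper_semicontinuous_on S u"
  unfolding upper_semicontinuous_on_def continuous_on_def by (auto dest: order_tendstoD(2))

lemma upper_semicontinuous_on_add:
  assumes "upper_semicontinuous_on S u" "upper_semicontinuous_on S v"
  shows "upper_semicontinuous_on S (\<lambda>z. u z + v z)"
  unfolding upper_semicontinuous_on_def
proof (intro ballI allI impI)
  fix z a assume z: "z \<in> S" "u z + v z < a"
  define e where "e = (a - u z - v z) / 2"
  have "u z < u z + e" "v z < v z + e" using z(2) unfolding e_def by auto
  hence "\<forall>\<^sub>F w in at z within S. u w < u z + e" "\<forall>\<^sub>F w in at z within S. v w < v z + e"
    using assms z(1) unfolding upper_semicontinuous_on_def by blast+
  thus "\<forall>\<^sub>F w in at z within S. u w + v w < a"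
    by eventually_elim (simp add: e_def field_simps)
qed

lemma upper_semicontinuous_on_sequence:
  assumes "upper_semicontinuous_on S u" "\<And>k. x k \<in> S" "x \<longlonglongrightarrow> z" "z \<in> S" "u z < a"
  shows "\<forall>\<^sub>F k in sequentially. u (x k) < a"
proof -
  have "\<forall>\<^sub>F w in at z within S. u w < a"
    using assms unfolding upper_semicontinuous_on_def by blast
  hence "\<forall>\<^sub>F w in nhds z. w \<in> S \<longrightarrow> u w < a"
    using assms(5) by (auto simp: eventually_at_filter elim: eventually_mono)
  from filterlim_iff[THEN iffD1, OF assms(3), rule_format, OF this] show ?thesis
    using assms(2) by simp
qed

text \<open>If every value were exceeded by some u (f z), the neighbourhoods on which u stays below
  u (f z) would cover S. In a finite subcover the point f z with the largest value would lie in no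
  member.\<close>

lemma upper_semicontinuous_on_attains_max:
  assumes "compact S" "S \<noteq> {}" "upper_semicontinuous_on S u"
  shows "\<exists>z\<in>S. \<forall>w\<in>S. u w \<le> u z"
proof (rule ccontr)
  assume "\<not> ?thesis"
  then obtain f where f: "\<And>z. z \<in> S \<Longrightarrow> f z \<in> S \<and> u z < u (f z)" by (metis not_le)
  have "\<exists>T. open T \<and> z \<in> T \<and> (\<forall>w\<in>T \<inter> S. u w < u (f z))" if z: "z \<in> S" for z
  proof -
    have "\<forall>\<^sub>F w in at z within S. u w < u (f z)"
      using assms(3) f[OF z] z unfolding upper_semicontinuous_on_def by blast
    then obtain T where T: "open T" "z \<in> T" "\<And>w. w \<in> T \<Longrightarrow> w \<noteq> z \<Longrightarrow> w \<in> S \<Longrightarrow> u w < u (f z)"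
      unfolding eventually_at_topological by blast
    have "u w < u (f z)" if "w \<in> T \<inter> S" for w
      using T(3)[of w] f[OF z] that by (cases "w = z") auto
    thus ?thesis using T(1,2) by blast
  qed
  then obtain T where T: "\<And>z. z \<in> S \<Longrightarrow> open (T z) \<and> z \<in> T z \<and> (\<forall>w\<in>T z \<inter> S. u w < u (f z))" by metis
  obtain D where D: "D \<subseteq> S" "finite D" "S \<subseteq> (\<Union>z\<in>D. T z)"
    by (rule compactE_image[OF assms(1), of S T]) (use T in auto)
  have "D \<noteq> {}" using D(3) assms(2) by blast
  obtain z where z: "z \<in> D" "\<And>y. y \<in> D \<Longrightarrow> u (f y) \<le> u (f z)"
    using arg_min_if_finite[OF D(2) \<open>D \<noteq> {}\<close>, of "\<lambda>z. - u (f z)"] by (metis neg_less_iff_less not_le)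
  have "f z \<in> S" using f z D by blast
  then obtain y where "y \<in> D" "f z \<in> T y" using D(3) by blast
  hence "u (f z) < u (f y)" using T[of y] D(1) \<open>f z \<in> S\<close> by blast
  thus False using z(2)[OF \<open>y \<in> D\<close>] by simp
qed

section \<open>Second order expansions of functions with subgradients\<close>

text \<open>McShane's extension, the lower envelope of the cones of slope L with vertices on the
  graph over K.\<close>

lemma Lipschitz_extension:
  fixes f :: "'a::real_normed_vector \<Rightarrow> real"
  assumes "\<And>x y. x \<in> K \<Longrightarrow> y \<in> K \<Longrightarrow> \<bar>f x - f y\<bar> \<le> L * norm (x - y)" "0 \<le> L" "K \<noteq> {}"
  shows "\<exists>F. (\<forall>x y. \<bar>F x - F y\<bar> \<le> L * norm (x - y)) \<and> (\<forall>x\<in>K. F x = f x)"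
proof -
  define F where "F = (\<lambda>x. INF k\<in>K. f k + L * norm (x - k))"
  obtain k0 where k0: "k0 \<in> K" using assms(3) by blast
  have lb: "f k0 - L * norm (x - k0) \<le> f k + L * norm (x - k)" if "k \<in> K" for k x
  proof -
    have "f k0 - f k \<le> L * norm (k0 - k)" using assms(1)[OF k0 that] by linarith
    also have "\<dots> \<le> L * (norm (x - k) + norm (x - k0))"
      using norm_triangle_ineq4[of "x - k" "x - k0"] assms(2) by (intro mult_left_mono) auto
    finally show ?thesis by (simp add: algebra_simps)
  qed
  have bdd: "bdd_below ((\<lambda>k. f k + L * norm (x - k)) ` K)" for x
    using lb[of _ x] by (intro bdd_belowI2) auto
  have le: "F x \<le> F y + L * norm (x - y)" for x y
  proof -
    have "F x - L * norm (x - y) \<le> F y"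
      unfolding F_def
    proof (rule cINF_greatest[OF assms(3)])
      fix k assume k: "k \<in> K"
      have "L * norm (x - k) \<le> L * (norm (x - y) + norm (y - k))"
        using norm_triangle_ineq[of "x - y" "y - k"] assms(2) by (intro mult_left_mono) auto
      thus "(INF k\<in>K. f k + L * norm (x - k)) - L * norm (x - y) \<le> f k + L * norm (y - k)"
        using cINF_lower[OF bdd k, of x] by (simp add: algebra_simps)
    qed
    thus ?thesis by simp
  qed
  have "\<bar>F x - F y\<bar> \<le> L * norm (x - y)" for x y
    using le[of x y] le[of y x] by (simp add: norm_minus_commute abs_le_iff)
  moreover have "F x = f x" if x: "x \<in> K" for x
  proof (rule antisym)
    show "F x \<le> f x" unfolding F_def using cINF_lower[OF bdd x, of x] by simp
    show "f x \<le> F x" unfolding F_def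
      using assms(1)[OF x] assms(3) by (intro cINF_greatest) (force simp: abs_le_iff)+
  qed
  ultimately show ?thesis by blast
qed

text \<open>On N equal pieces the quadratic errors add up to m/N, which vanishes in the limit. This
  takes the place of an integration: where it is applied, D is not known to be
  differentiable.\<close>

lemma abs_diff_le_subdivision:
  fixes D :: "real \<Rightarrow> real"
  assumes "\<And>s t. 0 \<le> s \<Longrightarrow> s \<le> t \<Longrightarrow> t \<le> 1 \<Longrightarrow> \<bar>D t - D s\<bar> \<le> \<omega> * (t - s) + m * (t - s)\<^sup>2"
  shows "\<bar>D 1 - D 0\<bar> \<le> \<omega>"
proof -
  have le: "\<bar>D 1 - D 0\<bar> \<le> \<omega> + m * inverse (real (Suc n))" for n
  proof -
    let ?N = "real (Suc n)"
    have "D 1 - D 0 = (\<Sum>i<Suc n. D (real (Suc i) / ?N) - D (real i / ?N))"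
      using sum_lessThan_telescope[of "\<lambda>i. D (real i / ?N)" "Suc n"] by simp
    also have "\<bar>\<dots>\<bar> \<le> (\<Sum>i<Suc n. \<bar>D (real (Suc i) / ?N) - D (real i / ?N)\<bar>)" by (rule sum_abs)
    also have "\<dots> \<le> (\<Sum>i<Suc n. \<omega> * (1 / ?N) + m * (1 / ?N)\<^sup>2)"
    proof (rule sum_mono)
      fix i assume "i \<in> {..<Suc n}"
      hence "0 \<le> real i / ?N" "real i / ?N \<le> real (Suc i) / ?N" "real (Suc i) / ?N \<le> 1"
        by (auto simp: field_simps)
      moreover have "real (Suc i) / ?N - real i / ?N = 1 / ?N" by (simp flip: diff_divide_distrib)
      ultimately show "\<bar>D (real (Suc i) / ?N) - D (real i / ?N)\<bar> \<le> \<omega> * (1 / ?N) + m * (1 / ?N)\<^sup>2"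
        using assms by metis
    qed
    also have "\<dots> = ?N * (\<omega> * (1 / ?N) + m * (1 / ?N)\<^sup>2)" by simp
    also have "\<dots> = \<omega> + m * inverse ?N"
    proof -
      have "N * (\<omega> * (1 / N) + m * (1 / N)\<^sup>2) = \<omega> + m * inverse N" if "N > 0" for N :: real
        using that by (simp add: field_simps power2_eq_square)
      thus ?thesis by simp
    qed
    finally show ?thesis .
  qed
  have "(\<lambda>n. \<omega> + m * inverse (real (Suc n))) \<longlonglongrightarrow> \<omega> + m * 0"
    by (intro tendsto_intros LIMSEQ_inverse_real_of_nat)
  hence lim: "(\<lambda>n. \<omega> + m * inverse (real (Suc n))) \<longlonglongrightarrow> \<omega>" by simp
  show ?thesis by (rule LIMSEQ_le_const[OF lim]) (use le in auto)
qed

text \<open>Along a segment the increment of a lies between the subgradient slopes at its two ends.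
  Slopes that are affine up to \<eta> r therefore sum up, over finer and finer subdivisions, to a
  quadratic with error of order r^2.\<close>

lemma subgradient_expansion:
  fixes a :: "'a::euclidean_space \<Rightarrow> real" and P l :: "'a \<Rightarrow> 'a"
  assumes sub: "\<And>x z. a z + P z \<bullet> (x - z) \<le> a x"
    and "linear l" and l: "\<And>y. norm y \<le> r \<Longrightarrow> norm (P (z + y) - P z - l y) \<le> \<eta> * r"
    and y: "norm y \<le> r" and "0 \<le> \<eta>"
  shows "\<bar>a (z + y) - a z - P z \<bullet> y - (y \<bullet> l y) / 2\<bar> \<le> \<eta> * r\<^sup>2"
proof -
  define m where "m = y \<bullet> l y"
  define D where "D = (\<lambda>t. a (z + t *\<^sub>R y) - t * (P z \<bullet> y) - t\<^sup>2 * m / 2)"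
  have "0 \<le> r" using y norm_ge_zero order_trans by blast
  have grad: "\<bar>P (z + s *\<^sub>R y) \<bullet> y - P z \<bullet> y - s * m\<bar> \<le> \<eta> * r * norm y" if "0 \<le> s" "s \<le> 1" for s
  proof -
    have "norm (s *\<^sub>R y) \<le> r" using that y mult_left_le_one_le[of "norm y" s] by simp
    from l[OF this] have "norm (P (z + s *\<^sub>R y) - P z - l (s *\<^sub>R y)) * norm y \<le> \<eta> * r * norm y"
      by (intro mult_right_mono) auto
    moreover have "P (z + s *\<^sub>R y) \<bullet> y - P z \<bullet> y - s * m = (P (z + s *\<^sub>R y) - P z - l (s *\<^sub>R y)) \<bullet> y"
      unfolding m_def linear_scale[OF \<open>linear l\<close>] by (simp add: inner_commute[of _ y] inner_diff_right)
    ultimately show ?thesis using Cauchy_Schwarz_ineq2 order_trans by metis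
  qed
  have "\<bar>D 1 - D 0\<bar> \<le> \<eta> * r * norm y"
  proof (rule abs_diff_le_subdivision[where m = "\<bar>m\<bar>"])
    fix s t :: real assume st: "0 \<le> s" "s \<le> t" "t \<le> 1"
    have d: "z + t *\<^sub>R y - (z + s *\<^sub>R y) = (t - s) *\<^sub>R y" for s t by (simp add: scaleR_diff_left)
    have 1: "(t - s) * (P (z + s *\<^sub>R y) \<bullet> y) \<le> a (z + t *\<^sub>R y) - a (z + s *\<^sub>R y)"
      using sub[of "z + s *\<^sub>R y" "z + t *\<^sub>R y"] unfolding d by simp
    have 2: "a (z + t *\<^sub>R y) - a (z + s *\<^sub>R y) \<le> (t - s) * (P (z + t *\<^sub>R y) \<bullet> y)"
      using sub[of "z + t *\<^sub>R y" "z + s *\<^sub>R y"] unfolding d by (simp add: left_diff_distrib)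
    have 3: "(t - s) * (P z \<bullet> y + s * m - \<eta> * r * norm y) \<le> (t - s) * (P (z + s *\<^sub>R y) \<bullet> y)"
      using grad[of s] st by (intro mult_left_mono) (auto simp: abs_le_iff)
    have 4: "(t - s) * (P (z + t *\<^sub>R y) \<bullet> y) \<le> (t - s) * (P z \<bullet> y + t * m + \<eta> * r * norm y)"
      using grad[of t] st by (intro mult_left_mono) (auto simp: abs_le_iff)
    have 5: "\<bar>(t - s)\<^sup>2 * m\<bar> \<le> \<bar>m\<bar> * (t - s)\<^sup>2" "0 \<le> \<bar>m\<bar> * (t - s)\<^sup>2"
      by (simp_all add: abs_mult)
    \<comment> \<open>The increment of t^2 m/2 between s and t, the quadratic part contributed by
      this piece.\<close>
    define q where "q = (t - s) * (t + s) / 2 * m"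
    have 6: "D t - D s = a (z + t *\<^sub>R y) - a (z + s *\<^sub>R y) - (t - s) * (P z \<bullet> y) - q"
      unfolding D_def q_def by (simp add: field_simps power2_eq_square)
    have 7: "(t - s) * (P z \<bullet> y + s * m - \<eta> * r * norm y) =
        (t - s) * (P z \<bullet> y) + q - (t - s)\<^sup>2 * m / 2 - \<eta> * r * norm y * (t - s)"
      "(t - s) * (P z \<bullet> y + t * m + \<eta> * r * norm y) =
        (t - s) * (P z \<bullet> y) + q + (t - s)\<^sup>2 * m / 2 + \<eta> * r * norm y * (t - s)"
      unfolding q_def by (simp_all add: field_simps power2_eq_square)
    have "- (\<eta> * r * norm y * (t - s) + \<bar>m\<bar> * (t - s)\<^sup>2) \<le> D t - D s"
      using 1 3 5 unfolding 6 7 by linarith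
    moreover have "D t - D s \<le> \<eta> * r * norm y * (t - s) + \<bar>m\<bar> * (t - s)\<^sup>2"
      using 2 4 5 unfolding 6 7 by linarith
    ultimately show "\<bar>D t - D s\<bar> \<le> \<eta> * r * norm y * (t - s) + \<bar>m\<bar> * (t - s)\<^sup>2"
      unfolding abs_le_iff by linarith
  qed
  moreover have "\<eta> * r * norm y \<le> \<eta> * r\<^sup>2"
    using y \<open>0 \<le> \<eta>\<close> \<open>0 \<le> r\<close> by (simp add: power2_eq_square mult_left_mono mult.assoc)
  ultimately show ?thesis unfolding D_def m_def by simp
qed

section \<open>Contact points of two functions with subgradients\<close>

definition self_adjoint :: "('a::real_inner \<Rightarrow> 'a) \<Rightarrow> bool" where
  "self_adjoint A \<longleftrightarrow> linear A \<and> (\<forall>x y. x \<bullet> A y = A x \<bullet> y)"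

lemma self_adjointD:
  assumes "self_adjoint A"
  shows "linear A" "x \<bullet> A y = A x \<bullet> y"
  using assms by (auto simp: self_adjoint_def)

lemma self_adjoint_add_scaleR:
  assumes "self_adjoint A"
  shows "self_adjoint (\<lambda>y. A y + c *\<^sub>R y)"
  using self_adjointD[OF assms] unfolding self_adjoint_def
  by (auto intro!: linearI simp: linear_add linear_scale algebra_simps)

text \<open>Two functions with subgradients \<open>P\<close> and \<open>Q\<close>, as in a sup-convolution. Where
  \<open>a + b - 2c|z|\<^sup>2\<close> is touched from above by an affine function, \<open>a\<close> and \<open>b\<close> are each
  touched from above by a paraboloid, so their gradients are Lipschitz on that contact set.\<close>

locale semiconvex_pair =
  fixes a b :: "'a::euclidean_space \<Rightarrow> real" and P Q :: "'a \<Rightarrow> 'a" and c M :: real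
  assumes c: "0 < c"
    and suba: "\<And>x z. a z + P z \<bullet> (x - z) \<le> a x" and subb: "\<And>x z. b z + Q z \<bullet> (x - z) \<le> b x"
    and bda: "\<And>z. norm (P z) \<le> M" and bdb: "\<And>z. norm (Q z) \<le> M"
begin

text \<open>In the application a and b are sup-convolutions to which c |z|^2 was added to make them
  convex; \<phi> is then the sum of the sup-convolutions themselves.\<close>

definition "\<phi> z = a z + b z - 2 * c * (norm z)\<^sup>2"

text \<open>Geometrically, an affine function of slope q touches \<phi> from above at z.\<close>

definition "maximizer q z \<longleftrightarrow> (\<forall>y. \<phi> y - q \<bullet> y \<le> \<phi> z - q \<bullet> z)"

lemma Lipschitz_of_subgradient:
  fixes f :: "'a \<Rightarrow> real"
  assumes "\<And>x z. f z + R z \<bullet> (x - z) \<le> f x" "\<And>z. norm (R z) \<le> M"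
  shows "\<bar>f x - f z\<bar> \<le> M * norm (x - z)"
proof -
  have "f z - f x \<le> M * norm (x - z)" for x z
  proof -
    have "\<bar>R z \<bullet> (x - z)\<bar> \<le> norm (R z) * norm (x - z)" by (rule Cauchy_Schwarz_ineq2)
    also have "\<dots> \<le> M * norm (x - z)" using assms(2) by (intro mult_right_mono) auto
    finally show ?thesis using assms(1)[of z x] by linarith
  qed
  from this[of x z] this[of z x] show ?thesis by (simp add: abs_le_iff norm_minus_commute)
qed

lemma M_nonneg: "0 \<le> M" using bda norm_ge_zero order_trans by blast

lemma continuous_of_subgradient:
  fixes f :: "'a \<Rightarrow> real"
  assumes "\<And>x z. f z + R z \<bullet> (x - z) \<le> f x" "\<And>z. norm (R z) \<le> M"
  shows "continuous_on A f"
proof -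
  have "M-lipschitz_on A f"
    using Lipschitz_of_subgradient[OF assms] M_nonneg by (intro lipschitz_onI) (auto simp: dist_norm)
  thus ?thesis by (rule lipschitz_on_continuous_on)
qed

lemma continuous_\<phi>: "continuous_on A \<phi>"
  unfolding \<phi>_def
  by (intro continuous_intros continuous_of_subgradient[OF suba bda] continuous_of_subgradient[OF subb bdb])

lemma maximizer_upper:
  assumes "maximizer q z"
  shows "(a (z + y) + b (z + y)) - (a z + b z) \<le> (q + (4 * c) *\<^sub>R z) \<bullet> y + 2 * c * (norm y)\<^sup>2"
proof -
  have "\<phi> (z + y) - \<phi> z \<le> q \<bullet> y"
    using assms[unfolded maximizer_def, rule_format, of "z + y"] by (simp add: inner_add_right)
  moreover have "(norm (z + y))\<^sup>2 = (norm z)\<^sup>2 + 2 * (z \<bullet> y) + (norm y)\<^sup>2"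
    by (simp add: power2_norm_eq_inner inner_add_left inner_add_right inner_commute)
  ultimately show ?thesis unfolding \<phi>_def
    by (simp add: inner_add_left algebra_simps)
qed

text \<open>At a contact point a + b has an affine support below and a paraboloid above. Two such
  bounds with a common value must have the same slope.\<close>

lemma maximizer_gradient:
  assumes "maximizer q z"
  shows "P z + Q z = q + (4 * c) *\<^sub>R z"
proof -
  define v where "v = P z + Q z - (q + (4 * c) *\<^sub>R z)"
  \<comment> \<open>The maximum point of v \<bullet> y - 2 c |y|^2, where a difference v of the
    slopes would be most visible.\<close>
  define y where "y = (1 / (4 * c)) *\<^sub>R v"
  have "(P z + Q z) \<bullet> y \<le> (a (z + y) + b (z + y)) - (a z + b z)"
    using suba[of z "z + y"] subb[of z "z + y"] by (simp add: inner_add_left)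
  hence "v \<bullet> y \<le> 2 * c * (norm y)\<^sup>2"
    using maximizer_upper[OF assms, of y] unfolding v_def by (simp only: inner_diff_left)
  moreover have "v \<bullet> y = (norm v)\<^sup>2 / (4 * c)" unfolding y_def by (simp add: power2_norm_eq_inner)
  moreover have "2 * c * (norm y)\<^sup>2 = (norm v)\<^sup>2 / (8 * c)"
    unfolding y_def using c by (simp add: field_simps power2_eq_square)
  moreover have "X \<le> 0" if "X / (4 * c) \<le> X / (8 * c)" for X using that c by (simp add: field_simps)
  ultimately have "(norm v)\<^sup>2 \<le> 0" by metis
  thus ?thesis unfolding v_def by simp
qed

text \<open>Subtract the affine support of b from the paraboloid above a + b.\<close>

lemma maximizer_upper_a:
  assumes "maximizer q z"
  shows "a (z + y) - a z \<le> P z \<bullet> y + 2 * c * (norm y)\<^sup>2"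
  using maximizer_upper[OF assms, of y] subb[of z "z + y"]
  by (simp flip: maximizer_gradient[OF assms] add: inner_add_left)

lemma maximizer_upper_b:
  assumes "maximizer q z"
  shows "b (z + y) - b z \<le> Q z \<bullet> y + 2 * c * (norm y)\<^sup>2"
  using maximizer_upper[OF assms, of y] suba[of z "z + y"]
  by (simp flip: maximizer_gradient[OF assms] add: inner_add_left)

text \<open>Starting from x, go the distance |x - z| in the direction of R x - R z. There the
  support at x has to stay below the paraboloid at z, and the point is within 2 |x - z| of z, whence
  8 c = 2 c times 2^2. The paraboloid is required at z only; x may lie off the contact set.\<close>

lemma gradient_Lipschitz_at:
  fixes f :: "'a \<Rightarrow> real"
  assumes sub: "\<And>x z. f z + R z \<bullet> (x - z) \<le> f x"
    and up: "\<And>y. f (z + y) - f z \<le> R z \<bullet> y + 2 * c * (norm y)\<^sup>2"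
  shows "norm (R x - R z) \<le> 8 * c * norm (x - z)"
proof (cases "x = z \<or> R x = R z")
  case True
  thus ?thesis using c by auto
next
  case False
  define d where "d = norm (x - z)"
  define v where "v = R x - R z"
  define u where "u = (d / norm v) *\<^sub>R v"
  have pos: "0 < d" "0 < norm v" using False unfolding d_def v_def by auto
  have nu: "norm u = d" unfolding u_def using pos by simp
  have 1: "f x + R x \<bullet> u \<le> f (z + (x + u - z))" using sub[of x "x + u"] by simp
  have 2: "f (z + (x + u - z)) - f z \<le> R z \<bullet> (x + u - z) + 2 * c * (norm (x + u - z))\<^sup>2" by (rule up)
  have 3: "f z + R z \<bullet> (x - z) \<le> f x" by (rule sub)
  have "norm (x + u - z) \<le> 2 * d"
    using norm_triangle_ineq[of "x - z" u] nu unfolding d_def by (simp add: algebra_simps)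
  hence "(norm (x + u - z))\<^sup>2 \<le> 4 * d\<^sup>2"
    using power_mono[of "norm (x + u - z)" "2 * d" 2] by (simp add: power_mult_distrib)
  hence 4: "2 * c * (norm (x + u - z))\<^sup>2 \<le> 8 * c * d\<^sup>2" using c by simp
  have 5: "R z \<bullet> (x + u - z) = R z \<bullet> (x - z) + R z \<bullet> u" by (simp add: inner_diff_right inner_add_right)
  have "v \<bullet> u \<le> 8 * c * d\<^sup>2" unfolding v_def inner_diff_left using 1 2 3 4 5 by linarith
  moreover have "v \<bullet> u = norm v * d"
    unfolding u_def using pos by (simp add: dot_square_norm power2_eq_square)
  ultimately have "norm v * d \<le> (8 * c * d) * d" by (simp add: power2_eq_square mult.assoc)
  thus ?thesis using pos unfolding v_def d_def by simp
qed

lemma gradient_Lipschitz: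
  assumes "maximizer q z"
  shows "norm (P x - P z) \<le> 8 * c * norm (x - z)" "norm (Q x - Q z) \<le> 8 * c * norm (x - z)"
  using gradient_Lipschitz_at[OF suba maximizer_upper_a[OF assms]]
    gradient_Lipschitz_at[OF subb maximizer_upper_b[OF assms]] by auto

context
  fixes \<rho> R0 :: real
  assumes \<rho>: "0 < \<rho>"
    and maxi: "\<And>q. norm q \<le> \<rho> \<Longrightarrow> \<exists>z. norm z \<le> R0 \<and> maximizer q z"
begin

definition "contact = {z. norm z \<le> R0 \<and> (\<exists>q. norm q \<le> \<rho> \<and> maximizer q z)}"

lemma compact_contact: "compact contact"
  unfolding compact_eq_bounded_closed
proof
  show "bounded contact" unfolding contact_def by (intro boundedI[of _ R0]) auto
  show "closed contact"
    unfolding closed_sequential_limits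
  proof (intro allI impI, elim conjE)
    fix z l assume z: "\<forall>n. z n \<in> contact" "z \<longlonglongrightarrow> l"
    obtain q where q: "\<And>n. norm (q n) \<le> \<rho>" "\<And>n. maximizer (q n) (z n)"
      using z(1) unfolding contact_def by simp metis
    have "\<forall>n. q n \<in> cball 0 \<rho>" using q by simp
    with compact_cball obtain q' r where q': "q' \<in> cball 0 \<rho>" "strict_mono r" "(q \<circ> r) \<longlonglongrightarrow> q'"
      unfolding compact_def by metis
    have zr: "(\<lambda>n. z (r n)) \<longlonglongrightarrow> l" using LIMSEQ_subseq_LIMSEQ[OF z(2) q'(2)] by (simp add: o_def)
    have qr: "(\<lambda>n. q (r n)) \<longlonglongrightarrow> q'" using q'(3) by (simp add: o_def)
    have "norm l \<le> R0"
      by (rule LIMSEQ_le_const2[OF tendsto_norm[OF z(2)]]) (use z(1) in \<open>auto simp: contact_def\<close>)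
    moreover have "maximizer q' l"
      unfolding maximizer_def
    proof
      fix y
      have c\<phi>: "(\<lambda>n. \<phi> (z (r n))) \<longlonglongrightarrow> \<phi> l"
        using continuous_on_tendsto_compose[OF continuous_\<phi>[of UNIV] zr] by simp
      show "\<phi> y - q' \<bullet> y \<le> \<phi> l - q' \<bullet> l"
        by (rule LIMSEQ_le[of "\<lambda>n. \<phi> y - q (r n) \<bullet> y" _ "\<lambda>n. \<phi> (z (r n)) - q (r n) \<bullet> z (r n)"])
           (use q(2) in \<open>auto intro!: tendsto_intros qr zr c\<phi> simp: maximizer_def\<close>)
    qed
    ultimately show "l \<in> contact" unfolding contact_def using q'(1) by auto
  qed
qed

lemma not_negligible_contact: "\<not> negligible contact"
proof
  assume neg: "negligible contact"
  define T where "T = (\<lambda>z. P z + Q z - (4 * c) *\<^sub>R z)"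
  \<comment> \<open>8 c from each of the two gradients and 4 c from the linear term.\<close>
  have Lip: "norm (T x - T z) \<le> 20 * c * norm (x - z)" if z: "z \<in> contact" for x z
  proof -
    obtain q where q: "maximizer q z" using z unfolding contact_def by blast
    have "T x - T z = (P x - P z) + (Q x - Q z) - (4 * c) *\<^sub>R (x - z)"
      unfolding T_def by (simp add: algebra_simps)
    also have "norm \<dots> \<le> norm (P x - P z) + norm (Q x - Q z) + norm ((4 * c) *\<^sub>R (x - z))"
      by (meson add_right_mono norm_triangle_ineq norm_triangle_ineq4 order_trans)
    also have "norm ((4 * c) *\<^sub>R (x - z)) = 4 * c * norm (x - z)" using c by simp
    finally show ?thesis using gradient_Lipschitz[OF q, of x] by (simp add: algebra_simps)
  qed
  have "negligible (T ` contact)"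
  proof (rule negligible_locally_Lipschitz_image[OF _ neg])
    fix x assume "x \<in> contact"
    thus "\<exists>S B. open S \<and> x \<in> S \<and> (\<forall>y\<in>contact \<inter> S. norm (T y - T x) \<le> B * norm (y - x))"
      using Lip by (intro exI[of _ UNIV] exI[of _ "20 * c"]) auto
  qed simp
  moreover have "cball 0 \<rho> \<subseteq> T ` contact"
  proof
    fix q :: 'a assume "q \<in> cball 0 \<rho>"
    hence "norm q \<le> \<rho>" by simp
    from maxi[OF this] obtain z where z: "norm z \<le> R0" "maximizer q z" by blast
    have "T z = q" unfolding T_def using maximizer_gradient[OF z(2)] by simp
    thus "q \<in> T ` contact" using z \<open>norm q \<le> \<rho>\<close> unfolding contact_def by blast
  qed
  ultimately have "negligible (cball (0::'a) \<rho>)" by (rule negligible_subset)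
  hence "negligible (ball (0::'a) \<rho>)" using ball_subset_cball by (rule negligible_subset)
  thus False using open_not_negligible[of "ball (0::'a) \<rho>"] \<rho> by simp
qed

text \<open>Adding the distance to the contact set to the list of functions that become almost affine
  forces the contact set to be dense at the chosen scale.\<close>

lemma exists_almost_quadratic_scale:
  assumes "0 < \<eta>" "\<eta> \<le> 1" "0 < r0"
  obtains z q r A B where "norm z \<le> R0" "norm q \<le> \<rho>" "maximizer q z" "0 < r" "r < r0"
    "self_adjoint A" "self_adjoint B"
    "\<And>y. norm (A y) \<le> DIM('a) * (8 * c + 2) * norm y" "\<And>y. norm (B y) \<le> DIM('a) * (8 * c + 2) * norm y"
    "\<And>y. norm y \<le> r \<Longrightarrow> \<bar>a (z + y) - a z - P z \<bullet> y - (y \<bullet> A y) / 2\<bar> \<le> \<eta> * r\<^sup>2"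
    "\<And>y. norm y \<le> r \<Longrightarrow> \<bar>b (z + y) - b z - Q z \<bullet> y - (y \<bullet> B y) / 2\<bar> \<le> \<eta> * r\<^sup>2"
proof -
  define N where "N = real DIM('a)"
  have N: "N \<ge> 1" unfolding N_def by (simp add: Suc_leI)
  define L where "L = 8 * c + 1"
  have L: "1 \<le> L" "8 * c \<le> L" unfolding L_def using c by auto
  \<comment> \<open>The componentwise error below is (32 c + 3) \<eta>' r; summed over N coordinates
    it becomes \<eta> r.\<close>
  define \<eta>' where "\<eta>' = \<eta> / (N * (32 * c + 3))"
  have \<eta>': "0 < \<eta>'" "\<eta>' \<le> 1" "N * ((32 * c + 3) * \<eta>') = \<eta>"
  proof -
    have "1 \<le> N * (32 * c + 3)" using N c mult_mono[of 1 N 1 "32 * c + 3"] by simp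
    thus "0 < \<eta>'" "\<eta>' \<le> 1" "N * ((32 * c + 3) * \<eta>') = \<eta>"
      unfolding \<eta>'_def using assms c by (auto simp: field_simps)
  qed
  have ne: "contact \<noteq> {}" using not_negligible_contact by auto
  have ext: "\<exists>F. (\<forall>x y. \<bar>F x - F y\<bar> \<le> L * norm (x - y)) \<and> (\<forall>x\<in>contact. F x = R x \<bullet> e)"
    if R: "\<And>x z. z \<in> contact \<Longrightarrow> norm (R x - R z) \<le> 8 * c * norm (x - z)" and e: "e \<in> Basis" for R e
  proof (rule Lipschitz_extension[OF _ _ ne])
    fix x y assume "x \<in> contact" "y \<in> contact"
    have "\<bar>R x \<bullet> e - R y \<bullet> e\<bar> \<le> norm (R x - R y)"
      using Basis_le_norm[OF e, of "R x - R y"] by (simp add: inner_diff_left)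
    also have "\<dots> \<le> 8 * c * norm (x - y)" using R \<open>y \<in> contact\<close> by blast
    also have "\<dots> \<le> L * norm (x - y)" using L by (intro mult_right_mono) auto
    finally show "\<bar>R x \<bullet> e - R y \<bullet> e\<bar> \<le> L * norm (x - y)" .
  qed (use L in auto)
  have LP: "norm (P x - P z) \<le> 8 * c * norm (x - z)" and LQ: "norm (Q x - Q z) \<le> 8 * c * norm (x - z)"
    if "z \<in> contact" for x z using that gradient_Lipschitz unfolding contact_def by blast+
  obtain FP where FP: "\<And>e. e \<in> Basis \<Longrightarrow> (\<forall>x y. \<bar>FP e x - FP e y\<bar> \<le> L * norm (x - y)) \<and> (\<forall>x\<in>contact. FP e x = P x \<bullet> e)"
    using ext[OF LP] by metis
  obtain FQ where FQ: "\<And>e. e \<in> Basis \<Longrightarrow> (\<forall>x y. \<bar>FQ e x - FQ e y\<bar> \<le> L * norm (x - y)) \<and> (\<forall>x\<in>contact. FQ e x = Q x \<bullet> e)"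
    using ext[OF LQ] by metis
  \<comment> \<open>\<open>None\<close> carries the distance to the contact set,
    \<open>Some (t, e)\<close> the e-component of P or Q, extended from that set. All of them become
    almost affine at the same point and scale.\<close>
  define F where "F = (\<lambda>j. case j of None \<Rightarrow> (\<lambda>x. infdist x contact)
      | Some (t, e) \<Rightarrow> if t then FP e else FQ e)"
  define J where "J = insert None (Some ` ((UNIV :: bool set) \<times> (Basis :: 'a set)))"
  have "finite J" unfolding J_def by (intro finite.insertI finite_imageI finite_cartesian_product) auto
  have FL: "\<bar>F j x - F j y\<bar> \<le> L * norm (x - y)" if "j \<in> J" for j x y
  proof (cases j)
    case None
    have "\<bar>infdist x contact - infdist y contact\<bar> \<le> dist x y" by (rule infdist_triangle_abs)
    also have "\<dots> \<le> L * norm (x - y)"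
      using L mult_right_mono[of 1 L "norm (x - y)"] by (simp add: dist_norm)
    finally show ?thesis using None by (simp add: F_def)
  next
    case (Some te)
    thus ?thesis using that FP FQ unfolding J_def F_def by (cases te) auto
  qed
  obtain z r where z: "z \<in> contact" and r: "0 < r" "r < r0" and
    l: "\<forall>j\<in>J. \<exists>l. linear l \<and> (\<forall>y. norm y \<le> r \<longrightarrow> \<bar>F j (z + y) - F j z - l y\<bar> \<le> \<eta>' * r)"
    using exists_almost_affine_scale[where F = F, OF \<open>finite J\<close> FL compact_contact not_negligible_contact \<eta>'(1) \<open>0 < r0\<close>] by blast
  \<comment> \<open>The distance is 0 at z and nowhere negative. Its linear approximation is
    therefore nearly nonpositive at y, as the value at -y shows, so every z + y has a contact point
    within 2 \<eta>' r.\<close>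
  have dense: "\<exists>k\<in>contact. norm (z + y - k) \<le> 2 * \<eta>' * r" if y: "norm y \<le> r" for y
  proof -
    obtain l0 where l0: "linear l0" "\<And>y. norm y \<le> r \<Longrightarrow> \<bar>infdist (z + y) contact - infdist z contact - l0 y\<bar> \<le> \<eta>' * r"
      using l unfolding J_def F_def by auto
    have "infdist z contact = 0" using z by simp
    moreover have "l0 (- y) = - l0 y" using l0(1) by (rule linear_neg)
    moreover have "0 \<le> infdist (z + - y) contact" by (rule infdist_nonneg)
    ultimately have "infdist (z + y) contact \<le> 2 * \<eta>' * r"
      using l0(2)[OF y] l0(2)[of "- y", unfolded norm_minus_cancel, OF y] by linarith
    moreover obtain k where "k \<in> contact" "infdist (z + y) contact = dist (z + y) k"
      using infdist_attains_inf[OF compact_imp_closed[OF compact_contact] ne] by blast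
    ultimately show ?thesis by (auto simp: dist_norm)
  qed
  have expand: "\<exists>A. self_adjoint A \<and> (\<forall>y. norm (A y) \<le> N * (8 * c + 2) * norm y) \<and>
      (\<forall>y. norm y \<le> r \<longrightarrow> \<bar>f (z + y) - f z - R z \<bullet> y - (y \<bullet> A y) / 2\<bar> \<le> \<eta> * r\<^sup>2)"
    if sub: "\<And>x z. f z + R z \<bullet> (x - z) \<le> f x"
      and R: "\<And>x z. z \<in> contact \<Longrightarrow> norm (R x - R z) \<le> 8 * c * norm (x - z)"
      and G: "\<And>e. e \<in> Basis \<Longrightarrow> (\<forall>x y. \<bar>G e x - G e y\<bar> \<le> L * norm (x - y)) \<and> (\<forall>x\<in>contact. G e x = R x \<bullet> e)"
      and lG: "\<And>e. e \<in> Basis \<Longrightarrow> \<exists>l. linear l \<and> (\<forall>y. norm y \<le> r \<longrightarrow> \<bar>G e (z + y) - G e z - l y\<bar> \<le> \<eta>' * r)"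
    for f R and G :: "'a \<Rightarrow> 'a \<Rightarrow> real"
  proof -
    obtain l where l: "\<And>e. e \<in> Basis \<Longrightarrow> linear (l e)"
      "\<And>e y. e \<in> Basis \<Longrightarrow> norm y \<le> r \<Longrightarrow> \<bar>G e (z + y) - G e z - l e y\<bar> \<le> \<eta>' * r"
      using lG by metis
    define S where "S = (\<lambda>y. \<Sum>e\<in>Basis. l e y *\<^sub>R e)"
    have linS: "linear S" unfolding S_def
      by (intro linearI) (simp_all add: linear_add[OF l(1)] linear_scale[OF l(1)] scaleR_add_left
          sum.distrib scaleR_sum_right)
    have Se: "S y \<bullet> e = l e y" if "e \<in> Basis" for e y
      unfolding S_def using that by (simp add: inner_sum_left inner_Basis if_distrib cong: if_cong)
    have lbd: "\<bar>l e y\<bar> \<le> (8 * c + 2) * norm y" if e: "e \<in> Basis" for e y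
    proof (cases "y = 0")
      case True thus ?thesis using linear_0[OF l(1)[OF e]] by simp
    next
      case False
      \<comment> \<open>The slope is measured at length r, where the Lipschitz constant 8 c + 1
        bounds it up to the error \<eta>' \<le> 1.\<close>
      define y' where "y' = (r / norm y) *\<^sub>R y"
      have ny: "norm y' = r" unfolding y'_def using False r by simp
      have "\<bar>G e (z + y') - G e z\<bar> \<le> L * norm (z + y' - z)" using G[OF e] by blast
      hence "\<bar>l e y'\<bar> \<le> L * r + \<eta>' * r" using l(2)[OF e, of y'] ny by simp
      also have "\<dots> \<le> (8 * c + 2) * r" unfolding L_def using \<eta>'(2) r by (simp flip: distrib_right)
      finally have "\<bar>l e y'\<bar> \<le> (8 * c + 2) * r" .
      moreover have "l e y' = (r / norm y) * l e y"
        unfolding y'_def using linear_scale[OF l(1)[OF e]] by simp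
      moreover have "X \<le> K * n" if "\<bar>r / n\<bar> * X \<le> K * r" "0 < n" for X K n
      proof -
        have "r * X \<le> r * (K * n)" using that r by (simp add: field_simps)
        thus ?thesis using r by simp
      qed
      ultimately show ?thesis using False by (metis abs_mult zero_less_norm_iff)
    qed
    have nS: "norm (S y) \<le> N * (8 * c + 2) * norm y" for y
    proof -
      have "norm (S y) \<le> (\<Sum>e\<in>Basis. \<bar>S y \<bullet> e\<bar>)" by (rule norm_le_l1)
      also have "\<dots> \<le> (\<Sum>e\<in>(Basis::'a set). (8 * c + 2) * norm y)" using lbd Se by (intro sum_mono) auto
      finally show ?thesis by (simp add: N_def)
    qed
    have RS: "norm (R (z + y) - R z - S y) \<le> \<eta> * r" if y: "norm y \<le> r" for y
    proof -
      \<comment> \<open>Off the contact set the extension \<open>G\<close> need not agree with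
        \<open>R\<close>. The detour through a nearby contact point costs 16 c for \<open>R\<close>
        and 2 L for \<open>G\<close>, in units of \<eta>' r.\<close>
      obtain k where k: "k \<in> contact" "norm (z + y - k) \<le> 2 * \<eta>' * r" using dense[OF y] by blast
      have "\<bar>(R (z + y) - R z - S y) \<bullet> e\<bar> \<le> (32 * c + 3) * \<eta>' * r" if e: "e \<in> Basis" for e
      proof -
        have "\<bar>(R (z + y) - R k) \<bullet> e\<bar> \<le> norm (R (z + y) - R k)" using e by (rule Basis_le_norm)
        also have "\<dots> \<le> 8 * c * norm (z + y - k)" using R[OF k(1)] .
        also have "\<dots> \<le> 8 * c * (2 * \<eta>' * r)" using k(2) c by (intro mult_left_mono) auto
        finally have 1: "\<bar>R (z + y) \<bullet> e - R k \<bullet> e\<bar> \<le> 16 * c * (\<eta>' * r)" by (simp add: inner_diff_left)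
        have "\<bar>G e k - G e (z + y)\<bar> \<le> L * norm (z + y - k)" using G[OF e] by (metis norm_minus_commute)
        also have "\<dots> \<le> L * (2 * \<eta>' * r)" using k(2) L by (intro mult_left_mono) auto
        finally have 2: "\<bar>R k \<bullet> e - G e (z + y)\<bar> \<le> 2 * L * (\<eta>' * r)" using G[OF e] k(1) by simp
        have 3: "\<bar>G e (z + y) - R z \<bullet> e - l e y\<bar> \<le> \<eta>' * r" using l(2)[OF e y] G[OF e] z by simp
        have 4: "(R (z + y) - R z - S y) \<bullet> e = R (z + y) \<bullet> e - R z \<bullet> e - l e y"
          using Se[OF e] by (simp add: inner_diff_left)
        have 5: "16 * c * (\<eta>' * r) + 2 * L * (\<eta>' * r) + \<eta>' * r = (32 * c + 3) * \<eta>' * r"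
          unfolding L_def by (simp add: algebra_simps)
        show ?thesis using 1 2 3 unfolding 4 5[symmetric] by linarith
      qed
      hence "(\<Sum>e\<in>Basis. \<bar>(R (z + y) - R z - S y) \<bullet> e\<bar>) \<le> N * ((32 * c + 3) * \<eta>' * r)"
        unfolding N_def by (intro sum_bounded_above) auto
      also have "\<dots> = \<eta> * r" using \<eta>'(3) by (simp flip: mult.assoc)
      finally show ?thesis using norm_le_l1[of "R (z + y) - R z - S y"] by linarith
    qed
    \<comment> \<open>The symmetric part of \<open>S\<close>, which has the same quadratic
      form.\<close>
    define A where "A = (\<lambda>y. (1/2) *\<^sub>R (S y + adjoint S y))"
    have adj: "x \<bullet> adjoint S y = S x \<bullet> y" for x y using adjoint_works[OF linS] .
    have nadj: "norm (adjoint S y) \<le> N * (8 * c + 2) * norm y" for y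
    proof -
      have "(norm (adjoint S y))\<^sup>2 = S (adjoint S y) \<bullet> y" by (simp add: power2_norm_eq_inner adj)
      also have "\<dots> \<le> norm (S (adjoint S y)) * norm y" by (rule norm_cauchy_schwarz)
      also have "\<dots> \<le> (N * (8 * c + 2) * norm (adjoint S y)) * norm y" using nS by (intro mult_right_mono) auto
      finally have "norm (adjoint S y) * norm (adjoint S y) \<le> (N * (8 * c + 2) * norm y) * norm (adjoint S y)"
        by (simp add: power2_eq_square mult.assoc mult.commute[of "norm y"])
      thus ?thesis using N c by (cases "norm (adjoint S y) = 0") auto
    qed
    have "linear A" unfolding A_def
      using linS adjoint_linear[OF linS] by (intro linear_compose_scale_right linear_compose_add)
    moreover have "x \<bullet> A y = A x \<bullet> y" for x y
      unfolding A_def using adj[of x y] adj[of y x] by (simp add: inner_add_left inner_add_right inner_commute)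
    ultimately have "self_adjoint A" unfolding self_adjoint_def by blast
    moreover have "norm (A y) \<le> N * (8 * c + 2) * norm y" for y
      using norm_triangle_ineq[of "S y" "adjoint S y"] nS[of y] nadj[of y] unfolding A_def by simp
    moreover have "y \<bullet> A y = y \<bullet> S y" for y
      unfolding A_def using adj[of y y] by (simp add: inner_add_right inner_commute)
    ultimately show ?thesis
      using subgradient_expansion[of f R S r z \<eta>, OF sub linS RS] assms(1) by (intro exI[of _ A]) auto
  qed
  have lP: "\<exists>l. linear l \<and> (\<forall>y. norm y \<le> r \<longrightarrow> \<bar>FP e (z + y) - FP e z - l y\<bar> \<le> \<eta>' * r)" if "e \<in> Basis" for e
    using l[rule_format, of "Some (True, e)"] that unfolding J_def F_def by simp
  have lQ: "\<exists>l. linear l \<and> (\<forall>y. norm y \<le> r \<longrightarrow> \<bar>FQ e (z + y) - FQ e z - l y\<bar> \<le> \<eta>' * r)" if "e \<in> Basis" for e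
    using l[rule_format, of "Some (False, e)"] that unfolding J_def F_def by simp
  obtain A where A: "self_adjoint A" "\<And>y. norm (A y) \<le> N * (8 * c + 2) * norm y"
    "\<And>y. norm y \<le> r \<Longrightarrow> \<bar>a (z + y) - a z - P z \<bullet> y - (y \<bullet> A y) / 2\<bar> \<le> \<eta> * r\<^sup>2"
    using expand[OF suba LP FP lP] by metis
  obtain B where B: "self_adjoint B" "\<And>y. norm (B y) \<le> N * (8 * c + 2) * norm y"
    "\<And>y. norm y \<le> r \<Longrightarrow> \<bar>b (z + y) - b z - Q z \<bullet> y - (y \<bullet> B y) / 2\<bar> \<le> \<eta> * r\<^sup>2"
    using expand[OF subb LQ FQ lQ] by metis
  obtain q where "norm q \<le> \<rho>" "maximizer q z" "norm z \<le> R0" using z unfolding contact_def by blast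
  with A B r that show thesis unfolding N_def by blast
qed

end

end

section \<open>The local maximum principle for semicontinuous functions\<close>

text \<open>The maximizing point is kept as a function w: 2 c w z will be a subgradient of the
  convexified sup-convolution, and w z is the point to which a touching paraboloid is
  transferred.\<close>

lemma exists_sup_convolution:
  fixes U :: "'a::euclidean_space \<Rightarrow> real"
  assumes "compact C" "C \<noteq> {}" "upper_semicontinuous_on C U"
  obtains w where "\<And>z. w z \<in> C"
    "\<And>z v. v \<in> C \<Longrightarrow> U v - c * (norm (z - v))\<^sup>2 \<le> U (w z) - c * (norm (z - w z))\<^sup>2"
proof -
  have "\<exists>w\<in>C. \<forall>v\<in>C. U v + (- (c * (norm (z - v))\<^sup>2)) \<le> U w + (- (c * (norm (z - w))\<^sup>2))" for z
    by (intro upper_semicontinuous_on_attains_max assms upper_semicontinuous_on_add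
        continuous_on_imp_upper_semicontinuous_on continuous_intros)
  hence "\<forall>z. \<exists>w. w \<in> C \<and> (\<forall>v\<in>C. U v - c * (norm (z - v))\<^sup>2 \<le> U w - c * (norm (z - w))\<^sup>2)"
    by simp blast
  thus thesis using that by metis
qed

text \<open>Otherwise pairs at vanishing distance, not both in S, would converge to a single
  frontier point, and semicontinuity would push U + W below \<sigma> along the sequence.\<close>

lemma near_diagonal_interior:
  fixes S :: "'a::euclidean_space set"
  assumes "open S" "bounded S" "upper_semicontinuous_on (closure S) U" "upper_semicontinuous_on (closure S) W"
    and neg: "\<And>z. z \<in> frontier S \<Longrightarrow> U z + W z < \<sigma>"
  shows "\<exists>\<delta>>0. \<forall>w\<in>closure S. \<forall>w'\<in>closure S. norm (w - w') \<le> \<delta> \<longrightarrow> \<sigma> \<le> U w + W w' \<longrightarrow> w \<in> S \<and> w' \<in> S"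
proof (rule ccontr)
  assume "\<not> ?thesis"
  hence "\<forall>n. \<exists>w w'. w \<in> closure S \<and> w' \<in> closure S \<and> norm (w - w') \<le> inverse (real (Suc n)) \<and>
      \<sigma> \<le> U w + W w' \<and> \<not> (w \<in> S \<and> w' \<in> S)"
    by (metis inverse_positive_iff_positive of_nat_0_less_iff zero_less_Suc)
  then obtain w w' where w: "\<And>n. w n \<in> closure S" "\<And>n. w' n \<in> closure S"
    "\<And>n. norm (w n - w' n) \<le> inverse (real (Suc n))" "\<And>n. \<sigma> \<le> U (w n) + W (w' n)"
    "\<And>n. \<not> (w n \<in> S \<and> w' n \<in> S)" by metis
  have "compact (closure S)" using assms(2) by simp
  then obtain l r where l: "l \<in> closure S" "strict_mono r" "(w \<circ> r) \<longlonglongrightarrow> l"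
    using w(1) unfolding compact_def by metis
  have wr: "(\<lambda>n. w (r n)) \<longlonglongrightarrow> l" using l(3) by (simp add: o_def)
  have "(\<lambda>n. norm (w n - w' n)) \<longlonglongrightarrow> 0"
    by (rule tendsto_sandwich[OF _ _ tendsto_const LIMSEQ_inverse_real_of_nat]) (use w(3) in auto)
  hence "(\<lambda>n. w n - w' n) \<longlonglongrightarrow> 0" by (rule tendsto_norm_zero_cancel)
  from tendsto_diff[OF wr LIMSEQ_subseq_LIMSEQ[OF this l(2), unfolded o_def]]
  have wr': "(\<lambda>n. w' (r n)) \<longlonglongrightarrow> l" by simp
  have "l \<notin> S"
  proof
    assume "l \<in> S"
    hence "\<forall>\<^sub>F n in sequentially. w (r n) \<in> S" "\<forall>\<^sub>F n in sequentially. w' (r n) \<in> S"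
      using wr wr' assms(1) by (auto dest: topological_tendstoD)
    hence "\<forall>\<^sub>F n in sequentially. False" by eventually_elim (use w(5) in blast)
    thus False by simp
  qed
  hence "U l + W l < \<sigma>" using neg l(1) assms(1) by (simp add: frontier_def interior_open)
  define e where "e = (\<sigma> - U l - W l) / 2"
  have e: "e > 0" using \<open>U l + W l < \<sigma>\<close> unfolding e_def by simp
  have "\<forall>\<^sub>F n in sequentially. U (w (r n)) < U l + e"
    by (rule upper_semicontinuous_on_sequence[OF assms(3) _ wr l(1)]) (use w(1) e in auto)
  moreover have "\<forall>\<^sub>F n in sequentially. W (w' (r n)) < W l + e"
    by (rule upper_semicontinuous_on_sequence[OF assms(4) _ wr' l(1)]) (use w(2) e in auto)
  ultimately have "\<forall>\<^sub>F n in sequentially. U (w (r n)) + W (w' (r n)) < \<sigma>"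
    by eventually_elim (simp add: e_def field_simps)
  hence "\<forall>\<^sub>F n in sequentially. False" by eventually_elim (use w(4) not_less in blast)
  thus False by simp
qed

definition touched_above :: "('a::real_inner \<Rightarrow> real) \<Rightarrow> 'a \<Rightarrow> 'a \<Rightarrow> ('a \<Rightarrow> 'a) \<Rightarrow> bool" where
  "touched_above U z p A \<longleftrightarrow> (\<forall>\<^sub>F v in at z. U v \<le> U z + p \<bullet> (v - z) + (v - z) \<bullet> A (v - z) / 2)"

lemma quadratic_recenter:
  fixes A :: "'a::real_inner \<Rightarrow> 'a"
  assumes "self_adjoint A"
  shows "g \<bullet> (y + u) + (y + u) \<bullet> A (y + u) / 2 =
    g \<bullet> y + y \<bullet> A y / 2 + (g + A y) \<bullet> u + u \<bullet> A u / 2"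
proof -
  have "y \<bullet> A u = A y \<bullet> u" by (rule self_adjointD[OF assms])
  moreover have "u \<bullet> A y = A y \<bullet> u" by (rule inner_commute)
  ultimately show ?thesis
    by (simp add: linear_add[OF self_adjointD(1)[OF assms]] inner_add_left inner_add_right field_simps)
qed

text \<open>A function that is close to a quadratic is touched from above by a slightly more convex one;
  the touching transfers from a sup-convolution to the function itself by translation.\<close>

lemma touching_quadratic:
  fixes f U :: "'a::euclidean_space \<Rightarrow> real"
  assumes cf: "continuous_on UNIV f"
    and f: "\<And>z v. v \<in> S \<Longrightarrow> U v - c * (norm (z - v))\<^sup>2 \<le> f z"
    and fw: "\<And>z. f z = U (w z) - c * (norm (z - w z))\<^sup>2"
    and A: "self_adjoint A"
    and "0 < r" "0 < \<eta>"
    and exp: "\<And>y. norm y \<le> r \<Longrightarrow> f (z0 + y) \<le> f z0 + g \<bullet> y + y \<bullet> A y / 2 + \<eta> * r\<^sup>2"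
    and inS: "\<And>y. norm y < r \<Longrightarrow> w (z0 + y) \<in> S" and "open S"
  shows "\<exists>y. norm y < r \<and> touched_above U (w (z0 + y)) (g + (A y + (8 * \<eta>) *\<^sub>R y)) (\<lambda>u. A u + (8 * \<eta>) *\<^sub>R u)"
proof -
  define B where "B = (\<lambda>y. A y + (8 * \<eta>) *\<^sub>R y)"
  have B: "self_adjoint B" unfolding B_def by (rule self_adjoint_add_scaleR[OF A])
  define q where "q = (\<lambda>y. g \<bullet> y + y \<bullet> B y / 2)"
  have cq: "continuous_on X q" for X
    unfolding q_def using linear_continuous_on[of B X] self_adjointD(1)[OF B] linear_conv_bounded_linear[of B]
    by (intro continuous_intros) auto
  have cfz: "continuous_on X (\<lambda>y. f (z0 + y))" for X
    by (intro continuous_on_compose2[OF cf] continuous_intros) auto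
  have "continuous_on (cball 0 r) (\<lambda>y. f (z0 + y) - q y)"
    by (intro continuous_intros cq cfz)
  moreover have "cball (0::'a) r \<noteq> {}" using \<open>0 < r\<close> by simp
  ultimately obtain y where y: "y \<in> cball 0 r" "\<And>x. x \<in> cball 0 r \<Longrightarrow> f (z0 + x) - q x \<le> f (z0 + y) - q y"
    using continuous_attains_sup[OF compact_cball, of 0 r "\<lambda>y. f (z0 + y) - q y"] by blast
  have q0: "q 0 = 0" unfolding q_def by simp
  have qy: "q y = g \<bullet> y + y \<bullet> A y / 2 + 4 * \<eta> * (norm y)\<^sup>2"
    unfolding q_def B_def by (simp add: inner_add_right power2_norm_eq_inner field_simps)
  \<comment> \<open>The extra curvature costs 4 \<eta> |y|^2 against an error of at most \<eta> r^2,
    so the maximum lies within r/2 of the centre.\<close>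
  have "f z0 \<le> f (z0 + y) - q y" using y(2)[of 0] \<open>0 < r\<close> q0 by simp
  hence "4 * \<eta> * (norm y)\<^sup>2 \<le> \<eta> * r\<^sup>2" using exp[of y] y(1) unfolding qy by simp
  hence "4 * (norm y)\<^sup>2 \<le> r\<^sup>2" using \<open>0 < \<eta>\<close> by (simp add: mult.left_commute[of 4] mult.assoc)
  moreover have "0 < r\<^sup>2" using \<open>0 < r\<close> by simp
  ultimately have "(norm y)\<^sup>2 < r\<^sup>2" by linarith
  hence ny: "norm y < r" using \<open>0 < r\<close> by (simp add: power2_less_imp_less)
  define z1 w1 where "z1 = z0 + y" and "w1 = w (z0 + y)"
  have w1: "w1 \<in> S" unfolding w1_def using inS ny by blast
  have touch: "f (z1 + u) \<le> f z1 + (g + B y) \<bullet> u + u \<bullet> B u / 2" if "norm u < r - norm y" for u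
  proof -
    have "norm (y + u) \<le> r" using that norm_triangle_ineq[of y u] by linarith
    hence "f (z0 + (y + u)) - q (y + u) \<le> f (z0 + y) - q y" using y(2) by simp
    moreover have "q (y + u) = q y + (g + B y) \<bullet> u + u \<bullet> B u / 2"
      unfolding q_def by (rule quadratic_recenter[OF B, of g y u, unfolded add.assoc[symmetric]])
    ultimately show ?thesis unfolding z1_def by (simp add: add.assoc)
  qed
  have "\<forall>\<^sub>F v in at w1. v \<in> S" using w1 \<open>open S\<close> by (intro eventually_at_in_open')
  moreover have "\<forall>\<^sub>F v in at w1. dist v w1 < r - norm y"
    using ny by (auto simp: eventually_at intro!: exI[of _ "r - norm y"])
  ultimately have "\<forall>\<^sub>F v in at w1. U v \<le> U w1 + (g + B y) \<bullet> (v - w1) + (v - w1) \<bullet> B (v - w1) / 2"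
  proof eventually_elim
    case (elim v)
    \<comment> \<open>Translating v and z by the same vector leaves the penalty c |z - v|^2
      unchanged.\<close>
    have "U v - c * (norm (z1 + (v - w1) - v))\<^sup>2 \<le> f (z1 + (v - w1))" using f elim(1) by blast
    moreover have "z1 + (v - w1) - v = z1 - w1" by simp
    moreover have "f (z1 + (v - w1)) \<le> f z1 + (g + B y) \<bullet> (v - w1) + (v - w1) \<bullet> B (v - w1) / 2"
      using elim(2) by (intro touch) (simp add: dist_norm)
    moreover have "f z1 = U w1 - c * (norm (z1 - w1))\<^sup>2" unfolding z1_def w1_def by (rule fw)
    ultimately show ?case by simp
  qed
  thus ?thesis using ny unfolding w1_def B_def touched_above_def by (intro exI[of _ y]) simp
qed

text \<open>The points z1 and z2 need not coincide. That R does not depend on \<epsilon> is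
  essential: it gives compactness of the gradients and Hessians when \<epsilon> tends to 0.\<close>

theorem local_maximum_principle:
  fixes U W :: "'a::euclidean_space \<Rightarrow> real"
  assumes S: "open S" "bounded S"
    and U: "upper_semicontinuous_on (closure S) U" and W: "upper_semicontinuous_on (closure S) W"
    and neg: "\<And>z. z \<in> frontier S \<Longrightarrow> U z + W z < 0" and zs: "zs \<in> S" "0 < U zs + W zs"
  obtains R where "\<And>\<epsilon>. 0 < \<epsilon> \<Longrightarrow> \<exists>z1\<in>S. \<exists>z2\<in>S. \<exists>p1 p2 A B. self_adjoint A \<and> self_adjoint B \<and>
     norm p1 \<le> R \<and> norm (p1 + p2) \<le> \<epsilon> \<and> (\<forall>y. norm (A y) \<le> R * norm y) \<and> (\<forall>y. norm (B y) \<le> R * norm y) \<and>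
     (\<forall>y. y \<bullet> A y + y \<bullet> B y \<le> \<epsilon> * (norm y)\<^sup>2) \<and> touched_above U z1 p1 A \<and> touched_above W z2 p2 B"
proof -
  define C where "C = closure S"
  have C: "compact C" "C \<noteq> {}" "S \<subseteq> C" "zs \<in> C"
    unfolding C_def using S(2) zs(1) closure_subset by auto
  define \<sigma> where "\<sigma> = U zs + W zs"
  have \<sigma>: "0 < \<sigma>" unfolding \<sigma>_def using zs by simp
  have "U z + W z < \<sigma> / 2" if "z \<in> frontier S" for z using neg[OF that] \<sigma> by linarith
  from near_diagonal_interior[OF S U W this] obtain \<delta> where \<delta>: "\<delta> > 0"
    "\<forall>w\<in>C. \<forall>w'\<in>C. norm (w - w') \<le> \<delta> \<longrightarrow> \<sigma> / 2 \<le> U w + W w' \<longrightarrow> w \<in> S \<and> w' \<in> S"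
    unfolding C_def by blast
  obtain mU where mU: "\<And>w. w \<in> C \<Longrightarrow> U w \<le> mU"
    using upper_semicontinuous_on_attains_max[OF C(1,2)] U unfolding C_def by metis
  obtain mW where mW: "\<And>w. w \<in> C \<Longrightarrow> W w \<le> mW"
    using upper_semicontinuous_on_attains_max[OF C(1,2)] W unfolding C_def by metis
  define m where "m = mU + mW"
  have m: "U w + W w' \<le> m" if "w \<in> C" "w' \<in> C" for w w' using mU mW that unfolding m_def by (intro add_mono)
  have mpos: "0 < m" using m[OF C(4,4)] zs(2) by linarith
  obtain RC where RC: "RC > 0" "\<And>w. w \<in> C \<Longrightarrow> norm w \<le> RC"
    using compact_imp_bounded[OF C(1)] bounded_pos by blast
  \<comment> \<open>With 4 m \<le> c \<delta>^2, a value of \<phi> of at least \<sigma>/2 forces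
    both maximizing points to within \<delta>/2 of z, hence within \<delta> of each other.\<close>
  define c where "c = 4 * m / \<delta>\<^sup>2"
  have cp: "0 < c" "4 * m \<le> c * \<delta>\<^sup>2" using mpos \<delta>(1) unfolding c_def by auto
  obtain wU where wU: "\<And>z. wU z \<in> C"
    "\<And>z v. v \<in> C \<Longrightarrow> U v - c * (norm (z - v))\<^sup>2 \<le> U (wU z) - c * (norm (z - wU z))\<^sup>2"
    using exists_sup_convolution[OF C(1,2), of U c] U unfolding C_def by blast
  obtain wW where wW: "\<And>z. wW z \<in> C"
    "\<And>z v. v \<in> C \<Longrightarrow> W v - c * (norm (z - v))\<^sup>2 \<le> W (wW z) - c * (norm (z - wW z))\<^sup>2"
    using exists_sup_convolution[OF C(1,2), of W c] W unfolding C_def by blast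
  define f where "f = (\<lambda>z. U (wU z) - c * (norm (z - wU z))\<^sup>2)"
  define k where "k = (\<lambda>z. W (wW z) - c * (norm (z - wW z))\<^sup>2)"
  define a where "a = (\<lambda>z. f z + c * (norm z)\<^sup>2)"
  define b where "b = (\<lambda>z. k z + c * (norm z)\<^sup>2)"
  define P where "P = (\<lambda>z. (2 * c) *\<^sub>R wU z)"
  define Q where "Q = (\<lambda>z. (2 * c) *\<^sub>R wW z)"
  \<comment> \<open>Completing the square: a sup-convolution plus c |z|^2 is a supremum of affine
    functions, with slope 2 c w z at z.\<close>
  have sub: "u (w z) - c * (norm (z - w z))\<^sup>2 + c * (norm z)\<^sup>2 + ((2 * c) *\<^sub>R w z) \<bullet> (x - z)
       \<le> u (w x) - c * (norm (x - w x))\<^sup>2 + c * (norm x)\<^sup>2"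
    if "\<And>z. w z \<in> C" "\<And>z v. v \<in> C \<Longrightarrow> u v - c * (norm (z - v))\<^sup>2 \<le> u (w z) - c * (norm (z - w z))\<^sup>2"
    for u and w :: "'a \<Rightarrow> 'a" and x z
  proof -
    have "u (w z) - c * (norm (x - w z))\<^sup>2 \<le> u (w x) - c * (norm (x - w x))\<^sup>2" using that by blast
    moreover have "- c * (norm (z - v))\<^sup>2 + c * (norm z)\<^sup>2 + ((2 * c) *\<^sub>R v) \<bullet> (x - z)
        = - c * (norm (x - v))\<^sup>2 + c * (norm x)\<^sup>2" for v
      unfolding power2_norm_eq_inner
      by (simp add: inner_diff_left inner_diff_right inner_commute algebra_simps)
    from this[of "w z"] have "- (c * (norm (z - w z))\<^sup>2) + c * (norm z)\<^sup>2 + ((2 * c) *\<^sub>R w z) \<bullet> (x - z)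
        = - (c * (norm (x - w z))\<^sup>2) + c * (norm x)\<^sup>2" by simp
    ultimately show ?thesis by linarith
  qed
  interpret semiconvex_pair a b P Q c "2 * c * RC"
  proof
    show "a z + P z \<bullet> (x - z) \<le> a x" for x z
      unfolding a_def f_def P_def by (rule sub[of wU U, OF wU])
    show "b z + Q z \<bullet> (x - z) \<le> b x" for x z
      unfolding b_def k_def Q_def by (rule sub[of wW W, OF wW])
    show "norm (P z) \<le> 2 * c * RC" "norm (Q z) \<le> 2 * c * RC" for z
      unfolding P_def Q_def using cp(1) wU(1) wW(1) RC(2) by auto
  qed (rule cp(1))
  have \<phi>eq: "\<phi> z = f z + k z" for z unfolding \<phi>_def by (simp add: a_def b_def)
  have \<phi>zs: "\<sigma> \<le> \<phi> zs"
    using wU(2)[OF C(4), of zs] wW(2)[OF C(4), of zs] unfolding \<phi>eq f_def k_def \<sigma>_def by simp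
  have inS: "wU z \<in> S \<and> wW z \<in> S" if "\<sigma> / 2 \<le> \<phi> z" for z
  proof (rule \<delta>(2)[rule_format, OF wU(1) wW(1)])
    have eq: "\<phi> z = U (wU z) + W (wW z) - c * (norm (z - wU z))\<^sup>2 - c * (norm (z - wW z))\<^sup>2"
      unfolding \<phi>eq f_def k_def by simp
    have nn: "0 \<le> c * (norm (z - wU z))\<^sup>2" "0 \<le> c * (norm (z - wW z))\<^sup>2" using c by auto
    show "\<sigma> / 2 \<le> U (wU z) + W (wW z)" using that nn unfolding eq by linarith
    have "c * (norm (z - wU z))\<^sup>2 \<le> m" "c * (norm (z - wW z))\<^sup>2 \<le> m"
      using that nn m[OF wU(1) wW(1), of z z] \<sigma> unfolding eq by linarith+
    hence "c * (2 * norm (z - wU z))\<^sup>2 \<le> c * \<delta>\<^sup>2" "c * (2 * norm (z - wW z))\<^sup>2 \<le> c * \<delta>\<^sup>2"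
      using cp(2) by (simp_all add: power_mult_distrib)
    hence "2 * norm (z - wU z) \<le> \<delta>" "2 * norm (z - wW z) \<le> \<delta>"
      using cp(1) \<delta>(1) by (auto intro: power2_le_imp_le)
    thus "norm (wU z - wW z) \<le> \<delta>"
      using norm_triangle_ineq4[of "z - wW z" "z - wU z"] by simp
  qed
  \<comment> \<open>Away from C both penalties grow like the square of the distance, so beyond R0
    they outweigh any affine function of slope at most 1. A maximum over the ball is then a maximum
    everywhere.\<close>
  define R0 where "R0 = RC + 1 + (m + 2 * RC + 2) / (2 * c)"
  have R0: "RC + 1 \<le> R0" unfolding R0_def using c mpos RC(1) by simp
  have far: "\<phi> y - q \<bullet> y < \<phi> zs - q \<bullet> zs" if q: "norm q \<le> 1" and y: "R0 < norm y" for q y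
  proof -
    define s where "s = norm y - RC"
    have s: "1 \<le> s" "(m + 2 * RC + 2) / (2 * c) \<le> s" using y R0 unfolding s_def R0_def by auto
    hence "m + 2 * RC + 2 \<le> 2 * c * s" using c by (simp add: field_simps)
    hence "(m + 2 * RC + 2) * s \<le> 2 * c * s * s" using s by (intro mult_right_mono) auto
    moreover have "(m + 2 * RC + 1) * 1 \<le> (m + 2 * RC + 1) * s"
      using s mpos RC by (intro mult_left_mono) auto
    ultimately have big: "m + 2 * RC + 1 + s \<le> 2 * c * s\<^sup>2" by (simp add: power2_eq_square algebra_simps)
    have "c * s\<^sup>2 \<le> c * (norm (y - wU y))\<^sup>2" "c * s\<^sup>2 \<le> c * (norm (y - wW y))\<^sup>2"
      using norm_triangle_ineq2[of y "wU y"] norm_triangle_ineq2[of y "wW y"] RC(2)[OF wU(1), of y]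
        RC(2)[OF wW(1), of y] c s unfolding s_def by (auto intro!: power_mono)
    hence 1: "\<phi> y \<le> m - 2 * c * s\<^sup>2" using m[OF wU(1) wW(1), of y y] unfolding \<phi>eq f_def k_def by linarith
    have "\<bar>q \<bullet> y\<bar> \<le> 1 * norm y"
      using Cauchy_Schwarz_ineq2[of q y] mult_right_mono[OF q, of "norm y"] by simp
    moreover have "\<bar>q \<bullet> zs\<bar> \<le> 1 * RC"
      using Cauchy_Schwarz_ineq2[of q zs] mult_mono[OF q RC(2)[OF C(4)]] by simp
    ultimately show ?thesis using 1 big \<phi>zs \<sigma> unfolding s_def by linarith
  qed
  have maxi: "\<exists>z. norm z \<le> R0 \<and> maximizer q z" if q: "norm q \<le> 1" for q
  proof -
    have zsB: "zs \<in> cball 0 R0" using RC(2)[OF C(4)] R0 by simp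
    obtain z where z: "z \<in> cball 0 R0" "\<And>y. y \<in> cball 0 R0 \<Longrightarrow> \<phi> y - q \<bullet> y \<le> \<phi> z - q \<bullet> z"
    proof -
      have "continuous_on (cball 0 R0) (\<lambda>y. \<phi> y - q \<bullet> y)" by (intro continuous_intros continuous_\<phi>)
      from continuous_attains_sup[OF compact_cball _ this] zsB that show thesis by blast
    qed
    have "\<phi> y - q \<bullet> y \<le> \<phi> z - q \<bullet> z" for y
      using z(2)[of y] far[OF q, of y] z(2)[OF zsB] by (cases "norm y \<le> R0") auto
    thus ?thesis unfolding maximizer_def using z(1) by auto
  qed
  \<comment> \<open>Uniform continuity will keep \<phi> above \<sigma>/2 on a whole ball about each
    contact point, so that \<open>wU\<close> and \<open>wW\<close> take interior values on that
    ball.\<close>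
  have uc: "uniformly_continuous_on (cball 0 (R0 + 1)) \<phi>"
    by (intro compact_uniformly_continuous continuous_\<phi> compact_cball)
  have "\<sigma> / 4 > 0" using \<sigma> by simp
  then obtain r1 where r1: "r1 > 0" "\<forall>x\<in>cball 0 (R0 + 1). \<forall>y\<in>cball 0 (R0 + 1). dist y x < r1 \<longrightarrow> dist (\<phi> y) (\<phi> x) < \<sigma> / 4"
    using uc unfolding uniformly_continuous_on_def by blast
  have cf: "continuous_on UNIV f"
  proof -
    have "f = (\<lambda>z. a z - c * (norm z)\<^sup>2)" unfolding a_def by simp
    moreover have "continuous_on UNIV \<dots>"
      by (intro continuous_intros continuous_of_subgradient[OF suba bda])
    ultimately show ?thesis by simp
  qed
  have ck: "continuous_on UNIV k"
  proof -
    have "k = (\<lambda>z. b z - c * (norm z)\<^sup>2)" unfolding b_def by simp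
    moreover have "continuous_on UNIV \<dots>"
      by (intro continuous_intros continuous_of_subgradient[OF subb bdb])
    ultimately show ?thesis by simp
  qed
  \<comment> \<open>A bound for the final Hessians: the first term comes from the almost quadratic
    expansions, 2 c from removing c |z|^2, and 8 from the added curvature 8 \<eta> with \<eta> \<le>
    1.\<close>
  define H where "H = DIM('a) * (8 * c + 2) + 2 * c + 8"
  have H: "0 < H" unfolding H_def using c by (intro add_nonneg_pos add_nonneg_nonneg mult_nonneg_nonneg) auto
  define R where "R = 2 * c * RC + 2 * c * R0 + H"
  show thesis
  proof (rule that[of R])
    fix \<epsilon> :: real assume "0 < \<epsilon>"
    \<comment> \<open>4 \<eta> is lost in the two expansions and 16 \<eta> in the two added
      curvatures, together at most \<epsilon>.\<close>
    define \<eta> where "\<eta> = min 1 (\<epsilon> / 20)"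
    have \<eta>: "0 < \<eta>" "\<eta> \<le> 1" "20 * \<eta> \<le> \<epsilon>" unfolding \<eta>_def using \<open>0 < \<epsilon>\<close> by auto
    \<comment> \<open>The three bounds serve, in turn, the existence of maxima, the smallness of the
      gradient sum (which equals q at the contact point), and the height of \<phi> at contact
      points.\<close>
    define \<rho> where "\<rho> = min 1 (min (\<epsilon> / 2) (\<sigma> / (8 * R0)))"
    have R0pos: "0 < R0" using R0 RC by linarith
    have \<rho>: "0 < \<rho>" "\<rho> \<le> 1" "\<rho> \<le> \<epsilon> / 2" "\<rho> \<le> \<sigma> / (8 * R0)"
      unfolding \<rho>_def using \<open>0 < \<epsilon>\<close> \<sigma> R0pos by auto
    hence \<rho>R0: "\<rho> * (2 * R0) \<le> \<sigma> / 4" using R0pos by (simp add: field_simps)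
    \<comment> \<open>Moving from the contact point to the touching points changes the gradients by
      at most H r0 each, together at most \<epsilon>/2.\<close>
    define r0 where "r0 = min (min 1 r1) (\<epsilon> / (4 * H))"
    have r0: "0 < r0" "r0 \<le> 1" "r0 \<le> r1" "2 * (H * r0) \<le> \<epsilon> / 2"
    proof -
      show "0 < r0" "r0 \<le> 1" "r0 \<le> r1" unfolding r0_def using \<open>0 < \<epsilon>\<close> H r1 by auto
      have "r0 \<le> \<epsilon> / (4 * H)" unfolding r0_def by simp
      thus "2 * (H * r0) \<le> \<epsilon> / 2" using H by (simp add: field_simps)
    qed
    have maxi\<rho>: "\<exists>z. norm z \<le> R0 \<and> maximizer q z" if "norm q \<le> \<rho>" for q
      using maxi[of q] that \<rho>(2) by simp
    obtain z q r A B where zq: "norm z \<le> R0" "norm q \<le> \<rho>" "maximizer q z" and r: "0 < r" "r < r0"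
      and A: "self_adjoint A" and B: "self_adjoint B"
      and nA: "\<And>y. norm (A y) \<le> DIM('a) * (8 * c + 2) * norm y" and nB: "\<And>y. norm (B y) \<le> DIM('a) * (8 * c + 2) * norm y"
      and ea: "\<And>y. norm y \<le> r \<Longrightarrow> \<bar>a (z + y) - a z - P z \<bullet> y - (y \<bullet> A y) / 2\<bar> \<le> \<eta> * r\<^sup>2"
      and eb: "\<And>y. norm y \<le> r \<Longrightarrow> \<bar>b (z + y) - b z - Q z \<bullet> y - (y \<bullet> B y) / 2\<bar> \<le> \<eta> * r\<^sup>2"
      by (rule exists_almost_quadratic_scale[OF \<rho>(1) maxi\<rho> \<eta>(1,2) r0(1)]) (assumption, rule that, assumption+)
    have high: "wU (z + y) \<in> S \<and> wW (z + y) \<in> S" if y: "norm y < r" for y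
    proof (rule inS)
      have "\<phi> zs - q \<bullet> zs \<le> \<phi> z - q \<bullet> z" using zq(3) unfolding maximizer_def by blast
      moreover have "\<bar>q \<bullet> (zs - z)\<bar> \<le> \<rho> * (2 * R0)"
      proof -
        have "norm (zs - z) \<le> 2 * R0"
          using norm_triangle_ineq4[of zs z] RC(2)[OF C(4)] R0 zq(1) by linarith
        thus ?thesis using Cauchy_Schwarz_ineq2[of q "zs - z"] mult_mono[OF zq(2), of "norm (zs - z)" "2 * R0"] \<rho>(1) by simp
      qed
      ultimately have "3 * \<sigma> / 4 \<le> \<phi> z" using \<rho>R0 \<phi>zs by (simp add: inner_diff_right abs_le_iff)
      moreover have "dist (\<phi> (z + y)) (\<phi> z) < \<sigma> / 4"
      proof (intro r1(2)[rule_format])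
        show "z \<in> cball 0 (R0 + 1)" "z + y \<in> cball 0 (R0 + 1)" unfolding mem_cball_0
          using y r r0 zq(1) norm_triangle_ineq[of z y] by linarith+
        show "dist (z + y) z < r1" using y r r0 by (simp add: dist_norm)
      qed
      ultimately show "\<sigma> / 2 \<le> \<phi> (z + y)" unfolding dist_real_def by linarith
    qed
    have sq: "(norm (z + y))\<^sup>2 = (norm z)\<^sup>2 + 2 * (z \<bullet> y) + y \<bullet> y" for y
      by (simp add: power2_norm_eq_inner inner_add_left inner_add_right inner_commute)
    \<comment> \<open>Removing c |z|^2 turns the expansions of \<open>a\<close> and \<open>b\<close>
      into expansions of \<open>f\<close> and \<open>k\<close>.\<close>
    define A' where "A' = (\<lambda>y. A y - (2 * c) *\<^sub>R y)"
    define B' where "B' = (\<lambda>y. B y - (2 * c) *\<^sub>R y)"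
    have A': "self_adjoint A'" unfolding A'_def using self_adjoint_add_scaleR[OF A, of "- (2 * c)"] by simp
    have B': "self_adjoint B'" unfolding B'_def using self_adjoint_add_scaleR[OF B, of "- (2 * c)"] by simp
    define g where "g = P z - (2 * c) *\<^sub>R z"
    define g' where "g' = Q z - (2 * c) *\<^sub>R z"
    have ef: "f (z + y) \<le> f z + g \<bullet> y + y \<bullet> A' y / 2 + \<eta> * r\<^sup>2" if "norm y \<le> r" for y
      using ea[OF that] unfolding a_def g_def A'_def sq
      by (simp add: inner_diff_left inner_diff_right abs_le_iff diff_divide_distrib algebra_simps)
    have ek: "k (z + y) \<le> k z + g' \<bullet> y + y \<bullet> B' y / 2 + \<eta> * r\<^sup>2" if "norm y \<le> r" for y
      using eb[OF that] unfolding b_def g'_def B'_def sq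
      by (simp add: inner_diff_left inner_diff_right abs_le_iff diff_divide_distrib algebra_simps)
    have fS: "U v - c * (norm (z - v))\<^sup>2 \<le> f z" "W v - c * (norm (z - v))\<^sup>2 \<le> k z" if "v \<in> S" for z v
      using wU(2) wW(2) that C(3) unfolding f_def k_def by blast+
    define A1 where "A1 = (\<lambda>y. A' y + (8 * \<eta>) *\<^sub>R y)"
    define B1 where "B1 = (\<lambda>y. B' y + (8 * \<eta>) *\<^sub>R y)"
    obtain y1 where y1: "norm y1 < r" "touched_above U (wU (z + y1)) (g + A1 y1) A1"
      using touching_quadratic[OF cf fS(1) _ A' r(1) \<eta>(1) ef, of S wU] high S(1) unfolding f_def A1_def by blast
    obtain y2 where y2: "norm y2 < r" "touched_above W (wW (z + y2)) (g' + B1 y2) B1"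
      using touching_quadratic[OF ck fS(2) _ B' r(1) \<eta>(1) ek, of S wW] high S(1) unfolding k_def B1_def by blast
    have A1: "self_adjoint A1" "self_adjoint B1"
      unfolding A1_def B1_def by (rule self_adjoint_add_scaleR[OF A'] self_adjoint_add_scaleR[OF B'])+
    have norm3: "norm (D y - (2 * c) *\<^sub>R y + (8 * \<eta>) *\<^sub>R y) \<le> H * norm y"
      if "\<And>y. norm (D y) \<le> DIM('a) * (8 * c + 2) * norm y" for D :: "'a \<Rightarrow> 'a" and y
    proof -
      have "norm (D y - (2 * c) *\<^sub>R y + (8 * \<eta>) *\<^sub>R y) \<le> norm (D y) + norm ((2 * c) *\<^sub>R y) + norm ((8 * \<eta>) *\<^sub>R y)"
        by (meson add_right_mono norm_triangle_ineq norm_triangle_ineq4 order_trans)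
      also have "norm ((2 * c) *\<^sub>R y) = 2 * c * norm y" using c by simp
      also have "norm ((8 * \<eta>) *\<^sub>R y) = 8 * \<eta> * norm y" using \<eta> by simp
      also have "8 * \<eta> * norm y \<le> 8 * norm y" using \<eta> by (intro mult_right_mono) auto
      finally show ?thesis using that[of y] unfolding H_def by (simp only: distrib_right) linarith
    qed
    have nA1: "norm (A1 y) \<le> H * norm y" and nB1: "norm (B1 y) \<le> H * norm y" for y
      unfolding A1_def B1_def A'_def B'_def by (rule norm3, rule nA, rule norm3, rule nB)
    have ng: "norm g \<le> 2 * c * RC + 2 * c * R0" "norm g' \<le> 2 * c * RC + 2 * c * R0"
    proof -
      have "norm ((2 * c) *\<^sub>R z) \<le> 2 * c * R0" using zq(1) c by simp
      thus "norm g \<le> 2 * c * RC + 2 * c * R0" "norm g' \<le> 2 * c * RC + 2 * c * R0"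
        unfolding g_def g'_def using norm_triangle_ineq4[of "P z" "(2 * c) *\<^sub>R z"]
          norm_triangle_ineq4[of "Q z" "(2 * c) *\<^sub>R z"] bda[of z] bdb[of z] by linarith+
    qed
    have n1: "norm (A1 y1) \<le> H * r0" "norm (B1 y2) \<le> H * r0"
    proof -
      have "H * norm y1 \<le> H * r0" "H * norm y2 \<le> H * r0"
        using y1(1) y2(1) r H by (auto intro!: mult_left_mono)
      thus "norm (A1 y1) \<le> H * r0" "norm (B1 y2) \<le> H * r0" using nA1[of y1] nB1[of y2] by linarith+
    qed
    have n2: "H * r0 \<le> H" using r0 H by simp
    have HR: "H \<le> R" unfolding R_def using c RC R0pos by simp
    have le1: "norm (g + A1 y1) \<le> R"
      using norm_triangle_ineq[of g "A1 y1"] ng n1 n2 unfolding R_def by linarith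
    have le2: "norm (A1 y) \<le> R * norm y" "norm (B1 y) \<le> R * norm y" for y
      using nA1[of y] nB1[of y] mult_right_mono[OF HR, of "norm y"] by (auto intro: order_trans)
    have "g + g' = q" unfolding g_def g'_def using maximizer_gradient[OF zq(3)]
      by (simp add: algebra_simps flip: scaleR_add_left)
    hence "(g + A1 y1) + (g' + B1 y2) = q + A1 y1 + B1 y2" by simp
    also have "norm \<dots> \<le> norm q + norm (A1 y1) + norm (B1 y2)"
      by (meson add_right_mono norm_triangle_ineq order_trans)
    also have "\<dots> \<le> \<epsilon>" using zq(2) \<rho>(3) n1 r0(4) by linarith
    finally have le3: "norm ((g + A1 y1) + (g' + B1 y2)) \<le> \<epsilon>" .
    \<comment> \<open>A quadratic form is determined on the sphere of radius r, where maximality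
      bounds a + b from above. The resulting curvature 4 c cancels against the 2 c removed from each
      of the two Hessians.\<close>
    have le4: "y \<bullet> A1 y + y \<bullet> B1 y \<le> \<epsilon> * (norm y)\<^sup>2" for y
    proof (cases "y = 0")
      case False
      define t where "t = r / norm y"
      have t: "0 < t" "norm (t *\<^sub>R y) = r" unfolding t_def using False r by auto
      have "a (z + t *\<^sub>R y) + b (z + t *\<^sub>R y) - (a z + b z) \<le> (P z + Q z) \<bullet> (t *\<^sub>R y) + 2 * c * r\<^sup>2"
        using maximizer_upper[OF zq(3), of "t *\<^sub>R y"] t(2) unfolding maximizer_gradient[OF zq(3)] by simp
      hence "(t *\<^sub>R y) \<bullet> A (t *\<^sub>R y) + (t *\<^sub>R y) \<bullet> B (t *\<^sub>R y) \<le> 4 * c * r\<^sup>2 + 4 * \<eta> * r\<^sup>2"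
        using ea[of "t *\<^sub>R y"] eb[of "t *\<^sub>R y"] t(2) unfolding inner_add_left abs_le_iff by linarith
      moreover have "(t *\<^sub>R y) \<bullet> A (t *\<^sub>R y) + (t *\<^sub>R y) \<bullet> B (t *\<^sub>R y) = t\<^sup>2 * (y \<bullet> A y + y \<bullet> B y)"
        by (simp add: linear_scale[OF self_adjointD(1)[OF A]] linear_scale[OF self_adjointD(1)[OF B]] power2_eq_square distrib_left)
      moreover have "r\<^sup>2 = t\<^sup>2 * (norm y)\<^sup>2" using t by (simp add: power_mult_distrib flip: t(2))
      ultimately have "t\<^sup>2 * (y \<bullet> A y + y \<bullet> B y) \<le> t\<^sup>2 * ((4 * c + 4 * \<eta>) * (norm y)\<^sup>2)"
        by (simp add: algebra_simps)
      hence "y \<bullet> A y + y \<bullet> B y \<le> (4 * c + 4 * \<eta>) * (norm y)\<^sup>2" using t(1) by simp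
      moreover have "y \<bullet> A1 y + y \<bullet> B1 y = y \<bullet> A y + y \<bullet> B y - 4 * c * (norm y)\<^sup>2 + 16 * \<eta> * (norm y)\<^sup>2"
        unfolding A1_def B1_def A'_def B'_def power2_norm_eq_inner
        by (simp add: inner_add_right inner_diff_right algebra_simps)
      moreover have "20 * \<eta> * (norm y)\<^sup>2 \<le> \<epsilon> * (norm y)\<^sup>2" using \<eta>(3) by (intro mult_right_mono) auto
      ultimately show ?thesis by (simp only: distrib_right)
    qed simp
    show "\<exists>z1\<in>S. \<exists>z2\<in>S. \<exists>p1 p2 A B. self_adjoint A \<and> self_adjoint B \<and>
     norm p1 \<le> R \<and> norm (p1 + p2) \<le> \<epsilon> \<and> (\<forall>y. norm (A y) \<le> R * norm y) \<and> (\<forall>y. norm (B y) \<le> R * norm y) \<and>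
     (\<forall>y. y \<bullet> A y + y \<bullet> B y \<le> \<epsilon> * (norm y)\<^sup>2) \<and> touched_above U z1 p1 A \<and> touched_above W z2 p2 B"
    proof (rule bexI[of _ "wU (z + y1)"], rule bexI[of _ "wW (z + y2)"], rule exI[of _ "g + A1 y1"],
        rule exI[of _ "g' + B1 y2"], rule exI[of _ A1], rule exI[of _ B1], intro conjI)
      show "wU (z + y1) \<in> S" "wW (z + y2) \<in> S" using high y1(1) y2(1) by auto
    qed (use A1 y1(2) y2(2) le1 le2 le3 le4 in auto)
  qed
qed

section \<open>The p-Laplace operator and its logarithmic form\<close>

text \<open>As \<open>0 powr a = 0\<close>, the expression vanishes at \<xi> = 0 also when an
  exponent is negative, which is the convention for the p-Laplacian at a critical point when p
  \<noteq> 2.\<close>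

definition p_laplace_form :: "real \<Rightarrow> real ^ 'n \<Rightarrow> real ^ 'n ^ 'n \<Rightarrow> real" where
  "p_laplace_form p \<xi> X =
     norm \<xi> powr (p - 2) * trace X + (p - 2) * norm \<xi> powr (p - 4) * (\<xi> \<bullet> (X *v \<xi>))"

text \<open>Substituting \<open>u = exp v\<close> turns the equation into \<open>v\<^sub>t = log_operator p (D v) (D\<^sup>2 v)\<close>, in
  which \<open>v\<close> itself does not occur.\<close>

definition log_operator :: "real \<Rightarrow> real ^ 'n \<Rightarrow> real ^ 'n ^ 'n \<Rightarrow> real" where
  "log_operator p \<xi> X = p_laplace_form p \<xi> X / (p - 1) + norm \<xi> powr p"

definition outer :: "real ^ 'n \<Rightarrow> real ^ 'n ^ 'n" where
  "outer \<xi> = (\<chi> i j. \<xi> $ i * \<xi> $ j)"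

lemma outer_mult_vec: "outer \<xi> *v h = (\<xi> \<bullet> h) *\<^sub>R \<xi>"
  by (simp add: outer_def matrix_vector_mult_def vec_eq_iff inner_vec_def sum_distrib_left
      mult.assoc mult.commute mult.left_commute)

lemma trace_outer: "trace (outer \<xi>) = (norm \<xi>)\<^sup>2"
  by (simp add: trace_def outer_def power2_norm_eq_inner inner_vec_def)

lemma trace_scaleR: "trace (c *\<^sub>R X) = c * trace (X :: real ^ 'n ^ 'n)"
  by (simp add: trace_def sum_distrib_left)

lemma trace_transpose: "trace (transpose X) = trace (X :: real ^ 'n ^ 'n)"
  by (simp add: trace_def transpose_def)

lemma inner_matrix_sum: "\<xi> \<bullet> (X *v \<xi>) = (\<Sum>i\<in>UNIV. \<Sum>j\<in>UNIV. \<xi> $ i * \<xi> $ j * X $ i $ j)"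
  by (simp add: inner_vec_def matrix_vector_mult_def sum_distrib_left mult.assoc mult.commute mult.left_commute)

lemma inner_transpose: "\<xi> \<bullet> (transpose X *v \<eta>) = \<eta> \<bullet> (X *v (\<xi> :: real ^ 'n))"
  by (metis dot_lmul_matrix inner_commute vector_transpose_matrix transpose_transpose)

text \<open>Superjets are taken with arbitrary matrices, while recentring a quadratic polynomial
  requires a symmetric one. Quadratic form and trace, hence the operator, do not notice the
  change.\<close>

definition symmetrize :: "real ^ 'n ^ 'n \<Rightarrow> real ^ 'n ^ 'n" where
  "symmetrize X = (1/2) *\<^sub>R (X + transpose X)"

lemma transpose_symmetrize: "transpose (symmetrize X) = symmetrize X"
  by (simp add: symmetrize_def transpose_def vec_eq_iff add.commute)

lemma inner_symmetrize: "\<xi> \<bullet> (symmetrize X *v \<xi>) = \<xi> \<bullet> (X *v \<xi>)"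
proof -
  have "symmetrize X *v \<xi> = (1/2) *\<^sub>R (X *v \<xi> + transpose X *v \<xi>)"
    unfolding symmetrize_def by (simp only: scaleR_matrix_vector_assoc[symmetric] matrix_vector_mult_add_rdistrib)
  thus ?thesis by (simp only: inner_scaleR_right inner_add_right inner_transpose) simp
qed

lemma trace_symmetrize: "trace (symmetrize X) = trace X"
  by (simp add: symmetrize_def trace_scaleR trace_add trace_transpose)

lemma p_laplace_form_symmetrize: "p_laplace_form p \<xi> (symmetrize X) = p_laplace_form p \<xi> X"
  by (simp add: p_laplace_form_def inner_symmetrize trace_symmetrize)

lemma log_operator_symmetrize: "log_operator p \<xi> (symmetrize X) = log_operator p \<xi> X"
  by (simp add: log_operator_def p_laplace_form_symmetrize)

lemma p_laplacian_eq_form: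
  assumes "2 < p"
  shows "p_laplacian p \<psi> z = p_laplace_form p (x_gradient \<psi> z) (x_hessian \<psi> z)"
  using assms by (simp add: p_laplacian_def p_laplace_form_def Let_def inner_matrix_sum)

lemma p_laplace_form_scaleR:
  assumes "0 < s"
  shows "p_laplace_form p (s *\<^sub>R \<xi>) (s *\<^sub>R X) = s powr (p - 1) * p_laplace_form p \<xi> X"
proof -
  have 1: "s powr (p - 2) * s = s powr (p - 1)"
    using assms powr_add[of s "p - 2" 1] by simp
  have 2: "s powr (p - 4) * (s * (s * s)) = s powr (p - 1)"
    using assms powr_add[of s "p - 4" 3] by (simp add: powr_numeral power3_eq_cube)
  have "p_laplace_form p (s *\<^sub>R \<xi>) (s *\<^sub>R X) = (s powr (p - 2) * s) * (norm \<xi> powr (p - 2) * trace X)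
     + (s powr (p - 4) * (s * (s * s))) * ((p - 2) * norm \<xi> powr (p - 4) * (\<xi> \<bullet> (X *v \<xi>)))"
    using assms by (simp add: p_laplace_form_def trace_scaleR powr_mult
        matrix_vector_mult_scaleR flip: scaleR_matrix_vector_assoc)
  also have "\<dots> = s powr (p - 1) * p_laplace_form p \<xi> X"
    unfolding 1 2 p_laplace_form_def by (simp add: distrib_left)
  finally show ?thesis .
qed

text \<open>For u = exp v the Hessian is u times D^2 v plus the outer product of Dv with itself. The
  latter contributes |\<xi>|^p through the trace and (p - 2) |\<xi>|^p through the form.\<close>

lemma p_laplace_form_add_outer:
  assumes "2 < p"
  shows "p_laplace_form p \<xi> (X + outer \<xi>) = (p - 1) * log_operator p \<xi> X"
proof (cases "\<xi> = 0")
  case True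
  thus ?thesis using assms by (simp add: p_laplace_form_def log_operator_def)
next
  case False
  hence n: "0 < norm \<xi>" by simp
  have 1: "norm \<xi> powr (p - 2) * (norm \<xi>)\<^sup>2 = norm \<xi> powr p"
    using n powr_add[of "norm \<xi>" "p - 2" 2] by (simp add: powr_numeral)
  have 2: "norm \<xi> powr (p - 4) * ((norm \<xi>)\<^sup>2 * (norm \<xi>)\<^sup>2) = norm \<xi> powr p"
    using n powr_add[of "norm \<xi>" "p - 4" 4] by (simp add: powr_numeral flip: power_add)
  have "p_laplace_form p \<xi> (X + outer \<xi>) = p_laplace_form p \<xi> X + norm \<xi> powr (p - 2) * (norm \<xi>)\<^sup>2
     + (p - 2) * (norm \<xi> powr (p - 4) * ((norm \<xi>)\<^sup>2 * (norm \<xi>)\<^sup>2))"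
    by (simp add: p_laplace_form_def trace_add trace_outer matrix_vector_mult_add_rdistrib outer_mult_vec
        inner_add_right power2_norm_eq_inner algebra_simps)
  also have "\<dots> = (p - 1) * log_operator p \<xi> X"
    unfolding 1 2 log_operator_def using assms by (simp add: field_simps)
  finally show ?thesis .
qed

lemma p_laplace_form_log:
  assumes "2 < p" "0 < s"
  shows "p_laplace_form p (s *\<^sub>R \<xi>) (s *\<^sub>R (X + outer \<xi>)) = s powr (p - 1) * ((p - 1) * log_operator p \<xi> X)"
  by (simp only: p_laplace_form_scaleR[OF assms(2)] p_laplace_form_add_outer[OF assms(1)])

text \<open>Ellipticity: the trace is a sum of values of the form at coordinate vectors, and both
  coefficients are nonnegative for p \<ge> 2.\<close>

lemma p_laplace_form_mono:
  assumes "2 \<le> p" "\<And>y. y \<bullet> (X *v y) \<le> y \<bullet> (Y *v y)"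
  shows "p_laplace_form p \<xi> X \<le> p_laplace_form p \<xi> Y"
proof -
  have tr: "trace X = (\<Sum>i\<in>UNIV. axis i 1 \<bullet> (X *v axis i 1))" for X :: "real ^ 'n ^ 'n"
    by (simp add: trace_def inner_axis' matrix_vector_mul_component inner_axis)
  have "trace X \<le> trace Y" unfolding tr by (intro sum_mono assms)
  thus ?thesis unfolding p_laplace_form_def using assms by (intro add_mono mult_left_mono) auto
qed

lemma log_operator_mono:
  assumes "2 \<le> p" "\<And>y. y \<bullet> (X *v y) \<le> y \<bullet> (Y *v y)"
  shows "log_operator p \<xi> X \<le> log_operator p \<xi> Y"
  unfolding log_operator_def using assms by (intro add_right_mono divide_right_mono p_laplace_form_mono) auto

text \<open>For p < 4 the power is singular at 0, but the product is bounded by |\<xi>|^(p - 2),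
  which tends to 0. Critical points therefore call for no separate argument in the
  comparison.\<close>

lemma continuous_powr_norm_mult:
  fixes i j :: "'n::finite"
  assumes "2 < p"
  shows "continuous_on UNIV (\<lambda>\<xi>::real ^ 'n. norm \<xi> powr (p - 4) * (\<xi> $ i * \<xi> $ j))"
  unfolding continuous_on_eq_continuous_at[OF open_UNIV]
proof
  fix \<xi> :: "real ^ 'n"
  show "isCont (\<lambda>\<xi>. norm \<xi> powr (p - 4) * (\<xi> $ i * \<xi> $ j)) \<xi>"
  proof (cases "\<xi> = 0")
    case False
    thus ?thesis by (intro continuous_intros) auto
  next
    case True
    have "((\<lambda>\<xi>::real ^ 'n. norm \<xi> powr (p - 4) * (\<xi> $ i * \<xi> $ j)) \<longlongrightarrow> 0) (at 0)"
    proof (rule tendsto_rabs_zero_cancel, rule tendsto_sandwich[OF _ _ tendsto_const])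
      show "\<forall>\<^sub>F \<xi>::real ^ 'n in at 0. 0 \<le> \<bar>norm \<xi> powr (p - 4) * (\<xi> $ i * \<xi> $ j)\<bar>" by simp
      show "\<forall>\<^sub>F \<xi>::real ^ 'n in at 0. \<bar>norm \<xi> powr (p - 4) * (\<xi> $ i * \<xi> $ j)\<bar> \<le> norm \<xi> powr (p - 2)"
      proof (rule eventually_at_filter[THEN iffD2], intro always_eventually allI impI)
        fix \<xi> :: "real ^ 'n" assume "\<xi> \<noteq> 0"
        hence n: "0 < norm \<xi>" by simp
        have "\<bar>\<xi> $ i * \<xi> $ j\<bar> \<le> norm \<xi> * norm \<xi>"
          unfolding abs_mult by (intro mult_mono component_le_norm_cart) auto
        hence "norm \<xi> powr (p - 4) * \<bar>\<xi> $ i * \<xi> $ j\<bar> \<le> norm \<xi> powr (p - 4) * (norm \<xi> * norm \<xi>)"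
          by (intro mult_left_mono) auto
        also have "\<dots> = norm \<xi> powr (p - 2)"
          using n powr_add[of "norm \<xi>" "p - 4" 2] by (simp add: powr_numeral power2_eq_square)
        finally show "\<bar>norm \<xi> powr (p - 4) * (\<xi> $ i * \<xi> $ j)\<bar> \<le> norm \<xi> powr (p - 2)" by (simp add: abs_mult)
      qed
      have "((\<lambda>\<xi>::real ^ 'n. norm \<xi> powr (p - 2)) \<longlongrightarrow> norm (0::real ^ 'n) powr (p - 2)) (at 0)"
        using assms by (intro tendsto_powr' tendsto_intros) auto
      thus "((\<lambda>\<xi>::real ^ 'n. norm \<xi> powr (p - 2)) \<longlongrightarrow> 0) (at 0)" using assms by simp
    qed
    thus ?thesis using True by (simp add: isCont_def)
  qed
qed

lemma continuous_p_laplace_form: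
  assumes "2 < p"
  shows "continuous_on UNIV (\<lambda>(\<xi>, X). p_laplace_form p \<xi> (X :: real ^ 'n ^ 'n))"
proof -
  have eq: "p_laplace_form p \<xi> X = norm \<xi> powr (p - 2) * (\<Sum>i\<in>UNIV. X $ i $ i)
      + (p - 2) * (\<Sum>i\<in>UNIV. \<Sum>j\<in>UNIV. (norm \<xi> powr (p - 4) * (\<xi> $ i * \<xi> $ j)) * X $ i $ j)"
    for \<xi> and X :: "real ^ 'n ^ 'n"
    unfolding p_laplace_form_def inner_matrix_sum trace_def sum_distrib_left by (simp add: mult.assoc)
  have c: "continuous_on UNIV (\<lambda>z::(real ^ 'n) \<times> (real ^ 'n ^ 'n). norm (fst z) powr (p - 4) * (fst z $ i * fst z $ j))" for i j
    using continuous_on_compose2[OF continuous_powr_norm_mult[OF assms, of i j] continuous_on_fst[OF continuous_on_id]] by auto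
  show ?thesis unfolding case_prod_beta eq
    using assms by (intro continuous_intros c continuous_on_powr') auto
qed

lemma continuous_log_operator:
  assumes "2 < p"
  shows "continuous_on UNIV (\<lambda>(\<xi>, X). log_operator p \<xi> (X :: real ^ 'n ^ 'n))"
  unfolding log_operator_def case_prod_beta
  using continuous_p_laplace_form[OF assms] assms unfolding case_prod_beta
  by (intro continuous_intros continuous_on_powr') auto

section \<open>Parabolic jets\<close>

definition jet_polynomial :: "real ^ 'n \<Rightarrow> real \<Rightarrow> real ^ 'n ^ 'n \<Rightarrow> (real ^ 'n) \<times> real \<Rightarrow> real" where
  "jet_polynomial \<xi> \<tau> X d = \<xi> \<bullet> fst d + \<tau> * snd d + fst d \<bullet> (X *v fst d) / 2"

text \<open>Homogeneous of degree two under the parabolic scaling that multiplies h by s and k by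
  s^2.\<close>

definition parabolic_size :: "(real ^ 'n) \<times> real \<Rightarrow> real" where
  "parabolic_size d = (norm (fst d))\<^sup>2 + \<bar>snd d\<bar>"

definition superjet ::
  "((real ^ 'n) \<times> real \<Rightarrow> real) \<Rightarrow> (real ^ 'n) \<times> real \<Rightarrow> real ^ 'n \<Rightarrow> real \<Rightarrow> real ^ 'n ^ 'n \<Rightarrow> bool" where
  "superjet v z \<xi> \<tau> X \<longleftrightarrow> (\<forall>\<epsilon>>0. \<forall>\<^sub>F w in at z.
     v w \<le> v z + jet_polynomial \<xi> \<tau> X (w - z) + \<epsilon> * parabolic_size (w - z))"

definition has_jet ::
  "((real ^ 'n) \<times> real \<Rightarrow> real) \<Rightarrow> (real ^ 'n) \<times> real \<Rightarrow> real ^ 'n \<Rightarrow> real \<Rightarrow> real ^ 'n ^ 'n \<Rightarrow> bool" where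
  "has_jet v z \<xi> \<tau> X \<longleftrightarrow> (\<forall>\<epsilon>>0. \<forall>\<^sub>F w in at z.
     \<bar>v w - v z - jet_polynomial \<xi> \<tau> X (w - z)\<bar> \<le> \<epsilon> * parabolic_size (w - z))"

definition jet_sub ::
  "(real ^ 'n \<Rightarrow> real ^ 'n ^ 'n \<Rightarrow> real) \<Rightarrow> ((real ^ 'n) \<times> real) set \<Rightarrow> ((real ^ 'n) \<times> real \<Rightarrow> real) \<Rightarrow> bool" where
  "jet_sub F S v \<longleftrightarrow> (\<forall>z\<in>S. \<forall>\<xi> \<tau> X. superjet v z \<xi> \<tau> X \<longrightarrow> \<tau> \<le> F \<xi> X)"

text \<open>Exact touching by polynomials, which exponentiate to admissible test functions for u.
  This makes it the weaker notion; its equivalence with superjets is the purpose of the box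
  construction below.\<close>

definition quadratic_sub ::
  "(real ^ 'n \<Rightarrow> real ^ 'n ^ 'n \<Rightarrow> real) \<Rightarrow> ((real ^ 'n) \<times> real) set \<Rightarrow> ((real ^ 'n) \<times> real \<Rightarrow> real) \<Rightarrow> bool" where
  "quadratic_sub F S v \<longleftrightarrow> (\<forall>z\<in>S. \<forall>\<xi> \<tau> X K. transpose X = X \<longrightarrow>
     (\<forall>\<^sub>F w in at z. v w \<le> v z + jet_polynomial \<xi> \<tau> X (w - z) + K * (snd (w - z))\<^sup>2) \<longrightarrow> \<tau> \<le> F \<xi> X)"

text \<open>A function \<open>v\<close> is a supersolution for \<open>F\<close> iff \<open>- v\<close> is a subsolution for \<open>reflect F\<close>.\<close>

definition reflect :: "(real ^ 'n \<Rightarrow> real ^ 'n ^ 'n \<Rightarrow> real) \<Rightarrow> real ^ 'n \<Rightarrow> real ^ 'n ^ 'n \<Rightarrow> real" where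
  "reflect F \<xi> X = - F (- \<xi>) (- X)"

lemma parabolic_size_nonneg [simp]: "0 \<le> parabolic_size d"
  by (simp add: parabolic_size_def)

lemma jet_polynomial_0 [simp]: "jet_polynomial \<xi> \<tau> X 0 = 0"
  by (simp add: jet_polynomial_def)

lemma matrix_vector_mult_uminus: "(- X) *v h = - (X *v (h :: real ^ 'n))"
  by (simp add: matrix_vector_mult_def vec_eq_iff sum_negf)

lemma jet_polynomial_uminus: "jet_polynomial (- \<xi>) (- \<tau>) (- X) d = - jet_polynomial \<xi> \<tau> X d"
  by (simp add: jet_polynomial_def matrix_vector_mult_uminus)

lemma jet_polynomial_symmetrize: "jet_polynomial \<xi> \<tau> (symmetrize X) d = jet_polynomial \<xi> \<tau> X d"
  by (simp add: jet_polynomial_def inner_symmetrize)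

lemma eventually_snd_small:
  fixes z :: "'a::real_normed_vector \<times> real"
  assumes "0 < \<delta>"
  shows "\<forall>\<^sub>F w in at z. \<bar>snd (w - z)\<bar> < \<delta>"
proof -
  have "\<bar>snd d\<bar> < \<delta>" if "norm d < \<delta>" for d :: "'a \<times> real"
    using that norm_snd_le[of "snd d" "fst d"] by simp
  thus ?thesis using assms unfolding eventually_at dist_norm by blast
qed

lemma eventually_fst_small:
  fixes z :: "'a::real_normed_vector \<times> real"
  assumes "0 < \<delta>"
  shows "\<forall>\<^sub>F w in at z. norm (fst (w - z)) < \<delta>"
proof -
  have "norm (fst d) < \<delta>" if "norm d < \<delta>" for d :: "'a \<times> real"
    using that norm_fst_le[of "fst d" "snd d"] by simp
  thus ?thesis using assms unfolding eventually_at dist_norm by blast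
qed

text \<open>Near z the term K k^2 is at most \<epsilon> |k|.\<close>

lemma superjet_of_quadratic:
  assumes "\<forall>\<^sub>F w in at z. v w \<le> v z + jet_polynomial \<xi> \<tau> X (w - z) + K * (snd (w - z))\<^sup>2"
  shows "superjet v z \<xi> \<tau> X"
  unfolding superjet_def
proof (intro allI impI)
  fix \<epsilon> :: real assume "0 < \<epsilon>"
  have "0 < \<epsilon> / (\<bar>K\<bar> + 1)" using \<open>0 < \<epsilon>\<close> by simp
  from assms eventually_snd_small[OF this, of z]
  show "\<forall>\<^sub>F w in at z. v w \<le> v z + jet_polynomial \<xi> \<tau> X (w - z) + \<epsilon> * parabolic_size (w - z)"
  proof eventually_elim
    case (elim w)
    define k where "k = snd (w - z)"
    have "(\<bar>K\<bar> + 1) * \<bar>k\<bar> \<le> \<epsilon>" using elim(2) unfolding k_def by (simp add: field_simps)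
    hence "(\<bar>K\<bar> + 1) * \<bar>k\<bar> * \<bar>k\<bar> \<le> \<epsilon> * \<bar>k\<bar>" by (intro mult_right_mono) auto
    moreover have "(\<bar>K\<bar> + 1) * \<bar>k\<bar> * \<bar>k\<bar> = \<bar>K\<bar> * k\<^sup>2 + k\<^sup>2"
      by (simp add: power2_eq_square distrib_right mult.assoc)
    moreover have "K * k\<^sup>2 \<le> \<bar>K\<bar> * k\<^sup>2" by (intro mult_right_mono) auto
    moreover have "\<epsilon> * \<bar>k\<bar> \<le> \<epsilon> * parabolic_size (w - z)"
      unfolding k_def parabolic_size_def using \<open>0 < \<epsilon>\<close> by (intro mult_left_mono) auto
    ultimately show ?case using elim(1) zero_le_power2[of k] unfolding k_def by linarith
  qed
qed

lemma jet_sub_imp_quadratic_sub: "jet_sub F S v \<Longrightarrow> quadratic_sub F S v"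
  unfolding jet_sub_def quadratic_sub_def using superjet_of_quadratic by blast

lemma superjet_mono:
  assumes "superjet u z \<xi> \<tau> X" "v z = u z" "\<forall>\<^sub>F w in at z. v w \<le> u w"
  shows "superjet v z \<xi> \<tau> X"
  unfolding superjet_def
proof (intro allI impI)
  fix \<epsilon> :: real assume "0 < \<epsilon>"
  with assms(1) have "\<forall>\<^sub>F w in at z. u w \<le> u z + jet_polynomial \<xi> \<tau> X (w - z) + \<epsilon> * parabolic_size (w - z)"
    unfolding superjet_def by blast
  with assms(3) show "\<forall>\<^sub>F w in at z. v w \<le> v z + jet_polynomial \<xi> \<tau> X (w - z) + \<epsilon> * parabolic_size (w - z)"
    by eventually_elim (simp add: assms(2))
qed

lemma has_jet_imp_superjet: "has_jet v z \<xi> \<tau> X \<Longrightarrow> superjet v z \<xi> \<tau> X"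
  unfolding has_jet_def superjet_def
  by (elim all_forward imp_forward) (auto elim!: eventually_mono)

lemma has_jet_uminus: "has_jet v z \<xi> \<tau> X \<Longrightarrow> has_jet (\<lambda>w. - v w) z (- \<xi>) (- \<tau>) (- X)"
  unfolding has_jet_def jet_polynomial_uminus
  by (elim all_forward imp_forward) (auto elim!: eventually_mono)

lemma has_jet_add_const: "has_jet v z \<xi> \<tau> X \<Longrightarrow> has_jet (\<lambda>w. v w + c) z \<xi> \<tau> X"
  unfolding has_jet_def by simp

lemma jet_polynomial_shift:
  assumes "transpose X = X"
  shows "jet_polynomial \<xi> \<tau> X (d + e) = jet_polynomial \<xi> \<tau> X d + jet_polynomial (\<xi> + X *v fst d) \<tau> X e"
proof -
  have "fst d \<bullet> (X *v fst e) = fst e \<bullet> (X *v fst d)" using inner_transpose[of "fst d" X "fst e"] assms by simp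
  thus ?thesis
    by (simp add: jet_polynomial_def inner_add_left inner_add_right matrix_vector_right_distrib field_simps)
       (metis inner_commute)
qed

lemma continuous_jet_polynomial: "continuous_on A (jet_polynomial \<xi> \<tau> X)"
  unfolding jet_polynomial_def
  by (intro continuous_intros linear_continuous_on_compose[OF _ matrix_vector_mul_linear]) auto

text \<open>The paraboloid \<open>2\<epsilon>|h|\<^sup>2 + (2\<epsilon>/\<kappa>)k\<^sup>2\<close> dominates \<open>\<epsilon>(|h|\<^sup>2 + |k|)\<close> on the boundary of the
  box \<open>|h| \<le> \<rho>, |k| \<le> \<kappa>\<close>, while its slope in \<open>k\<close> stays below \<open>4\<epsilon>\<close> inside. Hence tests by quadratic
  polynomials suffice, although a superjet only controls \<open>o(|h|\<^sup>2 + |k|)\<close>.\<close>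

definition jet_box :: "(real ^ 'n) \<times> real \<Rightarrow> real \<Rightarrow> real \<Rightarrow> ((real ^ 'n) \<times> real) set" where
  "jet_box z \<rho> \<kappa> = {w. norm (fst (w - z)) \<le> \<rho> \<and> \<bar>snd (w - z)\<bar> \<le> \<kappa>}"

definition box_test ::
  "real ^ 'n \<Rightarrow> real \<Rightarrow> real ^ 'n ^ 'n \<Rightarrow> real \<Rightarrow> real \<Rightarrow> (real ^ 'n) \<times> real \<Rightarrow> real" where
  "box_test \<xi> \<tau> X \<epsilon> \<kappa> d = jet_polynomial \<xi> \<tau> (X + (4 * \<epsilon>) *\<^sub>R mat 1) d + (2 * \<epsilon> / \<kappa>) * (snd d)\<^sup>2"

lemma box_test_0 [simp]: "box_test \<xi> \<tau> X \<epsilon> \<kappa> 0 = 0"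
  by (simp add: box_test_def)

lemma jet_box_eq: "jet_box z \<rho> \<kappa> = cball (fst z) \<rho> \<times> cball (snd z) \<kappa>"
  by (auto simp: jet_box_def dist_norm norm_minus_commute)

lemma compact_jet_box: "compact (jet_box z \<rho> \<kappa>)"
  unfolding jet_box_eq by (intro compact_Times compact_cball)

lemma jet_box_subset_ball:
  assumes "\<rho> \<le> r / 3" "\<kappa> \<le> r / 3" "0 < r"
  shows "jet_box z \<rho> \<kappa> \<subseteq> ball z r"
proof
  fix w assume "w \<in> jet_box z \<rho> \<kappa>"
  hence "norm (fst (w - z)) + norm (snd (w - z)) \<le> r / 3 + r / 3"
    using assms unfolding jet_box_def by simp
  moreover have "norm (w - z) \<le> norm (fst (w - z)) + norm (snd (w - z))"
    using norm_Pair_le[of "fst (w - z)" "snd (w - z)"] by (simp only: prod.collapse)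
  ultimately show "w \<in> ball z r" using assms(3) by (simp add: dist_norm norm_minus_commute)
qed

lemma jet_polynomial_add_mat:
  "jet_polynomial \<xi> \<tau> (X + c *\<^sub>R mat 1) d = jet_polynomial \<xi> \<tau> X d + c / 2 * (norm (fst d))\<^sup>2"
  by (simp add: jet_polynomial_def matrix_vector_mult_add_rdistrib inner_add_right power2_norm_eq_inner
      add_divide_distrib flip: scaleR_matrix_vector_assoc)

text \<open>Complete the square in k: 2 \<epsilon> k^2/\<kappa> dominates \<epsilon> |k| up to the
  deficit \<epsilon> \<kappa>/8, which occurs at |k| = \<kappa>/4.\<close>

lemma box_test_ge:
  assumes "0 < \<epsilon>" "0 < \<kappa>"
  shows "jet_polynomial \<xi> \<tau> X d + \<epsilon> * parabolic_size d + \<epsilon> * (norm (fst d))\<^sup>2 - \<epsilon> * \<kappa> / 8 \<le> box_test \<xi> \<tau> X \<epsilon> \<kappa> d"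
proof -
  define k where "k = \<bar>snd d\<bar>"
  have "0 \<le> (2 * \<epsilon> / \<kappa>) * (k - \<kappa> / 4)\<^sup>2" using assms by simp
  also have "\<dots> = (2 * \<epsilon> / \<kappa>) * k\<^sup>2 - \<epsilon> * k + \<epsilon> * \<kappa> / 8"
    using assms by (simp add: field_simps power2_eq_square)
  finally have "\<epsilon> * k - \<epsilon> * \<kappa> / 8 \<le> (2 * \<epsilon> / \<kappa>) * (snd d)\<^sup>2" unfolding k_def by simp
  thus ?thesis unfolding box_test_def jet_polynomial_add_mat parabolic_size_def k_def by (simp add: algebra_simps)
qed

text \<open>On |h| = \<rho> the surplus \<epsilon> \<rho>^2 loses at most \<epsilon> \<kappa>/8
  \<le> \<epsilon> \<rho>^2/2. On |k| = \<kappa> the time term is 2 \<epsilon> \<kappa>, twice what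
  is needed there.\<close>

lemma box_test_boundary:
  assumes "0 < \<epsilon>" "0 < \<kappa>" "\<kappa> \<le> 4 * \<rho>\<^sup>2" "0 < \<rho>"
    and "norm (fst d) = \<rho> \<or> \<bar>snd d\<bar> = \<kappa>"
  shows "jet_polynomial \<xi> \<tau> X d + \<epsilon> * parabolic_size d + min (\<epsilon> * \<rho>\<^sup>2 / 2) (\<epsilon> * \<kappa>) \<le> box_test \<xi> \<tau> X \<epsilon> \<kappa> d"
  using assms(5)
proof
  assume "norm (fst d) = \<rho>"
  moreover have "\<epsilon> * \<kappa> \<le> \<epsilon> * (4 * \<rho>\<^sup>2)" using assms by (intro mult_left_mono) auto
  ultimately show ?thesis using box_test_ge[OF assms(1,2), of \<xi> \<tau> X d] by simp
next
  assume k: "\<bar>snd d\<bar> = \<kappa>"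
  hence "(snd d)\<^sup>2 = \<kappa> * \<kappa>" by (metis power2_abs power2_eq_square)
  hence "(2 * \<epsilon> / \<kappa>) * (snd d)\<^sup>2 = 2 * \<epsilon> * \<kappa>" using assms by simp
  moreover have "0 \<le> \<epsilon> * (norm (fst d))\<^sup>2" using assms by simp
  ultimately show ?thesis unfolding box_test_def jet_polynomial_add_mat parabolic_size_def k
    by (simp add: algebra_simps min_def)
qed

text \<open>Inside the box the correction to the time slope is at most 4 \<epsilon> in absolute
  value.\<close>

lemma box_test_shift:
  assumes "transpose X = X"
  shows "box_test \<xi> \<tau> X \<epsilon> \<kappa> (d + e) = box_test \<xi> \<tau> X \<epsilon> \<kappa> d
    + jet_polynomial (\<xi> + (X + (4 * \<epsilon>) *\<^sub>R mat 1) *v fst d) (\<tau> + 4 * \<epsilon> * snd d / \<kappa>) (X + (4 * \<epsilon>) *\<^sub>R mat 1) e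
    + (2 * \<epsilon> / \<kappa>) * (snd e)\<^sup>2"
proof -
  have tr: "transpose (X + (4 * \<epsilon>) *\<^sub>R mat 1) = X + (4 * \<epsilon>) *\<^sub>R mat 1"
    using assms by (simp add: transpose_def vec_eq_iff mat_def)
  show ?thesis unfolding box_test_def jet_polynomial_shift[OF tr]
    by (simp add: jet_polynomial_def power2_eq_square algebra_simps add_divide_distrib)
qed

lemma continuous_box_test: "continuous_on A (box_test \<xi> \<tau> X \<epsilon> \<kappa>)"
proof -
  have "continuous_on A (\<lambda>d. jet_polynomial \<xi> \<tau> (X + (4 * \<epsilon>) *\<^sub>R mat 1) d + (2 * \<epsilon> / \<kappa>) * (snd d)\<^sup>2)"
    by (intro continuous_intros continuous_jet_polynomial)
  thus ?thesis unfolding box_test_def[abs_def] .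
qed

lemma tendsto_matrix_vector_mult:
  fixes A :: "'b \<Rightarrow> real ^ 'n ^ 'm"
  assumes "(A \<longlongrightarrow> A0) G" "(h \<longlongrightarrow> h0) G"
  shows "((\<lambda>x. A x *v h x) \<longlongrightarrow> A0 *v h0) G"
  unfolding matrix_vector_mult_def by (intro tendsto_intros assms)

text \<open>This is stability under suprema; with \<open>V = {v}\<close> it passes from quadratic tests to superjets.\<close>

lemma jet_sub_envelope:
  fixes F :: "real ^ 'n \<Rightarrow> real ^ 'n ^ 'n \<Rightarrow> real"
  assumes contF: "continuous_on UNIV (\<lambda>(\<xi>, X). F \<xi> X)"
    and symF: "\<And>\<xi> X. F \<xi> (symmetrize X) = F \<xi> X"
    and "open S"
    and V: "\<And>v. v \<in> V \<Longrightarrow> quadratic_sub F S v \<and> upper_semicontinuous_on S v \<and> (\<forall>z\<in>S. v z \<le> W z)"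
    and approx: "\<And>z \<epsilon> N. z \<in> S \<Longrightarrow> 0 < \<epsilon> \<Longrightarrow> open N \<Longrightarrow> z \<in> N \<Longrightarrow> \<exists>v\<in>V. \<exists>z'\<in>N \<inter> S. W z - \<epsilon> < v z'"
  shows "jet_sub F S W"
  unfolding jet_sub_def
proof (intro ballI allI impI)
  fix z :: "(real ^ 'n) \<times> real" and \<xi> \<tau> X0
  assume z: "z \<in> S" and sj0: "superjet W z \<xi> \<tau> X0"
  define X where "X = symmetrize X0"
  have trX: "transpose X = X" unfolding X_def by (rule transpose_symmetrize)
  have sj: "superjet W z \<xi> \<tau> X" using sj0 unfolding superjet_def X_def jet_polynomial_symmetrize .
  \<comment> \<open>The test at the maximum point is exact but perturbed: the point moves by h, the
    Hessian by 4 \<epsilon> and the time slope by at most 4 \<epsilon>. Continuity of F removes this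
    in the limit.\<close>
  have main: "\<exists>h. norm h \<le> \<epsilon> \<and> \<tau> - 4 * \<epsilon> \<le> F (\<xi> + (X + (4 * \<epsilon>) *\<^sub>R mat 1) *v h) (X + (4 * \<epsilon>) *\<^sub>R mat 1)"
    if \<epsilon>: "0 < \<epsilon>" for \<epsilon>
  proof -
    have "\<forall>\<^sub>F w in at z. W w \<le> W z + jet_polynomial \<xi> \<tau> X (w - z) + \<epsilon> * parabolic_size (w - z)"
      using sj \<epsilon> unfolding superjet_def by blast
    then obtain r1 where r1: "0 < r1" "\<And>w. w \<noteq> z \<Longrightarrow> dist w z < r1 \<Longrightarrow>
        W w \<le> W z + jet_polynomial \<xi> \<tau> X (w - z) + \<epsilon> * parabolic_size (w - z)"
      unfolding eventually_at by auto
    obtain r2 where r2: "0 < r2" "ball z r2 \<subseteq> S" using \<open>open S\<close> z openE by blast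
    define r where "r = min r1 r2"
    define \<rho> where "\<rho> = min \<epsilon> (r / 3)"
    define \<kappa> where "\<kappa> = min \<rho> (4 * \<rho>\<^sup>2)"
    have r: "0 < r" "r \<le> r1" "r \<le> r2" using r1 r2 unfolding r_def by auto
    have \<rho>: "0 < \<rho>" "\<rho> \<le> \<epsilon>" "\<rho> \<le> r / 3" using r \<epsilon> unfolding \<rho>_def by auto
    have \<kappa>: "0 < \<kappa>" "\<kappa> \<le> 4 * \<rho>\<^sup>2" "\<kappa> \<le> r / 3" using \<rho> unfolding \<kappa>_def by auto
    define B where "B = jet_box z \<rho> \<kappa>"
    have Bball: "B \<subseteq> ball z r" unfolding B_def using \<rho>(3) \<kappa>(3) r(1) by (rule jet_box_subset_ball)
    have BS: "B \<subseteq> S" using Bball r2(2) subset_ball[OF r(3), of z] by blast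
    have Wle: "W w \<le> W z + jet_polynomial \<xi> \<tau> X (w - z) + \<epsilon> * parabolic_size (w - z)" if "w \<in> B" for w
      using that Bball r r1(2)[of w] by (cases "w = z") (auto simp: dist_commute parabolic_size_def)
    define m where "m = min (\<epsilon> * \<rho>\<^sup>2 / 2) (\<epsilon> * \<kappa>)"
    have m: "0 < m" unfolding m_def using \<epsilon> \<rho> \<kappa> by simp
    define P where "P = box_test \<xi> \<tau> X \<epsilon> \<kappa>"
    have Wbd: "W w - P (w - z) \<le> W z - m" if "w \<in> B" "norm (fst (w - z)) = \<rho> \<or> \<bar>snd (w - z)\<bar> = \<kappa>" for w
      using Wle[OF that(1)] box_test_boundary[OF \<epsilon> \<kappa>(1,2) \<rho>(1) that(2), of \<xi> \<tau> X] unfolding P_def m_def by linarith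
    have cPz: "continuous_on UNIV (\<lambda>w. P (w - z))"
      unfolding P_def by (intro continuous_on_compose2[OF continuous_box_test[of UNIV]] continuous_intros) auto
    \<comment> \<open>Here P < m/2, so a member of V that comes within m/2 of W z at some point of
      \<open>N\<close> exceeds there every boundary value, and its maximum over the box is
      interior.\<close>
    define N where "N = {w. P (w - z) < m / 2} \<inter> {w. norm (fst (w - z)) < \<rho>} \<inter> {w. \<bar>snd (w - z)\<bar> < \<kappa>}"
    have "open N" unfolding N_def
      by (intro open_Int open_Collect_less cPz continuous_intros)
    moreover have "z \<in> N" unfolding N_def P_def using m \<rho> \<kappa> by simp
    ultimately obtain v z' where v: "v \<in> V" "z' \<in> N" "W z - m / 2 < v z'"
      using approx[OF z, of "m / 2" N] m by auto
    have z'B: "z' \<in> B" using v(2) unfolding N_def B_def jet_box_def by auto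
    have "upper_semicontinuous_on B (\<lambda>w. v w + (- P (w - z)))"
    proof (rule upper_semicontinuous_on_add)
      show "upper_semicontinuous_on B v"
        using V[OF v(1)] upper_semicontinuous_on_subset[OF _ BS] by blast
      show "upper_semicontinuous_on B (\<lambda>w. - P (w - z))"
        by (intro continuous_on_imp_upper_semicontinuous_on continuous_intros continuous_on_subset[OF cPz]) simp
    qed
    from upper_semicontinuous_on_attains_max[OF compact_jet_box[of z \<rho> \<kappa>, folded B_def] _ this] z'B
    obtain z1 where "z1 \<in> B" "\<forall>w\<in>B. v w + - P (w - z) \<le> v z1 + - P (z1 - z)" by blast
    hence z1: "z1 \<in> B" "\<And>w. w \<in> B \<Longrightarrow> v w - P (w - z) \<le> v z1 - P (z1 - z)" by auto
    have "W z - m < v z1 - P (z1 - z)"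
      using z1(2)[OF z'B] v(2,3) unfolding N_def by auto
    moreover have "v z1 \<le> W z1" using V[OF v(1)] z1(1) BS by blast
    ultimately have "\<not> (norm (fst (z1 - z)) = \<rho> \<or> \<bar>snd (z1 - z)\<bar> = \<kappa>)" using Wbd[OF z1(1)] by linarith
    hence z1i: "norm (fst (z1 - z)) < \<rho>" "\<bar>snd (z1 - z)\<bar> < \<kappa>" using z1(1) unfolding B_def jet_box_def by auto
    have "open {w. norm (fst (w - z)) < \<rho> \<and> \<bar>snd (w - z)\<bar> < \<kappa>}"
      by (intro open_Collect_conj open_Collect_less continuous_intros)
    hence "\<forall>\<^sub>F w in at z1. w \<in> {w. norm (fst (w - z)) < \<rho> \<and> \<bar>snd (w - z)\<bar> < \<kappa>}"
      using z1i by (intro eventually_at_in_open') auto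
    hence "\<forall>\<^sub>F w in at z1. v w \<le> v z1
        + jet_polynomial (\<xi> + (X + (4 * \<epsilon>) *\<^sub>R mat 1) *v fst (z1 - z)) (\<tau> + 4 * \<epsilon> * snd (z1 - z) / \<kappa>) (X + (4 * \<epsilon>) *\<^sub>R mat 1) (w - z1)
        + (2 * \<epsilon> / \<kappa>) * (snd (w - z1))\<^sup>2"
    proof eventually_elim
      case (elim w)
      hence "w \<in> B" unfolding B_def jet_box_def by auto
      moreover have "w - z = (z1 - z) + (w - z1)" by simp
      ultimately have "v w - P ((z1 - z) + (w - z1)) \<le> v z1 - P (z1 - z)" using z1(2) by metis
      thus ?case unfolding P_def box_test_shift[OF trX] by simp
    qed
    moreover have "transpose (X + (4 * \<epsilon>) *\<^sub>R mat 1) = X + (4 * \<epsilon>) *\<^sub>R mat 1"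
      using trX by (simp add: transpose_def vec_eq_iff mat_def)
    ultimately have "\<tau> + 4 * \<epsilon> * snd (z1 - z) / \<kappa> \<le> F (\<xi> + (X + (4 * \<epsilon>) *\<^sub>R mat 1) *v fst (z1 - z)) (X + (4 * \<epsilon>) *\<^sub>R mat 1)"
      using V[OF v(1)] z1(1) BS unfolding quadratic_sub_def by blast
    moreover have "\<tau> - 4 * \<epsilon> \<le> \<tau> + 4 * \<epsilon> * snd (z1 - z) / \<kappa>"
    proof -
      have "- \<kappa> \<le> snd (z1 - z)" using z1i(2) by linarith
      hence "4 * \<epsilon> * (- \<kappa>) \<le> 4 * \<epsilon> * snd (z1 - z)" using \<epsilon> by (intro mult_left_mono) auto
      thus ?thesis using \<kappa>(1) by (simp add: field_simps)
    qed
    ultimately show ?thesis using z1i(1) \<rho>(2) by (intro exI[of _ "fst (z1 - z)"]) linarith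
  qed
  obtain h where h: "\<And>\<epsilon>. 0 < \<epsilon> \<Longrightarrow> norm (h \<epsilon>) \<le> \<epsilon> \<and>
      \<tau> - 4 * \<epsilon> \<le> F (\<xi> + (X + (4 * \<epsilon>) *\<^sub>R mat 1) *v h \<epsilon>) (X + (4 * \<epsilon>) *\<^sub>R mat 1)" using main by metis
  define e where "e = (\<lambda>n. inverse (real (Suc n)))"
  have e: "e \<longlonglongrightarrow> 0" "\<And>n. 0 < e n" unfolding e_def by (rule LIMSEQ_inverse_real_of_nat) simp
  have h0: "(\<lambda>n. h (e n)) \<longlonglongrightarrow> 0"
    by (rule Lim_null_comparison[OF _ e(1)]) (use h e in auto)
  have X0: "(\<lambda>n. X + (4 * e n) *\<^sub>R mat 1) \<longlonglongrightarrow> X + (4 * 0) *\<^sub>R mat 1"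
    by (intro tendsto_intros e)
  have "(\<lambda>n. (X + (4 * e n) *\<^sub>R mat 1) *v h (e n)) \<longlonglongrightarrow> (X + (4 * 0) *\<^sub>R mat 1) *v 0"
    by (intro tendsto_matrix_vector_mult X0 h0)
  hence "(\<lambda>n. \<xi> + (X + (4 * e n) *\<^sub>R mat 1) *v h (e n)) \<longlonglongrightarrow> \<xi> + 0" by (intro tendsto_intros) simp
  with X0 have "(\<lambda>n. (\<xi> + (X + (4 * e n) *\<^sub>R mat 1) *v h (e n), X + (4 * e n) *\<^sub>R mat 1)) \<longlonglongrightarrow> (\<xi>, X)"
    by (intro tendsto_Pair) auto
  from continuous_on_tendsto_compose[OF contF this]
  have l1: "(\<lambda>n. F (\<xi> + (X + (4 * e n) *\<^sub>R mat 1) *v h (e n)) (X + (4 * e n) *\<^sub>R mat 1)) \<longlonglongrightarrow> F \<xi> X" by simp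
  have l2: "(\<lambda>n. \<tau> - 4 * e n) \<longlonglongrightarrow> \<tau> - 4 * 0" by (intro tendsto_intros e)
  have "\<tau> - 4 * 0 \<le> F \<xi> X"
    by (rule LIMSEQ_le[OF l2 l1]) (use h e in auto)
  thus "\<tau> \<le> F \<xi> X0" unfolding X_def symF by simp
qed

corollary quadratic_sub_imp_jet_sub:
  assumes "continuous_on UNIV (\<lambda>(\<xi>, X). F \<xi> X)" "\<And>\<xi> X. F \<xi> (symmetrize X) = F \<xi> X"
    and "open S" "upper_semicontinuous_on S v" "quadratic_sub F S v"
  shows "jet_sub F S v"
proof (rule jet_sub_envelope[OF assms(1-3), of "{v}"])
  fix z and \<epsilon> :: real and N assume "z \<in> S" "0 < \<epsilon>" "z \<in> N"
  thus "\<exists>v'\<in>{v}. \<exists>z'\<in>N \<inter> S. v z - \<epsilon> < v' z'" by (intro bexI[of _ v] bexI[of _ z]) auto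
qed (use assms in auto)

section \<open>Jets of differentiable functions and the chain rule\<close>

text \<open>The mean value theorem for the remainder along the segment to y, whose derivative is
  bounded through the differentiability of the gradient at x.\<close>

lemma second_order_expansion:
  fixes f :: "'a::euclidean_space \<Rightarrow> real" and G :: "'a \<Rightarrow> 'a"
  assumes f: "\<forall>\<^sub>F y in nhds x. (f has_derivative (\<lambda>h. G y \<bullet> h)) (at y)"
    and G: "(G has_derivative G') (at x)" and "0 < \<epsilon>"
  shows "\<forall>\<^sub>F y in nhds x. \<bar>f y - f x - G x \<bullet> (y - x) - (y - x) \<bullet> G' (y - x) / 2\<bar> \<le> \<epsilon> * (norm (y - x))\<^sup>2"
proof -
  have lin: "linear G'" using G has_derivative_linear by blast
  obtain d1 where d1: "0 < d1" "\<And>y. norm (y - x) < d1 \<Longrightarrow> norm (G y - G x - G' (y - x)) \<le> \<epsilon> * norm (y - x)"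
    using G \<open>0 < \<epsilon>\<close> unfolding has_derivative_at_alt by blast
  obtain d2 where d2: "0 < d2" "\<And>y. dist y x < d2 \<Longrightarrow> (f has_derivative (\<lambda>h. G y \<bullet> h)) (at y)"
    using f unfolding eventually_nhds_metric by blast
  have "\<bar>f y - f x - G x \<bullet> (y - x) - (y - x) \<bullet> G' (y - x) / 2\<bar> \<le> \<epsilon> * (norm (y - x))\<^sup>2"
    if y: "dist y x < min d1 d2" for y
  proof -
    define h where "h = y - x"
    define \<phi> where "\<phi> = (\<lambda>s. f (x + s *\<^sub>R h) - s * (G x \<bullet> h) - s\<^sup>2 / 2 * (h \<bullet> G' h))"
    define \<phi>' where "\<phi>' = (\<lambda>s. (G (x + s *\<^sub>R h) - G x - G' (s *\<^sub>R h)) \<bullet> h)"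
    have nh: "norm (s *\<^sub>R h) < min d1 d2" if "0 \<le> s" "s \<le> 1" for s
      using that y mult_left_le_one_le[of "norm h" s] unfolding h_def by (simp add: dist_norm)
    have der: "(\<phi> has_real_derivative \<phi>' s) (at s)" if "0 \<le> s" "s \<le> 1" for s
    proof -
      have "dist (x + s *\<^sub>R h) x < d2" using nh[OF that] by (simp add: dist_norm)
      from d2(2)[OF this] have df: "(f has_derivative (\<lambda>k. G (x + s *\<^sub>R h) \<bullet> k)) (at (x + s *\<^sub>R h))" .
      have "((\<lambda>s. x + s *\<^sub>R h) has_derivative (\<lambda>k. k *\<^sub>R h)) (at s)"
        by (auto intro!: derivative_eq_intros)
      from has_derivative_compose[OF this df]
      have 1: "((\<lambda>s. f (x + s *\<^sub>R h)) has_real_derivative G (x + s *\<^sub>R h) \<bullet> h) (at s)"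
        unfolding has_field_derivative_def by (rule has_derivative_eq_rhs) (simp add: fun_eq_iff mult.commute)
      show ?thesis unfolding \<phi>_def
        by (auto intro!: derivative_eq_intros 1 simp: \<phi>'_def linear_scale[OF lin] inner_diff_right inner_commute)
    qed
    obtain s where s: "0 < s" "s < 1" "\<phi> 1 - \<phi> 0 = (1 - 0) * \<phi>' s"
      using MVT2[of 0 1 \<phi> \<phi>'] der by auto
    have "\<bar>\<phi>' s\<bar> \<le> norm (G (x + s *\<^sub>R h) - G x - G' (s *\<^sub>R h)) * norm h"
      unfolding \<phi>'_def by (rule Cauchy_Schwarz_ineq2)
    also have "\<dots> \<le> (\<epsilon> * norm (s *\<^sub>R h)) * norm h"
      using d1(2)[of "x + s *\<^sub>R h"] nh[of s] s by (intro mult_right_mono) auto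
    also have "\<dots> = s * (\<epsilon> * (norm h)\<^sup>2)" using s by (simp add: power2_eq_square)
    also have "\<dots> \<le> \<epsilon> * (norm h)\<^sup>2" using s \<open>0 < \<epsilon>\<close> by (intro mult_left_le_one_le) auto
    finally show ?thesis using s(3) unfolding \<phi>_def h_def by simp
  qed
  thus ?thesis unfolding eventually_nhds_metric using d1(1) d2(1) by (intro exI[of _ "min d1 d2"]) auto
qed

lemma second_order_expansion_real:
  fixes \<phi> \<phi>' :: "real \<Rightarrow> real"
  assumes "\<forall>\<^sub>F s in nhds b. (\<phi> has_real_derivative \<phi>' s) (at s)" "(\<phi>' has_real_derivative \<phi>2) (at b)" "0 < \<epsilon>"
  shows "\<forall>\<^sub>F s in nhds b. \<bar>\<phi> s - \<phi> b - \<phi>' b * (s - b) - \<phi>2 / 2 * (s - b)\<^sup>2\<bar> \<le> \<epsilon> * (s - b)\<^sup>2"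
proof -
  have "\<forall>\<^sub>F s in nhds b. (\<phi> has_derivative (\<lambda>h. \<phi>' s \<bullet> h)) (at s)"
    using assms(1) by (simp add: has_field_derivative_def)
  from second_order_expansion[OF this assms(2)[unfolded has_field_derivative_def] assms(3)]
  show ?thesis by (simp add: power2_eq_square mult.commute mult.left_commute)
qed

lemma norm_matrix_vector_bound:
  fixes X :: "real ^ 'n ^ 'm"
  obtains B where "0 \<le> B" "\<And>h. norm (X *v h) \<le> B * norm h"
proof -
  obtain B where "0 < B" "\<forall>h. norm (X *v h) \<le> B * norm h"
    using linear_bounded_pos[OF matrix_vector_mul_linear[of X]] by blast
  thus thesis by (intro that[of B]) auto
qed

lemma eventually_parabolic_small:
  assumes "0 < \<eta>"
  shows "\<forall>\<^sub>F w in at z. norm (fst (w - z)) < \<eta> \<and> parabolic_size (w - z) < \<eta>"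
proof -
  have "0 < min 1 (\<eta> / 2)" "0 < \<eta> / 2" using assms by auto
  from eventually_fst_small[OF this(1), of z] eventually_snd_small[OF this(2), of z]
  show ?thesis
  proof eventually_elim
    case (elim w)
    have "(norm (fst (w - z)))\<^sup>2 \<le> norm (fst (w - z)) * 1"
      unfolding power2_eq_square using elim by (intro mult_left_mono) auto
    thus ?case using elim assms unfolding parabolic_size_def by auto
  qed
qed

text \<open>In the quadratic term of \<phi> the increment of v may be replaced by \<xi> \<bullet> h,
  since the rest of it is of the order of the parabolic size N.\<close>

lemma has_jet_compose:
  fixes v :: "(real ^ 'n) \<times> real \<Rightarrow> real"
  assumes v: "has_jet v z \<xi> \<tau> X"
    and \<phi>: "\<And>\<epsilon>. 0 < \<epsilon> \<Longrightarrow> \<forall>\<^sub>F s in nhds (v z).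
       \<bar>\<phi> s - \<phi> (v z) - \<phi>1 * (s - v z) - \<phi>2 / 2 * (s - v z)\<^sup>2\<bar> \<le> \<epsilon> * (s - v z)\<^sup>2"
  shows "has_jet (\<lambda>w. \<phi> (v w)) z (\<phi>1 *\<^sub>R \<xi>) (\<phi>1 * \<tau>) (\<phi>1 *\<^sub>R X + \<phi>2 *\<^sub>R outer \<xi>)"
  unfolding has_jet_def
proof (intro allI impI)
  fix \<epsilon> :: real assume \<epsilon>: "0 < \<epsilon>"
  obtain B where B: "0 \<le> B" "\<And>h. norm (X *v h) \<le> B * norm h" using norm_matrix_vector_bound by blast
  \<comment> \<open>C N bounds the increment of v after removal of \<xi> \<bullet> h. D collects the
    coefficients of the three errors: the remainder of \<phi>, the remainder of v, and the
    replacement inside the square.\<close>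
  define C where "C = \<bar>\<tau>\<bar> + B / 2 + 1"
  define D where "D = (2 * (norm \<xi>)\<^sup>2 + 2 * C\<^sup>2) + \<bar>\<phi>1\<bar> + \<bar>\<phi>2\<bar> / 2 * (C * (2 * norm \<xi> + C))"
  have C: "1 \<le> C" unfolding C_def using B by simp
  have D: "0 \<le> D" unfolding D_def using C by simp
  define \<epsilon>1 where "\<epsilon>1 = min 1 (\<epsilon> / (D + 1))"
  have \<epsilon>1: "0 < \<epsilon>1" "\<epsilon>1 \<le> 1" unfolding \<epsilon>1_def using \<epsilon> D by auto
  have "\<epsilon>1 \<le> \<epsilon> / (D + 1)" unfolding \<epsilon>1_def by simp
  hence "\<epsilon>1 * (D + 1) \<le> \<epsilon>" using D by (simp add: pos_le_divide_eq)
  hence D\<epsilon>: "\<epsilon>1 * D \<le> \<epsilon>" using \<epsilon>1 by (simp add: distrib_left)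
  obtain r where r: "0 < r" "\<And>s. dist s (v z) < r \<Longrightarrow>
       \<bar>\<phi> s - \<phi> (v z) - \<phi>1 * (s - v z) - \<phi>2 / 2 * (s - v z)\<^sup>2\<bar> \<le> \<epsilon>1 * (s - v z)\<^sup>2"
    using \<phi>[OF \<epsilon>1(1)] unfolding eventually_nhds_metric by blast
  \<comment> \<open>Small enough to force |v w - v z| < r, where the expansion of \<phi> is
    available.\<close>
  define \<eta> where "\<eta> = min \<epsilon>1 (r / (norm \<xi> + C + 1))"
  have den: "0 < norm \<xi> + C + 1" using C by (simp add: add_nonneg_pos)
  have \<eta>: "0 < \<eta>" "\<eta> \<le> \<epsilon>1" unfolding \<eta>_def using \<epsilon>1 r den by auto
  have "\<eta> \<le> r / (norm \<xi> + C + 1)" unfolding \<eta>_def by simp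
  hence \<eta>r: "\<eta> * (norm \<xi> + C + 1) \<le> r" using den by (simp add: pos_le_divide_eq)
  have "\<forall>\<^sub>F w in at z. \<bar>v w - v z - jet_polynomial \<xi> \<tau> X (w - z)\<bar> \<le> \<epsilon>1 * parabolic_size (w - z)"
    using v \<epsilon>1 unfolding has_jet_def by blast
  with eventually_parabolic_small[OF \<eta>(1), of z]
  show "\<forall>\<^sub>F w in at z. \<bar>\<phi> (v w) - \<phi> (v z) - jet_polynomial (\<phi>1 *\<^sub>R \<xi>) (\<phi>1 * \<tau>) (\<phi>1 *\<^sub>R X + \<phi>2 *\<^sub>R outer \<xi>) (w - z)\<bar>
      \<le> \<epsilon> * parabolic_size (w - z)"
  proof eventually_elim
    case (elim w)
    define h k N where "h = fst (w - z)" and "k = snd (w - z)" and "N = parabolic_size (w - z)"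
    define J where "J = jet_polynomial \<xi> \<tau> X (w - z)"
    define \<delta> where "\<delta> = v w - v z"
    define q where "q = \<xi> \<bullet> h"
    define e where "e = \<delta> - q"
    have hN: "norm h < \<eta>" "N < \<eta>" "\<bar>\<delta> - J\<bar> \<le> \<epsilon>1 * N"
      using elim unfolding h_def N_def \<delta>_def J_def by auto
    have N: "N = (norm h)\<^sup>2 + \<bar>k\<bar>" "0 \<le> N" unfolding N_def h_def k_def by (simp_all add: parabolic_size_def)
    have q: "\<bar>q\<bar> \<le> norm \<xi> * norm h" unfolding q_def by (rule Cauchy_Schwarz_ineq2)
    have "\<bar>h \<bullet> (X *v h)\<bar> \<le> norm h * norm (X *v h)" by (rule Cauchy_Schwarz_ineq2)
    also have "\<dots> \<le> norm h * (B * norm h)" using B by (intro mult_left_mono) auto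
    finally have hX: "\<bar>h \<bullet> (X *v h)\<bar> \<le> B * (norm h)\<^sup>2" by (simp add: power2_eq_square mult.left_commute)
    have Jq: "J - q = \<tau> * k + h \<bullet> (X *v h) / 2" unfolding J_def q_def jet_polynomial_def h_def k_def by simp
    have "\<bar>J - q\<bar> \<le> \<bar>\<tau>\<bar> * \<bar>k\<bar> + B / 2 * (norm h)\<^sup>2"
      unfolding Jq using hX abs_triangle_ineq[of "\<tau> * k" "h \<bullet> (X *v h) / 2"] by (simp add: abs_mult)
    also have "\<dots> \<le> \<bar>\<tau>\<bar> * N + B / 2 * N" using B unfolding N(1) by (intro add_mono mult_left_mono) auto
    finally have "\<bar>J - q\<bar> \<le> (C - 1) * N" unfolding C_def by (simp add: distrib_right)
    moreover have "\<epsilon>1 * N \<le> 1 * N" using \<epsilon>1 N by (intro mult_right_mono) auto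
    moreover have "(C - 1) * N + 1 * N = C * N" by (simp add: algebra_simps)
    ultimately have e: "\<bar>e\<bar> \<le> C * N" unfolding e_def using hN(3) by linarith
    have CN: "C * N \<le> C * \<eta>" using C hN by (intro mult_left_mono) auto
    have \<xi>h: "norm \<xi> * norm h \<le> norm \<xi> * \<eta>" using hN by (intro mult_left_mono) auto
    have "\<bar>\<delta>\<bar> \<le> norm \<xi> * \<eta> + C * \<eta>" using e q CN \<xi>h unfolding e_def by linarith
    also have "\<dots> < \<eta> * (norm \<xi> + C + 1)" using \<eta> by (simp add: algebra_simps)
    finally have "\<bar>\<delta>\<bar> < r" using \<eta>r by linarith
    hence t1: "\<bar>\<phi> (v w) - \<phi> (v z) - \<phi>1 * \<delta> - \<phi>2 / 2 * \<delta>\<^sup>2\<bar> \<le> \<epsilon>1 * \<delta>\<^sup>2"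
      using r(2)[of "v w"] unfolding \<delta>_def by (simp add: dist_real_def)
    have "q\<^sup>2 \<le> (norm \<xi>)\<^sup>2 * (norm h)\<^sup>2"
      using q by (metis abs_ge_zero power2_abs power_mono power_mult_distrib)
    also have "\<dots> \<le> (norm \<xi>)\<^sup>2 * N" unfolding N(1) by (intro mult_left_mono) auto
    finally have q2: "q\<^sup>2 \<le> (norm \<xi>)\<^sup>2 * N" .
    have "e\<^sup>2 \<le> (C * N)\<^sup>2" using e by (metis abs_ge_zero power2_abs power_mono)
    also have "\<dots> = C\<^sup>2 * (N * N)" by (simp add: power2_eq_square)
    also have "\<dots> \<le> C\<^sup>2 * (1 * N)" using hN \<eta> \<epsilon>1 N by (intro mult_left_mono mult_right_mono) auto
    finally have e2: "e\<^sup>2 \<le> C\<^sup>2 * N" by simp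
    have "\<delta>\<^sup>2 \<le> 2 * q\<^sup>2 + 2 * e\<^sup>2" using sum_squares_bound[of q e] unfolding e_def by (simp add: power2_eq_square algebra_simps)
    hence "\<delta>\<^sup>2 \<le> (2 * (norm \<xi>)\<^sup>2 + 2 * C\<^sup>2) * N" using q2 e2 by (simp add: distrib_right)
    hence t1': "\<epsilon>1 * \<delta>\<^sup>2 \<le> \<epsilon>1 * ((2 * (norm \<xi>)\<^sup>2 + 2 * C\<^sup>2) * N)" using \<epsilon>1 by (intro mult_left_mono) auto
    have t2: "\<bar>\<phi>1 * (\<delta> - J)\<bar> \<le> \<epsilon>1 * (\<bar>\<phi>1\<bar> * N)"
      unfolding abs_mult using mult_left_mono[OF hN(3), of "\<bar>\<phi>1\<bar>"] by (simp add: mult.left_commute)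
    have "\<bar>\<delta>\<^sup>2 - q\<^sup>2\<bar> = \<bar>e\<bar> * \<bar>2 * q + e\<bar>"
      unfolding e_def abs_mult[symmetric] by (simp add: power2_eq_square algebra_simps)
    also have "\<dots> \<le> (C * N) * (2 * (norm \<xi> * \<eta>) + C * \<eta>)"
    proof (rule mult_mono[OF e])
      show "\<bar>2 * q + e\<bar> \<le> 2 * (norm \<xi> * \<eta>) + C * \<eta>" using e q CN \<xi>h by linarith
    qed (use N C in auto)
    also have "\<dots> = \<eta> * (C * (2 * norm \<xi> + C) * N)" by (simp add: algebra_simps)
    also have "\<dots> \<le> \<epsilon>1 * (C * (2 * norm \<xi> + C) * N)" using \<eta> C N by (intro mult_right_mono) auto
    finally have "\<bar>\<phi>2\<bar> / 2 * \<bar>\<delta>\<^sup>2 - q\<^sup>2\<bar> \<le> \<bar>\<phi>2\<bar> / 2 * (\<epsilon>1 * (C * (2 * norm \<xi> + C) * N))" by (intro mult_left_mono) auto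
    hence t3: "\<bar>\<phi>2 / 2 * (\<delta>\<^sup>2 - q\<^sup>2)\<bar> \<le> \<epsilon>1 * (\<bar>\<phi>2\<bar> / 2 * (C * (2 * norm \<xi> + C)) * N)"
      unfolding abs_mult by (simp add: mult.left_commute mult.assoc)
    have "jet_polynomial (\<phi>1 *\<^sub>R \<xi>) (\<phi>1 * \<tau>) (\<phi>1 *\<^sub>R X + \<phi>2 *\<^sub>R outer \<xi>) d
        = \<phi>1 * jet_polynomial \<xi> \<tau> X d + \<phi>2 / 2 * (\<xi> \<bullet> fst d)\<^sup>2" for d
      unfolding jet_polynomial_def
      by (simp add: matrix_vector_mult_add_rdistrib outer_mult_vec inner_add_right power2_eq_square
          inner_commute[of "fst d" \<xi>] add_divide_distrib distrib_left flip: scaleR_matrix_vector_assoc)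
    hence jet: "jet_polynomial (\<phi>1 *\<^sub>R \<xi>) (\<phi>1 * \<tau>) (\<phi>1 *\<^sub>R X + \<phi>2 *\<^sub>R outer \<xi>) (w - z) = \<phi>1 * J + \<phi>2 / 2 * q\<^sup>2"
      unfolding J_def q_def h_def by blast
    have "\<phi> (v w) - \<phi> (v z) - (\<phi>1 * J + \<phi>2 / 2 * q\<^sup>2) =
       (\<phi> (v w) - \<phi> (v z) - \<phi>1 * \<delta> - \<phi>2 / 2 * \<delta>\<^sup>2) + \<phi>1 * (\<delta> - J) + \<phi>2 / 2 * (\<delta>\<^sup>2 - q\<^sup>2)"
      by (simp add: algebra_simps)
    also have "\<bar>\<dots>\<bar> \<le> \<epsilon>1 * ((2 * (norm \<xi>)\<^sup>2 + 2 * C\<^sup>2) * N) + \<epsilon>1 * (\<bar>\<phi>1\<bar> * N)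
        + \<epsilon>1 * (\<bar>\<phi>2\<bar> / 2 * (C * (2 * norm \<xi> + C)) * N)"
      using t1 t1' t2 t3 by linarith
    also have "\<dots> = (\<epsilon>1 * D) * N" unfolding D_def by (simp add: algebra_simps)
    also have "\<dots> \<le> \<epsilon> * N" using D\<epsilon> N by (intro mult_right_mono) auto
    finally show ?case unfolding jet N_def .
  qed
qed

lemma has_jet_ln:
  assumes "has_jet v z \<xi> \<tau> X" "0 < v z"
  shows "has_jet (\<lambda>w. ln (v w)) z ((1 / v z) *\<^sub>R \<xi>) (\<tau> / v z)
     ((1 / v z) *\<^sub>R X - outer ((1 / v z) *\<^sub>R \<xi>))"
proof -
  have "\<forall>\<^sub>F s in nhds (v z). \<bar>ln s - ln (v z) - (1 / v z) * (s - v z) - (- (1 / (v z)\<^sup>2)) / 2 * (s - v z)\<^sup>2\<bar> \<le> \<epsilon> * (s - v z)\<^sup>2"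
    if "0 < \<epsilon>" for \<epsilon>
  proof (rule second_order_expansion_real[where \<phi>' = "\<lambda>s. 1 / s", OF _ _ that])
    have "\<forall>\<^sub>F s in nhds (v z). s \<in> {0<..}" using assms(2) by (intro eventually_nhds_in_open) auto
    thus "\<forall>\<^sub>F s in nhds (v z). (ln has_real_derivative 1 / s) (at s)"
      by eventually_elim (auto intro!: derivative_eq_intros)
    show "((\<lambda>s. 1 / s) has_real_derivative - (1 / (v z)\<^sup>2)) (at (v z))"
      using assms(2) by (auto intro!: derivative_eq_intros simp: power2_eq_square)
  qed
  from has_jet_compose[OF assms(1) this]
  have "has_jet (\<lambda>w. ln (v w)) z ((1 / v z) *\<^sub>R \<xi>) (1 / v z * \<tau>)
     ((1 / v z) *\<^sub>R X + (- (1 / (v z)\<^sup>2)) *\<^sub>R outer \<xi>)" .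
  moreover have "outer ((1 / v z) *\<^sub>R \<xi>) = (1 / (v z)\<^sup>2) *\<^sub>R outer \<xi>"
    by (simp add: outer_def vec_eq_iff power2_eq_square)
  ultimately show ?thesis by simp
qed

section \<open>Viscosity solutions and parabolic jets\<close>

lemma x_gradient_eqI:
  assumes "((\<lambda>y. \<psi> (y, t)) has_derivative (\<lambda>h. G \<bullet> h)) (at x)"
  shows "x_gradient \<psi> (x, t) = G"
proof -
  have "frechet_derivative (\<lambda>y. \<psi> (y, t)) (at x) = (\<lambda>h. G \<bullet> h)"
    using frechet_derivative_at[OF assms] by simp
  thus ?thesis by (simp add: x_gradient_def vec_eq_iff inner_axis)
qed

lemma x_hessian_eqI:
  assumes "((\<lambda>y. x_gradient \<psi> (y, t)) has_derivative (\<lambda>h. H *v h)) (at x)"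
  shows "x_hessian \<psi> (x, t) = H"
proof -
  have "frechet_derivative (\<lambda>y. x_gradient \<psi> (y, t)) (at x) = (\<lambda>h. H *v h)"
    using frechet_derivative_at[OF assms] by simp
  thus ?thesis by (simp add: x_hessian_def jacobian_def)
qed

lemma has_derivative_x_gradient:
  assumes "(\<lambda>y. \<psi> (y, t)) differentiable at x"
  shows "((\<lambda>y. \<psi> (y, t)) has_derivative (\<lambda>h. x_gradient \<psi> (x, t) \<bullet> h)) (at x)"
proof -
  let ?D = "frechet_derivative (\<lambda>y. \<psi> (y, t)) (at x)"
  have D: "((\<lambda>y. \<psi> (y, t)) has_derivative ?D) (at x)"
    using assms frechet_derivative_works by blast
  hence lin: "linear ?D" by (rule has_derivative_linear)
  have "?D h = x_gradient \<psi> (x, t) \<bullet> h" for h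
  proof -
    have "?D h = ?D (\<Sum>i\<in>UNIV. h $ i *\<^sub>R axis i 1)"
      using basis_expansion[of h] by (simp add: scalar_mult_eq_scaleR)
    also have "\<dots> = (\<Sum>i\<in>UNIV. h $ i * ?D (axis i 1))"
      by (simp add: linear_sum[OF lin] linear_scale[OF lin])
    also have "\<dots> = x_gradient \<psi> (x, t) \<bullet> h"
      by (simp add: x_gradient_def inner_vec_def mult.commute)
    finally show ?thesis .
  qed
  hence "?D = (\<lambda>h. x_gradient \<psi> (x, t) \<bullet> h)" by blast
  thus ?thesis using D by simp
qed

lemma has_derivative_x_hessian:
  assumes "(\<lambda>y. x_gradient \<psi> (y, t)) differentiable at x"
  shows "((\<lambda>y. x_gradient \<psi> (y, t)) has_derivative (\<lambda>h. x_hessian \<psi> (x, t) *v h)) (at x)"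
proof -
  let ?D = "frechet_derivative (\<lambda>y. x_gradient \<psi> (y, t)) (at x)"
  have D: "((\<lambda>y. x_gradient \<psi> (y, t)) has_derivative ?D) (at x)"
    using assms frechet_derivative_works by blast
  hence "x_hessian \<psi> (x, t) *v h = ?D h" for h
    unfolding x_hessian_def jacobian_def by (simp add: matrix_works has_derivative_linear)
  hence "(\<lambda>h. x_hessian \<psi> (x, t) *v h) = ?D" by blast
  thus ?thesis using D by simp
qed

text \<open>Split the increment at (y, t): Taylor's formula in x at the fixed time t, then the time
  increment at the fixed point y, where joint continuity of the time derivative keeps it close to
  its value at z.\<close>

lemma test_function_has_jet:
  assumes \<psi>: "test_function S \<psi>" and "open S" "z \<in> S"
  shows "has_jet \<psi> z (x_gradient \<psi> z) (t_derivative \<psi> z) (x_hessian \<psi> z)"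
  unfolding has_jet_def
proof (intro allI impI)
  fix \<epsilon> :: real assume \<epsilon>: "0 < \<epsilon>"
  obtain x t where z: "z = (x, t)" by (cases z)
  have diff: "(\<lambda>y. \<psi> (y, s)) differentiable at y" "(\<lambda>y. x_gradient \<psi> (y, s)) differentiable at y"
    "(\<lambda>\<tau>. \<psi> (y, \<tau>)) differentiable at s" if "(y, s) \<in> S" for y s
    using \<psi> that unfolding test_function_def by blast+
  obtain r where r: "0 < r" "ball z r \<subseteq> S" using assms openE by blast
  have "continuous_on S (t_derivative \<psi>)" using \<psi> unfolding test_function_def by blast
  then obtain r' where r': "0 < r'" "\<And>w. w \<in> S \<Longrightarrow> dist w z < r' \<Longrightarrow> dist (t_derivative \<psi> w) (t_derivative \<psi> z) < \<epsilon>"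
    using \<open>z \<in> S\<close> \<epsilon> unfolding continuous_on_iff by metis
  have "\<forall>\<^sub>F y in nhds x. y \<in> {y. (y, t) \<in> S}"
  proof (rule eventually_nhds_in_open)
    have "{y. (y, t) \<in> S} = (\<lambda>y. (y, t)) -` S" by auto
    moreover have "open ((\<lambda>y. (y, t)) -` S)"
      using \<open>open S\<close> by (intro continuous_open_vimage continuous_intros)
    ultimately show "open {y. (y, t) \<in> S}" by simp
    show "x \<in> {y. (y, t) \<in> S}" using \<open>z \<in> S\<close> z by simp
  qed
  hence "\<forall>\<^sub>F y in nhds x. ((\<lambda>y. \<psi> (y, t)) has_derivative (\<lambda>h. x_gradient \<psi> (y, t) \<bullet> h)) (at y)"
  proof eventually_elim
    case (elim y)
    show ?case by (rule has_derivative_x_gradient[OF diff(1)]) (use elim in simp)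
  qed
  moreover have "((\<lambda>y. x_gradient \<psi> (y, t)) has_derivative (\<lambda>h. x_hessian \<psi> (x, t) *v h)) (at x)"
    using has_derivative_x_hessian diff(2) \<open>z \<in> S\<close> z by blast
  ultimately have "\<forall>\<^sub>F y in nhds x. \<bar>\<psi> (y, t) - \<psi> (x, t) - x_gradient \<psi> (x, t) \<bullet> (y - x)
      - (y - x) \<bullet> (x_hessian \<psi> (x, t) *v (y - x)) / 2\<bar> \<le> \<epsilon> * (norm (y - x))\<^sup>2"
    by (rule second_order_expansion[OF _ _ \<epsilon>])
  then obtain d where d: "0 < d" "\<And>y. dist y x < d \<Longrightarrow> \<bar>\<psi> (y, t) - \<psi> (x, t) - x_gradient \<psi> (x, t) \<bullet> (y - x)
      - (y - x) \<bullet> (x_hessian \<psi> (x, t) *v (y - x)) / 2\<bar> \<le> \<epsilon> * (norm (y - x))\<^sup>2"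
    unfolding eventually_nhds_metric by blast
  have est: "\<bar>\<psi> w - \<psi> z - jet_polynomial (x_gradient \<psi> z) (t_derivative \<psi> z) (x_hessian \<psi> z) (w - z)\<bar> \<le> \<epsilon> * parabolic_size (w - z)"
    if w: "dist w z < min d (min r r')" for w
  proof -
    obtain y s where ys: "w = (y, s)" by (cases w)
    have ball: "dist (y, \<sigma>) z \<le> dist w z" if "\<bar>\<sigma> - t\<bar> \<le> \<bar>s - t\<bar>" for \<sigma>
      using that unfolding ys z dist_Pair_Pair dist_real_def
      by (intro real_sqrt_le_mono add_left_mono) (simp add: abs_le_square_iff)
    have "dist y x < d" using w dist_fst_le[of w z] unfolding ys z by simp
    note 1 = d(2)[OF this]
    have 2: "\<bar>\<psi> (y, s) - \<psi> (y, t) - t_derivative \<psi> z * (s - t)\<bar> \<le> \<epsilon> * \<bar>s - t\<bar>"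
    proof -
      define g where "g = (\<lambda>\<sigma>. \<psi> (y, \<sigma>) - t_derivative \<psi> z * \<sigma>)"
      have "norm (g s - g t) \<le> \<epsilon> * norm (s - t)"
      proof (rule field_differentiable_bound[where S = "closed_segment s t" and f' = "\<lambda>\<sigma>. t_derivative \<psi> (y, \<sigma>) - t_derivative \<psi> z"])
        fix \<sigma> assume \<sigma>: "\<sigma> \<in> closed_segment s t"
        hence le: "\<bar>\<sigma> - t\<bar> \<le> \<bar>s - t\<bar>" by (auto simp: closed_segment_eq_real_ivl split: if_splits)
        have lt: "dist (y, \<sigma>) z < min d (min r r')" using ball[OF le] w by linarith
        hence S: "(y, \<sigma>) \<in> S" using r by (auto simp: dist_commute)
        have "((\<lambda>\<tau>. \<psi> (y, \<tau>)) has_real_derivative t_derivative \<psi> (y, \<sigma>)) (at \<sigma>)"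
          using diff(3)[OF S] by (simp add: t_derivative_def DERIV_deriv_iff_real_differentiable)
        hence "(g has_real_derivative t_derivative \<psi> (y, \<sigma>) - t_derivative \<psi> z) (at \<sigma>)"
          unfolding g_def by (auto intro!: derivative_eq_intros)
        thus "(g has_field_derivative t_derivative \<psi> (y, \<sigma>) - t_derivative \<psi> z) (at \<sigma> within closed_segment s t)"
          by (rule DERIV_subset) simp
        show "norm (t_derivative \<psi> (y, \<sigma>) - t_derivative \<psi> z) \<le> \<epsilon>"
          using r'(2)[OF S] lt by (simp add: dist_real_def)
      qed auto
      moreover have "g s - g t = \<psi> (y, s) - \<psi> (y, t) - t_derivative \<psi> z * (s - t)"
        unfolding g_def by (simp add: algebra_simps)
      ultimately show ?thesis by simp
    qed
    show ?thesis using 1 2 unfolding ys jet_polynomial_def parabolic_size_def z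
      by (simp add: distrib_left)
  qed
  show "\<forall>\<^sub>F w in at z. \<bar>\<psi> w - \<psi> z - jet_polynomial (x_gradient \<psi> z) (t_derivative \<psi> z) (x_hessian \<psi> z) (w - z)\<bar>
      \<le> \<epsilon> * parabolic_size (w - z)"
    unfolding eventually_at using est d(1) r(1) r'(1) by (intro exI[of _ "min d (min r r')"]) auto
qed

lemma has_jet_tendsto:
  fixes v :: "(real ^ 'n) \<times> real \<Rightarrow> real"
  assumes "has_jet v z \<xi> \<tau> X"
  shows "(v \<longlongrightarrow> v z) (at z)"
proof -
  let ?J = "\<lambda>w. jet_polynomial \<xi> \<tau> X (w - z)"
  have "((\<lambda>w. w - z) \<longlongrightarrow> z - z) (at z)" by (intro tendsto_intros)
  hence w: "((\<lambda>w. w - z) \<longlongrightarrow> 0) (at z)" by simp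
  have J: "(?J \<longlongrightarrow> 0) (at z)"
    using continuous_on_tendsto_compose[OF continuous_jet_polynomial[of UNIV \<xi> \<tau> X] w] by simp
  have N: "((\<lambda>w. parabolic_size (w - z)) \<longlongrightarrow> (norm (fst (0 :: (real ^ 'n) \<times> real)))\<^sup>2 + \<bar>snd (0 :: (real ^ 'n) \<times> real)\<bar>) (at z)"
    unfolding parabolic_size_def by (intro tendsto_intros w)
  have "\<forall>\<^sub>F w in at z. norm (v w - v z - ?J w) \<le> parabolic_size (w - z)"
    using assms[unfolded has_jet_def, rule_format, of 1] by simp
  from Lim_null_comparison[OF this] N have "((\<lambda>w. v w - v z - ?J w) \<longlongrightarrow> 0) (at z)" by simp
  from tendsto_add[OF tendsto_add[OF this J] tendsto_const[of "v z"]] show ?thesis by simp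
qed

section \<open>Exponentials of quadratics as test functions\<close>

text \<open>Turns a polynomial test for ln u into a test for u. It is smooth on the whole space,
  hence a test function on every set.\<close>

definition exp_test ::
  "real \<Rightarrow> (real ^ 'n) \<times> real \<Rightarrow> real ^ 'n \<Rightarrow> real \<Rightarrow> real ^ 'n ^ 'n \<Rightarrow> real \<Rightarrow> (real ^ 'n) \<times> real \<Rightarrow> real" where
  "exp_test c z \<xi> \<tau> X K w = c * exp (jet_polynomial \<xi> \<tau> X (w - z) + K * (snd (w - z))\<^sup>2)"

context
  fixes c K :: real and z :: "(real ^ 'n) \<times> real" and \<xi> :: "real ^ 'n" and \<tau> :: real and X :: "real ^ 'n ^ 'n"
  assumes sym: "transpose X = X"
begin

abbreviation (input) "\<psi> \<equiv> exp_test c z \<xi> \<tau> X K"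
abbreviation (input) "grad \<equiv> (\<lambda>y. \<xi> + X *v (y - fst z))"

lemma has_derivative_matrix_vector: "((\<lambda>y. X *v (y - a)) has_derivative (\<lambda>h. X *v h)) (at x)"
proof -
  have "((\<lambda>y. X *v y) has_derivative (\<lambda>h. X *v h)) (at (x - a))"
    by (intro linear_imp_has_derivative matrix_vector_mul_linear)
  moreover have "((\<lambda>y. y - a) has_derivative (\<lambda>h. h)) (at x)" by (auto intro!: derivative_eq_intros)
  ultimately show ?thesis using has_derivative_compose[of "\<lambda>y. y - a" "\<lambda>h. h" x UNIV "\<lambda>y. X *v y" "\<lambda>h. X *v h"] by simp
qed

lemma exp_test_has_derivative:
  "((\<lambda>y. \<psi> (y, t)) has_derivative (\<lambda>h. (\<psi> (x, t) *\<^sub>R grad x) \<bullet> h)) (at x)"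
proof -
  have l: "((\<lambda>y. \<xi> \<bullet> (y - fst z)) has_derivative (\<lambda>h. \<xi> \<bullet> h)) (at x)"
    by (auto intro!: derivative_eq_intros)
  have "((\<lambda>y. y - fst z) has_derivative (\<lambda>h. h)) (at x)" by (auto intro!: derivative_eq_intros)
  from has_derivative_inner[OF this has_derivative_matrix_vector]
  have "((\<lambda>y. (y - fst z) \<bullet> (X *v (y - fst z))) has_derivative (\<lambda>h. 2 * ((X *v (x - fst z)) \<bullet> h))) (at x)"
  proof (rule has_derivative_eq_rhs)
    show "(\<lambda>h. (x - fst z) \<bullet> (X *v h) + h \<bullet> (X *v (x - fst z))) = (\<lambda>h. 2 * ((X *v (x - fst z)) \<bullet> h))"
      using inner_transpose[of "x - fst z" X] sym by (simp add: inner_commute)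
  qed
  from has_derivative_mult_right[OF this, of "1/2"]
  have q: "((\<lambda>y. (y - fst z) \<bullet> (X *v (y - fst z)) / 2) has_derivative (\<lambda>h. (X *v (x - fst z)) \<bullet> h)) (at x)" by simp
  from has_derivative_mult_right[OF has_derivative_exp[OF has_derivative_add[OF has_derivative_add[OF has_derivative_add[OF l
      has_derivative_const[of "\<tau> * (t - snd z)"]] q] has_derivative_const[of "K * (t - snd z)\<^sup>2"]]], of c]
  show ?thesis
    unfolding exp_test_def jet_polynomial_def by (simp add: inner_add_left mult.assoc mult.commute mult.left_commute)
qed

lemma x_gradient_exp_test: "x_gradient \<psi> (x, t) = \<psi> (x, t) *\<^sub>R grad x"
  by (rule x_gradient_eqI[OF exp_test_has_derivative])

lemma x_gradient_exp_test_has_derivative: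
  "((\<lambda>y. x_gradient \<psi> (y, t)) has_derivative (\<lambda>h. (\<psi> (x, t) *\<^sub>R (outer (grad x) + X)) *v h)) (at x)"
  unfolding x_gradient_exp_test
  by (rule has_derivative_eq_rhs)
     (auto intro!: derivative_eq_intros exp_test_has_derivative has_derivative_matrix_vector
       simp: fun_eq_iff matrix_vector_mult_add_rdistrib outer_mult_vec inner_add_left distrib_left scaleR_add_left scaleR_add_right
       simp flip: scaleR_matrix_vector_assoc)

lemma x_hessian_exp_test: "x_hessian \<psi> (x, t) = \<psi> (x, t) *\<^sub>R (outer (grad x) + X)"
  by (rule x_hessian_eqI[OF x_gradient_exp_test_has_derivative])

lemma exp_test_has_t_derivative:
  "((\<lambda>s. \<psi> (x, s)) has_real_derivative \<psi> (x, t) * (\<tau> + 2 * K * (t - snd z))) (at t)"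
  unfolding exp_test_def jet_polynomial_def
  by (auto intro!: derivative_eq_intros simp: algebra_simps power2_eq_square)

lemma t_derivative_exp_test: "t_derivative \<psi> (x, t) = \<psi> (x, t) * (\<tau> + 2 * K * (t - snd z))"
  using exp_test_has_t_derivative by (simp add: t_derivative_def DERIV_imp_deriv)

lemma test_function_exp_test: "test_function S \<psi>"
  unfolding test_function_def
proof (intro conjI)
  have c\<psi>: "continuous_on S \<psi>"
    unfolding exp_test_def[abs_def]
    by (intro continuous_intros continuous_on_compose2[OF continuous_jet_polynomial[of UNIV]]) auto
  have cX: "continuous_on S (\<lambda>w. X *v (fst w - fst z))"
    by (intro linear_continuous_on_compose[OF _ matrix_vector_mul_linear] continuous_intros)
  have g: "x_gradient \<psi> = (\<lambda>w. \<psi> w *\<^sub>R grad (fst w))"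
    by (auto simp: fun_eq_iff x_gradient_exp_test)
  show "continuous_on S (x_gradient \<psi>)" unfolding g by (intro continuous_intros c\<psi> cX)
  have h: "x_hessian \<psi> = (\<lambda>w. \<psi> w *\<^sub>R (outer (grad (fst w)) + X))"
    by (auto simp: fun_eq_iff x_hessian_exp_test)
  have "continuous_on S (\<lambda>w. outer (grad (fst w)))"
    unfolding outer_def by (intro continuous_on_vec_lambda continuous_intros cX)
  thus "continuous_on S (x_hessian \<psi>)" unfolding h by (intro continuous_intros c\<psi>)
  have t: "t_derivative \<psi> = (\<lambda>w. \<psi> w * (\<tau> + 2 * K * (snd w - snd z)))"
    by (auto simp: fun_eq_iff t_derivative_exp_test)
  show "continuous_on S (t_derivative \<psi>)" unfolding t by (intro continuous_intros c\<psi>)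
  show "\<forall>(x, t)\<in>S. (\<lambda>y. \<psi> (y, t)) differentiable at x \<and> (\<lambda>y. x_gradient \<psi> (y, t)) differentiable at x \<and>
      (\<lambda>\<tau>. \<psi> (x, \<tau>)) differentiable at t"
  proof (clarify, intro conjI)
    fix x t
    show "(\<lambda>y. \<psi> (y, t)) differentiable at x"
      by (rule differentiableI[OF exp_test_has_derivative])
    show "(\<lambda>y. x_gradient \<psi> (y, t)) differentiable at x"
      by (rule differentiableI[OF x_gradient_exp_test_has_derivative])
    show "(\<lambda>\<tau>. \<psi> (x, \<tau>)) differentiable at t"
      by (rule differentiableI[OF exp_test_has_t_derivative[unfolded has_field_derivative_def]])
  qed
qed

lemma p_laplacian_exp_test:
  assumes "2 < p" "0 < c"
  shows "p_laplacian p \<psi> z = c powr (p - 1) * ((p - 1) * log_operator p \<xi> X)"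
proof -
  have 1: "\<psi> z = c" by (simp add: exp_test_def)
  obtain x t where z: "z = (x, t)" by (cases z)
  have "x_gradient \<psi> z = c *\<^sub>R \<xi>" "x_hessian \<psi> z = c *\<^sub>R (X + outer \<xi>)"
    using x_gradient_exp_test[of x t] x_hessian_exp_test[of x t] 1 unfolding z by (simp_all add: add.commute)
  thus ?thesis by (simp only: p_laplacian_eq_form[OF assms(1)] p_laplace_form_log[OF assms])
qed

lemma t_derivative_exp_test_center: "t_derivative \<psi> z = c * \<tau>"
  using t_derivative_exp_test[of "fst z" "snd z"] by (simp add: exp_test_def)

end

section \<open>Passage between viscosity inequalities for u and jets of ln u\<close>

lemma powr_minus_one:
  assumes "(0::real) < s"
  shows "s powr (p - 1) = s powr (p - 2) * s"
  using assms powr_add[of s "p - 2" 1] by simp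

text \<open>The exponential of a polynomial touching ln u touches u at the same point with the same
  value, and the positive factor (p - 1) u^(p - 1) common to both terms divides out.\<close>

lemma viscosity_subsolution_imp_quadratic_sub:
  fixes u :: "(real ^ 'n) \<times> real \<Rightarrow> real"
  assumes p: "2 < p" and "open S" and u: "viscosity_subsolution p S u"
  shows "quadratic_sub (log_operator p) S (\<lambda>z. ln (u z))"
  unfolding quadratic_sub_def
proof (intro ballI allI impI)
  fix z :: "(real ^ 'n) \<times> real" and \<xi> \<tau> X K
  assume z: "z \<in> S" and X: "transpose X = X"
    and touch: "\<forall>\<^sub>F w in at z. ln (u w) \<le> ln (u z) + jet_polynomial \<xi> \<tau> X (w - z) + K * (snd (w - z))\<^sup>2"
  have pos: "\<And>w. w \<in> S \<Longrightarrow> 0 < u w" using u unfolding viscosity_subsolution_def by blast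
  let ?\<psi> = "exp_test (u z) z \<xi> \<tau> X K"
  have "\<forall>\<^sub>F w in at z. w \<in> S" using z \<open>open S\<close> by (intro eventually_at_in_open')
  with touch have "\<forall>\<^sub>F w in at z. u w - ?\<psi> w \<le> u z - ?\<psi> z"
  proof eventually_elim
    case (elim w)
    have "u w = exp (ln (u w))" using pos elim(2) by simp
    also have "\<dots> \<le> exp (ln (u z) + jet_polynomial \<xi> \<tau> X (w - z) + K * (snd (w - z))\<^sup>2)" using elim(1) by simp
    also have "\<dots> = ?\<psi> w" using pos[OF z] by (simp add: exp_test_def exp_add)
    finally show ?case by (simp add: exp_test_def)
  qed
  hence "local_max_on S (\<lambda>w. u w - ?\<psi> w) z"
    using z at_within_open[OF z \<open>open S\<close>] unfolding local_max_on_def by simp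
  hence "p_laplacian p ?\<psi> z - (p - 1) * u z powr (p - 2) * t_derivative ?\<psi> z \<ge> 0"
    using u test_function_exp_test[OF X] unfolding viscosity_subsolution_def by blast
  hence "0 \<le> (u z powr (p - 2) * u z * (p - 1)) * (log_operator p \<xi> X - \<tau>)"
    unfolding p_laplacian_exp_test[OF X p pos[OF z]] t_derivative_exp_test_center[OF X] powr_minus_one[OF pos[OF z]]
    by (simp add: algebra_simps)
  moreover have "0 < u z powr (p - 2) * u z * (p - 1)" using pos[OF z] p by simp
  ultimately show "\<tau> \<le> log_operator p \<xi> X" by (simp add: zero_le_mult_iff)
qed

lemma viscosity_supersolution_imp_quadratic_sub:
  fixes u :: "(real ^ 'n) \<times> real \<Rightarrow> real"
  assumes p: "2 < p" and "open S" and u: "viscosity_supersolution p S u"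
  shows "quadratic_sub (reflect (log_operator p)) S (\<lambda>z. - ln (u z))"
  unfolding quadratic_sub_def
proof (intro ballI allI impI)
  fix z :: "(real ^ 'n) \<times> real" and \<xi> \<tau> X K
  assume z: "z \<in> S" and X: "transpose X = X"
    and touch: "\<forall>\<^sub>F w in at z. - ln (u w) \<le> - ln (u z) + jet_polynomial \<xi> \<tau> X (w - z) + K * (snd (w - z))\<^sup>2"
  have X': "transpose (- X) = - X" using X by (simp add: transpose_def vec_eq_iff)
  have pos: "\<And>w. w \<in> S \<Longrightarrow> 0 < u w" using u unfolding viscosity_supersolution_def by blast
  let ?\<psi> = "exp_test (u z) z (- \<xi>) (- \<tau>) (- X) (- K)"
  have "\<forall>\<^sub>F w in at z. w \<in> S" using z \<open>open S\<close> by (intro eventually_at_in_open')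
  with touch have "\<forall>\<^sub>F w in at z. u z - ?\<psi> z \<le> u w - ?\<psi> w"
  proof eventually_elim
    case (elim w)
    have "?\<psi> w = exp (ln (u z) - jet_polynomial \<xi> \<tau> X (w - z) - K * (snd (w - z))\<^sup>2)"
      using pos[OF z] by (simp add: exp_test_def exp_add exp_diff jet_polynomial_uminus exp_minus divide_inverse)
    also have "\<dots> \<le> exp (ln (u w))" using elim(1) by simp
    also have "\<dots> = u w" using pos elim(2) by simp
    finally show ?case by (simp add: exp_test_def)
  qed
  hence "local_min_on S (\<lambda>w. u w - ?\<psi> w) z"
    using z at_within_open[OF z \<open>open S\<close>] unfolding local_min_on_def by simp
  hence "p_laplacian p ?\<psi> z - (p - 1) * u z powr (p - 2) * t_derivative ?\<psi> z \<le> 0"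
    using u test_function_exp_test[OF X'] unfolding viscosity_supersolution_def by blast
  hence "(u z powr (p - 2) * u z * (p - 1)) * (log_operator p (- \<xi>) (- X) + \<tau>) \<le> 0"
    unfolding p_laplacian_exp_test[OF X' p pos[OF z]] t_derivative_exp_test_center[OF X'] powr_minus_one[OF pos[OF z]]
    by (simp add: algebra_simps)
  moreover have "0 < u z powr (p - 2) * u z * (p - 1)" using pos[OF z] p by simp
  moreover have "x \<le> 0" if "k * x \<le> 0" "0 < k" for k x :: real using that by (simp add: mult_le_0_iff)
  ultimately have "log_operator p (- \<xi>) (- X) + \<tau> \<le> 0" by blast
  thus "\<tau> \<le> reflect (log_operator p) \<xi> X" by (simp add: reflect_def)
qed

lemma log_test_inequality:
  assumes "2 < p" "0 < s"
  shows "p_laplace_form p D H = s powr (p - 2) * s * (p - 1) * log_operator p ((1 / s) *\<^sub>R D) ((1 / s) *\<^sub>R H - outer ((1 / s) *\<^sub>R D))"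
  using p_laplace_form_log[OF assms, of "(1 / s) *\<^sub>R D" "(1 / s) *\<^sub>R H - outer ((1 / s) *\<^sub>R D)"] assms(2)
  unfolding powr_minus_one[OF assms(2)] by (simp add: mult.assoc)

text \<open>A constant is added to make the test function agree with u at z; the logarithm of the
  result has a jet there, and that jet is a superjet of ln u.\<close>

lemma jet_sub_imp_viscosity_subsolution:
  fixes u :: "(real ^ 'n) \<times> real \<Rightarrow> real"
  assumes p: "2 < p" and "open S" and pos: "\<And>z. z \<in> S \<Longrightarrow> 0 < u z" and usc: "upper_semicontinuous_on S u"
    and u: "jet_sub (log_operator p) S (\<lambda>z. ln (u z))"
  shows "viscosity_subsolution p S u"
  unfolding viscosity_subsolution_def
proof (intro conjI ballI allI impI pos usc)
  fix \<psi> and z :: "(real ^ 'n) \<times> real"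
  assume \<psi>: "test_function S \<psi>" and lm: "local_max_on S (\<lambda>w. u w - \<psi> w) z"
  hence z: "z \<in> S" and le: "\<forall>\<^sub>F w in at z. u w - \<psi> w \<le> u z - \<psi> z"
    using at_within_open[OF _ \<open>open S\<close>, of z] unfolding local_max_on_def by auto
  define \<theta> where "\<theta> = (\<lambda>w. \<psi> w + (u z - \<psi> z))"
  define s where "s = u z"
  have s: "0 < s" "\<theta> z = s" unfolding s_def \<theta>_def using pos[OF z] by auto
  have "has_jet \<theta> z (x_gradient \<psi> z) (t_derivative \<psi> z) (x_hessian \<psi> z)"
    unfolding \<theta>_def by (intro has_jet_add_const test_function_has_jet[OF \<psi> \<open>open S\<close> z])
  from has_jet_ln[OF this] s have jet: "has_jet (\<lambda>w. ln (\<theta> w)) z ((1 / s) *\<^sub>R x_gradient \<psi> z) (t_derivative \<psi> z / s)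
     ((1 / s) *\<^sub>R x_hessian \<psi> z - outer ((1 / s) *\<^sub>R x_gradient \<psi> z))" by simp
  have "\<forall>\<^sub>F w in at z. w \<in> S" using z \<open>open S\<close> by (intro eventually_at_in_open')
  with le have "\<forall>\<^sub>F w in at z. ln (u w) \<le> ln (\<theta> w)"
    by eventually_elim (use pos in \<open>force simp: \<theta>_def\<close>)
  from superjet_mono[OF has_jet_imp_superjet[OF jet] _ this]
  have "t_derivative \<psi> z / s \<le> log_operator p ((1 / s) *\<^sub>R x_gradient \<psi> z) ((1 / s) *\<^sub>R x_hessian \<psi> z - outer ((1 / s) *\<^sub>R x_gradient \<psi> z))"
    using u z s unfolding jet_sub_def s_def by auto
  hence "s powr (p - 2) * s * (p - 1) * (t_derivative \<psi> z / s) \<le> p_laplacian p \<psi> z"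
    unfolding p_laplacian_eq_form[OF p] log_test_inequality[OF p s(1)] using s p by (intro mult_left_mono) auto
  thus "p_laplacian p \<psi> z - (p - 1) * u z powr (p - 2) * t_derivative \<psi> z \<ge> 0"
    using s unfolding s_def[symmetric] by (simp add: mult.commute mult.left_commute)
qed

lemma jet_sub_imp_viscosity_supersolution:
  fixes u :: "(real ^ 'n) \<times> real \<Rightarrow> real"
  assumes p: "2 < p" and "open S" and pos: "\<And>z. z \<in> S \<Longrightarrow> 0 < u z" and lsc: "lower_semicontinuous_on S u"
    and u: "jet_sub (reflect (log_operator p)) S (\<lambda>z. - ln (u z))"
  shows "viscosity_supersolution p S u"
  unfolding viscosity_supersolution_def
proof (intro conjI ballI allI impI pos lsc)
  fix \<psi> and z :: "(real ^ 'n) \<times> real"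
  assume \<psi>: "test_function S \<psi>" and lm: "local_min_on S (\<lambda>w. u w - \<psi> w) z"
  hence z: "z \<in> S" and le: "\<forall>\<^sub>F w in at z. u z - \<psi> z \<le> u w - \<psi> w"
    using at_within_open[OF _ \<open>open S\<close>, of z] unfolding local_min_on_def by auto
  define \<theta> where "\<theta> = (\<lambda>w. \<psi> w + (u z - \<psi> z))"
  define s where "s = u z"
  have s: "0 < s" "\<theta> z = s" unfolding s_def \<theta>_def using pos[OF z] by auto
  have j\<theta>: "has_jet \<theta> z (x_gradient \<psi> z) (t_derivative \<psi> z) (x_hessian \<psi> z)"
    unfolding \<theta>_def by (intro has_jet_add_const test_function_has_jet[OF \<psi> \<open>open S\<close> z])
  from has_jet_ln[OF this] s have jet: "has_jet (\<lambda>w. ln (\<theta> w)) z ((1 / s) *\<^sub>R x_gradient \<psi> z) (t_derivative \<psi> z / s)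
     ((1 / s) *\<^sub>R x_hessian \<psi> z - outer ((1 / s) *\<^sub>R x_gradient \<psi> z))" by simp
  have "\<forall>\<^sub>F w in at z. w \<in> S" using z \<open>open S\<close> by (intro eventually_at_in_open')
  \<comment> \<open>The shifted test function lies below u here, so its positivity near z comes from
    continuity at z and not from that of u.\<close>
  moreover have "\<forall>\<^sub>F w in at z. 0 < \<theta> w"
    using order_tendstoD(1)[OF has_jet_tendsto[OF j\<theta>], of 0] s by simp
  ultimately have "\<forall>\<^sub>F w in at z. - ln (u w) \<le> - ln (\<theta> w)"
    using le by eventually_elim (use pos in \<open>force simp: \<theta>_def\<close>)
  from superjet_mono[OF has_jet_imp_superjet[OF has_jet_uminus[OF jet]] _ this]
  have "- (t_derivative \<psi> z / s) \<le> - log_operator p ((1 / s) *\<^sub>R x_gradient \<psi> z) ((1 / s) *\<^sub>R x_hessian \<psi> z - outer ((1 / s) *\<^sub>R x_gradient \<psi> z))"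
    using u z s unfolding jet_sub_def s_def reflect_def by fastforce
  hence "p_laplacian p \<psi> z \<le> s powr (p - 2) * s * (p - 1) * (t_derivative \<psi> z / s)"
    unfolding p_laplacian_eq_form[OF p] log_test_inequality[OF p s(1)] using s p by (intro mult_left_mono) auto
  thus "p_laplacian p \<psi> z - (p - 1) * u z powr (p - 2) * t_derivative \<psi> z \<le> 0"
    using s unfolding s_def[symmetric] by (simp add: mult.commute mult.left_commute)
qed

section \<open>Comparison on cylinders\<close>

text \<open>Products of k with h or k are o(|k|), so mixed and pure time second derivatives
  disappear in the parabolic remainder. Only the spatial block of A survives.\<close>

lemma superjet_of_full_quadratic:
  fixes U :: "(real ^ 'n) \<times> real \<Rightarrow> real"
  assumes A: "linear A" "\<And>y. norm (A y) \<le> R * norm y"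
    and U: "touched_above U z p A"
  shows "superjet U z (fst p) (snd p) (matrix (\<lambda>h. fst (A (h, 0))))"
  unfolding superjet_def
proof (intro allI impI)
  fix \<epsilon> :: real assume \<epsilon>: "0 < \<epsilon>"
  let ?X = "matrix (\<lambda>h. fst (A (h, 0)))"
  have "linear (\<lambda>h. fst (A (h, 0)))"
  proof (rule linearI)
    fix x y :: "real ^ 'n" and r :: real
    show "fst (A (x + y, 0)) = fst (A (x, 0)) + fst (A (y, 0))"
      using linear_add[OF A(1), of "(x, 0)" "(y, 0)"] by simp
    show "fst (A (r *\<^sub>R x, 0)) = r *\<^sub>R fst (A (x, 0))"
      using linear_scale[OF A(1), of r "(x, 0)"] by simp
  qed
  hence X: "?X *v h = fst (A (h, 0))" for h by (simp add: matrix_works)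
  have R: "0 \<le> R"
  proof -
    have "0 \<le> R * norm ((0, 1) :: (real ^ 'n) \<times> real)" using A(2) norm_ge_zero order_trans by blast
    thus ?thesis by (simp add: norm_Pair)
  qed
  define \<delta> where "\<delta> = \<epsilon> / (2 * (R + 1))"
  have \<delta>: "0 < \<delta>" unfolding \<delta>_def using \<epsilon> R by simp
  have \<delta>': "2 * (R + 1) * \<delta> = \<epsilon>" unfolding \<delta>_def using R by simp
  from U[unfolded touched_above_def] eventually_fst_small[OF \<delta>, of z] eventually_snd_small[OF \<delta>, of z]
  show "\<forall>\<^sub>F w in at z. U w \<le> U z + jet_polynomial (fst p) (snd p) ?X (w - z) + \<epsilon> * parabolic_size (w - z)"
  proof eventually_elim
    case (elim w)
    obtain h k where d: "w - z = (h, k)" by (cases "w - z")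
    have hk: "norm h < \<delta>" "\<bar>k\<bar> < \<delta>" using elim(2,3) unfolding d by auto
    have split: "(h, k) = (h, 0) + (0, k)" by simp
    have n: "norm (h, 0 :: real) = norm h" "norm (0 :: real ^ 'n, k) = \<bar>k\<bar>" by (simp_all add: norm_Pair)
    have 1: "\<bar>(h, 0) \<bullet> A (0, k)\<bar> \<le> norm h * (R * \<bar>k\<bar>)"
      using Cauchy_Schwarz_ineq2[of "(h, 0)" "A (0, k)"] mult_left_mono[OF A(2)[of "(0, k)"], of "norm h"] unfolding n by simp
    have 2: "\<bar>(0, k) \<bullet> A (h, 0)\<bar> \<le> \<bar>k\<bar> * (R * norm h)"
      using Cauchy_Schwarz_ineq2[of "(0, k)" "A (h, 0)"] mult_left_mono[OF A(2)[of "(h, 0)"], of "\<bar>k\<bar>"] unfolding n by simp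
    have 3: "\<bar>(0, k) \<bullet> A (0, k)\<bar> \<le> \<bar>k\<bar> * (R * \<bar>k\<bar>)"
      using Cauchy_Schwarz_ineq2[of "(0, k)" "A (0, k)"] mult_left_mono[OF A(2)[of "(0, k)"], of "\<bar>k\<bar>"] unfolding n by simp
    have 4: "R * \<bar>k\<bar> * norm h \<le> R * \<bar>k\<bar> * \<delta>" "R * \<bar>k\<bar> * \<bar>k\<bar> \<le> R * \<bar>k\<bar> * \<delta>"
      using hk R by (intro mult_left_mono; simp)+
    have "A (h, k) = A (h, 0) + A (0, k)" unfolding split by (rule linear_add[OF A(1)])
    hence "(h, k) \<bullet> A (h, k) = (h, 0) \<bullet> A (h, 0) + (h, 0) \<bullet> A (0, k) + (0, k) \<bullet> A (h, 0) + (0, k) \<bullet> A (0, k)"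
      by (subst (1) split) (simp only: inner_add_left inner_add_right add.assoc)
    also have "\<dots> \<le> (h, 0) \<bullet> A (h, 0) + 3 * (R * \<bar>k\<bar> * \<delta>)"
      using 1 2 3 4 by (simp add: mult.assoc mult.commute mult.left_commute abs_le_iff)
    also have "(h, 0) \<bullet> A (h, 0) = h \<bullet> (?X *v h)" unfolding X by (cases "A (h, 0)") simp
    also have "3 * (R * \<bar>k\<bar> * \<delta>) \<le> 2 * (\<epsilon> * \<bar>k\<bar>)"
    proof -
      have "3 * R \<le> 4 * (R + 1)" using R by simp
      hence "3 * R * (\<bar>k\<bar> * \<delta>) \<le> 4 * (R + 1) * (\<bar>k\<bar> * \<delta>)" using \<delta> by (intro mult_right_mono) auto
      also have "\<dots> = 2 * ((2 * (R + 1) * \<delta>) * \<bar>k\<bar>)" by (simp add: algebra_simps)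
      finally show ?thesis unfolding \<delta>' by (simp add: mult.assoc)
    qed
    finally have "(h, k) \<bullet> A (h, k) / 2 \<le> h \<bullet> (?X *v h) / 2 + \<epsilon> * \<bar>k\<bar>" by simp
    moreover have "p \<bullet> (h, k) = fst p \<bullet> h + snd p * k" by (cases p) simp
    moreover have "\<epsilon> * \<bar>k\<bar> \<le> \<epsilon> * ((norm h)\<^sup>2 + \<bar>k\<bar>)" using \<epsilon> by (intro mult_left_mono) auto
    ultimately show ?case using elim(1) unfolding d jet_polynomial_def parabolic_size_def by simp
  qed
qed

lemma superjet_add_jet:
  assumes "superjet U z \<xi> \<tau> X" "has_jet f z \<xi>' \<tau>' X'"
  shows "superjet (\<lambda>w. U w + f w) z (\<xi> + \<xi>') (\<tau> + \<tau>') (X + X')"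
  unfolding superjet_def
proof (intro allI impI)
  fix \<epsilon> :: real assume "0 < \<epsilon>"
  hence "0 < \<epsilon> / 2" by simp
  with assms have "\<forall>\<^sub>F w in at z. U w \<le> U z + jet_polynomial \<xi> \<tau> X (w - z) + \<epsilon> / 2 * parabolic_size (w - z)"
    "\<forall>\<^sub>F w in at z. \<bar>f w - f z - jet_polynomial \<xi>' \<tau>' X' (w - z)\<bar> \<le> \<epsilon> / 2 * parabolic_size (w - z)"
    unfolding superjet_def has_jet_def by blast+
  thus "\<forall>\<^sub>F w in at z. U w + f w \<le> U z + f z + jet_polynomial (\<xi> + \<xi>') (\<tau> + \<tau>') (X + X') (w - z) + \<epsilon> * parabolic_size (w - z)"
  proof eventually_elim
    case (elim w)
    have pos: "\<epsilon> * parabolic_size (w - z) = \<epsilon> / 2 * parabolic_size (w - z) + \<epsilon> / 2 * parabolic_size (w - z)" by simp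
    have "jet_polynomial (\<xi> + \<xi>') (\<tau> + \<tau>') (X + X') d = jet_polynomial \<xi> \<tau> X d + jet_polynomial \<xi>' \<tau>' X' d" for d
      by (simp add: jet_polynomial_def inner_add_left distrib_right matrix_vector_mult_add_rdistrib inner_add_right add_divide_distrib)
    from this[of "w - z"] show ?case using elim pos unfolding abs_le_iff by linarith
  qed
qed

lemma has_jet_time:
  fixes z :: "(real ^ 'n) \<times> real"
  assumes "(g has_real_derivative g') (at (snd z))"
  shows "has_jet (\<lambda>w. g (snd w)) z 0 g' 0"
  unfolding has_jet_def
proof (intro allI impI)
  fix \<epsilon> :: real assume "0 < \<epsilon>"
  then obtain d where d: "0 < d" "\<And>s. norm (s - snd z) < d \<Longrightarrow> norm (g s - g (snd z) - g' * (s - snd z)) \<le> \<epsilon> * norm (s - snd z)"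
    using assms unfolding has_field_derivative_def has_derivative_at_alt by blast
  from eventually_snd_small[OF d(1), of z]
  show "\<forall>\<^sub>F w in at z. \<bar>g (snd w) - g (snd z) - jet_polynomial 0 g' 0 (w - z)\<bar> \<le> \<epsilon> * parabolic_size (w - z)"
  proof eventually_elim
    case (elim w)
    have "\<bar>g (snd w) - g (snd z) - g' * (snd w - snd z)\<bar> \<le> \<epsilon> * \<bar>snd w - snd z\<bar>" using d(2)[of "snd w"] elim by simp
    also have "\<dots> \<le> \<epsilon> * parabolic_size (w - z)"
      unfolding parabolic_size_def using \<open>0 < \<epsilon>\<close> by (intro mult_left_mono) auto
    finally show ?case by (simp add: jet_polynomial_def)
  qed
qed

lemma norm_matrix_le_of_entries:
  fixes X :: "real ^ 'n ^ 'm"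
  assumes "\<And>i j. \<bar>X $ i $ j\<bar> \<le> R"
  shows "norm X \<le> real CARD('m) * (real CARD('n) * R)"
proof -
  have "norm X \<le> (\<Sum>i\<in>UNIV. norm (X $ i))" unfolding norm_vec_def by (intro L2_set_le_sum) auto
  also have "\<dots> \<le> (\<Sum>i\<in>(UNIV :: 'm set). real CARD('n) * R)"
  proof (rule sum_mono)
    fix i
    have "norm (X $ i) \<le> (\<Sum>j\<in>UNIV. norm (X $ i $ j))" unfolding norm_vec_def[of "X $ i"] by (intro L2_set_le_sum) auto
    also have "\<dots> \<le> (\<Sum>j\<in>(UNIV :: 'n set). R)" using assms by (intro sum_mono) auto
    finally show "norm (X $ i) \<le> real CARD('n) * R" by simp
  qed
  finally show ?thesis by simp
qed

text \<open>The penalty \<open>exp(\<Lambda>(t - s))\<close> is negligible at the point of positive difference, dominates the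
  unknown values at the final time, and makes the subsolution strict.\<close>

theorem cylinder_comparison:
  fixes \<Omega> :: "(real ^ 'n) set" and v w :: "(real ^ 'n) \<times> real \<Rightarrow> real"
  assumes contF: "continuous_on UNIV (\<lambda>(\<xi>, X). F \<xi> X)"
    and monoF: "\<And>\<xi> X Y. (\<And>y. y \<bullet> (X *v y) \<le> y \<bullet> (Y *v y)) \<Longrightarrow> F \<xi> X \<le> F \<xi> Y"
    and \<Omega>: "open \<Omega>" "bounded \<Omega>"
    and v: "upper_semicontinuous_on (closure \<Omega> \<times> {0..T}) v" "jet_sub F (\<Omega> \<times> {0<..<T}) v"
    and w: "upper_semicontinuous_on (closure \<Omega> \<times> {0..T}) w" "jet_sub (reflect F) (\<Omega> \<times> {0<..<T}) w"
    and bd: "\<And>z. z \<in> parabolic_boundary \<Omega> T \<Longrightarrow> v z + w z \<le> 0"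
    and z: "z \<in> closure \<Omega> \<times> {0..<T}"
  shows "v z + w z \<le> 0"
proof (rule ccontr)
  assume "\<not> v z + w z \<le> 0"
  define \<sigma> where "\<sigma> = v z + w z"
  have \<sigma>: "0 < \<sigma>" using \<open>\<not> v z + w z \<le> 0\<close> unfolding \<sigma>_def by simp
  define S where "S = \<Omega> \<times> {0<..<T}"
  define t2 where "t2 = snd z"
  have "z \<notin> parabolic_boundary \<Omega> T" using bd \<sigma> unfolding \<sigma>_def by fastforce
  hence zS: "z \<in> S" and t2: "0 < t2" "t2 < T"
    using z \<Omega>(1) unfolding S_def t2_def parabolic_boundary_def frontier_def by (auto simp: interior_open)
  have S: "open S" "bounded S" unfolding S_def using \<Omega> by (auto intro: open_Times bounded_Times)
  have clS: "closure S = closure \<Omega> \<times> {0..T}" unfolding S_def closure_Times using t2 by simp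
  have comp: "compact (closure S)" "closure S \<noteq> {}" using S(2) zS closure_subset[of S] by auto
  have "upper_semicontinuous_on (closure S) (\<lambda>z. v z + w z)"
    using v(1) w(1) unfolding clS by (rule upper_semicontinuous_on_add)
  from upper_semicontinuous_on_attains_max[OF comp this]
  obtain M where M: "\<And>y. y \<in> closure S \<Longrightarrow> v y + w y \<le> M" by metis
  \<comment> \<open>With s midway between t2 and T the penalty is exp(- \<Lambda> d) at t2 and
    exp(\<Lambda> d) at T, so a single choice of \<Lambda> puts it below \<sigma> at t2 and above M
    at T.\<close>
  define s d where "s = (t2 + T) / 2" and "d = (T - t2) / 2"
  have sd: "0 < d" "s - t2 = d" "T - s = d" unfolding s_def d_def using t2 by (auto simp: field_simps)
  define \<Lambda> where "\<Lambda> = (\<bar>M\<bar> + 1 / \<sigma>) / d"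
  have \<Lambda>: "0 < \<Lambda>" "\<Lambda> * d = \<bar>M\<bar> + 1 / \<sigma>" unfolding \<Lambda>_def using sd \<sigma> by (auto simp: add_nonneg_pos)
  define \<kappa> where "\<kappa> = (\<lambda>t. exp (\<Lambda> * (t - s)))"
  have e: "\<bar>M\<bar> + 1 / \<sigma> < exp (\<Lambda> * d)" using exp_ge_add_one_self[of "\<Lambda> * d"] \<Lambda>(2) by linarith
  have \<kappa>T: "M < \<kappa> T" unfolding \<kappa>_def sd(3) using e \<sigma> by (smt (verit) zero_less_divide_1_iff)
  have \<kappa>t2: "\<kappa> t2 < \<sigma>"
  proof -
    have "1 / \<sigma> < exp (\<Lambda> * d)" using e by linarith
    hence "1 < \<sigma> * exp (\<Lambda> * d)" using \<sigma> by (simp add: field_simps)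
    moreover have "\<kappa> t2 = 1 / exp (\<Lambda> * d)" unfolding \<kappa>_def sd(2)[symmetric] by (simp add: exp_minus field_simps flip: exp_add)
    ultimately have "\<kappa> t2 * exp (\<Lambda> * d) < \<sigma> * exp (\<Lambda> * d)" by simp
    thus ?thesis by simp
  qed
  have \<kappa>pos: "0 < \<kappa> t" for t unfolding \<kappa>_def by simp
  define U where "U = (\<lambda>z. v z + (- \<kappa> (snd z)))"
  have uscU: "upper_semicontinuous_on (closure S) U"
    unfolding U_def clS \<kappa>_def
    by (intro upper_semicontinuous_on_add v(1) continuous_on_imp_upper_semicontinuous_on continuous_intros)
  have neg: "U y + w y < 0" if y: "y \<in> frontier S" for y
  proof (cases "snd y = T")
    case True
    thus ?thesis using M[of y] y \<kappa>T unfolding U_def frontier_def by auto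
  next
    case False
    have "y \<in> closure S" "y \<notin> S" using y S(1) unfolding frontier_def by (auto simp: interior_open)
    hence "y \<in> parabolic_boundary \<Omega> T"
      using False \<Omega>(1) unfolding clS unfolding S_def parabolic_boundary_def frontier_def
      by (cases y) (auto simp: interior_open)
    thus ?thesis using bd[of y] \<kappa>pos[of "snd y"] unfolding U_def by simp
  qed
  have posz: "0 < U z + w z" using \<kappa>t2 unfolding U_def \<sigma>_def t2_def by simp
  have uscw: "upper_semicontinuous_on (closure S) w" using w(1) unfolding clS .
  obtain R where R: "\<And>\<epsilon>. 0 < \<epsilon> \<Longrightarrow> \<exists>z1\<in>S. \<exists>z2\<in>S. \<exists>p1 p2 A B. self_adjoint A \<and> self_adjoint B \<and>
     norm p1 \<le> R \<and> norm (p1 + p2) \<le> \<epsilon> \<and> (\<forall>y. norm (A y) \<le> R * norm y) \<and> (\<forall>y. norm (B y) \<le> R * norm y) \<and>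
     (\<forall>y. y \<bullet> A y + y \<bullet> B y \<le> \<epsilon> * (norm y)\<^sup>2) \<and> touched_above U z1 p1 A \<and> touched_above w z2 p2 B"
    by (rule local_maximum_principle[OF S uscU uscw neg zS posz]) (assumption, rule that, assumption)
  \<comment> \<open>The derivative of the penalty at time 0, its lower bound on the cylinder; it
    measures the strictness gained.\<close>
  define c0 where "c0 = \<Lambda> * exp (- (\<Lambda> * s))"
  have c0: "0 < c0" unfolding c0_def using \<Lambda> by simp
  define R' where "R' = real CARD('n) * (real CARD('n) * R)"
  have step: "\<exists>\<xi> \<xi>' \<tau> Y. norm \<xi> \<le> R \<and> norm (Y :: real ^ 'n ^ 'n) \<le> R' \<and> norm (\<xi> + \<xi>') \<le> \<epsilon> \<and> \<bar>\<tau>\<bar> \<le> \<epsilon> \<and>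
      c0 + \<tau> \<le> F \<xi> (- Y + \<epsilon> *\<^sub>R mat 1) - F (- \<xi>') (- Y)" if \<epsilon>: "0 < \<epsilon>" for \<epsilon>
  proof -
    obtain z1 z2 p1 p2 A B where zz: "z1 \<in> S" "z2 \<in> S" and sa: "self_adjoint A" "self_adjoint B"
      and np: "norm p1 \<le> R" "norm (p1 + p2) \<le> \<epsilon>"
      and n: "\<forall>y. norm (A y) \<le> R * norm y" "\<forall>y. norm (B y) \<le> R * norm y"
      and AB: "\<forall>y. y \<bullet> A y + y \<bullet> B y \<le> \<epsilon> * (norm y)\<^sup>2"
      and tU: "touched_above U z1 p1 A" and tw: "touched_above w z2 p2 B"
      using R[OF \<epsilon>] by (elim bexE exE conjE) (rule that, assumption+)
    note lin = self_adjointD(1)[OF sa(1)] self_adjointD(1)[OF sa(2)]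
    note nA = n(1)[rule_format] and nB = n(2)[rule_format] and AB = AB[rule_format]
    define X Y where "X = matrix (\<lambda>h. fst (A (h, 0)))" and "Y = matrix (\<lambda>h. fst (B (h, 0)))"
    have jU: "superjet U z1 (fst p1) (snd p1) X" unfolding X_def by (rule superjet_of_full_quadratic[OF lin(1) nA tU])
    have jw: "superjet w z2 (fst p2) (snd p2) Y" unfolding Y_def by (rule superjet_of_full_quadratic[OF lin(2) nB tw])
    have "(\<kappa> has_real_derivative \<Lambda> * \<kappa> (snd z1)) (at (snd z1))"
      unfolding \<kappa>_def by (auto intro!: derivative_eq_intros)
    from superjet_add_jet[OF jU has_jet_time[of \<kappa> _ z1, OF this]]
    have "superjet v z1 (fst p1) (snd p1 + \<Lambda> * \<kappa> (snd z1)) X" unfolding U_def by simp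
    hence 1: "snd p1 + \<Lambda> * \<kappa> (snd z1) \<le> F (fst p1) X"
      using v(2) zz(1) unfolding jet_sub_def S_def by blast
    have "- (\<Lambda> * s) \<le> \<Lambda> * (snd z1 - s)" using zz(1) \<Lambda> unfolding S_def by (auto simp: algebra_simps)
    hence 2: "c0 \<le> \<Lambda> * \<kappa> (snd z1)" unfolding c0_def \<kappa>_def using \<Lambda> by simp
    have 3: "snd p2 \<le> - F (- fst p2) (- Y)" using w(2) zz(2) jw unfolding jet_sub_def S_def reflect_def by blast
    have Xq: "y \<bullet> (matrix (\<lambda>h. fst (D (h, 0))) *v y) = (y, 0) \<bullet> D (y, 0)" if D: "linear D"
      for y and D :: "(real ^ 'n) \<times> real \<Rightarrow> (real ^ 'n) \<times> real"
    proof -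
      have "linear (\<lambda>h. fst (D (h, 0)))"
      proof (rule linearI)
        fix x y :: "real ^ 'n" and r :: real
        show "fst (D (x + y, 0)) = fst (D (x, 0)) + fst (D (y, 0))"
          using linear_add[OF D, of "(x, 0)" "(y, 0)"] by simp
        show "fst (D (r *\<^sub>R x, 0)) = r *\<^sub>R fst (D (x, 0))"
          using linear_scale[OF D, of r "(x, 0)"] by simp
      qed
      hence "matrix (\<lambda>h. fst (D (h, 0))) *v y = fst (D (y, 0))" by (simp add: matrix_works)
      thus ?thesis by (cases "D (y, 0)") simp
    qed
    \<comment> \<open>The bound on A + B, restricted to purely spatial vectors.\<close>
    have "y \<bullet> (X *v y) \<le> y \<bullet> ((- Y + \<epsilon> *\<^sub>R mat 1) *v y)" for y
      using AB[of "(y, 0)"] unfolding X_def Xq[OF lin(1)] matrix_vector_mult_add_rdistrib inner_add_right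
        matrix_vector_mult_uminus inner_minus_right Y_def Xq[OF lin(2)]
      by (simp add: power2_norm_eq_inner norm_Pair flip: scaleR_matrix_vector_assoc)
    hence 4: "F (fst p1) X \<le> F (fst p1) (- Y + \<epsilon> *\<^sub>R mat 1)" by (rule monoF)
    have "\<bar>Y $ i $ j\<bar> \<le> R" for i j
    proof -
      have "\<bar>Y $ i $ j\<bar> \<le> norm (fst (B (axis j 1, 0)))"
        unfolding Y_def matrix_def using component_le_norm_cart[of "fst (B (axis j 1, 0))" i] by simp
      also have "\<dots> \<le> norm (B (axis j 1, 0))" by (metis norm_fst_le prod.collapse)
      also have "\<dots> \<le> R" using nB[of "(axis j 1, 0)"] by (simp add: norm_Pair)
      finally show ?thesis .
    qed
    hence 5: "norm Y \<le> R'" unfolding R'_def by (rule norm_matrix_le_of_entries)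
    have 6: "norm (fst p1) \<le> R" using np(1) by (metis norm_fst_le order_trans prod.collapse)
    have "norm (fst (p1 + p2)) \<le> \<epsilon>" "norm (snd (p1 + p2)) \<le> \<epsilon>"
      using np(2) by (metis norm_fst_le norm_snd_le order_trans prod.collapse)+
    thus ?thesis using 1 2 3 4 5 6
      by (intro exI[of _ "fst p1"] exI[of _ "fst p2"] exI[of _ "snd p1 + snd p2"] exI[of _ Y]) auto
  qed
  define \<epsilon> where "\<epsilon> = (\<lambda>n. inverse (real (Suc n)))"
  have \<epsilon>: "\<epsilon> \<longlonglongrightarrow> 0" "\<And>n. 0 < \<epsilon> n" unfolding \<epsilon>_def by (rule LIMSEQ_inverse_real_of_nat) simp
  have "\<forall>n. \<exists>\<xi> \<xi>' \<tau> Y. norm \<xi> \<le> R \<and> norm (Y :: real ^ 'n ^ 'n) \<le> R' \<and> norm (\<xi> + \<xi>') \<le> \<epsilon> n \<and> \<bar>\<tau>\<bar> \<le> \<epsilon> n \<and>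
      c0 + \<tau> \<le> F \<xi> (- Y + \<epsilon> n *\<^sub>R mat 1) - F (- \<xi>') (- Y)" using step \<epsilon>(2) by blast
  then obtain \<xi> \<xi>' \<tau> and Y :: "nat \<Rightarrow> real ^ 'n ^ 'n" where seq: "\<And>n. norm (\<xi> n) \<le> R" "\<And>n. norm (Y n) \<le> R'"
    "\<And>n. norm (\<xi> n + \<xi>' n) \<le> \<epsilon> n" "\<And>n. \<bar>\<tau> n\<bar> \<le> \<epsilon> n"
    "\<And>n. c0 + \<tau> n \<le> F (\<xi> n) (- Y n + \<epsilon> n *\<^sub>R mat 1) - F (- \<xi>' n) (- Y n)" by metis
  \<comment> \<open>Along a convergent subsequence both operator values tend to the same limit,
    which contradicts the fixed gap c0.\<close>
  have c: "compact (cball (0 :: real ^ 'n) R \<times> cball (0 :: real ^ 'n ^ 'n) R')" by (intro compact_Times compact_cball)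
  have "\<forall>n. (\<xi> n, Y n) \<in> cball 0 R \<times> cball 0 R'" using seq by simp
  from c[unfolded compact_def, THEN spec, THEN mp, OF this]
  obtain l r where r: "strict_mono r" "((\<lambda>n. (\<xi> n, Y n)) \<circ> r) \<longlonglongrightarrow> l" by blast
  obtain \<xi>0 Y0 where l: "l = (\<xi>0, Y0)" by (cases l)
  have lim\<xi>: "(\<lambda>n. \<xi> (r n)) \<longlonglongrightarrow> \<xi>0" and limY: "(\<lambda>n. Y (r n)) \<longlonglongrightarrow> Y0"
    using tendsto_fst[OF r(2)] tendsto_snd[OF r(2)] unfolding l by (simp_all add: o_def)
  have lim\<epsilon>: "(\<lambda>n. \<epsilon> (r n)) \<longlonglongrightarrow> 0" using LIMSEQ_subseq_LIMSEQ[OF \<epsilon>(1) r(1)] by (simp add: o_def)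
  have "(\<lambda>n. \<xi> (r n) + \<xi>' (r n)) \<longlonglongrightarrow> 0" by (rule Lim_null_comparison[OF _ lim\<epsilon>]) (use seq in auto)
  from tendsto_diff[OF lim\<xi> this] have lim\<xi>': "(\<lambda>n. - \<xi>' (r n)) \<longlonglongrightarrow> \<xi>0" by simp
  have lim\<tau>: "(\<lambda>n. \<tau> (r n)) \<longlonglongrightarrow> 0" by (rule Lim_null_comparison[OF _ lim\<epsilon>]) (use seq in auto)
  have "(\<lambda>n. (\<xi> (r n), - Y (r n) + \<epsilon> (r n) *\<^sub>R mat 1)) \<longlonglongrightarrow> (\<xi>0, - Y0 + 0 *\<^sub>R mat 1)"
    by (intro tendsto_intros lim\<xi> limY lim\<epsilon>)
  from continuous_on_tendsto_compose[OF contF this]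
  have F1: "(\<lambda>n. F (\<xi> (r n)) (- Y (r n) + \<epsilon> (r n) *\<^sub>R mat 1)) \<longlonglongrightarrow> F \<xi>0 (- Y0)" by simp
  have "(\<lambda>n. (- \<xi>' (r n), - Y (r n))) \<longlonglongrightarrow> (\<xi>0, - Y0)" by (intro tendsto_intros lim\<xi>' limY)
  from continuous_on_tendsto_compose[OF contF this]
  have F2: "(\<lambda>n. F (- \<xi>' (r n)) (- Y (r n))) \<longlonglongrightarrow> F \<xi>0 (- Y0)" by simp
  have "c0 + 0 \<le> F \<xi>0 (- Y0) - F \<xi>0 (- Y0)"
    by (rule LIMSEQ_le[OF tendsto_add[OF tendsto_const lim\<tau>] tendsto_diff[OF F1 F2]]) (use seq in auto)
  thus False using c0 by simp
qed

section \<open>Perron's method\<close>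

text \<open>Neighbourhoods of z include z itself, so the envelope is not below W on Q. The infimum
  is meaningful once W is locally bounded above, which the context below assumes.\<close>

definition usc_envelope :: "'a::topological_space set \<Rightarrow> ('a \<Rightarrow> real) \<Rightarrow> 'a \<Rightarrow> real" where
  "usc_envelope Q W z = Inf {a. \<forall>\<^sub>F w in nhds z. w \<in> Q \<longrightarrow> W w \<le> a}"

context
  fixes Q :: "'a::topological_space set" and W :: "'a \<Rightarrow> real"
  assumes locally_bounded: "\<forall>z\<in>Q. \<exists>a. \<forall>\<^sub>F w in nhds z. w \<in> Q \<longrightarrow> W w \<le> a"
begin

lemma usc_envelope_bdd_below:
  assumes "z \<in> Q"
  shows "bdd_below {a. \<forall>\<^sub>F w in nhds z. w \<in> Q \<longrightarrow> W w \<le> a}"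
  using assms by (intro bdd_belowI[of _ "W z"]) (auto dest: eventually_nhds_x_imp_x)

lemma usc_envelope_ge:
  assumes "z \<in> Q"
  shows "W z \<le> usc_envelope Q W z"
  unfolding usc_envelope_def
proof (rule cInf_greatest)
  show "{a. \<forall>\<^sub>F w in nhds z. w \<in> Q \<longrightarrow> W w \<le> a} \<noteq> {}" using locally_bounded[rule_format, OF assms] by blast
qed (use assms in \<open>auto dest: eventually_nhds_x_imp_x\<close>)

lemma usc_envelope_le:
  assumes "z \<in> Q" "\<forall>\<^sub>F w in nhds z. w \<in> Q \<longrightarrow> W w \<le> a"
  shows "usc_envelope Q W z \<le> a"
  unfolding usc_envelope_def by (rule cInf_lower[OF _ usc_envelope_bdd_below[OF assms(1)]]) (use assms in simp)

lemma upper_semicontinuous_on_usc_envelope: "upper_semicontinuous_on Q (usc_envelope Q W)"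
  unfolding upper_semicontinuous_on_def
proof (intro ballI allI impI)
  fix z a assume z: "z \<in> Q" "usc_envelope Q W z < a"
  then obtain a' where a': "\<forall>\<^sub>F w in nhds z. w \<in> Q \<longrightarrow> W w \<le> a'" "a' < a"
    using cInf_lessD[of "{a. \<forall>\<^sub>F w in nhds z. w \<in> Q \<longrightarrow> W w \<le> a}" a] locally_bounded[rule_format, OF z(1)]
    unfolding usc_envelope_def by blast
  hence "\<forall>\<^sub>F w in nhds z. \<forall>\<^sub>F w' in nhds w. w' \<in> Q \<longrightarrow> W w' \<le> a'" by (simp add: eventually_eventually)
  hence "\<forall>\<^sub>F w in nhds z. w \<in> Q \<longrightarrow> usc_envelope Q W w < a"
    by eventually_elim (use usc_envelope_le a'(2) in \<open>auto intro: le_less_trans\<close>)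
  thus "\<forall>\<^sub>F w in at z within Q. usc_envelope Q W w < a"
    unfolding eventually_at_filter by eventually_elim simp
qed

lemma usc_envelope_approx:
  assumes "z \<in> Q" "0 < \<epsilon>" "open N" "z \<in> N"
  shows "\<exists>w\<in>N \<inter> Q. usc_envelope Q W z - \<epsilon> < W w"
proof (rule ccontr)
  assume "\<not> ?thesis"
  hence "\<forall>w\<in>N. w \<in> Q \<longrightarrow> W w \<le> usc_envelope Q W z - \<epsilon>" by (auto simp: not_less)
  hence "\<forall>\<^sub>F w in nhds z. w \<in> Q \<longrightarrow> W w \<le> usc_envelope Q W z - \<epsilon>"
    using assms(3,4) unfolding eventually_nhds by blast
  from usc_envelope_le[OF assms(1) this] assms(2) show False by simp
qed

end

section \<open>Superjets of functions that have a jet\<close>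

lemma filterlim_ray:
  fixes z d :: "'a::real_normed_vector"
  assumes "d \<noteq> 0"
  shows "filterlim (\<lambda>s. z + s *\<^sub>R d) (at z) (at_right 0)"
proof (rule filterlim_atI)
  have "((\<lambda>s. z + s *\<^sub>R d) \<longlongrightarrow> z + 0 *\<^sub>R d) (at_right 0)" by (intro tendsto_intros)
  thus "((\<lambda>s. z + s *\<^sub>R d) \<longlongrightarrow> z) (at_right 0)" by simp
  show "\<forall>\<^sub>F s in at_right 0. z + s *\<^sub>R d \<noteq> z"
    using eventually_at_right_less[of "0::real"] by eventually_elim (use assms in simp)
qed

text \<open>Approach z along rays z + s d. Dividing by s identifies the time slopes, tested in both
  directions, and then the gradients; after these cancel, dividing by s^2 orders the
  Hessians.\<close>

lemma jet_superjet_comparison: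
  fixes b :: "(real ^ 'n) \<times> real \<Rightarrow> real"
  assumes b: "has_jet b z \<xi> \<tau> X" and s: "superjet b z \<xi>1 \<tau>1 X1"
  shows "\<xi>1 = \<xi>" "\<tau>1 = \<tau>" "y \<bullet> (X *v y) \<le> y \<bullet> (X1 *v y)"
proof -
  have ev: "\<forall>\<^sub>F w in at z. 0 \<le> jet_polynomial \<xi>1 \<tau>1 X1 (w - z) - jet_polynomial \<xi> \<tau> X (w - z) + \<epsilon> * parabolic_size (w - z)"
    if "0 < \<epsilon>" for \<epsilon>
  proof -
    have "0 < \<epsilon> / 2" using that by simp
    hence "\<forall>\<^sub>F w in at z. b w \<le> b z + jet_polynomial \<xi>1 \<tau>1 X1 (w - z) + \<epsilon> / 2 * parabolic_size (w - z)"
      "\<forall>\<^sub>F w in at z. \<bar>b w - b z - jet_polynomial \<xi> \<tau> X (w - z)\<bar> \<le> \<epsilon> / 2 * parabolic_size (w - z)"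
      using b s unfolding superjet_def has_jet_def by blast+
    thus ?thesis
    proof eventually_elim
      case (elim w)
      have "\<epsilon> * parabolic_size (w - z) = \<epsilon> / 2 * parabolic_size (w - z) + \<epsilon> / 2 * parabolic_size (w - z)" by simp
      thus ?case using elim by linarith
    qed
  qed
  have ray: "\<forall>\<^sub>F s in at_right 0. 0 \<le> s * ((\<xi>1 - \<xi>) \<bullet> h + (\<tau>1 - \<tau>) * k) + s\<^sup>2 * (h \<bullet> (X1 *v h) - h \<bullet> (X *v h)) / 2
      + \<epsilon> * (s\<^sup>2 * (norm h)\<^sup>2 + s * \<bar>k\<bar>)" if "0 < \<epsilon>" "(h, k) \<noteq> 0" for \<epsilon> h k
    using filterlim_iff[THEN iffD1, OF filterlim_ray[OF that(2), of z], rule_format, OF ev[OF that(1)]]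
      eventually_at_right_less[of "0::real"]
  proof eventually_elim
    case (elim s)
    have "z + s *\<^sub>R (h, k) - z = (s *\<^sub>R h, s * k)" by simp
    thus ?case using elim unfolding jet_polynomial_def parabolic_size_def
      by (simp add: matrix_vector_mult_scaleR inner_diff_left power_mult_distrib abs_mult power2_eq_square algebra_simps diff_divide_distrib)
  qed
  have slope: "0 \<le> (\<tau>1 - \<tau>) * k" if "\<bar>k\<bar> = 1" for k
  proof (rule field_le_epsilon)
    fix \<epsilon> :: real assume \<epsilon>: "0 < \<epsilon>"
    have "(0 :: real ^ 'n, k) \<noteq> 0" using that by (auto simp: zero_prod_def)
    from eventually_happens'[OF trivial_limit_at_right_real eventually_conj[OF ray[OF \<epsilon> this] eventually_at_right_less]]
    obtain s where s: "0 < s" "0 \<le> s * ((\<tau>1 - \<tau>) * k) + \<epsilon> * (s * \<bar>k\<bar>)" by auto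
    hence "0 \<le> s * ((\<tau>1 - \<tau>) * k + \<epsilon>)" using that by (simp add: algebra_simps)
    thus "0 \<le> (\<tau>1 - \<tau>) * k + \<epsilon>" using s(1) by (simp add: zero_le_mult_iff)
  qed
  from slope[of 1] slope[of "-1"] show "\<tau>1 = \<tau>" by simp
  have grad: "0 \<le> (\<xi>1 - \<xi>) \<bullet> h" for h
  proof (cases "h = 0")
    case False
    define B where "B = (h \<bullet> (X1 *v h) - h \<bullet> (X *v h)) / 2 + (norm h)\<^sup>2"
    have "(h, 0::real) \<noteq> 0" using False by (auto simp: zero_prod_def)
    from ray[OF zero_less_one this] eventually_at_right_less[of "0::real"]
    have "\<forall>\<^sub>F s in at_right 0. 0 \<le> (\<xi>1 - \<xi>) \<bullet> h + s * B"
    proof eventually_elim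
      case (elim s)
      hence "0 \<le> s * ((\<xi>1 - \<xi>) \<bullet> h + s * B)" unfolding B_def by (simp add: algebra_simps power2_eq_square)
      thus ?case using elim(2) by (simp add: zero_le_mult_iff)
    qed
    moreover have "((\<lambda>s. (\<xi>1 - \<xi>) \<bullet> h + s * B) \<longlongrightarrow> (\<xi>1 - \<xi>) \<bullet> h + 0 * B) (at_right 0)" by (intro tendsto_intros)
    ultimately show ?thesis using tendsto_lowerbound[of _ _ "at_right (0::real)" 0] by fastforce
  qed simp
  have "(\<xi>1 - \<xi>) \<bullet> (\<xi>1 - \<xi>) \<le> 0" using grad[of "- (\<xi>1 - \<xi>)"] unfolding inner_minus_right by linarith
  thus eq: "\<xi>1 = \<xi>" using inner_ge_zero[of "\<xi>1 - \<xi>"] by (simp add: order_antisym)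
  show "y \<bullet> (X *v y) \<le> y \<bullet> (X1 *v y)"
  proof (cases "y = 0")
    case False
    define c where "c = (y \<bullet> (X1 *v y) - y \<bullet> (X *v y)) / 2"
    have "0 \<le> c"
    proof (rule field_le_epsilon)
      fix e :: real assume "0 < e"
      define \<epsilon> where "\<epsilon> = e / (norm y)\<^sup>2"
      have \<epsilon>: "0 < \<epsilon>" "\<epsilon> * (norm y)\<^sup>2 = e" unfolding \<epsilon>_def using \<open>0 < e\<close> False by auto
      have "(y, 0::real) \<noteq> 0" using False by (auto simp: zero_prod_def)
      from eventually_happens'[OF trivial_limit_at_right_real eventually_conj[OF ray[OF \<epsilon>(1) this] eventually_at_right_less]]
      obtain s where s: "0 < s" "0 \<le> s\<^sup>2 * (y \<bullet> (X1 *v y) - y \<bullet> (X *v y)) / 2 + \<epsilon> * (s\<^sup>2 * (norm y)\<^sup>2)"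
        unfolding eq by auto
      hence "0 \<le> s\<^sup>2 * (c + \<epsilon> * (norm y)\<^sup>2)" unfolding c_def by (simp add: algebra_simps)
      thus "0 \<le> c + e" using s(1) unfolding \<epsilon>(2) by (simp add: zero_le_mult_iff)
    qed
    thus ?thesis unfolding c_def by simp
  qed simp
qed

lemma has_jet_of_quadratic:
  assumes "\<And>e. b (z + e) = b z + jet_polynomial \<xi> \<tau> X e + K * (snd e)\<^sup>2"
  shows "has_jet b z \<xi> \<tau> X"
proof -
  have b: "b w = b z + jet_polynomial \<xi> \<tau> X (w - z) + K * (snd (w - z))\<^sup>2" for w using assms[of "w - z"] by simp
  have "has_jet (\<lambda>w. K * (snd w - snd z)\<^sup>2) z 0 0 0"
    by (rule has_jet_time) (auto intro!: derivative_eq_intros)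
  moreover have "b w - b z - jet_polynomial \<xi> \<tau> X (w - z) =
      K * (snd w - snd z)\<^sup>2 - K * (snd z - snd z)\<^sup>2 - jet_polynomial 0 0 0 (w - z)" for w
    using b[of w] by (simp add: jet_polynomial_def)
  ultimately show ?thesis unfolding has_jet_def by simp
qed

section \<open>Admissible subsolutions and their supremum\<close>

text \<open>Barriers from above are asked for only up to T1 < T, because g may be unbounded as t
  tends to T. Barriers from below live on the whole cylinder, because they have to be members of the
  Perron family.\<close>

locale perron_problem =
  fixes F :: "real ^ 'n \<Rightarrow> real ^ 'n ^ 'n \<Rightarrow> real" and \<Omega> :: "(real ^ 'n) set" and T :: real
    and g :: "(real ^ 'n) \<times> real \<Rightarrow> real"
  assumes contF: "continuous_on UNIV (\<lambda>(\<xi>, X). F \<xi> X)"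
    and symF: "\<And>\<xi> X. F \<xi> (symmetrize X) = F \<xi> X"
    and monoF: "\<And>\<xi> X Y. (\<And>y. y \<bullet> (X *v y) \<le> y \<bullet> (Y *v y)) \<Longrightarrow> F \<xi> X \<le> F \<xi> Y"
    and \<Omega>: "open \<Omega>" "bounded \<Omega>" "\<Omega> \<noteq> {}" and T: "0 < T"
    and super_barrier: "\<And>z0 \<epsilon> T1. z0 \<in> parabolic_boundary \<Omega> T \<Longrightarrow> 0 < \<epsilon> \<Longrightarrow> snd z0 < T1 \<Longrightarrow> T1 < T \<Longrightarrow>
       \<exists>s. continuous_on (closure \<Omega> \<times> {0..T1}) s \<and> jet_sub (reflect F) (\<Omega> \<times> {0<..<T1}) (\<lambda>z. - s z) \<and>
         (\<forall>z\<in>parabolic_boundary \<Omega> T1. g z \<le> s z) \<and> s z0 \<le> g z0 + \<epsilon>"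
    and sub_barrier: "\<And>z0 \<epsilon>. z0 \<in> parabolic_boundary \<Omega> T \<Longrightarrow> 0 < \<epsilon> \<Longrightarrow>
       \<exists>v. continuous_on (closure \<Omega> \<times> {0..<T}) v \<and> jet_sub F (\<Omega> \<times> {0<..<T}) v \<and>
         (\<forall>z\<in>parabolic_boundary \<Omega> T. v z \<le> g z) \<and> g z0 - \<epsilon> \<le> v z0"
begin

abbreviation "Q \<equiv> closure \<Omega> \<times> {0..<T}"
abbreviation "S \<equiv> \<Omega> \<times> {0<..<T}"

definition "admissible v \<longleftrightarrow> upper_semicontinuous_on Q v \<and> jet_sub F S v \<and> (\<forall>z\<in>parabolic_boundary \<Omega> T. v z \<le> g z)"

definition "perron_sup z = Sup {v z |v. admissible v}"

lemma open_S: "open S" using \<Omega>(1) by (intro open_Times) auto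

lemma S_subset_Q: "S \<subseteq> Q" using closure_subset[of \<Omega>] by auto

lemma boundary_subset_Q: "parabolic_boundary \<Omega> T \<subseteq> Q"
  using closure_subset[of \<Omega>] T unfolding parabolic_boundary_def frontier_def by auto

lemma boundary_Int_S: "parabolic_boundary \<Omega> T \<inter> S = {}"
  using \<Omega>(1) unfolding parabolic_boundary_def by (auto simp: frontier_def interior_open)

lemma Q_cases: "z \<in> Q \<Longrightarrow> z \<in> S \<or> z \<in> parabolic_boundary \<Omega> T"
  using \<Omega>(1) unfolding parabolic_boundary_def frontier_def by (cases z) (auto simp: interior_open)

lemma jet_sub_subset: "jet_sub G A v \<Longrightarrow> B \<subseteq> A \<Longrightarrow> jet_sub G B v"
  unfolding jet_sub_def by blast

lemma comparison_upto:
  assumes v: "upper_semicontinuous_on Q v" "jet_sub F S v" and "T1 < T"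
    and w: "upper_semicontinuous_on (closure \<Omega> \<times> {0..T1}) w" "jet_sub (reflect F) (\<Omega> \<times> {0<..<T1}) w"
    and "\<And>z. z \<in> parabolic_boundary \<Omega> T1 \<Longrightarrow> v z + w z \<le> 0" and "z \<in> Q" "snd z < T1"
  shows "v z + w z \<le> 0"
proof (rule cylinder_comparison[OF contF monoF \<Omega>(1,2) _ _ w assms(6)])
  show "upper_semicontinuous_on (closure \<Omega> \<times> {0..T1}) v"
    by (rule upper_semicontinuous_on_subset[OF v(1)]) (use \<open>T1 < T\<close> in auto)
  show "jet_sub F (\<Omega> \<times> {0<..<T1}) v" by (rule jet_sub_subset[OF v(2)]) (use \<open>T1 < T\<close> in auto)
  show "z \<in> closure \<Omega> \<times> {0..<T1}" using assms(7,8) by auto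
qed

lemma boundary_upto_subset: "T1 < T \<Longrightarrow> parabolic_boundary \<Omega> T1 \<subseteq> parabolic_boundary \<Omega> T"
  unfolding parabolic_boundary_def by auto

lemma admissible_le_super_barrier:
  assumes v: "admissible v" and s: "continuous_on (closure \<Omega> \<times> {0..T1}) s" "jet_sub (reflect F) (\<Omega> \<times> {0<..<T1}) (\<lambda>z. - s z)"
    "\<forall>z\<in>parabolic_boundary \<Omega> T1. g z \<le> s z" and "T1 < T" "z \<in> Q" "snd z < T1"
  shows "v z \<le> s z"
proof -
  have "v z + - s z \<le> 0"
  proof (rule comparison_upto[OF _ _ \<open>T1 < T\<close> _ s(2) _ assms(6,7)])
    show "upper_semicontinuous_on (closure \<Omega> \<times> {0..T1}) (\<lambda>z. - s z)"
      by (intro continuous_on_imp_upper_semicontinuous_on continuous_intros s(1))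
    show "v z + - s z \<le> 0" if "z \<in> parabolic_boundary \<Omega> T1" for z
    proof -
      have "v z \<le> g z" using v that boundary_upto_subset[OF \<open>T1 < T\<close>] unfolding admissible_def by blast
      thus ?thesis using s(3) that by fastforce
    qed
  qed (use v in \<open>auto simp: admissible_def\<close>)
  thus ?thesis by simp
qed

lemma exists_admissible: "\<exists>v. admissible v \<and> continuous_on Q v"
proof -
  obtain x where "x \<in> \<Omega>" using \<Omega>(3) by blast
  hence "(x, 0) \<in> parabolic_boundary \<Omega> T" unfolding parabolic_boundary_def by simp
  from sub_barrier[OF this zero_less_one] show ?thesis
    unfolding admissible_def using continuous_on_imp_upper_semicontinuous_on by blast
qed

lemma admissible_bounded:
  assumes "z \<in> Q"
  shows "\<exists>s T1. continuous_on (closure \<Omega> \<times> {0..T1}) s \<and> snd z < T1 \<and> T1 < T \<and>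
      (\<forall>v y. admissible v \<longrightarrow> y \<in> Q \<longrightarrow> snd y < T1 \<longrightarrow> v y \<le> s y)"
proof -
  obtain x where "x \<in> \<Omega>" using \<Omega>(3) by blast
  hence x: "(x, 0) \<in> parabolic_boundary \<Omega> T" unfolding parabolic_boundary_def by simp
  have "snd z < T" using assms by auto
  then obtain T1 where T1: "snd z < T1" "T1 < T" using dense by blast
  have "snd (x, 0) < T1" using T1 assms by auto
  from super_barrier[OF x zero_less_one this T1(2)] T1 show ?thesis
    using admissible_le_super_barrier[OF _ _ _ _ T1(2)] by metis
qed

lemma bdd_above_admissible: "z \<in> Q \<Longrightarrow> bdd_above {v z |v. admissible v}"
  using admissible_bounded[of z] unfolding bdd_above_def by blast

lemma admissible_le_perron_sup: "admissible v \<Longrightarrow> z \<in> Q \<Longrightarrow> v z \<le> perron_sup z"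
  unfolding perron_sup_def by (intro cSup_upper bdd_above_admissible) auto

lemma perron_sup_le: "(\<And>v. admissible v \<Longrightarrow> v z \<le> a) \<Longrightarrow> perron_sup z \<le> a"
  unfolding perron_sup_def using exists_admissible by (intro cSup_least) auto

lemma eventually_below:
  fixes s W :: "(real ^ 'n) \<times> real \<Rightarrow> real"
  assumes "continuous_on A s" "z \<in> A" "0 < \<epsilon>" "\<forall>\<^sub>F w in nhds z. w \<in> Q \<longrightarrow> w \<in> A \<and> W w \<le> s w"
  shows "\<forall>\<^sub>F w in nhds z. w \<in> Q \<longrightarrow> W w \<le> s z + \<epsilon>"
proof -
  have "(s \<longlongrightarrow> s z) (at z within A)" using assms(1,2) unfolding continuous_on_def by blast
  from order_tendstoD(2)[OF this] have "\<forall>\<^sub>F w in at z within A. s w < s z + \<epsilon>" using \<open>0 < \<epsilon>\<close> by simp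
  hence "\<forall>\<^sub>F w in nhds z. w \<in> A \<longrightarrow> s w < s z + \<epsilon>"
    unfolding eventually_at_filter by eventually_elim (use \<open>0 < \<epsilon>\<close> in auto)
  with assms(4) show ?thesis by eventually_elim fastforce
qed

lemma eventually_snd_less: "snd z < T1 \<Longrightarrow> \<forall>\<^sub>F w in nhds (z :: (real ^ 'n) \<times> real). snd w < T1"
  using eventually_nhds_in_open[of "{w. snd w < T1}" z] by (simp add: open_Collect_less continuous_intros)

lemma super_barrier_eventually:
  fixes s W :: "(real ^ 'n) \<times> real \<Rightarrow> real"
  assumes "continuous_on (closure \<Omega> \<times> {0..T1}) s" "z \<in> Q" "snd z < T1" "0 < \<epsilon>"
    and "\<And>y. y \<in> Q \<Longrightarrow> snd y < T1 \<Longrightarrow> W y \<le> s y"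
  shows "\<forall>\<^sub>F w in nhds z. w \<in> Q \<longrightarrow> W w \<le> s z + \<epsilon>"
proof (rule eventually_below[OF assms(1) _ assms(4)])
  show "z \<in> closure \<Omega> \<times> {0..T1}" using assms(2,3) by auto
  show "\<forall>\<^sub>F w in nhds z. w \<in> Q \<longrightarrow> w \<in> closure \<Omega> \<times> {0..T1} \<and> W w \<le> s w"
    using eventually_snd_less[OF assms(3)] by eventually_elim (use assms(5) in auto)
qed

lemma perron_sup_locally_bounded:
  "\<forall>z\<in>Q. \<exists>a. \<forall>\<^sub>F w in nhds z. w \<in> Q \<longrightarrow> perron_sup w \<le> a"
proof
  fix z assume z: "z \<in> Q"
  obtain s T1 where s: "continuous_on (closure \<Omega> \<times> {0..T1}) s" "snd z < T1" "T1 < T"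
    "\<And>v y. admissible v \<Longrightarrow> y \<in> Q \<Longrightarrow> snd y < T1 \<Longrightarrow> v y \<le> s y"
    using admissible_bounded[OF z] by blast
  from super_barrier_eventually[OF s(1) z s(2) zero_less_one, of perron_sup]
  show "\<exists>a. \<forall>\<^sub>F w in nhds z. w \<in> Q \<longrightarrow> perron_sup w \<le> a" using perron_sup_le s(4) by blast
qed

definition "V = usc_envelope Q perron_sup"

lemma admissible_le_V: "admissible v \<Longrightarrow> z \<in> Q \<Longrightarrow> v z \<le> V z"
  unfolding V_def using admissible_le_perron_sup usc_envelope_ge[OF perron_sup_locally_bounded] order_trans by blast

text \<open>In the interior this is stability under suprema. At the boundary each continuous upper
  barrier lies above the whole family, so its value at z survives the passage to the
  envelope.\<close>

lemma admissible_V: "admissible V"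
  unfolding admissible_def
proof (intro conjI ballI)
  show "upper_semicontinuous_on Q V"
    unfolding V_def by (rule upper_semicontinuous_on_usc_envelope[OF perron_sup_locally_bounded])
  show "jet_sub F S V"
  proof (rule jet_sub_envelope[OF contF symF open_S, of "{v. admissible v}"])
    fix v assume "v \<in> {v. admissible v}"
    thus "quadratic_sub F S v \<and> upper_semicontinuous_on S v \<and> (\<forall>z\<in>S. v z \<le> V z)"
      using jet_sub_imp_quadratic_sub upper_semicontinuous_on_subset[OF _ S_subset_Q] admissible_le_V S_subset_Q
      unfolding admissible_def[of v] by (auto simp: admissible_def)
  next
    fix z \<epsilon> N assume z: "z \<in> S" and \<epsilon>: "(0::real) < \<epsilon>" and N: "open N" "z \<in> N"
    have "z \<in> Q" using z S_subset_Q by blast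
    from usc_envelope_approx[OF perron_sup_locally_bounded this \<epsilon> open_Int[OF N(1) open_S]] N z
    obtain w where w: "w \<in> N" "w \<in> S" "V z - \<epsilon> < perron_sup w" unfolding V_def by blast
    have "\<exists>v. admissible v \<and> V z - \<epsilon> < v w"
      using perron_sup_le[of w "V z - \<epsilon>"] w(3) by (meson not_le)
    thus "\<exists>v\<in>{v. admissible v}. \<exists>z'\<in>N \<inter> S. V z - \<epsilon> < v z'" using w by blast
  qed
  fix z assume z: "z \<in> parabolic_boundary \<Omega> T"
  hence zQ: "z \<in> Q" using boundary_subset_Q by blast
  show "V z \<le> g z"
  proof (rule field_le_epsilon)
    fix e :: real assume "0 < e"
    hence e: "0 < e / 2" by simp
    have "snd z < T" using zQ by auto
    then obtain T1 where T1: "snd z < T1" "T1 < T" using dense by blast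
    obtain s where s: "continuous_on (closure \<Omega> \<times> {0..T1}) s" "jet_sub (reflect F) (\<Omega> \<times> {0<..<T1}) (\<lambda>z. - s z)"
      "\<forall>z\<in>parabolic_boundary \<Omega> T1. g z \<le> s z" "s z \<le> g z + e / 2"
      using super_barrier[OF z e T1] by blast
    have le: "perron_sup y \<le> s y" if "y \<in> Q" "snd y < T1" for y
      using admissible_le_super_barrier[OF _ s(1-3) T1(2) that] by (intro perron_sup_le)
    have "\<forall>\<^sub>F w in nhds z. w \<in> Q \<longrightarrow> perron_sup w \<le> s z + e / 2"
      by (rule super_barrier_eventually[OF s(1) zQ T1(1) e]) (rule le)
    hence "V z \<le> s z + e / 2" unfolding V_def by (rule usc_envelope_le[OF perron_sup_locally_bounded zQ])
    thus "V z \<le> g z + e" using s(4) by simp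
  qed
qed

end

section \<open>The lower envelope and the solution\<close>

context perron_problem
begin

text \<open>\<open>- N\<close> is the lower semicontinuous envelope of \<open>V\<close>. The sign
  turns supersolution statements about it into subsolution statements for
  \<open>reflect F\<close>.\<close>

definition "N = usc_envelope Q (\<lambda>z. - V z)"

lemma neg_V_locally_bounded: "\<forall>z\<in>Q. \<exists>a. \<forall>\<^sub>F w in nhds z. w \<in> Q \<longrightarrow> - V w \<le> a"
proof
  fix z assume z: "z \<in> Q"
  obtain v where v: "admissible v" "continuous_on Q v" using exists_admissible by blast
  have "\<forall>\<^sub>F w in nhds z. w \<in> Q \<longrightarrow> - V w \<le> - v z + 1"
  proof (rule eventually_below[of Q "\<lambda>z. - v z"])
    show "continuous_on Q (\<lambda>z. - v z)" using v(2) by (intro continuous_intros)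
    show "\<forall>\<^sub>F w in nhds z. w \<in> Q \<longrightarrow> w \<in> Q \<and> - V w \<le> - v w"
      using admissible_le_V[OF v(1)] by (intro always_eventually) auto
  qed (use z in auto)
  thus "\<exists>a. \<forall>\<^sub>F w in nhds z. w \<in> Q \<longrightarrow> - V w \<le> a" by blast
qed

lemma N_ge: "z \<in> Q \<Longrightarrow> - V z \<le> N z"
  unfolding N_def by (rule usc_envelope_ge[OF neg_V_locally_bounded])

text \<open>Continuity of F, with the perturbations that the box test function undergoes at points
  of its box.\<close>

lemma operator_strict_near:
  assumes "\<tau> < F \<xi> X"
  shows "\<exists>\<epsilon>>0. \<forall>h. norm h \<le> \<epsilon> \<longrightarrow> \<tau> + 4 * \<epsilon> < F (\<xi> + (X - (4 * \<epsilon>) *\<^sub>R mat 1) *v h) (X - (4 * \<epsilon>) *\<^sub>R mat 1)"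
proof (rule ccontr)
  assume "\<not> ?thesis"
  hence "\<forall>\<epsilon>>0. \<exists>h. norm h \<le> \<epsilon> \<and> F (\<xi> + (X - (4 * \<epsilon>) *\<^sub>R mat 1) *v h) (X - (4 * \<epsilon>) *\<^sub>R mat 1) \<le> \<tau> + 4 * \<epsilon>"
    by (metis not_le)
  then obtain h where h: "\<And>\<epsilon>. 0 < \<epsilon> \<Longrightarrow> norm (h \<epsilon>) \<le> \<epsilon> \<and>
      F (\<xi> + (X - (4 * \<epsilon>) *\<^sub>R mat 1) *v h \<epsilon>) (X - (4 * \<epsilon>) *\<^sub>R mat 1) \<le> \<tau> + 4 * \<epsilon>" by metis
  define e where "e = (\<lambda>n. inverse (real (Suc n)))"
  have e: "e \<longlonglongrightarrow> 0" "\<And>n. 0 < e n" unfolding e_def by (rule LIMSEQ_inverse_real_of_nat) simp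
  have h0: "(\<lambda>n. h (e n)) \<longlonglongrightarrow> 0"
    by (rule Lim_null_comparison[OF _ e(1)]) (use h e in auto)
  have X0: "(\<lambda>n. X - (4 * e n) *\<^sub>R mat 1) \<longlonglongrightarrow> X - (4 * 0) *\<^sub>R mat 1"
    by (intro tendsto_intros e)
  have "(\<lambda>n. (X - (4 * e n) *\<^sub>R mat 1) *v h (e n)) \<longlonglongrightarrow> (X - (4 * 0) *\<^sub>R mat 1) *v 0"
    by (intro tendsto_matrix_vector_mult X0 h0)
  hence "(\<lambda>n. \<xi> + (X - (4 * e n) *\<^sub>R mat 1) *v h (e n)) \<longlonglongrightarrow> \<xi> + 0" by (intro tendsto_intros) simp
  with X0 have "(\<lambda>n. (\<xi> + (X - (4 * e n) *\<^sub>R mat 1) *v h (e n), X - (4 * e n) *\<^sub>R mat 1)) \<longlonglongrightarrow> (\<xi>, X)"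
    by (intro tendsto_Pair) auto
  from continuous_on_tendsto_compose[OF contF this]
  have l1: "(\<lambda>n. F (\<xi> + (X - (4 * e n) *\<^sub>R mat 1) *v h (e n)) (X - (4 * e n) *\<^sub>R mat 1)) \<longlonglongrightarrow> F \<xi> X" by simp
  have l2: "(\<lambda>n. \<tau> + 4 * e n) \<longlonglongrightarrow> \<tau> + 4 * 0" by (intro tendsto_intros e)
  have "F \<xi> X \<le> \<tau> + 4 * 0" by (rule LIMSEQ_le[OF l1 l2]) (use h e in auto)
  thus False using assms by simp
qed

text \<open>If the lower envelope \<open>- N\<close> were not a supersolution at \<open>z\<close>, a test paraboloid touching it from
  below could be raised a little, and the maximum of it and \<open>V\<close> would be admissible.\<close>

lemma jet_sub_N: "jet_sub (reflect F) S N"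
  unfolding jet_sub_def
proof (intro ballI allI impI, rule ccontr)
  fix z \<xi>' \<tau>' X0
  assume z: "z \<in> S" and sj0: "superjet N z \<xi>' \<tau>' X0" and "\<not> \<tau>' \<le> reflect F \<xi>' X0"
  define X' where "X' = symmetrize X0"
  have trX: "transpose X' = X'" unfolding X'_def by (rule transpose_symmetrize)
  have sj: "superjet N z \<xi>' \<tau>' X'" using sj0 unfolding superjet_def X'_def jet_polynomial_symmetrize .
  have "- X' = symmetrize (- X0)" unfolding X'_def by (simp add: symmetrize_def transpose_def vec_eq_iff field_simps)
  hence "- \<tau>' < F (- \<xi>') (- X')" using \<open>\<not> \<tau>' \<le> reflect F \<xi>' X0\<close> by (simp add: symF reflect_def)
  from operator_strict_near[OF this] obtain \<epsilon> where \<epsilon>: "0 < \<epsilon>"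
    "\<And>h. norm h \<le> \<epsilon> \<Longrightarrow> - \<tau>' + 4 * \<epsilon> < F (- \<xi>' + (- X' - (4 * \<epsilon>) *\<^sub>R mat 1) *v h) (- X' - (4 * \<epsilon>) *\<^sub>R mat 1)" by blast
  have zQ: "z \<in> Q" using z S_subset_Q by blast
  have "\<forall>\<^sub>F w in at z. N w \<le> N z + jet_polynomial \<xi>' \<tau>' X' (w - z) + \<epsilon> * parabolic_size (w - z)"
    using sj \<epsilon>(1) unfolding superjet_def by blast
  then obtain r1 where r1: "0 < r1" "\<And>w. w \<noteq> z \<Longrightarrow> dist w z < r1 \<Longrightarrow>
      N w \<le> N z + jet_polynomial \<xi>' \<tau>' X' (w - z) + \<epsilon> * parabolic_size (w - z)"
    unfolding eventually_at by auto
  obtain r2 where r2: "0 < r2" "ball z r2 \<subseteq> S" using open_S z openE by blast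
  define r where "r = min r1 r2"
  define \<rho> where "\<rho> = min \<epsilon> (r / 3)"
  define \<kappa> where "\<kappa> = min \<rho> (4 * \<rho>\<^sup>2)"
  have r: "0 < r" "r \<le> r1" "r \<le> r2" using r1 r2 unfolding r_def by auto
  have \<rho>: "0 < \<rho>" "\<rho> \<le> \<epsilon>" "\<rho> \<le> r / 3" using r \<epsilon>(1) unfolding \<rho>_def by auto
  have \<kappa>: "0 < \<kappa>" "\<kappa> \<le> 4 * \<rho>\<^sup>2" "\<kappa> \<le> r / 3" using \<rho> unfolding \<kappa>_def by auto
  define B where "B = jet_box z \<rho> \<kappa>"
  have Bball: "B \<subseteq> ball z r" unfolding B_def using \<rho>(3) \<kappa>(3) r(1) by (rule jet_box_subset_ball)
  have BS: "B \<subseteq> S" using Bball r2(2) subset_ball[OF r(3), of z] by blast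
  have Nle: "N w \<le> N z + jet_polynomial \<xi>' \<tau>' X' (w - z) + \<epsilon> * parabolic_size (w - z)" if "w \<in> B" for w
    using that Bball r r1(2)[of w] by (cases "w = z") (auto simp: dist_commute parabolic_size_def)
  define m where "m = min (\<epsilon> * \<rho>\<^sup>2 / 2) (\<epsilon> * \<kappa>)"
  have m: "0 < m" unfolding m_def using \<epsilon>(1) \<rho> \<kappa> by simp
  define P where "P = box_test \<xi>' \<tau>' X' \<epsilon> \<kappa>"
  \<comment> \<open>Raised by half of the amount m by which the box test wins on the boundary of the
    box: b stays below V there but exceeds V at points near z.\<close>
  define b where "b = (\<lambda>w. - N z - P (w - z) + m / 2)"
  have b_bd: "b w < V w" if "w \<in> B" "norm (fst (w - z)) = \<rho> \<or> \<bar>snd (w - z)\<bar> = \<kappa>" for w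
  proof -
    have "w \<in> Q" using that(1) BS S_subset_Q by blast
    thus ?thesis
      using Nle[OF that(1)] box_test_boundary[OF \<epsilon>(1) \<kappa>(1,2) \<rho>(1) that(2), of \<xi>' \<tau>' X'] N_ge[of w] m
      unfolding P_def m_def b_def by linarith
  qed
  have cPz: "continuous_on UNIV (\<lambda>w. P (w - z))"
    unfolding P_def by (intro continuous_on_compose2[OF continuous_box_test[of UNIV]] continuous_intros) auto
  have cb: "continuous_on UNIV b" unfolding b_def by (intro continuous_intros cPz)
  have jb: "has_jet b y (- \<xi>' + (- X' - (4 * \<epsilon>) *\<^sub>R mat 1) *v fst (y - z)) (- \<tau>' - 4 * \<epsilon> * snd (y - z) / \<kappa>) (- X' - (4 * \<epsilon>) *\<^sub>R mat 1)" for y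
  proof (rule has_jet_of_quadratic[where K = "- (2 * \<epsilon> / \<kappa>)"])
    fix e
    have "y + e - z = (y - z) + e" by simp
    hence "b (y + e) = b y - (jet_polynomial (\<xi>' + (X' + (4 * \<epsilon>) *\<^sub>R mat 1) *v fst (y - z)) (\<tau>' + 4 * \<epsilon> * snd (y - z) / \<kappa>) (X' + (4 * \<epsilon>) *\<^sub>R mat 1) e
        + (2 * \<epsilon> / \<kappa>) * (snd e)\<^sup>2)"
      unfolding b_def P_def by (simp only: box_test_shift[OF trX])
    moreover have e1: "- X' - (4 * \<epsilon>) *\<^sub>R mat 1 = - (X' + (4 * \<epsilon>) *\<^sub>R mat 1)" by simp
    moreover have e2: "- \<xi>' + (- (X' + (4 * \<epsilon>) *\<^sub>R mat 1)) *v fst (y - z) = - (\<xi>' + (X' + (4 * \<epsilon>) *\<^sub>R mat 1) *v fst (y - z))"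
      unfolding matrix_vector_mult_uminus by (rule minus_add_distrib[symmetric])
    moreover have e3: "- \<tau>' - 4 * \<epsilon> * snd (y - z) / \<kappa> = - (\<tau>' + 4 * \<epsilon> * snd (y - z) / \<kappa>)" by simp
    ultimately show "b (y + e) = b y + jet_polynomial (- \<xi>' + (- X' - (4 * \<epsilon>) *\<^sub>R mat 1) *v fst (y - z)) (- \<tau>' - 4 * \<epsilon> * snd (y - z) / \<kappa>) (- X' - (4 * \<epsilon>) *\<^sub>R mat 1) e
        + - (2 * \<epsilon> / \<kappa>) * (snd e)\<^sup>2"
      unfolding e1 e2 e3 jet_polynomial_uminus by linarith
  qed
  define v where "v = (\<lambda>w. if w \<in> B then max (V w) (b w) else V w)"
  have Vv: "V w \<le> v w" for w unfolding v_def by simp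
  have closedB: "closed B" unfolding B_def using compact_jet_box compact_imp_closed by blast
  have uscV: "upper_semicontinuous_on Q V" and jsV: "jet_sub F S V"
    and leV: "\<And>y. y \<in> parabolic_boundary \<Omega> T \<Longrightarrow> V y \<le> g y"
    using admissible_V unfolding admissible_def by auto
  have "admissible v"
    unfolding admissible_def
  proof (intro conjI ballI)
    show "upper_semicontinuous_on Q v"
      unfolding upper_semicontinuous_on_def
    proof (intro ballI allI impI)
      fix y a assume y: "y \<in> Q" "v y < a"
      hence "V y < a" using Vv[of y] by linarith
      hence V: "\<forall>\<^sub>F w in at y within Q. V w < a" using uscV y(1) unfolding upper_semicontinuous_on_def by blast
      show "\<forall>\<^sub>F w in at y within Q. v w < a"
      proof (cases "y \<in> B")
        case True
        hence "b y < a" using y(2) unfolding v_def by simp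
        hence "\<forall>\<^sub>F w in at y within Q. b w < a"
          using continuous_on_imp_upper_semicontinuous_on[OF continuous_on_subset[OF cb subset_UNIV]] y(1)
          unfolding upper_semicontinuous_on_def by blast
        with V show ?thesis by eventually_elim (simp add: v_def)
      next
        case False
        hence "\<forall>\<^sub>F w in nhds y. w \<in> - B" using closedB by (intro eventually_nhds_in_open) auto
        hence "\<forall>\<^sub>F w in at y within Q. w \<in> - B" unfolding eventually_at_filter by eventually_elim simp
        with V show ?thesis by eventually_elim (simp add: v_def)
      qed
    qed
    show "v y \<le> g y" if "y \<in> parabolic_boundary \<Omega> T" for y
      using that leV BS boundary_Int_S unfolding v_def by auto
    show "jet_sub F S v"
      unfolding jet_sub_def
    proof (intro ballI allI impI)
      fix y \<xi>1 \<tau>1 X1 assume y: "y \<in> S" and sjv: "superjet v y \<xi>1 \<tau>1 X1"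
      show "\<tau>1 \<le> F \<xi>1 X1"
      proof (cases "v y = V y")
        case True
        have "superjet V y \<xi>1 \<tau>1 X1"
          by (rule superjet_mono[OF sjv]) (use True Vv in auto)
        thus ?thesis using jsV y unfolding jet_sub_def by blast
      next
        case False
        hence yB: "y \<in> B" "v y = b y" "V y < b y" unfolding v_def by (auto split: if_splits simp: max_def)
        have int: "norm (fst (y - z)) < \<rho>" "\<bar>snd (y - z)\<bar> < \<kappa>"
          using b_bd[OF yB(1)] yB(1,3) unfolding B_def jet_box_def by fastforce+
        have "open {w. norm (fst (w - z)) < \<rho> \<and> \<bar>snd (w - z)\<bar> < \<kappa>}"
          by (intro open_Collect_conj open_Collect_less continuous_intros)
        hence "\<forall>\<^sub>F w in at y. w \<in> {w. norm (fst (w - z)) < \<rho> \<and> \<bar>snd (w - z)\<bar> < \<kappa>}"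
          using int by (intro eventually_at_in_open') auto
        hence "\<forall>\<^sub>F w in at y. b w \<le> v w"
          by eventually_elim (auto simp: v_def B_def jet_box_def)
        with sjv yB(2) have "superjet b y \<xi>1 \<tau>1 X1" using superjet_mono by metis
        note cmp = jet_superjet_comparison[OF jb this]
        have "- \<kappa> \<le> snd (y - z)" using int(2) by linarith
        hence "4 * \<epsilon> * (- \<kappa>) \<le> 4 * \<epsilon> * snd (y - z)" using \<epsilon>(1) by (intro mult_left_mono) auto
        hence "- \<tau>' - 4 * \<epsilon> * snd (y - z) / \<kappa> \<le> - \<tau>' + 4 * \<epsilon>" using \<kappa>(1) by (simp add: field_simps)
        also have "\<dots> < F (- \<xi>' + (- X' - (4 * \<epsilon>) *\<^sub>R mat 1) *v fst (y - z)) (- X' - (4 * \<epsilon>) *\<^sub>R mat 1)"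
          using int(1) \<rho>(2) by (intro \<epsilon>(2)) simp
        also have "\<dots> \<le> F \<xi>1 X1" unfolding cmp(1) by (rule monoF) (rule cmp(3))
        finally show ?thesis unfolding cmp(2) by simp
      qed
    qed
  qed
  \<comment> \<open>Near z there is a w with V w < - N z + m/4 and P < m/4, hence V w < b w,
    although no admissible function exceeds V.\<close>
  have "open {w. P (w - z) < m / 4}" by (intro open_Collect_less cPz continuous_intros)
  moreover have "open {w. norm (fst (w - z)) < \<rho> \<and> \<bar>snd (w - z)\<bar> < \<kappa>}"
    by (intro open_Collect_conj open_Collect_less continuous_intros)
  moreover have "z \<in> {w. P (w - z) < m / 4} \<inter> {w. norm (fst (w - z)) < \<rho> \<and> \<bar>snd (w - z)\<bar> < \<kappa>}"
    unfolding P_def using m \<rho> \<kappa> by simp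
  ultimately obtain w where w: "w \<in> Q" "P (w - z) < m / 4" "norm (fst (w - z)) < \<rho>" "\<bar>snd (w - z)\<bar> < \<kappa>" "N z - m / 4 < - V w"
    using usc_envelope_approx[OF neg_V_locally_bounded zQ, of "m / 4"
      "{w. P (w - z) < m / 4} \<inter> {w. norm (fst (w - z)) < \<rho> \<and> \<bar>snd (w - z)\<bar> < \<kappa>}"] m
    unfolding N_def by auto
  have "w \<in> B" using w(3,4) unfolding B_def jet_box_def by simp
  hence "b w \<le> v w" unfolding v_def by simp
  also have "\<dots> \<le> V w" using admissible_le_V[OF \<open>admissible v\<close> w(1)] .
  finally show False using w(2,5) unfolding b_def by linarith
qed

text \<open>A lower barrier at z is itself admissible, so V stays above it near z.\<close>

lemma N_le_boundary:
  assumes z: "z \<in> parabolic_boundary \<Omega> T"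
  shows "N z \<le> - g z"
proof (rule field_le_epsilon)
  fix e :: real assume "0 < e"
  hence e: "0 < e / 2" by simp
  have zQ: "z \<in> Q" using z boundary_subset_Q by blast
  obtain v where v: "continuous_on Q v" "jet_sub F S v" "\<forall>y\<in>parabolic_boundary \<Omega> T. v y \<le> g y" "g z - e / 2 \<le> v z"
    using sub_barrier[OF z e] by blast
  hence "admissible v" unfolding admissible_def using continuous_on_imp_upper_semicontinuous_on by blast
  have "\<forall>\<^sub>F w in nhds z. w \<in> Q \<longrightarrow> - V w \<le> - v z + e / 2"
  proof (rule eventually_below[of Q "\<lambda>z. - v z"])
    show "continuous_on Q (\<lambda>z. - v z)" using v(1) by (intro continuous_intros)
    show "\<forall>\<^sub>F w in nhds z. w \<in> Q \<longrightarrow> w \<in> Q \<and> - V w \<le> - v w"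
      using admissible_le_V[OF \<open>admissible v\<close>] by (intro always_eventually) auto
  qed (use zQ e in auto)
  hence "N z \<le> - v z + e / 2" unfolding N_def by (rule usc_envelope_le[OF neg_V_locally_bounded zQ])
  thus "N z \<le> - g z + e" using v(4) by simp
qed

text \<open>Comparison puts the subsolution V below the supersolution - N, while an envelope
  satisfies the opposite inequality. This is the continuity of V.\<close>

lemma N_eq: "z \<in> Q \<Longrightarrow> N z = - V z"
proof (rule antisym)
  assume z: "z \<in> Q"
  hence "snd z < T" by auto
  then obtain T1 where T1: "snd z < T1" "T1 < T" using dense by blast
  have sub: "closure \<Omega> \<times> {0..T1} \<subseteq> Q" using T1(2) by auto
  have uN: "upper_semicontinuous_on Q N"
    unfolding N_def by (rule upper_semicontinuous_on_usc_envelope[OF neg_V_locally_bounded])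
  have "V z + N z \<le> 0"
  proof (rule comparison_upto[OF _ _ T1(2) upper_semicontinuous_on_subset[OF uN sub] _ _ z T1(1)])
    show "jet_sub (reflect F) (\<Omega> \<times> {0<..<T1}) N" by (rule jet_sub_subset[OF jet_sub_N]) (use T1 in auto)
    fix y assume "y \<in> parabolic_boundary \<Omega> T1"
    hence "y \<in> parabolic_boundary \<Omega> T" using boundary_upto_subset[OF T1(2)] by blast
    thus "V y + N y \<le> 0" using N_le_boundary[of y] admissible_V unfolding admissible_def by fastforce
  qed (use admissible_V in \<open>auto simp: admissible_def\<close>)
  thus "N z \<le> - V z" by simp
qed (rule N_ge)

theorem perron_solution:
  "\<exists>v. continuous_on Q v \<and> jet_sub F S v \<and> jet_sub (reflect F) S (\<lambda>z. - v z) \<and>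
     (\<forall>z\<in>parabolic_boundary \<Omega> T. v z = g z)"
proof (intro exI[of _ V] conjI ballI)
  have uV: "upper_semicontinuous_on Q V" and jV: "jet_sub F S V"
    and leV: "\<And>y. y \<in> parabolic_boundary \<Omega> T \<Longrightarrow> V y \<le> g y"
    using admissible_V unfolding admissible_def by auto
  have uN: "upper_semicontinuous_on Q N"
    unfolding N_def by (rule upper_semicontinuous_on_usc_envelope[OF neg_V_locally_bounded])
  show "continuous_on Q V"
    unfolding continuous_on_def
  proof (intro ballI order_tendstoI)
    fix z a assume z: "z \<in> Q" and "V z < a"
    thus "\<forall>\<^sub>F w in at z within Q. V w < a" using uV unfolding upper_semicontinuous_on_def by blast
  next
    fix z a assume z: "z \<in> Q" and "a < V z"
    hence "N z < - a" using N_eq by simp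
    hence "\<forall>\<^sub>F w in at z within Q. N w < - a" using uN z unfolding upper_semicontinuous_on_def by blast
    moreover have "\<forall>\<^sub>F w in at z within Q. w \<in> Q" by (simp add: eventually_at_filter)
    ultimately show "\<forall>\<^sub>F w in at z within Q. a < V w" by eventually_elim (use N_eq in force)
  qed
  show "jet_sub F S V" by (rule jV)
  show "jet_sub (reflect F) S (\<lambda>z. - V z)"
    unfolding jet_sub_def
  proof (intro ballI allI impI)
    fix z \<xi> \<tau> X assume z: "z \<in> S" and sj: "superjet (\<lambda>z. - V z) z \<xi> \<tau> X"
    have "\<forall>\<^sub>F w in at z. w \<in> S" using z open_S by (intro eventually_at_in_open')
    hence "\<forall>\<^sub>F w in at z. N w \<le> - V w" by eventually_elim (use N_eq S_subset_Q in force)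
    hence "superjet N z \<xi> \<tau> X" using z N_eq S_subset_Q by (intro superjet_mono[OF sj]) auto
    thus "\<tau> \<le> reflect F \<xi> X" using jet_sub_N z unfolding jet_sub_def by blast
  qed
  fix z assume z: "z \<in> parabolic_boundary \<Omega> T"
  hence "z \<in> Q" using boundary_subset_Q by blast
  thus "V z = g z" using leV[OF z] N_le_boundary[OF z] N_eq[of z] by simp
qed

end

section \<open>Barriers\<close>

text \<open>For a barrier with a full jet, ellipticity reduces the viscosity inequality for the
  logarithm to the pointwise inequality for the barrier itself.\<close>

lemma reflect_log_operator_ge_of_jet:
  assumes "2 < p" "0 < s" and jet: "has_jet s' z D \<tau> H" "s' z = s"
    and ineq: "p_laplace_form p D H \<le> (p - 1) * s powr (p - 2) * \<tau>"
    and sj: "superjet (\<lambda>w. - ln (s' w)) z \<xi>1 \<tau>1 X1"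
  shows "\<tau>1 \<le> reflect (log_operator p) \<xi>1 X1"
proof -
  let ?\<xi> = "(1 / s) *\<^sub>R D" and ?X = "(1 / s) *\<^sub>R H - outer ((1 / s) *\<^sub>R D)"
  have "has_jet (\<lambda>w. ln (s' w)) z ?\<xi> (\<tau> / s) ?X"
    using has_jet_ln[OF jet(1)] jet(2) \<open>0 < s\<close> by simp
  note cmp = jet_superjet_comparison[OF has_jet_uminus[OF this] sj]
  have le: "y \<bullet> ((- X1) *v y) \<le> y \<bullet> (?X *v y)" for y
    using cmp(3)[of y] by (simp only: matrix_vector_mult_uminus inner_minus_right)
  have "log_operator p (- \<xi>1) (- X1) \<le> log_operator p ?\<xi> ?X"
    unfolding cmp(1) minus_minus by (rule log_operator_mono) (use le assms in auto)
  moreover have "s powr (p - 2) * s * (p - 1) * log_operator p ?\<xi> ?X \<le> s powr (p - 2) * s * (p - 1) * (\<tau> / s)"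
    using ineq \<open>0 < s\<close> unfolding log_test_inequality[OF assms(1,2)] by (simp add: mult.commute mult.left_commute)
  hence "log_operator p ?\<xi> ?X \<le> \<tau> / s"
    using assms(1,2) by (subst (asm) mult_le_cancel_left_pos) auto
  ultimately show ?thesis unfolding reflect_def cmp(2) by simp
qed

lemma log_operator_ge_of_jet:
  assumes "2 < p" "0 < s" and jet: "has_jet s' z D \<tau> H" "s' z = s"
    and ineq: "(p - 1) * s powr (p - 2) * \<tau> \<le> p_laplace_form p D H"
    and sj: "superjet (\<lambda>w. ln (s' w)) z \<xi>1 \<tau>1 X1"
  shows "\<tau>1 \<le> log_operator p \<xi>1 X1"
proof -
  let ?\<xi> = "(1 / s) *\<^sub>R D" and ?X = "(1 / s) *\<^sub>R H - outer ((1 / s) *\<^sub>R D)"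
  have "has_jet (\<lambda>w. ln (s' w)) z ?\<xi> (\<tau> / s) ?X"
    using has_jet_ln[OF jet(1)] jet(2) \<open>0 < s\<close> by simp
  note cmp = jet_superjet_comparison[OF this sj]
  have "log_operator p ?\<xi> ?X \<le> log_operator p \<xi>1 X1"
    unfolding cmp(1) by (rule log_operator_mono) (use cmp(3) assms in auto)
  moreover have "s powr (p - 2) * s * (p - 1) * (\<tau> / s) \<le> s powr (p - 2) * s * (p - 1) * log_operator p ?\<xi> ?X"
    using ineq \<open>0 < s\<close> unfolding log_test_inequality[OF assms(1,2)] by (simp add: mult.commute mult.left_commute)
  hence "\<tau> / s \<le> log_operator p ?\<xi> ?X"
    using assms(1,2) by (subst (asm) mult_le_cancel_left_pos) auto
  ultimately show ?thesis unfolding cmp(2) by simp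
qed

lemma log_operator_0: "2 < p \<Longrightarrow> log_operator p 0 0 = 0"
  by (simp add: log_operator_def p_laplace_form_def)

lemma has_jet_const: "has_jet (\<lambda>w. c) z 0 0 0"
  by (simp add: has_jet_def jet_polynomial_def)

text \<open>The constant m is a solution. Truncating there keeps the logarithm defined and confines
  the differential inequality to points with s > m, where s^(p - 2) is bounded below.\<close>

lemma jet_sub_ln_max:
  fixes s :: "(real ^ 'n) \<times> real \<Rightarrow> real"
  assumes p: "2 < p" and "0 < m" and "open S"
    and jets: "\<And>z. z \<in> S \<Longrightarrow> m < s z \<Longrightarrow> \<exists>D \<tau> H. has_jet s z D \<tau> H \<and> (p - 1) * s z powr (p - 2) * \<tau> \<le> p_laplace_form p D H"
  shows "jet_sub (log_operator p) S (\<lambda>z. ln (max (s z) m))"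
  unfolding jet_sub_def
proof (intro ballI allI impI)
  fix z and \<xi> :: "real ^ 'n" and \<tau> X assume z: "z \<in> S" and sj: "superjet (\<lambda>z. ln (max (s z) m)) z \<xi> \<tau> X"
  show "\<tau> \<le> log_operator p \<xi> X"
  proof (cases "m < s z")
    case True
    then obtain D \<tau>' H where j: "has_jet s z D \<tau>' H" "(p - 1) * s z powr (p - 2) * \<tau>' \<le> p_laplace_form p D H"
      using jets[OF z] by blast
    have "\<forall>\<^sub>F w in at z. m < s w" using order_tendstoD(1)[OF has_jet_tendsto[OF j(1)] True] .
    hence "\<forall>\<^sub>F w in at z. ln (s w) \<le> ln (max (s w) m)" by eventually_elim simp
    hence "superjet (\<lambda>w. ln (s w)) z \<xi> \<tau> X" by (intro superjet_mono[OF sj]) (use True in auto)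
    thus ?thesis using log_operator_ge_of_jet[OF p _ j(1) refl j(2)] True \<open>0 < m\<close> by auto
  next
    case False
    \<comment> \<open>Where the constant is active, a superjet has zero gradient and time slope and
      a nonnegative Hessian.\<close>
    have "superjet (\<lambda>w. ln m) z \<xi> \<tau> X"
      by (rule superjet_mono[OF sj]) (use False \<open>0 < m\<close> in \<open>auto simp: max_def\<close>)
    note cmp = jet_superjet_comparison[OF has_jet_const this]
    have "log_operator p (0 :: real ^ 'n) 0 \<le> log_operator p \<xi> X"
      unfolding cmp(1) by (rule log_operator_mono) (use cmp(3) p in auto)
    thus ?thesis unfolding cmp(2) log_operator_0[OF p] .
  qed
qed

lemma jet_sub_reflect_ln:
  fixes s :: "(real ^ 'n) \<times> real \<Rightarrow> real"
  assumes p: "2 < p" and pos: "\<And>z. z \<in> S \<Longrightarrow> 0 < s z"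
    and jets: "\<And>z. z \<in> S \<Longrightarrow> \<exists>D \<tau> H. has_jet s z D \<tau> H \<and> p_laplace_form p D H \<le> (p - 1) * s z powr (p - 2) * \<tau>"
  shows "jet_sub (reflect (log_operator p)) S (\<lambda>z. - ln (s z))"
  unfolding jet_sub_def
proof (intro ballI allI impI)
  fix z \<xi> \<tau> X assume z: "z \<in> S" and sj: "superjet (\<lambda>z. - ln (s z)) z \<xi> \<tau> X"
  obtain D \<tau>' H where j: "has_jet s z D \<tau>' H" "p_laplace_form p D H \<le> (p - 1) * s z powr (p - 2) * \<tau>'"
    using jets[OF z] by blast
  show "\<tau> \<le> reflect (log_operator p) \<xi> X" by (rule reflect_log_operator_ge_of_jet[OF p pos[OF z] j(1) refl j(2) sj])
qed

lemma has_jet_add: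
  assumes "has_jet U z \<xi> \<tau> X" "has_jet f z \<xi>' \<tau>' X'"
  shows "has_jet (\<lambda>w. U w + f w) z (\<xi> + \<xi>') (\<tau> + \<tau>') (X + X')"
  unfolding has_jet_def
proof (intro allI impI)
  fix \<epsilon> :: real assume "0 < \<epsilon>"
  hence "0 < \<epsilon> / 2" by simp
  with assms have "\<forall>\<^sub>F w in at z. \<bar>U w - U z - jet_polynomial \<xi> \<tau> X (w - z)\<bar> \<le> \<epsilon> / 2 * parabolic_size (w - z)"
    "\<forall>\<^sub>F w in at z. \<bar>f w - f z - jet_polynomial \<xi>' \<tau>' X' (w - z)\<bar> \<le> \<epsilon> / 2 * parabolic_size (w - z)"
    unfolding has_jet_def by blast+
  thus "\<forall>\<^sub>F w in at z. \<bar>U w + f w - (U z + f z) - jet_polynomial (\<xi> + \<xi>') (\<tau> + \<tau>') (X + X') (w - z)\<bar> \<le> \<epsilon> * parabolic_size (w - z)"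
  proof eventually_elim
    case (elim w)
    have "jet_polynomial (\<xi> + \<xi>') (\<tau> + \<tau>') (X + X') d = jet_polynomial \<xi> \<tau> X d + jet_polynomial \<xi>' \<tau>' X' d" for d
      by (simp add: jet_polynomial_def inner_add_left distrib_right matrix_vector_mult_add_rdistrib inner_add_right add_divide_distrib)
    moreover have "\<epsilon> * parabolic_size (w - z) = \<epsilon> / 2 * parabolic_size (w - z) + \<epsilon> / 2 * parabolic_size (w - z)" by simp
    ultimately show ?case using elim unfolding abs_le_iff by simp
  qed
qed

text \<open>The profile is a function of |x - x0|^2, whose jet is exact everywhere, so that no
  derivative of the norm enters.\<close>

lemma radial_jet:
  fixes z :: "(real ^ 'n) \<times> real"
  assumes "\<And>\<epsilon>. 0 < \<epsilon> \<Longrightarrow> \<forall>\<^sub>F s in nhds ((norm (fst z - x0))\<^sup>2).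
       \<bar>\<phi> s - \<phi> ((norm (fst z - x0))\<^sup>2) - \<phi>1 * (s - (norm (fst z - x0))\<^sup>2) - \<phi>2 / 2 * (s - (norm (fst z - x0))\<^sup>2)\<^sup>2\<bar>
         \<le> \<epsilon> * (s - (norm (fst z - x0))\<^sup>2)\<^sup>2"
    and k: "(k has_real_derivative k') (at (snd z))"
  shows "has_jet (\<lambda>w. \<phi> ((norm (fst w - x0))\<^sup>2) + k (snd w)) z ((2 * \<phi>1) *\<^sub>R (fst z - x0)) k'
     ((2 * \<phi>1) *\<^sub>R mat 1 + \<phi>2 *\<^sub>R outer (2 *\<^sub>R (fst z - x0)))"
proof -
  have "has_jet (\<lambda>w. (norm (fst w - x0))\<^sup>2) z (2 *\<^sub>R (fst z - x0)) 0 (2 *\<^sub>R mat 1)"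
  proof (rule has_jet_of_quadratic[where K = 0])
    fix e
    have "fst (z + e) - x0 = (fst z - x0) + fst e" by simp
    thus "(norm (fst (z + e) - x0))\<^sup>2 = (norm (fst z - x0))\<^sup>2 + jet_polynomial (2 *\<^sub>R (fst z - x0)) 0 (2 *\<^sub>R mat 1) e + 0 * (snd e)\<^sup>2"
      by (simp only: power2_norm_eq_inner jet_polynomial_def)
         (simp add: inner_add_left inner_add_right inner_commute flip: scaleR_matrix_vector_assoc)
  qed
  from has_jet_add[OF has_jet_compose[OF this assms(1)] has_jet_time[OF k]]
  show ?thesis by (simp add: mult.commute)
qed

text \<open>The gradient is an eigenvector of the Hessian, so the quadratic form is an eigenvalue
  times the squared norm of the gradient.\<close>

lemma p_laplace_form_radial:
  fixes d :: "real ^ 'n"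
  assumes "2 < p"
  shows "p_laplace_form p ((2 * \<phi>1) *\<^sub>R d) ((2 * \<phi>1) *\<^sub>R mat 1 + \<phi>2 *\<^sub>R outer (2 *\<^sub>R d))
    = norm ((2 * \<phi>1) *\<^sub>R d) powr (p - 2) * (2 * \<phi>1 * (real CARD('n) + p - 2) + 4 * \<phi>2 * (norm d)\<^sup>2 * (p - 1))"
proof (cases "(2 * \<phi>1) *\<^sub>R d = 0")
  case True
  show ?thesis unfolding p_laplace_form_def True by (simp add: matrix_vector_mult_0_right)
next
  case False
  define D where "D = (2 * \<phi>1) *\<^sub>R d"
  define H where "H = (2 * \<phi>1) *\<^sub>R mat 1 + \<phi>2 *\<^sub>R outer (2 *\<^sub>R d)"
  have n: "0 < norm D" using False unfolding D_def by simp
  have tr: "trace H = 2 * \<phi>1 * real CARD('n) + 4 * \<phi>2 * (norm d)\<^sup>2"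
    unfolding H_def by (simp add: trace_add trace_scaleR trace_outer trace_I power_mult_distrib)
  have "H *v D = (2 * \<phi>1 + 4 * \<phi>2 * (norm d)\<^sup>2) *\<^sub>R D"
    unfolding H_def D_def
    by (simp add: matrix_vector_mult_add_rdistrib outer_mult_vec power2_norm_eq_inner algebra_simps matrix_vector_mult_scaleR
        flip: scaleR_matrix_vector_assoc)
  hence q: "D \<bullet> (H *v D) = (2 * \<phi>1 + 4 * \<phi>2 * (norm d)\<^sup>2) * (norm D)\<^sup>2" by (simp add: power2_norm_eq_inner)
  have pw: "norm D powr (p - 4) * (norm D)\<^sup>2 = norm D powr (p - 2)"
    using n powr_add[of "norm D" "p - 4" 2] by (simp add: powr_numeral)
  have "p_laplace_form p D H = norm D powr (p - 2) * trace H
      + (p - 2) * (2 * \<phi>1 + 4 * \<phi>2 * (norm d)\<^sup>2) * (norm D powr (p - 4) * (norm D)\<^sup>2)"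
    unfolding p_laplace_form_def q by (simp add: algebra_simps)
  also have "\<dots> = norm D powr (p - 2) * (2 * \<phi>1 * (real CARD('n) + p - 2) + 4 * \<phi>2 * (norm d)\<^sup>2 * (p - 1))"
    unfolding pw tr by (simp add: algebra_simps)
  finally show ?thesis unfolding D_def H_def .
qed

lemma quadratic_barrier_jet:
  fixes z :: "(real ^ 'n) \<times> real"
  assumes "2 < p" and k: "(k has_real_derivative k') (at (snd z))"
  shows "\<exists>D H. has_jet (\<lambda>w. A * (norm (fst w - x0))\<^sup>2 + k (snd w)) z D k' H \<and>
     p_laplace_form p D H = (2 * \<bar>A\<bar> * norm (fst z - x0)) powr (p - 2) * (2 * A * (real CARD('n) + p - 2))"
proof -
  have "has_jet (\<lambda>w. A * (norm (fst w - x0))\<^sup>2 + k (snd w)) z ((2 * A) *\<^sub>R (fst z - x0)) k'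
     ((2 * A) *\<^sub>R mat 1 + 0 *\<^sub>R outer (2 *\<^sub>R (fst z - x0)))"
    by (rule radial_jet[OF _ k]) (auto simp: algebra_simps)
  moreover note p_laplace_form_radial[OF assms(1), of A "fst z - x0" 0]
  ultimately show ?thesis by (intro exI conjI) (assumption, simp add: abs_mult)
qed

text \<open>When \<alpha> is below (p - n)/(p - 1), the sign is opposite to that of A: positive A
  suits barriers from above and negative A those from below. The power of |x - x0| is that of the
  p-Laplacian of |x - x0|^\<alpha>.\<close>

lemma power_barrier_jet:
  fixes z :: "(real ^ 'n) \<times> real"
  assumes p: "2 < p" and k: "(k has_real_derivative k') (at (snd z))" and "fst z \<noteq> x0" "0 < \<alpha>" "A \<noteq> 0"
  shows "\<exists>D H. has_jet (\<lambda>w. A * ((norm (fst w - x0))\<^sup>2) powr (\<alpha> / 2) + k (snd w)) z D k' H \<and>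
     p_laplace_form p D H = - (sgn A * ((p - real CARD('n) - \<alpha> * (p - 1)) * (\<bar>A\<bar> * \<alpha>) powr (p - 1)
        * norm (fst z - x0) powr (- ((1 - \<alpha>) * (p - 1) + 1))))"
proof -
  define r where "r = norm (fst z - x0)"
  have r: "0 < r" unfolding r_def using assms(3) by simp
  have r2: "0 < r\<^sup>2" "r\<^sup>2 = r powr 2" using r by (auto simp: powr_numeral)
  define \<phi>' where "\<phi>' = (\<lambda>s. A * (\<alpha> / 2 * s powr (\<alpha> / 2 - 1)))"
  define \<phi>2 where "\<phi>2 = A * (\<alpha> / 2 * ((\<alpha> / 2 - 1) * (r\<^sup>2) powr (\<alpha> / 2 - 2)))"
  have "\<forall>\<^sub>F s in nhds (r\<^sup>2). \<bar>A * s powr (\<alpha> / 2) - A * (r\<^sup>2) powr (\<alpha> / 2) - \<phi>' (r\<^sup>2) * (s - r\<^sup>2) - \<phi>2 / 2 * (s - r\<^sup>2)\<^sup>2\<bar> \<le> \<epsilon> * (s - r\<^sup>2)\<^sup>2"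
    if "0 < \<epsilon>" for \<epsilon>
  proof (rule second_order_expansion_real[OF _ _ that])
    have "\<forall>\<^sub>F s in nhds (r\<^sup>2). s \<in> {0<..}" using r2 by (intro eventually_nhds_in_open) auto
    thus "\<forall>\<^sub>F s in nhds (r\<^sup>2). ((\<lambda>s. A * s powr (\<alpha> / 2)) has_real_derivative \<phi>' s) (at s)"
      by eventually_elim (auto intro!: derivative_eq_intros simp: \<phi>'_def)
    show "(\<phi>' has_real_derivative \<phi>2) (at (r\<^sup>2))"
      unfolding \<phi>'_def \<phi>2_def using r2 by (auto intro!: derivative_eq_intros)
  qed
  hence jet: "has_jet (\<lambda>w. A * ((norm (fst w - x0))\<^sup>2) powr (\<alpha> / 2) + k (snd w)) z ((2 * \<phi>' (r\<^sup>2)) *\<^sub>R (fst z - x0)) k'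
     ((2 * \<phi>' (r\<^sup>2)) *\<^sub>R mat 1 + \<phi>2 *\<^sub>R outer (2 *\<^sub>R (fst z - x0)))"
    unfolding r_def by (intro radial_jet k)
  have e1: "(r\<^sup>2) powr (\<alpha> / 2 - 1) = r powr (\<alpha> - 2)" "(r\<^sup>2) powr (\<alpha> / 2 - 2) * r\<^sup>2 = r powr (\<alpha> - 2)"
  proof -
    show "(r\<^sup>2) powr (\<alpha> / 2 - 1) = r powr (\<alpha> - 2)" unfolding r2(2) powr_powr by (simp add: algebra_simps)
    show "(r\<^sup>2) powr (\<alpha> / 2 - 2) * r\<^sup>2 = r powr (\<alpha> - 2)" unfolding r2(2) powr_powr by (simp add: algebra_simps flip: powr_add)
  qed
  have \<phi>1: "2 * \<phi>' (r\<^sup>2) = A * \<alpha> * r powr (\<alpha> - 2)" unfolding \<phi>'_def e1 by simp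
  have \<phi>2r: "4 * \<phi>2 * r\<^sup>2 = A * \<alpha> * (\<alpha> - 2) * r powr (\<alpha> - 2)"
  proof -
    have "4 * \<phi>2 * r\<^sup>2 = A * \<alpha> * (\<alpha> - 2) * ((r\<^sup>2) powr (\<alpha> / 2 - 2) * r\<^sup>2)" unfolding \<phi>2_def by (simp add: algebra_simps)
    thus ?thesis unfolding e1 .
  qed
  have nD: "norm ((2 * \<phi>' (r\<^sup>2)) *\<^sub>R (fst z - x0)) = (\<bar>A\<bar> * \<alpha>) * r powr (\<alpha> - 1)"
  proof -
    have "norm ((2 * \<phi>' (r\<^sup>2)) *\<^sub>R (fst z - x0)) = \<bar>A\<bar> * \<alpha> * (r powr (\<alpha> - 2) * r)"
      unfolding \<phi>1 norm_scaleR r_def[symmetric] using \<open>0 < \<alpha>\<close> r by (simp add: abs_mult)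
    moreover have "r powr (\<alpha> - 2) * r = r powr (\<alpha> - 1)" using powr_add[of r "\<alpha> - 2" 1] r by simp
    ultimately show ?thesis by simp
  qed
  have "p_laplace_form p ((2 * \<phi>' (r\<^sup>2)) *\<^sub>R (fst z - x0)) ((2 * \<phi>' (r\<^sup>2)) *\<^sub>R mat 1 + \<phi>2 *\<^sub>R outer (2 *\<^sub>R (fst z - x0)))
      = ((\<bar>A\<bar> * \<alpha>) * r powr (\<alpha> - 1)) powr (p - 2) * (A * \<alpha> * r powr (\<alpha> - 2) * (real CARD('n) + p - 2) + A * \<alpha> * (\<alpha> - 2) * r powr (\<alpha> - 2) * (p - 1))"
    unfolding p_laplace_form_radial[OF p] nD unfolding r_def[symmetric] \<phi>1 \<phi>2r ..
  also have "A * \<alpha> * r powr (\<alpha> - 2) * (real CARD('n) + p - 2) + A * \<alpha> * (\<alpha> - 2) * r powr (\<alpha> - 2) * (p - 1)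
      = - (sgn A * (p - real CARD('n) - \<alpha> * (p - 1)) * (\<bar>A\<bar> * \<alpha>) * r powr (\<alpha> - 2))"
  proof -
    have e: "sgn A * \<nu> * (\<bar>A\<bar> * \<alpha>) * q = A * (\<nu> * \<alpha> * q)" for \<nu> q
      using \<open>A \<noteq> 0\<close> by (cases "0 < A") auto
    show ?thesis unfolding e by (simp add: algebra_simps)
  qed
  also have "((\<bar>A\<bar> * \<alpha>) * r powr (\<alpha> - 1)) powr (p - 2) = (\<bar>A\<bar> * \<alpha>) powr (p - 2) * r powr ((\<alpha> - 1) * (p - 2))"
    using \<open>0 < \<alpha>\<close> by (simp add: powr_mult powr_powr)
  also have "\<dots> * - (sgn A * (p - real CARD('n) - \<alpha> * (p - 1)) * (\<bar>A\<bar> * \<alpha>) * r powr (\<alpha> - 2))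
      = - (sgn A * ((p - real CARD('n) - \<alpha> * (p - 1)) * ((\<bar>A\<bar> * \<alpha>) powr (p - 2) * (\<bar>A\<bar> * \<alpha>)) * (r powr ((\<alpha> - 1) * (p - 2)) * r powr (\<alpha> - 2))))"
    by (simp add: mult.commute mult.left_commute)
  also have "(\<bar>A\<bar> * \<alpha>) powr (p - 2) * (\<bar>A\<bar> * \<alpha>) = (\<bar>A\<bar> * \<alpha>) powr (p - 1)"
    using powr_minus_one[of "\<bar>A\<bar> * \<alpha>" p] assms by simp
  also have "r powr ((\<alpha> - 1) * (p - 2)) * r powr (\<alpha> - 2) = r powr (- ((1 - \<alpha>) * (p - 1) + 1))"
    by (simp add: algebra_simps flip: powr_add)
  finally show ?thesis using jet unfolding r_def by blast
qed

section \<open>Barriers for the given boundary values\<close>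

locale dirichlet_data =
  fixes \<Omega> :: "(real ^ 'n) set" and T p :: real and h :: "(real ^ 'n) \<times> real \<Rightarrow> real" and m :: real
  assumes \<Omega>: "open \<Omega>" "bounded \<Omega>" "\<Omega> \<noteq> {}" and T: "0 < T" and p: "2 < p" "real CARD('n) < p"
    and cont_h: "continuous_on (parabolic_boundary \<Omega> T) h"
    and m: "0 < m" "\<And>z. z \<in> parabolic_boundary \<Omega> T \<Longrightarrow> m \<le> h z"
begin

lemma h_pos: "z \<in> parabolic_boundary \<Omega> T \<Longrightarrow> 0 < h z"
  using m by fastforce

text \<open>Up to a time T1 < T the parabolic boundary sits in a compact part of itself, with
  closure \<Omega> as the bottom; up to T the values may be unbounded.\<close>

lemma boundary_values_bounded:
  assumes "T1 < T"
  obtains M where "0 < M" "\<And>z. z \<in> parabolic_boundary \<Omega> T1 \<Longrightarrow> h z \<le> M"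
proof -
  define K where "K = closure \<Omega> \<times> {0} \<union> frontier \<Omega> \<times> {0..T1}"
  have "compact K" unfolding K_def
    using \<Omega>(2) by (intro compact_Un compact_Times compact_frontier_bounded) auto
  moreover have "K \<subseteq> parabolic_boundary \<Omega> T"
    using assms T \<Omega>(1) unfolding K_def parabolic_boundary_def frontier_def by (auto simp: interior_open)
  ultimately have "compact (h ` K)" using cont_h continuous_on_subset compact_continuous_image by blast
  then obtain M where M: "0 < M" "\<forall>y\<in>h ` K. norm y \<le> M" using compact_imp_bounded bounded_pos by blast
  moreover have "parabolic_boundary \<Omega> T1 \<subseteq> K"
    using closure_subset[of \<Omega>] unfolding K_def parabolic_boundary_def by auto
  ultimately show thesis by (intro that[of M]) force+
qed

lemma boundary_values_near:
  assumes "z0 \<in> parabolic_boundary \<Omega> T"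
  shows "h z0 < c \<Longrightarrow> \<exists>\<delta>>0. \<forall>z\<in>parabolic_boundary \<Omega> T. norm (fst z - fst z0) < \<delta> \<longrightarrow> \<bar>snd z - snd z0\<bar> < \<delta> \<longrightarrow> h z \<le> c"
    and "c < h z0 \<Longrightarrow> \<exists>\<delta>>0. \<forall>z\<in>parabolic_boundary \<Omega> T. norm (fst z - fst z0) < \<delta> \<longrightarrow> \<bar>snd z - snd z0\<bar> < \<delta> \<longrightarrow> c \<le> h z"
proof -
  have lim: "(h \<longlongrightarrow> h z0) (at z0 within parabolic_boundary \<Omega> T)"
    using cont_h assms unfolding continuous_on_def by blast
  have box: "\<exists>\<delta>>0. \<forall>z\<in>parabolic_boundary \<Omega> T. norm (fst z - fst z0) < \<delta> \<longrightarrow> \<bar>snd z - snd z0\<bar> < \<delta> \<longrightarrow> P z"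
    if ev: "\<forall>\<^sub>F z in at z0 within parabolic_boundary \<Omega> T. P z" and "P z0" for P
  proof -
    obtain d where d: "0 < d" "\<And>z. z \<in> parabolic_boundary \<Omega> T \<Longrightarrow> z \<noteq> z0 \<Longrightarrow> dist z z0 < d \<Longrightarrow> P z"
      using ev unfolding eventually_at by auto
    have "P z" if z: "z \<in> parabolic_boundary \<Omega> T" "norm (fst z - fst z0) < d / 2" "\<bar>snd z - snd z0\<bar> < d / 2" for z
    proof (cases "z = z0")
      case False
      have "dist z z0 \<le> norm (fst (z - z0)) + norm (snd (z - z0))"
        unfolding dist_norm using norm_Pair_le[of "fst (z - z0)" "snd (z - z0)"] by (simp only: prod.collapse)
      also have "\<dots> < d" using z(2,3) by simp
      finally show ?thesis using d(2)[OF z(1) False] by blast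
    qed (use \<open>P z0\<close> in simp)
    thus ?thesis using d(1) by (intro exI[of _ "d / 2"]) auto
  qed
  show "h z0 < c \<Longrightarrow> \<exists>\<delta>>0. \<forall>z\<in>parabolic_boundary \<Omega> T. norm (fst z - fst z0) < \<delta> \<longrightarrow> \<bar>snd z - snd z0\<bar> < \<delta> \<longrightarrow> h z \<le> c"
    by (rule box) (use order_tendstoD(2)[OF lim, of c] in \<open>auto elim: eventually_mono\<close>)
  show "c < h z0 \<Longrightarrow> \<exists>\<delta>>0. \<forall>z\<in>parabolic_boundary \<Omega> T. norm (fst z - fst z0) < \<delta> \<longrightarrow> \<bar>snd z - snd z0\<bar> < \<delta> \<longrightarrow> c \<le> h z"
    by (rule box) (use order_tendstoD(1)[OF lim, of c] in \<open>auto elim: eventually_mono\<close>)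
qed

lemma domain_radius:
  obtains R where "1 \<le> R" "\<And>x. x \<in> closure \<Omega> \<Longrightarrow> norm (x - x0) \<le> R"
proof -
  have "bounded (closure \<Omega>)" using \<Omega>(2) by (rule bounded_closure)
  then obtain B where B: "\<And>x. x \<in> closure \<Omega> \<Longrightarrow> norm x \<le> B" unfolding bounded_iff by blast
  have "norm (x - x0) \<le> max 1 (B + norm x0)" if "x \<in> closure \<Omega>" for x
    using B[OF that] norm_triangle_ineq4[of x x0] by linarith
  thus thesis by (intro that[of "max 1 (B + norm x0)"]) auto
qed

text \<open>This exponent is below \<open>(p - n)/(p - 1)\<close>, the homogeneity of the fundamental solution of the
  p-Laplacian; here \<open>n < p\<close> is used.\<close>

definition "\<alpha> = (p - real CARD('n)) / (2 * (p - 1))"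
text \<open>\<open>\<nu>\<close> and \<open>\<beta>\<close> are the factor and the negated exponent
  of |x - x0| in \<open>power_barrier_jet\<close>; with this \<alpha>, \<nu> is (p - n)/2.\<close>

definition "\<nu> = p - real CARD('n) - \<alpha> * (p - 1)"
definition "\<beta> = (1 - \<alpha>) * (p - 1) + 1"

lemma exponents: "0 < \<alpha>" "0 < \<nu>" "0 < \<beta>"
proof -
  show "0 < \<alpha>" unfolding \<alpha>_def using p by simp
  have "q / (2 * r) * r = q / 2" if "0 < r" for q r :: real using that by simp
  from this[of "p - 1" "p - real CARD('n)"] have "\<alpha> * (p - 1) = (p - real CARD('n)) / 2"
    unfolding \<alpha>_def using p by linarith
  moreover have "1 \<le> real CARD('n)" by (simp add: Suc_leI)
  ultimately show "0 < \<nu>" "0 < \<beta>" unfolding \<nu>_def \<beta>_def using p by (auto simp: algebra_simps)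
qed

text \<open>The exponent is negative, so the diameter bound R gives a bound from below. The power
  A^(p - 1) is split so that A^(p - 2) can match the weight u^(p - 2) and one factor A remains in
  hand.\<close>

lemma lateral_bound:
  assumes "x \<in> \<Omega>" "x \<noteq> x0" "norm (x - x0) \<le> R" "1 \<le> A"
  shows "A powr (p - 2) * (A * (\<nu> * \<alpha> powr (p - 1) * R powr (- \<beta>))) \<le> \<nu> * (A * \<alpha>) powr (p - 1) * norm (x - x0) powr (- \<beta>)"
proof -
  have r: "0 < norm (x - x0)" using assms(2) by simp
  have "R powr (- \<beta>) \<le> norm (x - x0) powr (- \<beta>)"
    using r assms(3) exponents by (intro powr_mono2') auto
  hence "\<nu> * (A * \<alpha>) powr (p - 1) * R powr (- \<beta>) \<le> \<nu> * (A * \<alpha>) powr (p - 1) * norm (x - x0) powr (- \<beta>)"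
    using exponents by (intro mult_left_mono) auto
  moreover have "(A * \<alpha>) powr (p - 1) = A powr (p - 2) * A * \<alpha> powr (p - 1)"
    using powr_minus_one[of A p] assms(4) exponents by (simp add: powr_mult)
  ultimately show ?thesis by (simp add: ac_simps)
qed

lemma continuous_power_profile:
  "0 < a \<Longrightarrow> continuous_on X (\<lambda>w :: (real ^ 'n) \<times> real. ((norm (fst w - x0))\<^sup>2) powr a)"
  by (intro continuous_on_powr' continuous_intros) auto

lemma power_profile_eq: "((norm (d :: real ^ 'n))\<^sup>2) powr (\<alpha> / 2) = norm d powr \<alpha>"
proof (cases "d = 0")
  case False
  hence "((norm d)\<^sup>2) powr (\<alpha> / 2) = (norm d powr 2) powr (\<alpha> / 2)" by (simp add: powr_numeral)
  thus ?thesis unfolding powr_powr by simp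
qed simp

lemma outside_cases:
  assumes "\<And>z. z \<in> B \<Longrightarrow> norm (fst z - x0) < \<delta> \<Longrightarrow> \<bar>snd z - t0\<bar> < \<delta> \<Longrightarrow> P z"
    and "\<And>z. z \<in> B \<Longrightarrow> \<delta> \<le> norm (fst z - x0) \<Longrightarrow> P z" "\<And>z. z \<in> B \<Longrightarrow> \<delta> \<le> \<bar>snd z - t0\<bar> \<Longrightarrow> P z" and "z \<in> B"
  shows "P z"
  using assms by (meson not_le)

text \<open>Within the \<delta>-box about z0 the constant c, slightly larger than h z0, dominates h.
  Outside it one of the two growth terms exceeds the bound M of h up to T1.\<close>

lemma super_barrier_exists:
  assumes z0: "z0 \<in> parabolic_boundary \<Omega> T" and \<epsilon>: "0 < \<epsilon>" and T1: "snd z0 < T1" "T1 < T"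
  shows "\<exists>s. continuous_on (closure \<Omega> \<times> {0..T1}) s \<and>
      jet_sub (reflect (log_operator p)) (\<Omega> \<times> {0<..<T1}) (\<lambda>z. - s z) \<and>
      (\<forall>z\<in>parabolic_boundary \<Omega> T1. ln (h z) \<le> s z) \<and> s z0 \<le> ln (h z0) + \<epsilon>"
proof -
  obtain x0 t0 where z0eq: "z0 = (x0, t0)" by (cases z0)
  define c where "c = exp \<epsilon> * h z0"
  have c: "0 < c" "h z0 < c" "ln c = ln (h z0) + \<epsilon>"
    unfolding c_def using h_pos[OF z0] \<epsilon> by (auto simp: ln_mult)
  obtain \<delta> where \<delta>: "0 < \<delta>" "\<And>z. z \<in> parabolic_boundary \<Omega> T \<Longrightarrow> norm (fst z - x0) < \<delta> \<Longrightarrow> \<bar>snd z - t0\<bar> < \<delta> \<Longrightarrow> h z \<le> c"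
    using boundary_values_near(1)[OF z0 c(2)] unfolding z0eq by auto
  obtain M where M: "0 < M" "\<And>z. z \<in> parabolic_boundary \<Omega> T1 \<Longrightarrow> h z \<le> M" using boundary_values_bounded[OF T1(2)] by blast
  obtain R where R: "1 \<le> R" "\<And>x. x \<in> closure \<Omega> \<Longrightarrow> norm (x - x0) \<le> R" using domain_radius by blast
  have sub: "z \<in> parabolic_boundary \<Omega> T" "0 \<le> snd z" "fst z \<in> closure \<Omega>" if "z \<in> parabolic_boundary \<Omega> T1" for z
    using that T1 closure_subset[of \<Omega>] unfolding parabolic_boundary_def frontier_def by auto
  have conclude: ?thesis
    if cu: "continuous_on (closure \<Omega> \<times> {0..T1}) u" and uc: "\<And>z. z \<in> closure \<Omega> \<times> {0..T1} \<union> parabolic_boundary \<Omega> T1 \<Longrightarrow> c \<le> u z" and u0: "u z0 = c"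
      and jets: "\<And>z. z \<in> \<Omega> \<times> {0<..<T1} \<Longrightarrow> \<exists>D \<tau> H. has_jet u z D \<tau> H \<and> p_laplace_form p D H \<le> (p - 1) * u z powr (p - 2) * \<tau>"
      and far: "\<And>z. z \<in> parabolic_boundary \<Omega> T1 \<Longrightarrow> \<delta> \<le> norm (fst z - x0) \<Longrightarrow> M \<le> u z"
        "\<And>z. z \<in> parabolic_boundary \<Omega> T1 \<Longrightarrow> \<delta> \<le> \<bar>snd z - t0\<bar> \<Longrightarrow> M \<le> u z" for u
  proof (intro exI[of _ "\<lambda>z. ln (u z)"] conjI ballI)
    have pos: "0 < u z" if "z \<in> closure \<Omega> \<times> {0..T1}" for z using uc[of z] that c(1) by auto
    show "continuous_on (closure \<Omega> \<times> {0..T1}) (\<lambda>z. ln (u z))"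
      using pos by (intro continuous_on_ln cu) fastforce
    show "jet_sub (reflect (log_operator p)) (\<Omega> \<times> {0<..<T1}) (\<lambda>z. - ln (u z))"
    proof (rule jet_sub_reflect_ln[OF p(1) _ jets])
      fix z assume "z \<in> \<Omega> \<times> {0<..<T1}"
      hence "z \<in> closure \<Omega> \<times> {0..T1}" using closure_subset[of \<Omega>] by auto
      thus "0 < u z" by (rule pos)
    qed
    show "ln (u z0) \<le> ln (h z0) + \<epsilon>" using u0 c by simp
    fix z assume z: "z \<in> parabolic_boundary \<Omega> T1"
    have "h z \<le> u z"
    proof (rule outside_cases[OF _ _ _ z])
      fix y assume y: "y \<in> parabolic_boundary \<Omega> T1"
      show "norm (fst y - x0) < \<delta> \<Longrightarrow> \<bar>snd y - t0\<bar> < \<delta> \<Longrightarrow> h y \<le> u y"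
        using \<delta>(2)[OF sub(1)[OF y]] uc[of y] y by auto
      show "\<delta> \<le> norm (fst y - x0) \<Longrightarrow> h y \<le> u y" using far(1)[OF y] M(2)[OF y] by linarith
      show "\<delta> \<le> \<bar>snd y - t0\<bar> \<Longrightarrow> h y \<le> u y" using far(2)[OF y] M(2)[OF y] by linarith
    qed
    thus "ln (h z) \<le> ln (u z)" using h_pos[OF sub(1)[OF z]] by simp
  qed
  show ?thesis
  proof (cases "x0 \<in> \<Omega>")
    case True
    hence t0: "t0 = 0" using z0 \<Omega>(1) unfolding z0eq parabolic_boundary_def frontier_def by (auto simp: interior_open)
    define A where "A = M / \<delta>\<^sup>2"
    define C where "C = (2 * A * R) powr (p - 2) * (2 * A * (real CARD('n) + p - 2))"
    \<comment> \<open>The first summand exceeds M at times beyond \<delta>; the second pays for the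
      p-Laplacian of the paraboloid, using u \<ge> c in the weight u^(p - 2).\<close>
    define B where "B = M / \<delta> + C / ((p - 1) * c powr (p - 2))"
    have A: "0 < A" "A * \<delta>\<^sup>2 = M" unfolding A_def using M(1) \<delta>(1) by auto
    have C: "0 \<le> C" unfolding C_def using A R p by simp
    have pc: "0 < (p - 1) * c powr (p - 2)" using p c by simp
    have B: "0 \<le> B" "M \<le> B * \<delta>" "C \<le> (p - 1) * c powr (p - 2) * B"
    proof -
      show "0 \<le> B" unfolding B_def using M(1) \<delta>(1) C pc by (intro add_nonneg_nonneg divide_nonneg_nonneg) auto
      have "0 \<le> C / ((p - 1) * c powr (p - 2)) * \<delta>" using C pc \<delta>(1) by simp
      thus "M \<le> B * \<delta>" unfolding B_def using \<delta>(1) by (simp add: distrib_right)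
      have kC: "k * (C / k) = C" if "0 < k" for k :: real using that by simp
      have "(p - 1) * c powr (p - 2) * B = (p - 1) * c powr (p - 2) * (M / \<delta>) + C"
        unfolding B_def distrib_left kC[OF pc] ..
      moreover have "0 \<le> (p - 1) * c powr (p - 2) * (M / \<delta>)" using pc M(1) \<delta>(1) by simp
      ultimately show "C \<le> (p - 1) * c powr (p - 2) * B" by linarith
    qed
    define u where "u = (\<lambda>w. A * (norm (fst w - x0))\<^sup>2 + (c + B * snd w))"
    have uc: "c \<le> u z" if "0 \<le> snd z" for z unfolding u_def using A B that by simp
    show ?thesis
    proof (rule conclude[of u])
      show "continuous_on (closure \<Omega> \<times> {0..T1}) u" unfolding u_def by (intro continuous_intros)
      show "u z0 = c" unfolding u_def z0eq t0 by simp
      show "c \<le> u z" if "z \<in> closure \<Omega> \<times> {0..T1} \<union> parabolic_boundary \<Omega> T1" for z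
        using that sub(2)[of z] by (intro uc) auto
    next
      fix z assume z: "z \<in> parabolic_boundary \<Omega> T1"
      note nn = sub(2)[OF z]
      show "M \<le> u z" if "\<delta> \<le> norm (fst z - x0)"
      proof -
        have "A * \<delta>\<^sup>2 \<le> A * (norm (fst z - x0))\<^sup>2" using that A \<delta>(1) by (intro mult_left_mono power_mono) auto
        moreover have "0 \<le> B * snd z" using B nn by simp
        ultimately show ?thesis unfolding u_def using A(2) c(1) by simp
      qed
      show "M \<le> u z" if "\<delta> \<le> \<bar>snd z - t0\<bar>"
      proof -
        have "B * \<delta> \<le> B * snd z" using that B nn unfolding t0 by (intro mult_left_mono) auto
        moreover have "0 \<le> A * (norm (fst z - x0))\<^sup>2" using A by simp
        ultimately show ?thesis unfolding u_def using B(2) c(1) by simp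
      qed
    next
      fix z assume z: "z \<in> \<Omega> \<times> {0<..<T1}"
      have k: "((\<lambda>t. c + B * t) has_real_derivative B) (at (snd z))" by (auto intro!: derivative_eq_intros)
      obtain D H where DH: "has_jet u z D B H"
        "p_laplace_form p D H = (2 * \<bar>A\<bar> * norm (fst z - x0)) powr (p - 2) * (2 * A * (real CARD('n) + p - 2))"
        using quadratic_barrier_jet[OF p(1) k, of A x0] unfolding u_def by blast
      have "norm (fst z - x0) \<le> R" using R(2) z closure_subset[of \<Omega>] by auto
      hence "(2 * \<bar>A\<bar> * norm (fst z - x0)) powr (p - 2) \<le> (2 * A * R) powr (p - 2)"
        using A p by (intro powr_mono2) (auto intro: mult_left_mono)
      hence "p_laplace_form p D H \<le> C" unfolding DH(2) C_def using A p by (intro mult_right_mono) auto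
      also have "\<dots> \<le> (p - 1) * c powr (p - 2) * B" by (rule B(3))
      also have "\<dots> \<le> (p - 1) * u z powr (p - 2) * B"
        using uc[of z] z c(1) p B by (intro mult_right_mono mult_left_mono powr_mono2) auto
      finally show "\<exists>D \<tau> H. has_jet u z D \<tau> H \<and> p_laplace_form p D H \<le> (p - 1) * u z powr (p - 2) * \<tau>"
        using DH(1) by blast
    qed
  next
    case False
    hence t0: "0 \<le> t0" "t0 < T" using z0 T unfolding z0eq parabolic_boundary_def by auto
    define B where "B = M / \<delta>\<^sup>2"
    have B: "0 < B" "B * \<delta>\<^sup>2 = M" unfolding B_def using M(1) \<delta>(1) by auto
    \<comment> \<open>For A \<ge> 1 the barrier is at most A E, so the weight u^(p - 2) grows only
      like A^(p - 2).\<close>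
    define E where "E = R powr \<alpha> + (c + B * T\<^sup>2)"
    have "0 \<le> R powr \<alpha>" "0 \<le> B * T\<^sup>2" using B by auto
    hence E: "0 < E" unfolding E_def using c(1) by linarith
    define \<gamma> where "\<gamma> = \<nu> * \<alpha> powr (p - 1) * R powr (- \<beta>)"
    have \<gamma>: "0 < \<gamma>" unfolding \<gamma>_def using exponents R(1) by simp
    \<comment> \<open>The summands give A \<ge> 1, the bound M beyond distance \<delta>, and enough
      size for the p-Laplacian, of order A^(p - 1), to absorb the time derivative term, of order
      A^(p - 2).\<close>
    define A where "A = 1 + M / \<delta> powr \<alpha> + 2 * B * T * (p - 1) * E powr (p - 2) / \<gamma>"
    have A1: "0 \<le> M / \<delta> powr \<alpha>" "0 \<le> 2 * B * T * (p - 1) * E powr (p - 2) / \<gamma>"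
      using M(1) B(1) T p \<gamma> by auto
    hence A: "1 \<le> A" "M / \<delta> powr \<alpha> \<le> A" "2 * B * T * (p - 1) * E powr (p - 2) / \<gamma> \<le> A" unfolding A_def by auto
    have A\<delta>: "M \<le> A * \<delta> powr \<alpha>" using A(2) \<delta>(1) by (simp add: pos_divide_le_eq)
    have A\<gamma>: "2 * B * T * (p - 1) * E powr (p - 2) \<le> A * \<gamma>" using A(3) \<gamma> by (simp add: pos_divide_le_eq)
    define u where "u = (\<lambda>w. A * ((norm (fst w - x0))\<^sup>2) powr (\<alpha> / 2) + (c + B * (snd w - t0)\<^sup>2))"
    have ueq: "u w = A * norm (fst w - x0) powr \<alpha> + (c + B * (snd w - t0)\<^sup>2)" for w
      unfolding u_def power_profile_eq ..
    have nn: "0 \<le> A * norm (fst w - x0) powr \<alpha>" "0 \<le> B * (snd w - t0)\<^sup>2" for w using A B by auto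
    show ?thesis
    proof (rule conclude[of u])
      show "continuous_on (closure \<Omega> \<times> {0..T1}) u"
        unfolding u_def using exponents by (intro continuous_intros continuous_power_profile) auto
      show "u z0 = c" unfolding ueq z0eq by simp
      show "c \<le> u z" for z unfolding ueq using nn[of z] by simp
      show "M \<le> u z" if "\<delta> \<le> norm (fst z - x0)" for z
      proof -
        have "A * \<delta> powr \<alpha> \<le> A * norm (fst z - x0) powr \<alpha>"
          using that A \<delta>(1) exponents by (intro mult_left_mono powr_mono2) auto
        thus ?thesis unfolding ueq using A\<delta> nn[of z] c(1) by linarith
      qed
      show "M \<le> u z" if "\<delta> \<le> \<bar>snd z - t0\<bar>" for z
      proof -
        have "\<delta>\<^sup>2 \<le> (snd z - t0)\<^sup>2" using that \<delta>(1) by (simp add: abs_le_square_iff[symmetric])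
        hence "B * \<delta>\<^sup>2 \<le> B * (snd z - t0)\<^sup>2" using B by (intro mult_left_mono) auto
        thus ?thesis unfolding ueq using B(2) nn[of z] c(1) by linarith
      qed
    next
      fix z assume z: "z \<in> \<Omega> \<times> {0<..<T1}"
      \<comment> \<open>The singular point x0 is not in \<Omega>, so the profile is smooth at every
        interior point, whatever the shape of the boundary.\<close>
      hence zx: "fst z \<in> \<Omega>" "fst z \<noteq> x0" "norm (fst z - x0) \<le> R" using False R(2) closure_subset[of \<Omega>] by auto
      have k: "((\<lambda>t. c + B * (t - t0)\<^sup>2) has_real_derivative 2 * B * (snd z - t0)) (at (snd z))"
        by (auto intro!: derivative_eq_intros)
      have "A \<noteq> 0" using A by simp
      obtain D H where DH: "has_jet u z D (2 * B * (snd z - t0)) H"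
        "p_laplace_form p D H = - (\<nu> * (A * \<alpha>) powr (p - 1) * norm (fst z - x0) powr (- \<beta>))"
        using power_barrier_jet[OF p(1) k zx(2) exponents(1) \<open>A \<noteq> 0\<close>] A(1) unfolding u_def \<nu>_def[symmetric] \<beta>_def[symmetric] by auto
      have t: "\<bar>snd z - t0\<bar> \<le> T" using z T1 t0 by auto
      have "u z \<le> A * E"
      proof -
        have "norm (fst z - x0) powr \<alpha> \<le> R powr \<alpha>" using zx exponents by (intro powr_mono2) auto
        moreover have "(snd z - t0)\<^sup>2 \<le> T\<^sup>2" using t T by (simp add: abs_le_square_iff[symmetric])
        hence "B * (snd z - t0)\<^sup>2 \<le> B * T\<^sup>2" using B by (intro mult_left_mono) auto
        moreover have "c + B * T\<^sup>2 \<le> A * (c + B * T\<^sup>2)"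
          using A(1) B c mult_right_mono[of 1 A "c + B * T\<^sup>2"] by simp
        moreover have "A * norm (fst z - x0) powr \<alpha> \<le> A * R powr \<alpha>"
          using calculation(1) A(1) by (intro mult_left_mono) auto
        moreover have "A * E = A * R powr \<alpha> + A * (c + B * T\<^sup>2)" unfolding E_def by (rule distrib_left)
        ultimately show ?thesis unfolding ueq by linarith
      qed
      moreover have "0 < u z" unfolding ueq using nn[of z] c(1) by linarith
      ultimately have "u z powr (p - 2) \<le> (A * E) powr (p - 2)" using p by (intro powr_mono2) auto
      also have "\<dots> = A powr (p - 2) * E powr (p - 2)" using A E by (simp add: powr_mult)
      finally have "(p - 1) * u z powr (p - 2) * (2 * B * T) \<le> (p - 1) * (A powr (p - 2) * E powr (p - 2)) * (2 * B * T)"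
        using p B T by (intro mult_right_mono mult_left_mono) auto
      also have "\<dots> = A powr (p - 2) * (2 * B * T * (p - 1) * E powr (p - 2))" by (simp add: ac_simps)
      also have "\<dots> \<le> A powr (p - 2) * (A * \<gamma>)" using A\<gamma> by (intro mult_left_mono) auto
      also have "\<dots> \<le> - p_laplace_form p D H" unfolding DH(2) \<gamma>_def minus_minus using lateral_bound[OF zx A(1)] .
      finally have 1: "p_laplace_form p D H \<le> - ((p - 1) * u z powr (p - 2) * (2 * B * T))" by simp
      have "2 * B * (- T) \<le> 2 * B * (snd z - t0)" using t B by (intro mult_left_mono) auto
      moreover have "0 \<le> (p - 1) * u z powr (p - 2)" using p by simp
      ultimately have "(p - 1) * u z powr (p - 2) * (2 * B * (- T)) \<le> (p - 1) * u z powr (p - 2) * (2 * B * (snd z - t0))"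
        by (rule mult_left_mono)
      with 1 have "p_laplace_form p D H \<le> (p - 1) * u z powr (p - 2) * (2 * B * (snd z - t0))"
        unfolding mult_minus_right by (rule order_trans)
      thus "\<exists>D \<tau> H. has_jet u z D \<tau> H \<and> p_laplace_form p D H \<le> (p - 1) * u z powr (p - 2) * \<tau>"
        using DH(1) by blast
    qed
  qed
qed

text \<open>At boundary points outside the \<delta>-box u is nonpositive, and h is positive.
  Truncation at m replaces u wherever it is small, so the differential inequality is required only
  where u > m.\<close>

lemma sub_barrier_exists:
  assumes z0: "z0 \<in> parabolic_boundary \<Omega> T" and \<epsilon>: "0 < \<epsilon>"
  shows "\<exists>v. continuous_on (closure \<Omega> \<times> {0..<T}) v \<and> jet_sub (log_operator p) (\<Omega> \<times> {0<..<T}) v \<and>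
      (\<forall>z\<in>parabolic_boundary \<Omega> T. v z \<le> ln (h z)) \<and> ln (h z0) - \<epsilon> \<le> v z0"
proof -
  obtain x0 t0 where z0eq: "z0 = (x0, t0)" by (cases z0)
  define c where "c = exp (- \<epsilon>) * h z0"
  have c: "0 < c" "c < h z0" "ln c = ln (h z0) - \<epsilon>"
    unfolding c_def using h_pos[OF z0] \<epsilon> by (auto simp: ln_mult)
  obtain \<delta> where \<delta>: "0 < \<delta>" "\<And>z. z \<in> parabolic_boundary \<Omega> T \<Longrightarrow> norm (fst z - x0) < \<delta> \<Longrightarrow> \<bar>snd z - t0\<bar> < \<delta> \<Longrightarrow> c \<le> h z"
    using boundary_values_near(2)[OF z0 c(2)] unfolding z0eq by auto
  obtain R where R: "1 \<le> R" "\<And>x. x \<in> closure \<Omega> \<Longrightarrow> norm (x - x0) \<le> R" using domain_radius by blast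
  have bd: "0 \<le> snd z" if "z \<in> parabolic_boundary \<Omega> T" for z using that unfolding parabolic_boundary_def by auto
  have conclude: ?thesis
    if cu: "continuous_on (closure \<Omega> \<times> {0..<T}) u" and uc: "\<And>z. z \<in> parabolic_boundary \<Omega> T \<Longrightarrow> u z \<le> c" and u0: "u z0 = c"
      and jets: "\<And>z. z \<in> \<Omega> \<times> {0<..<T} \<Longrightarrow> m < u z \<Longrightarrow> \<exists>D \<tau> H. has_jet u z D \<tau> H \<and> (p - 1) * u z powr (p - 2) * \<tau> \<le> p_laplace_form p D H"
      and far: "\<And>z. z \<in> parabolic_boundary \<Omega> T \<Longrightarrow> \<delta> \<le> norm (fst z - x0) \<Longrightarrow> u z \<le> 0"
        "\<And>z. z \<in> parabolic_boundary \<Omega> T \<Longrightarrow> \<delta> \<le> \<bar>snd z - t0\<bar> \<Longrightarrow> u z \<le> 0" for u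
  proof (intro exI[of _ "\<lambda>z. ln (max (u z) m)"] conjI ballI)
    show "continuous_on (closure \<Omega> \<times> {0..<T}) (\<lambda>z. ln (max (u z) m))"
      using m(1) by (intro continuous_on_ln continuous_on_max cu continuous_intros) (auto simp: max_def)
    have "open (\<Omega> \<times> {0<..<T})" using \<Omega>(1) by (intro open_Times) auto
    thus "jet_sub (log_operator p) (\<Omega> \<times> {0<..<T}) (\<lambda>z. ln (max (u z) m))"
      using jets by (intro jet_sub_ln_max[OF p(1) m(1)])
    have "ln c \<le> ln (max (u z0) m)" using u0 c(1) by simp
    thus "ln (h z0) - \<epsilon> \<le> ln (max (u z0) m)" using c(3) by simp
    fix z assume z: "z \<in> parabolic_boundary \<Omega> T"
    have "u z \<le> h z"
    proof (rule outside_cases[OF _ _ _ z])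
      fix y assume y: "y \<in> parabolic_boundary \<Omega> T"
      show "norm (fst y - x0) < \<delta> \<Longrightarrow> \<bar>snd y - t0\<bar> < \<delta> \<Longrightarrow> u y \<le> h y"
        using \<delta>(2)[OF y] uc[OF y] by auto
      show "\<delta> \<le> norm (fst y - x0) \<Longrightarrow> u y \<le> h y" using far(1)[OF y] h_pos[OF y] by linarith
      show "\<delta> \<le> \<bar>snd y - t0\<bar> \<Longrightarrow> u y \<le> h y" using far(2)[OF y] h_pos[OF y] by linarith
    qed
    thus "ln (max (u z) m) \<le> ln (h z)" using m h_pos[OF z] z by (simp add: max_def)
  qed
  show ?thesis
  proof (cases "x0 \<in> \<Omega>")
    case True
    hence t0: "t0 = 0" using z0 \<Omega>(1) unfolding z0eq parabolic_boundary_def frontier_def by (auto simp: interior_open)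
    define A where "A = c / \<delta>\<^sup>2"
    define C where "C = (2 * A * R) powr (p - 2) * (2 * A * (real CARD('n) + p - 2))"
    \<comment> \<open>As in the barrier from above, but with c instead of M, to bring u down to 0,
      and with the weight bounded below through u > m.\<close>
    define B where "B = c / \<delta> + C / ((p - 1) * m powr (p - 2))"
    have A: "0 < A" "A * \<delta>\<^sup>2 = c" unfolding A_def using c(1) \<delta>(1) by auto
    have C: "0 \<le> C" unfolding C_def using A R p by simp
    have pm: "0 < (p - 1) * m powr (p - 2)" using p m by simp
    have B: "0 \<le> B" "c \<le> B * \<delta>" "C \<le> (p - 1) * m powr (p - 2) * B"
    proof -
      show "0 \<le> B" unfolding B_def using c(1) \<delta>(1) C pm by (intro add_nonneg_nonneg divide_nonneg_nonneg) auto
      have "0 \<le> C / ((p - 1) * m powr (p - 2)) * \<delta>" using C pm \<delta>(1) by simp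
      thus "c \<le> B * \<delta>" unfolding B_def using \<delta>(1) by (simp add: distrib_right)
      have kC: "k * (C / k) = C" if "0 < k" for k :: real using that by simp
      have "(p - 1) * m powr (p - 2) * B = (p - 1) * m powr (p - 2) * (c / \<delta>) + C"
        unfolding B_def distrib_left kC[OF pm] ..
      moreover have "0 \<le> (p - 1) * m powr (p - 2) * (c / \<delta>)" using pm c(1) \<delta>(1) by simp
      ultimately show "C \<le> (p - 1) * m powr (p - 2) * B" by linarith
    qed
    define u where "u = (\<lambda>w. (- A) * (norm (fst w - x0))\<^sup>2 + (c - B * snd w))"
    show ?thesis
    proof (rule conclude[of u])
      show "continuous_on (closure \<Omega> \<times> {0..<T}) u" unfolding u_def by (intro continuous_intros)
      show "u z0 = c" unfolding u_def z0eq t0 by simp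
    next
      fix z assume z: "z \<in> parabolic_boundary \<Omega> T"
      have nn: "0 \<le> A * (norm (fst z - x0))\<^sup>2" "0 \<le> B * snd z" using A B bd[OF z] by auto
      show "u z \<le> c" unfolding u_def using nn by simp
      show "u z \<le> 0" if "\<delta> \<le> norm (fst z - x0)"
      proof -
        have "A * \<delta>\<^sup>2 \<le> A * (norm (fst z - x0))\<^sup>2" using that A \<delta>(1) by (intro mult_left_mono power_mono) auto
        thus ?thesis unfolding u_def using A(2) nn by simp
      qed
      show "u z \<le> 0" if "\<delta> \<le> \<bar>snd z - t0\<bar>"
      proof -
        have "B * \<delta> \<le> B * snd z" using that B bd[OF z] unfolding t0 by (intro mult_left_mono) auto
        thus ?thesis unfolding u_def using B(2) nn by simp
      qed
    next
      fix z assume z: "z \<in> \<Omega> \<times> {0<..<T}" "m < u z"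
      have k: "((\<lambda>t. c - B * t) has_real_derivative - B) (at (snd z))" by (auto intro!: derivative_eq_intros)
      obtain D H where DH: "has_jet u z D (- B) H"
        "p_laplace_form p D H = (2 * \<bar>- A\<bar> * norm (fst z - x0)) powr (p - 2) * (2 * (- A) * (real CARD('n) + p - 2))"
        using quadratic_barrier_jet[OF p(1) k, of "- A" x0] unfolding u_def by blast
      have "norm (fst z - x0) \<le> R" using R(2) z(1) closure_subset[of \<Omega>] by auto
      hence "(2 * \<bar>- A\<bar> * norm (fst z - x0)) powr (p - 2) \<le> (2 * A * R) powr (p - 2)"
        using A p by (intro powr_mono2) (auto intro: mult_left_mono)
      hence "(2 * \<bar>- A\<bar> * norm (fst z - x0)) powr (p - 2) * (2 * A * (real CARD('n) + p - 2)) \<le> C"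
        unfolding C_def using A p by (intro mult_right_mono) auto
      hence "- p_laplace_form p D H \<le> C" unfolding DH(2) by simp
      also have "\<dots> \<le> (p - 1) * m powr (p - 2) * B" by (rule B(3))
      also have "\<dots> \<le> (p - 1) * u z powr (p - 2) * B"
        using z(2) m(1) p B by (intro mult_right_mono mult_left_mono powr_mono2) auto
      finally have "(p - 1) * u z powr (p - 2) * (- B) \<le> p_laplace_form p D H" by simp
      thus "\<exists>D \<tau> H. has_jet u z D \<tau> H \<and> (p - 1) * u z powr (p - 2) * \<tau> \<le> p_laplace_form p D H"
        using DH(1) by blast
    qed
  next
    case False
    hence t0: "0 \<le> t0" "t0 < T" using z0 T unfolding z0eq parabolic_boundary_def by auto
    define B where "B = c / \<delta>\<^sup>2"
    have B: "0 < B" "B * \<delta>\<^sup>2 = c" unfolding B_def using c(1) \<delta>(1) by auto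
    define \<gamma> where "\<gamma> = \<nu> * \<alpha> powr (p - 1) * R powr (- \<beta>)"
    have \<gamma>: "0 < \<gamma>" unfolding \<gamma>_def using exponents R(1) by simp
    \<comment> \<open>Here u \<le> c, so the weight is bounded by c^(p - 2) independently of A, and
      A \<ge> 1 gives A^(p - 2) \<ge> 1 on the other side.\<close>
    define A where "A = 1 + c / \<delta> powr \<alpha> + 2 * B * T * (p - 1) * c powr (p - 2) / \<gamma>"
    have A1: "0 \<le> c / \<delta> powr \<alpha>" "0 \<le> 2 * B * T * (p - 1) * c powr (p - 2) / \<gamma>"
      using c(1) B(1) T p \<gamma> by auto
    hence A: "1 \<le> A" "c / \<delta> powr \<alpha> \<le> A" "2 * B * T * (p - 1) * c powr (p - 2) / \<gamma> \<le> A" unfolding A_def by auto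
    have A\<delta>: "c \<le> A * \<delta> powr \<alpha>" using A(2) \<delta>(1) by (simp add: pos_divide_le_eq)
    have A\<gamma>: "2 * B * T * (p - 1) * c powr (p - 2) \<le> A * \<gamma>" using A(3) \<gamma> by (simp add: pos_divide_le_eq)
    define u where "u = (\<lambda>w. (- A) * ((norm (fst w - x0))\<^sup>2) powr (\<alpha> / 2) + (c - B * (snd w - t0)\<^sup>2))"
    have ueq: "u w = - (A * norm (fst w - x0) powr \<alpha>) + (c - B * (snd w - t0)\<^sup>2)" for w
      unfolding u_def power_profile_eq by simp
    have nn: "0 \<le> A * norm (fst w - x0) powr \<alpha>" "0 \<le> B * (snd w - t0)\<^sup>2" for w using A B by auto
    have uc: "u z \<le> c" for z unfolding ueq using nn[of z] by simp
    show ?thesis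
    proof (rule conclude[of u])
      show "continuous_on (closure \<Omega> \<times> {0..<T}) u"
        unfolding u_def using exponents by (intro continuous_intros continuous_power_profile) auto
      show "u z0 = c" unfolding ueq z0eq by simp
      show "u z \<le> c" for z by (rule uc)
      show "u z \<le> 0" if "\<delta> \<le> norm (fst z - x0)" for z
      proof -
        have "A * \<delta> powr \<alpha> \<le> A * norm (fst z - x0) powr \<alpha>"
          using that A \<delta>(1) exponents by (intro mult_left_mono powr_mono2) auto
        thus ?thesis unfolding ueq using A\<delta> nn[of z] by linarith
      qed
      show "u z \<le> 0" if "\<delta> \<le> \<bar>snd z - t0\<bar>" for z
      proof -
        have "\<delta>\<^sup>2 \<le> (snd z - t0)\<^sup>2" using that \<delta>(1) by (simp add: abs_le_square_iff[symmetric])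
        hence "B * \<delta>\<^sup>2 \<le> B * (snd z - t0)\<^sup>2" using B by (intro mult_left_mono) auto
        thus ?thesis unfolding ueq using B(2) nn[of z] by linarith
      qed
    next
      fix z assume z: "z \<in> \<Omega> \<times> {0<..<T}" "m < u z"
      hence zx: "fst z \<in> \<Omega>" "fst z \<noteq> x0" "norm (fst z - x0) \<le> R" using False R(2) closure_subset[of \<Omega>] by auto
      have k: "((\<lambda>t. c - B * (t - t0)\<^sup>2) has_real_derivative - (2 * B * (snd z - t0))) (at (snd z))"
        by (auto intro!: derivative_eq_intros)
      have "- A \<noteq> 0" using A by simp
      obtain D H where DH: "has_jet u z D (- (2 * B * (snd z - t0))) H"
        "p_laplace_form p D H = \<nu> * (A * \<alpha>) powr (p - 1) * norm (fst z - x0) powr (- \<beta>)"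
        using power_barrier_jet[OF p(1) k zx(2) exponents(1) \<open>- A \<noteq> 0\<close>] A(1) unfolding u_def \<nu>_def[symmetric] \<beta>_def[symmetric] by auto
      have t: "\<bar>snd z - t0\<bar> \<le> T" using z t0 by auto
      have "2 * B * (- (snd z - t0)) \<le> 2 * B * T" using t B by (intro mult_left_mono) auto
      hence "- (2 * B * (snd z - t0)) \<le> 2 * B * T" unfolding mult_minus_right .
      hence "(p - 1) * u z powr (p - 2) * (- (2 * B * (snd z - t0))) \<le> (p - 1) * u z powr (p - 2) * (2 * B * T)"
        using p by (intro mult_left_mono) auto
      also have "\<dots> \<le> (p - 1) * c powr (p - 2) * (2 * B * T)"
        using uc[of z] z(2) m(1) p B T by (intro mult_right_mono mult_left_mono powr_mono2) auto
      also have "\<dots> = 2 * B * T * (p - 1) * c powr (p - 2)" by (simp add: ac_simps)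
      also have "\<dots> \<le> 1 * (A * \<gamma>)" using A\<gamma> by simp
      also have "\<dots> \<le> A powr (p - 2) * (A * \<gamma>)"
        using A(1) p \<gamma> by (intro mult_right_mono ge_one_powr_ge_zero) auto
      also have "\<dots> \<le> p_laplace_form p D H" unfolding DH(2) \<gamma>_def using lateral_bound[OF zx A(1)] .
      finally show "\<exists>D \<tau> H. has_jet u z D \<tau> H \<and> (p - 1) * u z powr (p - 2) * \<tau> \<le> p_laplace_form p D H"
        using DH(1) by blast
    qed
  qed
qed

section \<open>Existence and uniqueness\<close>

sublocale perron_problem "log_operator p" \<Omega> T "\<lambda>z. ln (h z)"
proof
  show "\<And>\<xi> X Y. (\<And>y. y \<bullet> (X *v y) \<le> y \<bullet> (Y *v y)) \<Longrightarrow> log_operator p \<xi> X \<le> log_operator p \<xi> Y"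
    using p by (intro log_operator_mono) auto
qed (use \<Omega> T p continuous_log_operator log_operator_symmetrize super_barrier_exists sub_barrier_exists in auto)

lemma cylinder_Un_boundary: "cylinder \<Omega> T \<union> parabolic_boundary \<Omega> T = closure \<Omega> \<times> {0..<T}"
  using Q_cases S_subset_Q boundary_subset_Q unfolding cylinder_def by blast

lemma positive_viscosity_solution_exists: "\<exists>u. positive_viscosity_solution p \<Omega> T h u"
proof -
  obtain v where v: "continuous_on (closure \<Omega> \<times> {0..<T}) v" "jet_sub (log_operator p) (\<Omega> \<times> {0<..<T}) v"
    "jet_sub (reflect (log_operator p)) (\<Omega> \<times> {0<..<T}) (\<lambda>z. - v z)"
    "\<And>z. z \<in> parabolic_boundary \<Omega> T \<Longrightarrow> v z = ln (h z)"
    using perron_solution by blast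
  have cu: "continuous_on (closure \<Omega> \<times> {0..<T}) (\<lambda>z. exp (v z))" by (intro continuous_intros v(1))
  hence cS: "continuous_on (\<Omega> \<times> {0<..<T}) (\<lambda>z. exp (v z))"
    using S_subset_Q by (rule continuous_on_subset)
  have "lower_semicontinuous_on (\<Omega> \<times> {0<..<T}) (\<lambda>z. exp (v z))"
    unfolding lower_semicontinuous_on_uminus
    by (intro continuous_on_imp_upper_semicontinuous_on continuous_intros cS)
  hence "viscosity_supersolution p (\<Omega> \<times> {0<..<T}) (\<lambda>z. exp (v z))"
    using v(3) by (intro jet_sub_imp_viscosity_supersolution[OF p(1) open_S]) auto
  moreover have "viscosity_subsolution p (\<Omega> \<times> {0<..<T}) (\<lambda>z. exp (v z))"
    using v(2) continuous_on_imp_upper_semicontinuous_on[OF cS]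
    by (intro jet_sub_imp_viscosity_subsolution[OF p(1) open_S]) auto
  ultimately have "positive_viscosity_solution p \<Omega> T h (\<lambda>z. exp (v z))"
    unfolding positive_viscosity_solution_def cylinder_Un_boundary
    using cu v(4) h_pos by (simp add: cylinder_def)
  thus ?thesis by blast
qed

text \<open>An inequality, so that exchanging the two solutions gives uniqueness. Comparison runs up
  to T1 < T, where both logarithms are continuous on the closed cylinder.\<close>

lemma positive_viscosity_solution_le:
  assumes u: "positive_viscosity_solution p \<Omega> T h u" and v: "positive_viscosity_solution p \<Omega> T h v"
    and z: "z \<in> closure \<Omega> \<times> {0..<T}"
  shows "u z \<le> v z"
proof -
  have pos: "0 < u y" "0 < v y" if "y \<in> closure \<Omega> \<times> {0..<T}" for y
    using u v that unfolding positive_viscosity_solution_def cylinder_Un_boundary by auto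
  have cont: "continuous_on (closure \<Omega> \<times> {0..<T}) u" "continuous_on (closure \<Omega> \<times> {0..<T}) v"
    using u v unfolding positive_viscosity_solution_def cylinder_Un_boundary by auto
  have cl: "continuous_on (closure \<Omega> \<times> {0..<T}) (\<lambda>z. ln (u z))" "continuous_on (closure \<Omega> \<times> {0..<T}) (\<lambda>z. - ln (v z))"
    using pos by (intro continuous_intros cont; fastforce)+
  have "quadratic_sub (log_operator p) (\<Omega> \<times> {0<..<T}) (\<lambda>z. ln (u z))"
    using u unfolding positive_viscosity_solution_def cylinder_def
    by (intro viscosity_subsolution_imp_quadratic_sub[OF p(1) open_S]) auto
  hence ju: "jet_sub (log_operator p) (\<Omega> \<times> {0<..<T}) (\<lambda>z. ln (u z))"
    using continuous_on_subset[OF cl(1) S_subset_Q]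
    by (intro quadratic_sub_imp_jet_sub[OF contF symF open_S] continuous_on_imp_upper_semicontinuous_on)
  have cR: "continuous_on UNIV (\<lambda>(\<xi>, X). reflect (log_operator p) \<xi> (X :: real ^ 'n ^ 'n))"
  proof -
    have "continuous_on UNIV (\<lambda>z::(real ^ 'n) \<times> (real ^ 'n ^ 'n). (\<lambda>(\<xi>, X). log_operator p \<xi> X) (- fst z, - snd z))"
      by (rule continuous_on_compose2[OF contF]) (auto intro!: continuous_intros)
    hence "continuous_on UNIV (\<lambda>z::(real ^ 'n) \<times> (real ^ 'n ^ 'n). - log_operator p (- fst z) (- snd z))"
      by (intro continuous_intros) simp
    thus ?thesis by (simp add: reflect_def case_prod_beta)
  qed
  have sR: "reflect (log_operator p) \<xi> (symmetrize X) = reflect (log_operator p) \<xi> X" for \<xi> and X :: "real ^ 'n ^ 'n"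
  proof -
    have "- symmetrize X = symmetrize (- X)" by (simp add: symmetrize_def transpose_def vec_eq_iff field_simps)
    thus ?thesis by (simp add: reflect_def log_operator_symmetrize)
  qed
  have "quadratic_sub (reflect (log_operator p)) (\<Omega> \<times> {0<..<T}) (\<lambda>z. - ln (v z))"
    using v unfolding positive_viscosity_solution_def cylinder_def
    by (intro viscosity_supersolution_imp_quadratic_sub[OF p(1) open_S]) auto
  hence jv: "jet_sub (reflect (log_operator p)) (\<Omega> \<times> {0<..<T}) (\<lambda>z. - ln (v z))"
    using continuous_on_subset[OF cl(2) S_subset_Q]
    by (intro quadratic_sub_imp_jet_sub[OF cR sR open_S] continuous_on_imp_upper_semicontinuous_on)
  have "snd z < T" using z by auto
  then obtain T1 where T1: "snd z < T1" "T1 < T" using dense by blast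
  have "ln (u z) + - ln (v z) \<le> 0"
  proof (rule comparison_upto[OF continuous_on_imp_upper_semicontinuous_on[OF cl(1)] ju T1(2) _ _ _ z T1(1)])
    show "upper_semicontinuous_on (closure \<Omega> \<times> {0..T1}) (\<lambda>z. - ln (v z))"
      by (intro continuous_on_imp_upper_semicontinuous_on continuous_on_subset[OF cl(2)]) (use T1 in auto)
    show "jet_sub (reflect (log_operator p)) (\<Omega> \<times> {0<..<T1}) (\<lambda>z. - ln (v z))"
      by (rule jet_sub_subset[OF jv]) (use T1 in auto)
    fix y assume "y \<in> parabolic_boundary \<Omega> T1"
    hence "y \<in> parabolic_boundary \<Omega> T" using boundary_upto_subset[OF T1(2)] by blast
    thus "ln (u y) + - ln (v y) \<le> 0" using u v unfolding positive_viscosity_solution_def by simp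
  qed
  thus ?thesis using pos[OF z] by simp
qed

end

theorem theorem1p1:
  fixes \<Omega> :: "(real ^ 'n) set" and T p :: real and h :: "(real ^ 'n) \<times> real \<Rightarrow> real"
  assumes "CARD('n) \<ge> 2"
    and "open \<Omega>" "connected \<Omega>" "\<Omega> \<noteq> {}" "bounded \<Omega>"
    and "T > 0"
    and "real CARD('n) < p"
    and "continuous_on (parabolic_boundary \<Omega> T) h"
    and "\<forall>z \<in> parabolic_boundary \<Omega> T. 0 < h z"
    and "(INF z \<in> parabolic_boundary \<Omega> T. h z) > 0"
  shows "(\<exists>u. positive_viscosity_solution p \<Omega> T h u) \<and>
         (\<forall>u v. positive_viscosity_solution p \<Omega> T h u \<longrightarrow> positive_viscosity_solution p \<Omega> T h v \<longrightarrow>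
            (\<forall>z \<in> cylinder \<Omega> T \<union> parabolic_boundary \<Omega> T. u z = v z))"
proof -
  interpret dirichlet_data \<Omega> T p h "INF z \<in> parabolic_boundary \<Omega> T. h z"
  proof
    fix z assume "z \<in> parabolic_boundary \<Omega> T"
    \<comment> \<open>Positivity of h bounds its values below by 0, which makes the real infimum a
      genuine lower bound.\<close>
    thus "(INF z \<in> parabolic_boundary \<Omega> T. h z) \<le> h z"
      using assms(9) by (intro cINF_lower bdd_belowI2[of _ 0]) (auto intro: less_imp_le)
  qed (use assms in auto)
  show ?thesis
    using positive_viscosity_solution_exists positive_viscosity_solution_le
    unfolding cylinder_Un_boundary by (meson order_antisym)
qed

end
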